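(* Let $k$ be a commutative ring, $R$ a $k$-algebra, and let $H$ be a left finite $\times_R$-Hopf algebra which is also a right finite $\times_R$-anti-Hopf algebra. Then the left skew dual $H^\vee$ of $H$ is $\times_R$-Hopf.
   Context: **Monoidal categories.** Associativity constraints are suppressed. In a monoidal category $\mathcal C$ with neutral object $I$, a right inner hom-functor $\underline{\mathrm{hom}}_r(X,-)$ is a right adjoint of the endofunctor $-\otimes X$, and a left inner hom-functor $\underline{\mathrm{hom}}_\ell(X,-)$ is a right adjoint of $X\otimes -$. A monoidal functor $(\mathcal F,\xi)\colon\mathcal C\to\mathcal D$ has natural isomorphisms $\xi\colon\mathcal F(X\otimes Y)\to\mathcal F(X)\otimes\mathcal F(Y)$ and an isomorphism $\mathcal F(I)\cong I$, coherent with the constraints. If left inner homs exist, $\mathcal F$ preserves left inner hom-functors if the natural morphisms $\mathcal F(\underline{\mathrm{hom}}_\ell(X,Y))\to\underline{\mathrm{hom}}_\ell(\mathcal F(X),\mathcal F(Y))$ induced by $\mathcal F(X)\otimes\mathcal F(\underline{\mathrm{hom}}_\ell(X,Y))\cong\mathcal F(X\otimes\underline{\mathrm{hom}}_\ell(X,Y))\to\mathcal F(Y)$ ($\mathcal F$ applied to the counit of the adjunction) are isomorphisms for all $X,Y$. Preservation of right inner hom-functors is defined analogously. **Left weak centralizer.** For a monoidal functor $\mathcal F\colon\mathcal C\to\mathcal D$, $\mathcal W_\ell(\mathcal F)$ is the category of pairs $(X,\sigma)$ with $X\in\mathcal D$ and $\sigma=\sigma_{X,V}\colon X\otimes\mathcal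 F(V)\to\mathcal F(V)\otimes X$ a transformation natural in $V\in\mathcal C$ (not necessarily invertible), such that, up to the identifications $\xi$, $\sigma_{X,V\otimes W}=(\mathcal F(V)\otimes\sigma_{X,W})\circ(\sigma_{X,V}\otimes\mathcal F(W))$ and $\sigma_{X,I}=\mathrm{id}$. Morphisms are morphisms in $\mathcal D$ compatible with the $\sigma$'s. It is monoidal: $X\otimes Y$ carries $\sigma_{X\otimes Y,V}=(\sigma_{X,V}\otimes Y)\circ(X\otimes\sigma_{Y,V})$. **Bialgebroids.** Write $\overline R=R^{\mathrm{op}}$ and $R^e=R\otimes_k\overline R$. The category ${}_{R^e}\mathfrak M$ of left $R^e$-modules is monoidal, being identified with the category of $R$-bimodules; thus $M\otimes_R N$ is formed using the left $\overline R$-module structure of $M$ and the left $R$-module structure of $N$. An $R^e$-ring is a $k$-algebra $H$ with an algebra homomorphism $R^e\to H$; it induces an underlying functor ${}_H\mathfrak M\to{}_{R^e}\mathfrak M$ on left module categories. A $\times_R$-bialgebra is an $R^e$-ring $H$ together with a monoidal category structure on ${}_H\mathfrak M$ for which the underlying functor ${}_H\mathfrak M\to{}_{R^e}\mathfrak M$ is strict monoidal. A $\times_R$-bialgebra $H$ is a $\times_R$-Hopf algebra (is $\times_R$-Hopf) if the underlying functor ${}_H\mathfrak M\to{}_{R^e}\mathfrak M$ preserves right inner hom-functors. It is a $\times_R$-anti-Hopf algebra if its coopposite (the $\times_{R^{\mathrm{op}}}$-bialgebra with the same module category and the order of tensor products reversed) is $\times_{R^{\mathrm{op}}}$-Hopf;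 equivalently, if the underlying functor ${}_H\mathfrak M\to{}_{R^e}\mathfrak M$ preserves left inner hom-functors. **Finiteness and skew dual.** $H$ is left finite if it is finitely generated projective as left $\overline R$-module, and right finite if it is finitely generated projective as left $R$-module. (These module structures on $H$ are left multiplication via $\overline R\to R^e\to H$ and $R\to R^e\to H$, respectively.) If $H$ is left finite, the left skew dual is a $\times_R$-bialgebra structure on $H^\vee:=\mathrm{Hom}_{\overline R-}(H,R)$ (left $\overline R$-linear maps), characterized, up to isomorphism of $\times_R$-bialgebras, by the existence of an equivalence of monoidal categories ${}_{H^\vee}\mathfrak M\cong\mathcal W_\ell({}_H\mathfrak M\to{}_{R^e}\mathfrak M)$ commuting with the underlying functors to ${}_{R^e}\mathfrak M$. (The existence of $H^\vee$ with this property is known.) *)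

theory Defs
  imports "HOL-Library.Equipollence" "HOL-Algebra.Free_Abelian_Groups"
    "HOL-Algebra.Generated_Groups" "HOL-Algebra.Module"
begin

section \<open>Monoidal categories, monoidal functors, inner homs\<close>

record ('o, 'a) cat =
  Obj :: "'o set"
  Arr :: "'a set"
  Dom :: "'a \<Rightarrow> 'o"
  Cod :: "'a \<Rightarrow> 'o"
  Idn :: "'o \<Rightarrow> 'a"
  Cmp :: "'a \<Rightarrow> 'a \<Rightarrow> 'a"  (infixr \<open>\<bullet>\<index>\<close> 68)

record ('o, 'a) moncat = "('o, 'a) cat" +
  TensO :: "'o \<Rightarrow> 'o \<Rightarrow> 'o"  (infixr \<open>\<boxtimes>\<index>\<close> 72)
  TensA :: "'a \<Rightarrow> 'a \<Rightarrow> 'a"  (infixr \<open>\<star>\<index>\<close> 72)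
  UnitO :: "'o"
  Assoc :: "'o \<Rightarrow> 'o \<Rightarrow> 'o \<Rightarrow> 'a"
  LUnit :: "'o \<Rightarrow> 'a"
  RUnit :: "'o \<Rightarrow> 'a"

definition homset :: "('o, 'a, 'm) cat_scheme \<Rightarrow> 'o \<Rightarrow> 'o \<Rightarrow> 'a set" where
  "homset C X Y = {f \<in> Arr C. Dom C f = X \<and> Cod C f = Y}"

locale category =
  fixes C :: "('o, 'a, 'm) cat_scheme" (structure)
  assumes Dom_closed: "f \<in> Arr C \<Longrightarrow> Dom C f \<in> Obj C"
    and Cod_closed: "f \<in> Arr C \<Longrightarrow> Cod C f \<in> Obj C"
    and Idn_hom: "X \<in> Obj C \<Longrightarrow> Idn C X \<in> homset C X X"
    and Cmp_hom: "f \<in> homset C X Y \<Longrightarrow> g \<in> homset C Y Z \<Longrightarrow> g \<bullet> f \<in> homset C X Z"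
    and Cmp_Idn: "f \<in> homset C X Y \<Longrightarrow> f \<bullet> Idn C X = f"
    and Idn_Cmp: "f \<in> homset C X Y \<Longrightarrow> Idn C Y \<bullet> f = f"
    and Cmp_assoc: "f \<in> homset C W X \<Longrightarrow> g \<in> homset C X Y \<Longrightarrow> h \<in> homset C Y Z
      \<Longrightarrow> (h \<bullet> g) \<bullet> f = h \<bullet> (g \<bullet> f)"

definition inverse_arrows :: "('o, 'a, 'm) cat_scheme \<Rightarrow> 'a \<Rightarrow> 'a \<Rightarrow> bool" where
  "inverse_arrows C f g \<longleftrightarrow> f \<in> Arr C \<and> g \<in> homset C (Cod C f) (Dom C f) \<and>
     g \<bullet>\<^bsub>C\<^esub> f = Idn C (Dom C f) \<and> f \<bullet>\<^bsub>C\<^esub> g = Idn C (Cod C f)"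

definition iso_arrow :: "('o, 'a, 'm) cat_scheme \<Rightarrow> 'a \<Rightarrow> bool" where
  "iso_arrow C f \<longleftrightarrow> (\<exists>g. inverse_arrows C f g)"

definition inv_arrow :: "('o, 'a, 'm) cat_scheme \<Rightarrow> 'a \<Rightarrow> 'a" where
  "inv_arrow C f = (THE g. inverse_arrows C f g)"

locale monoidal_category = category C
  for C :: "('o, 'a, 'm) moncat_scheme" (structure) +
  assumes TensO_closed: "X \<in> Obj C \<Longrightarrow> Y \<in> Obj C \<Longrightarrow> X \<boxtimes> Y \<in> Obj C"
    and TensA_hom: "f \<in> homset C X X' \<Longrightarrow> g \<in> homset C Y Y'
      \<Longrightarrow> f \<star> g \<in> homset C (X \<boxtimes> Y) (X' \<boxtimes> Y')"
    and TensA_Idn: "X \<in> Obj C \<Longrightarrow> Y \<in> Obj C \<Longrightarrow> Idn C X \<star> Idn C Y = Idn C (X \<boxtimes> Y)"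
    and interchange: "f \<in> homset C X X' \<Longrightarrow> f' \<in> homset C X' X'' \<Longrightarrow>
      g \<in> homset C Y Y' \<Longrightarrow> g' \<in> homset C Y' Y''
      \<Longrightarrow> (f' \<bullet> f) \<star> (g' \<bullet> g) = (f' \<star> g') \<bullet> (f \<star> g)"
    and UnitO_closed: "UnitO C \<in> Obj C"
    and Assoc_hom: "X \<in> Obj C \<Longrightarrow> Y \<in> Obj C \<Longrightarrow> Z \<in> Obj C
      \<Longrightarrow> Assoc C X Y Z \<in> homset C ((X \<boxtimes> Y) \<boxtimes> Z) (X \<boxtimes> (Y \<boxtimes> Z))"
    and Assoc_iso: "X \<in> Obj C \<Longrightarrow> Y \<in> Obj C \<Longrightarrow> Z \<in> Obj C \<Longrightarrow> iso_arrow C (Assoc C X Y Z)"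
    and Assoc_natural: "f \<in> homset C X X' \<Longrightarrow> g \<in> homset C Y Y' \<Longrightarrow> h \<in> homset C Z Z'
      \<Longrightarrow> Assoc C X' Y' Z' \<bullet> ((f \<star> g) \<star> h) = (f \<star> (g \<star> h)) \<bullet> Assoc C X Y Z"
    and LUnit_hom: "X \<in> Obj C \<Longrightarrow> LUnit C X \<in> homset C (UnitO C \<boxtimes> X) X"
    and LUnit_iso: "X \<in> Obj C \<Longrightarrow> iso_arrow C (LUnit C X)"
    and LUnit_natural: "f \<in> homset C X Y
      \<Longrightarrow> LUnit C Y \<bullet> (Idn C (UnitO C) \<star> f) = f \<bullet> LUnit C X"
    and RUnit_hom: "X \<in> Obj C \<Longrightarrow> RUnit C X \<in> homset C (X \<boxtimes> UnitO C) X"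
    and RUnit_iso: "X \<in> Obj C \<Longrightarrow> iso_arrow C (RUnit C X)"
    and RUnit_natural: "f \<in> homset C X Y
      \<Longrightarrow> RUnit C Y \<bullet> (f \<star> Idn C (UnitO C)) = f \<bullet> RUnit C X"
    and pentagon: "W \<in> Obj C \<Longrightarrow> X \<in> Obj C \<Longrightarrow> Y \<in> Obj C \<Longrightarrow> Z \<in> Obj C
      \<Longrightarrow> (Idn C W \<star> Assoc C X Y Z) \<bullet> Assoc C W (X \<boxtimes> Y) Z \<bullet> (Assoc C W X Y \<star> Idn C Z)
        = Assoc C W X (Y \<boxtimes> Z) \<bullet> Assoc C (W \<boxtimes> X) Y Z"
    and triangle: "X \<in> Obj C \<Longrightarrow> Y \<in> Obj C
      \<Longrightarrow> (Idn C X \<star> LUnit C Y) \<bullet> Assoc C X (UnitO C) Y = RUnit C X \<star> Idn C Y"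

record ('o, 'a, 'p, 'b) ftor =
  FO :: "'o \<Rightarrow> 'p"
  FA :: "'a \<Rightarrow> 'b"

text \<open>The structure maps of a monoidal functor are
  \<open>Xi X Y : F (X \<boxtimes> Y) \<rightarrow> F X \<boxtimes> F Y\<close> and \<open>Xi0 : F I \<rightarrow> I\<close>.\<close>

record ('o, 'a, 'p, 'b) monftor = "('o, 'a, 'p, 'b) ftor" +
  Xi :: "'o \<Rightarrow> 'o \<Rightarrow> 'b"
  Xi0 :: "'b"

definition is_ftor ::
  "('o, 'a, 'm) cat_scheme \<Rightarrow> ('p, 'b, 'n) cat_scheme \<Rightarrow> ('o, 'a, 'p, 'b, 'z) ftor_scheme \<Rightarrow> bool"
where
  "is_ftor C D F \<longleftrightarrow> category C \<and> category D \<and>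
     (\<forall>X\<in>Obj C. FO F X \<in> Obj D) \<and>
     (\<forall>X Y. \<forall>f\<in>homset C X Y. FA F f \<in> homset D (FO F X) (FO F Y)) \<and>
     (\<forall>X\<in>Obj C. FA F (Idn C X) = Idn D (FO F X)) \<and>
     (\<forall>X Y Z. \<forall>f\<in>homset C X Y. \<forall>g\<in>homset C Y Z. FA F (g \<bullet>\<^bsub>C\<^esub> f) = FA F g \<bullet>\<^bsub>D\<^esub> FA F f)"

definition is_monftor ::
  "('o, 'a, 'm) moncat_scheme \<Rightarrow> ('p, 'b, 'n) moncat_scheme
    \<Rightarrow> ('o, 'a, 'p, 'b, 'z) monftor_scheme \<Rightarrow> bool"
where
  "is_monftor C D F \<longleftrightarrow> monoidal_category C \<and> monoidal_category D \<and> is_ftor C D F \<and>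
     (\<forall>X\<in>Obj C. \<forall>Y\<in>Obj C. Xi F X Y \<in> homset D (FO F (X \<boxtimes>\<^bsub>C\<^esub> Y)) (FO F X \<boxtimes>\<^bsub>D\<^esub> FO F Y)
        \<and> iso_arrow D (Xi F X Y)) \<and>
     Xi0 F \<in> homset D (FO F (UnitO C)) (UnitO D) \<and> iso_arrow D (Xi0 F) \<and>
     (\<forall>X X' Y Y'. \<forall>f\<in>homset C X X'. \<forall>g\<in>homset C Y Y'.
        Xi F X' Y' \<bullet>\<^bsub>D\<^esub> FA F (f \<star>\<^bsub>C\<^esub> g) = (FA F f \<star>\<^bsub>D\<^esub> FA F g) \<bullet>\<^bsub>D\<^esub> Xi F X Y) \<and>
     (\<forall>X\<in>Obj C. \<forall>Y\<in>Obj C. \<forall>Z\<in>Obj C.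
        Assoc D (FO F X) (FO F Y) (FO F Z) \<bullet>\<^bsub>D\<^esub> (Xi F X Y \<star>\<^bsub>D\<^esub> Idn D (FO F Z)) \<bullet>\<^bsub>D\<^esub>
          Xi F (X \<boxtimes>\<^bsub>C\<^esub> Y) Z
        = (Idn D (FO F X) \<star>\<^bsub>D\<^esub> Xi F Y Z) \<bullet>\<^bsub>D\<^esub> Xi F X (Y \<boxtimes>\<^bsub>C\<^esub> Z) \<bullet>\<^bsub>D\<^esub> FA F (Assoc C X Y Z)) \<and>
     (\<forall>X\<in>Obj C. FA F (LUnit C X)
        = LUnit D (FO F X) \<bullet>\<^bsub>D\<^esub> (Xi0 F \<star>\<^bsub>D\<^esub> Idn D (FO F X)) \<bullet>\<^bsub>D\<^esub> Xi F (UnitO C) X) \<and>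
     (\<forall>X\<in>Obj C. FA F (RUnit C X)
        = RUnit D (FO F X) \<bullet>\<^bsub>D\<^esub> (Idn D (FO F X) \<star>\<^bsub>D\<^esub> Xi0 F) \<bullet>\<^bsub>D\<^esub> Xi F X (UnitO C))"

definition strict_monoidal ::
  "('o, 'a, 'm) moncat_scheme \<Rightarrow> ('p, 'b, 'n) moncat_scheme \<Rightarrow> ('o, 'a, 'p, 'b, 'z) ftor_scheme \<Rightarrow> bool"
where
  "strict_monoidal C D F \<longleftrightarrow> monoidal_category C \<and> monoidal_category D \<and> is_ftor C D F \<and>
     (\<forall>X\<in>Obj C. \<forall>Y\<in>Obj C. FO F (X \<boxtimes>\<^bsub>C\<^esub> Y) = FO F X \<boxtimes>\<^bsub>D\<^esub> FO F Y) \<and>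
     (\<forall>f\<in>Arr C. \<forall>g\<in>Arr C. FA F (f \<star>\<^bsub>C\<^esub> g) = FA F f \<star>\<^bsub>D\<^esub> FA F g) \<and>
     FO F (UnitO C) = UnitO D \<and>
     (\<forall>X\<in>Obj C. \<forall>Y\<in>Obj C. \<forall>Z\<in>Obj C.
        FA F (Assoc C X Y Z) = Assoc D (FO F X) (FO F Y) (FO F Z)) \<and>
     (\<forall>X\<in>Obj C. FA F (LUnit C X) = LUnit D (FO F X) \<and> FA F (RUnit C X) = RUnit D (FO F X))"

definition strict_monftor ::
  "('o, 'a, 'm) moncat_scheme \<Rightarrow> ('p, 'b, 'n) moncat_scheme \<Rightarrow> ('o, 'a, 'p, 'b) ftor
    \<Rightarrow> ('o, 'a, 'p, 'b) monftor"
where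
  "strict_monftor C D F = \<lparr> FO = FO F, FA = FA F,
     Xi = (\<lambda>X Y. Idn D (FO F (X \<boxtimes>\<^bsub>C\<^esub> Y))), Xi0 = Idn D (FO F (UnitO C)) \<rparr>"

definition ftor_id :: "('o, 'a, 'o, 'a) ftor" where
  "ftor_id = \<lparr> FO = (\<lambda>X. X), FA = (\<lambda>f. f) \<rparr>"

definition ftor_comp ::
  "('p, 'b, 'q, 'c, 'y) ftor_scheme \<Rightarrow> ('o, 'a, 'p, 'b, 'z) ftor_scheme \<Rightarrow> ('o, 'a, 'q, 'c) ftor"
where
  "ftor_comp G F = \<lparr> FO = (\<lambda>X. FO G (FO F X)), FA = (\<lambda>f. FA G (FA F f)) \<rparr>"

definition monftor_comp ::
  "('q, 'c, 'm) moncat_scheme \<Rightarrow> ('p, 'b, 'q, 'c) monftor \<Rightarrow> ('o, 'a, 'p, 'b) monftor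
    \<Rightarrow> ('o, 'a, 'q, 'c) monftor"
where
  "monftor_comp E G F = \<lparr> FO = (\<lambda>X. FO G (FO F X)), FA = (\<lambda>f. FA G (FA F f)),
     Xi = (\<lambda>X Y. Xi G (FO F X) (FO F Y) \<bullet>\<^bsub>E\<^esub> FA G (Xi F X Y)),
     Xi0 = Xi0 G \<bullet>\<^bsub>E\<^esub> FA G (Xi0 F) \<rparr>"

text \<open>Equality of monoidal functors with source \<open>C\<close>; HOL functions are total, so the values
  outside \<open>C\<close> have to be disregarded.\<close>

definition monftor_eq_on ::
  "('o, 'a, 'm) moncat_scheme \<Rightarrow> ('o, 'a, 'p, 'b) monftor \<Rightarrow> ('o, 'a, 'p, 'b) monftor \<Rightarrow> bool"
where
  "monftor_eq_on C F G \<longleftrightarrow> (\<forall>X\<in>Obj C. FO F X = FO G X) \<and> (\<forall>f\<in>Arr C. FA F f = FA G f) \<and>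
     (\<forall>X\<in>Obj C. \<forall>Y\<in>Obj C. Xi F X Y = Xi G X Y) \<and> Xi0 F = Xi0 G"

definition natural_iso ::
  "('o, 'a, 'm) cat_scheme \<Rightarrow> ('p, 'b, 'n) cat_scheme
    \<Rightarrow> ('o, 'a, 'p, 'b, 'y) ftor_scheme \<Rightarrow> ('o, 'a, 'p, 'b, 'z) ftor_scheme
    \<Rightarrow> ('o \<Rightarrow> 'b) \<Rightarrow> bool"
where
  "natural_iso C D F G \<theta> \<longleftrightarrow>
     (\<forall>X\<in>Obj C. \<theta> X \<in> homset D (FO F X) (FO G X) \<and> iso_arrow D (\<theta> X)) \<and>
     (\<forall>X Y. \<forall>f\<in>homset C X Y. \<theta> Y \<bullet>\<^bsub>D\<^esub> FA F f = FA G f \<bullet>\<^bsub>D\<^esub> \<theta> X)"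

definition is_equivalence ::
  "('o, 'a, 'm) cat_scheme \<Rightarrow> ('p, 'b, 'n) cat_scheme \<Rightarrow> ('o, 'a, 'p, 'b, 'z) ftor_scheme \<Rightarrow> bool"
where
  "is_equivalence C D F \<longleftrightarrow> is_ftor C D F \<and>
     (\<exists>(G :: ('p, 'b, 'o, 'a) ftor) \<theta> \<theta>'. is_ftor D C G \<and>
        natural_iso C C (ftor_comp G F) ftor_id \<theta> \<and> natural_iso D D (ftor_comp F G) ftor_id \<theta>')"

text \<open>\<open>G\<close> is right adjoint to \<open>F : C \<rightarrow> D\<close> with counit \<open>\<epsilon>\<close>.\<close>

definition right_adjoint ::
  "('o, 'a, 'm) cat_scheme \<Rightarrow> ('p, 'b, 'n) cat_scheme \<Rightarrow> ('o, 'a, 'p, 'b) ftor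
    \<Rightarrow> ('p, 'b, 'o, 'a) ftor \<Rightarrow> ('p \<Rightarrow> 'b) \<Rightarrow> bool"
where
  "right_adjoint C D F G \<epsilon> \<longleftrightarrow> is_ftor C D F \<and> is_ftor D C G \<and>
     (\<forall>Y\<in>Obj D. \<epsilon> Y \<in> homset D (FO F (FO G Y)) Y) \<and>
     (\<forall>Y Y'. \<forall>g\<in>homset D Y Y'. \<epsilon> Y' \<bullet>\<^bsub>D\<^esub> FA F (FA G g) = g \<bullet>\<^bsub>D\<^esub> \<epsilon> Y) \<and>
     (\<forall>X\<in>Obj C. \<forall>Y\<in>Obj D. \<forall>f\<in>homset D (FO F X) Y.
        \<exists>!g. g \<in> homset C X (FO G Y) \<and> \<epsilon> Y \<bullet>\<^bsub>D\<^esub> FA F g = f)"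

definition right_inner_hom ::
  "('o, 'a, 'm) moncat_scheme \<Rightarrow> 'o \<Rightarrow> ('o, 'a, 'o, 'a) ftor \<Rightarrow> ('o \<Rightarrow> 'a) \<Rightarrow> bool"
where
  "right_inner_hom C X G \<epsilon> \<longleftrightarrow>
     right_adjoint C C \<lparr> FO = (\<lambda>W. W \<boxtimes>\<^bsub>C\<^esub> X), FA = (\<lambda>f. f \<star>\<^bsub>C\<^esub> Idn C X) \<rparr> G \<epsilon>"

definition left_inner_hom ::
  "('o, 'a, 'm) moncat_scheme \<Rightarrow> 'o \<Rightarrow> ('o, 'a, 'o, 'a) ftor \<Rightarrow> ('o \<Rightarrow> 'a) \<Rightarrow> bool"
where
  "left_inner_hom C X G \<epsilon> \<longleftrightarrow>
     right_adjoint C C \<lparr> FO = (\<lambda>W. X \<boxtimes>\<^bsub>C\<^esub> W), FA = (\<lambda>f. Idn C X \<star>\<^bsub>C\<^esub> f) \<rparr> G \<epsilon>"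

text \<open>Preservation is required for every object \<open>X\<close> whose inner hom-functors, upstairs and
  downstairs, exist. If inner homs exist for all objects this is the usual notion. The guard only
  matters for module categories in a universe not closed under all exponentials, see
  \<open>module_universe\<close> below.\<close>

definition preserves_right_inner_homs ::
  "('o, 'a, 'm) moncat_scheme \<Rightarrow> ('p, 'b, 'n) moncat_scheme \<Rightarrow> ('o, 'a, 'p, 'b) monftor \<Rightarrow> bool"
where
  "preserves_right_inner_homs C D F \<longleftrightarrow>
     (\<forall>X\<in>Obj C. \<forall>G \<epsilon> G' \<epsilon>'. right_inner_hom C X G \<epsilon> \<longrightarrow> right_inner_hom D (FO F X) G' \<epsilon>' \<longrightarrow>
        (\<forall>Y\<in>Obj C. iso_arrow D (THE \<phi>. \<phi> \<in> homset D (FO F (FO G Y)) (FO G' (FO F Y)) \<and>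
           \<epsilon>' (FO F Y) \<bullet>\<^bsub>D\<^esub> (\<phi> \<star>\<^bsub>D\<^esub> Idn D (FO F X))
             = FA F (\<epsilon> Y) \<bullet>\<^bsub>D\<^esub> inv_arrow D (Xi F (FO G Y) X))))"

definition preserves_left_inner_homs ::
  "('o, 'a, 'm) moncat_scheme \<Rightarrow> ('p, 'b, 'n) moncat_scheme \<Rightarrow> ('o, 'a, 'p, 'b) monftor \<Rightarrow> bool"
where
  "preserves_left_inner_homs C D F \<longleftrightarrow>
     (\<forall>X\<in>Obj C. \<forall>G \<epsilon> G' \<epsilon>'. left_inner_hom C X G \<epsilon> \<longrightarrow> left_inner_hom D (FO F X) G' \<epsilon>' \<longrightarrow>
        (\<forall>Y\<in>Obj C. iso_arrow D (THE \<phi>. \<phi> \<in> homset D (FO F (FO G Y)) (FO G' (FO F Y)) \<and>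
           \<epsilon>' (FO F Y) \<bullet>\<^bsub>D\<^esub> (Idn D (FO F X) \<star>\<^bsub>D\<^esub> \<phi>)
             = FA F (\<epsilon> Y) \<bullet>\<^bsub>D\<^esub> inv_arrow D (Xi F X (FO G Y)))))"


section \<open>The left weak centralizer of a monoidal functor\<close>

datatype ('o, 'f) arrow = Arrow (src: 'o) (tgt: 'o) (fn: 'f)

definition wc_objects ::
  "('o, 'a, 'm) moncat_scheme \<Rightarrow> ('p, 'b, 'n) moncat_scheme \<Rightarrow> ('o, 'a, 'p, 'b) monftor
    \<Rightarrow> ('p \<times> ('o \<Rightarrow> 'b)) set"
where
  "wc_objects C D F = {(X, \<sigma>). X \<in> Obj D \<and> \<sigma> \<in> extensional (Obj C) \<and>
     (\<forall>V\<in>Obj C. \<sigma> V \<in> homset D (X \<boxtimes>\<^bsub>D\<^esub> FO F V) (FO F V \<boxtimes>\<^bsub>D\<^esub> X)) \<and>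
     (\<forall>V W. \<forall>f\<in>homset C V W.
        \<sigma> W \<bullet>\<^bsub>D\<^esub> (Idn D X \<star>\<^bsub>D\<^esub> FA F f) = (FA F f \<star>\<^bsub>D\<^esub> Idn D X) \<bullet>\<^bsub>D\<^esub> \<sigma> V) \<and>
     (\<forall>V\<in>Obj C. \<forall>W\<in>Obj C.
        Assoc D (FO F V) (FO F W) X \<bullet>\<^bsub>D\<^esub> (Xi F V W \<star>\<^bsub>D\<^esub> Idn D X) \<bullet>\<^bsub>D\<^esub> \<sigma> (V \<boxtimes>\<^bsub>C\<^esub> W)
        = (Idn D (FO F V) \<star>\<^bsub>D\<^esub> \<sigma> W) \<bullet>\<^bsub>D\<^esub> Assoc D (FO F V) X (FO F W) \<bullet>\<^bsub>D\<^esub>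
          (\<sigma> V \<star>\<^bsub>D\<^esub> Idn D (FO F W)) \<bullet>\<^bsub>D\<^esub> inv_arrow D (Assoc D X (FO F V) (FO F W)) \<bullet>\<^bsub>D\<^esub>
          (Idn D X \<star>\<^bsub>D\<^esub> Xi F V W)) \<and>
     LUnit D X \<bullet>\<^bsub>D\<^esub> (Xi0 F \<star>\<^bsub>D\<^esub> Idn D X) \<bullet>\<^bsub>D\<^esub> \<sigma> (UnitO C)
       = RUnit D X \<bullet>\<^bsub>D\<^esub> (Idn D X \<star>\<^bsub>D\<^esub> Xi0 F)}"

definition wc_arrows ::
  "('o, 'a, 'm) moncat_scheme \<Rightarrow> ('p, 'b, 'n) moncat_scheme \<Rightarrow> ('o, 'a, 'p, 'b) monftor
    \<Rightarrow> ('p \<times> ('o \<Rightarrow> 'b), 'b) arrow set"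
where
  "wc_arrows C D F = {Arrow P Q f | P Q f. P \<in> wc_objects C D F \<and> Q \<in> wc_objects C D F \<and>
     f \<in> homset D (fst P) (fst Q) \<and>
     (\<forall>V\<in>Obj C. (Idn D (FO F V) \<star>\<^bsub>D\<^esub> f) \<bullet>\<^bsub>D\<^esub> snd P V = snd Q V \<bullet>\<^bsub>D\<^esub> (f \<star>\<^bsub>D\<^esub> Idn D (FO F V)))}"

definition wc_tens ::
  "('o, 'a, 'm) moncat_scheme \<Rightarrow> ('p, 'b, 'n) moncat_scheme \<Rightarrow> ('o, 'a, 'p, 'b) monftor
    \<Rightarrow> 'p \<times> ('o \<Rightarrow> 'b) \<Rightarrow> 'p \<times> ('o \<Rightarrow> 'b) \<Rightarrow> 'p \<times> ('o \<Rightarrow> 'b)"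
where
  "wc_tens C D F P Q = (let X = fst P; Y = fst Q in
     (X \<boxtimes>\<^bsub>D\<^esub> Y, \<lambda>V\<in>Obj C.
        Assoc D (FO F V) X Y \<bullet>\<^bsub>D\<^esub> (snd P V \<star>\<^bsub>D\<^esub> Idn D Y) \<bullet>\<^bsub>D\<^esub>
        inv_arrow D (Assoc D X (FO F V) Y) \<bullet>\<^bsub>D\<^esub> (Idn D X \<star>\<^bsub>D\<^esub> snd Q V) \<bullet>\<^bsub>D\<^esub>
        Assoc D X Y (FO F V)))"

definition weak_centralizer ::
  "('o, 'a, 'm) moncat_scheme \<Rightarrow> ('p, 'b, 'n) moncat_scheme \<Rightarrow> ('o, 'a, 'p, 'b) monftor
    \<Rightarrow> ('p \<times> ('o \<Rightarrow> 'b), ('p \<times> ('o \<Rightarrow> 'b), 'b) arrow) moncat"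
where
  "weak_centralizer C D F =
     (let tens = wc_tens C D F;
          I = (UnitO D, \<lambda>V\<in>Obj C. inv_arrow D (RUnit D (FO F V)) \<bullet>\<^bsub>D\<^esub> LUnit D (FO F V)) in
     \<lparr> Obj = wc_objects C D F, Arr = wc_arrows C D F, Dom = src, Cod = tgt,
       Idn = (\<lambda>P. Arrow P P (Idn D (fst P))),
       Cmp = (\<lambda>g f. Arrow (src f) (tgt g) (fn g \<bullet>\<^bsub>D\<^esub> fn f)),
       TensO = tens,
       TensA = (\<lambda>f g. Arrow (tens (src f) (src g)) (tens (tgt f) (tgt g)) (fn f \<star>\<^bsub>D\<^esub> fn g)),
       UnitO = I,
       Assoc = (\<lambda>P Q S. Arrow (tens (tens P Q) S) (tens P (tens Q S))
                          (Assoc D (fst P) (fst Q) (fst S))),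
       LUnit = (\<lambda>P. Arrow (tens I P) P (LUnit D (fst P))),
       RUnit = (\<lambda>P. Arrow (tens P I) P (RUnit D (fst P))) \<rparr>)"

definition wc_underlying ::
  "('o, 'a, 'm) moncat_scheme \<Rightarrow> ('p, 'b, 'n) moncat_scheme \<Rightarrow> ('o, 'a, 'p, 'b) monftor
    \<Rightarrow> ('p \<times> ('o \<Rightarrow> 'b), ('p \<times> ('o \<Rightarrow> 'b), 'b) arrow, 'p, 'b) monftor"
where
  "wc_underlying C D F = strict_monftor (weak_centralizer C D F) D \<lparr> FO = fst, FA = fn \<rparr>"


section \<open>Left modules over noncommutative rings\<close>

text \<open>The additive group of a module is given as a (multiplicatively written) HOL-Algebra group, so
  \<open>mult\<close> is the addition and \<open>one\<close> is the zero element of the module.\<close>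

record ('s, 'm) lmod = "'m monoid" +
  scal :: "'s \<Rightarrow> 'm \<Rightarrow> 'm"

definition left_module :: "('s, 'x) ring_scheme \<Rightarrow> ('s, 'm, 'y) lmod_scheme \<Rightarrow> bool" where
  "left_module A M \<longleftrightarrow> ring A \<and> comm_group M \<and>
     (\<forall>a\<in>carrier A. \<forall>x\<in>carrier M. scal M a x \<in> carrier M) \<and>
     (\<forall>a\<in>carrier A. \<forall>x\<in>carrier M. \<forall>y\<in>carrier M.
        scal M a (x \<otimes>\<^bsub>M\<^esub> y) = scal M a x \<otimes>\<^bsub>M\<^esub> scal M a y) \<and>
     (\<forall>a\<in>carrier A. \<forall>b\<in>carrier A. \<forall>x\<in>carrier M.
        scal M (a \<oplus>\<^bsub>A\<^esub> b) x = scal M a x \<otimes>\<^bsub>M\<^esub> scal M b x) \<and>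
     (\<forall>a\<in>carrier A. \<forall>b\<in>carrier A. \<forall>x\<in>carrier M. scal M (a \<otimes>\<^bsub>A\<^esub> b) x = scal M a (scal M b x)) \<and>
     (\<forall>x\<in>carrier M. scal M \<one>\<^bsub>A\<^esub> x = x)"

definition lmod_hom ::
  "('s, 'x) ring_scheme \<Rightarrow> ('s, 'm, 'y) lmod_scheme \<Rightarrow> ('s, 'n, 'z) lmod_scheme \<Rightarrow> ('m \<Rightarrow> 'n) set"
where
  "lmod_hom A M N = {f \<in> hom M N \<inter> extensional (carrier M).
     \<forall>a\<in>carrier A. \<forall>x\<in>carrier M. f (scal M a x) = scal N a (f x)}"

definition free_lmod :: "('s, 'x) ring_scheme \<Rightarrow> nat \<Rightarrow> ('s, nat \<Rightarrow> 's) lmod" where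
  "free_lmod A n = \<lparr> carrier = {..<n} \<rightarrow>\<^sub>E carrier A,
     mult = (\<lambda>x y. \<lambda>i\<in>{..<n}. x i \<oplus>\<^bsub>A\<^esub> y i), one = (\<lambda>i\<in>{..<n}. \<zero>\<^bsub>A\<^esub>),
     scal = (\<lambda>a x. \<lambda>i\<in>{..<n}. a \<otimes>\<^bsub>A\<^esub> x i) \<rparr>"

definition fg_projective :: "('s, 'x) ring_scheme \<Rightarrow> ('s, 'm, 'y) lmod_scheme \<Rightarrow> bool" where
  "fg_projective A P \<longleftrightarrow> left_module A P \<and>
     (\<exists>n. \<exists>i\<in>lmod_hom A P (free_lmod A n). \<exists>p\<in>lmod_hom A (free_lmod A n) P.
        \<forall>x\<in>carrier P. p (i x) = x)"

text \<open>The left regular module of \<open>B\<close>, with scalars acting through a map \<open>f\<close> into \<open>B\<close>.\<close>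

definition module_along :: "('s \<Rightarrow> 'b) \<Rightarrow> ('b, 'x) ring_scheme \<Rightarrow> ('s, 'b) lmod" where
  "module_along f B = \<lparr> carrier = carrier B, mult = ring.add B, one = \<zero>\<^bsub>B\<^esub>,
     scal = (\<lambda>a b. f a \<otimes>\<^bsub>B\<^esub> b) \<rparr>"

text \<open>The category of all left \<open>A\<close>-modules whose underlying set belongs to the universe \<open>U\<close>.\<close>

definition module_cat ::
  "'u set set \<Rightarrow> ('s, 'x) ring_scheme \<Rightarrow> (('s, 'u) lmod, (('s, 'u) lmod, 'u \<Rightarrow> 'u) arrow) cat"
where
  "module_cat U A = (let Ob = {M. left_module A M \<and> carrier M \<in> U} in
     \<lparr> Obj = Ob, Arr = {Arrow M N f | M N f. M \<in> Ob \<and> N \<in> Ob \<and> f \<in> lmod_hom A M N},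
       Dom = src, Cod = tgt,
       Idn = (\<lambda>M. Arrow M M (\<lambda>x\<in>carrier M. x)),
       Cmp = (\<lambda>g f. Arrow (src f) (tgt g) (compose (carrier (src f)) (fn g) (fn f))) \<rparr>)"

text \<open>HOL has no class of all modules, so module categories are relative to a universe of sets.
  Besides being closed under smaller sets and having an infinite member (hence closed under tensor
  products), a universe is required to be closed under \<open>S\<close>-indexed powers, which will be used for
  \<open>S = carrier R\<close> and \<open>S = carrier H\<close>. Then \<open>R\<close>, \<open>H\<close> and the skew dual of \<open>H\<close> have copies in \<open>U\<close>, and
  inner hom-functors exist for every module that is no larger than \<open>R\<close> or \<open>H\<close>. A Grothendieck universe
  containing \<open>S\<close> satisfies the condition, and then all inner hom-functors exist. By
  \<open>module_universe_exists\<close> below, such universes are available in HOL for every \<open>S\<close>.\<close>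

definition module_universe :: "'s set \<Rightarrow> 'u set set \<Rightarrow> bool" where
  "module_universe S U \<longleftrightarrow> (\<exists>A\<in>U. infinite A) \<and> (\<forall>A\<in>U. \<forall>B. B \<lesssim> A \<longrightarrow> B \<in> U) \<and>
     (\<forall>A\<in>U. \<exists>B\<in>U. (S \<rightarrow>\<^sub>E A) \<lesssim> B)"


lemma module_universe_exists:
  assumes "infinite (T::'t set)" "(S::'s set) \<lesssim> T"
  shows "module_universe S {A :: 't set set. A \<lesssim> Pow T}"
proof -
  have 1: "infinite (Pow T)" using assms by simp
  have ST: "S \<times> T \<lesssim> T"
  proof -
    have "S \<times> T \<lesssim> T \<times> T" using assms(2) by (intro times_lepoll_mono) auto
    moreover have "T \<times> T \<lesssim> T" 
      using card_of_Times_same_infinite[OF assms(1)]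
      by (meson lepoll_def card_of_ordLeq ordIso_iff_ordLeq)
    ultimately show ?thesis by (rule lepoll_trans)
  qed
  have powers: "(S \<rightarrow>\<^sub>E A) \<lesssim> Pow T" if A: "A \<lesssim> Pow T" for A :: "'t set set"
  proof -
    obtain f where f: "inj_on f A" "f ` A \<subseteq> Pow T" using A by (auto simp: lepoll_def)
    have "(S \<rightarrow>\<^sub>E A) \<lesssim> Pow (S \<times> T)"
      unfolding lepoll_def
    proof (intro exI conjI)
      show "inj_on (\<lambda>g. {(s, t). s \<in> S \<and> t \<in> f (g s)}) (S \<rightarrow>\<^sub>E A)"
      proof (rule inj_onI)
        fix g h assume g: "g \<in> S \<rightarrow>\<^sub>E A" and h: "h \<in> S \<rightarrow>\<^sub>E A" and
         e: "{(s,t). s \<in> S \<and> t \<in> f (g s)} = {(s,t). s \<in> S \<and> t \<in> f (h s)}"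
        have "g s = h s" if s: "s \<in> S" for s
        proof -
          have "f (g s) = f (h s)" using e s by blast
          then show ?thesis using inj_onD[OF f(1)] PiE_mem[OF g s] PiE_mem[OF h s] by blast
        qed
        then show "g = h" using g h by (meson PiE_ext)
      qed
      show "(\<lambda>g. {(s, t). s \<in> S \<and> t \<in> f (g s)}) ` (S \<rightarrow>\<^sub>E A) \<subseteq> Pow (S \<times> T)"
        using f(2) by (fastforce simp: PiE_iff)
    qed
    also have "\<dots> \<lesssim> Pow T" using ST 
    proof -
      obtain j where "inj_on j (S \<times> T)" "j ` (S \<times> T) \<subseteq> T" using ST by (auto simp: lepoll_def)
      then show ?thesis unfolding lepoll_def
        by (intro exI[of _ "image j"] conjI inj_on_image_Pow image_Pow_mono)
    qed
    finally show ?thesis .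
  qed
  have PT: "Pow T \<in> {A. A \<lesssim> Pow T}" by simp
  show ?thesis
    unfolding module_universe_def
  proof (intro conjI ballI allI impI)
    show "\<exists>A\<in>{A :: 't set set. A \<lesssim> Pow T}. infinite A" using 1 PT by blast
    show "B \<in> {A. A \<lesssim> Pow T}" if "A \<in> {A. A \<lesssim> Pow T}" "B \<lesssim> A" for A B :: "'t set set"
      using that lepoll_trans[of B A "Pow T"] by simp
    show "\<exists>B\<in>{A :: 't set set. A \<lesssim> Pow T}. (S \<rightarrow>\<^sub>E A) \<lesssim> B" if "A \<in> {A. A \<lesssim> Pow T}" for A :: "'t set set"
      using PT powers[of A] that by (intro bexI[of _ "Pow T"]) simp_all
  qed
qed


section \<open>Tensor products and the enveloping algebra\<close>

definition tensor_relations ::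
  "'s set \<Rightarrow> ('s \<Rightarrow> 'm \<Rightarrow> 'm) \<Rightarrow> ('s \<Rightarrow> 'n \<Rightarrow> 'n) \<Rightarrow> ('m, 'x) monoid_scheme \<Rightarrow> ('n, 'y) monoid_scheme
    \<Rightarrow> ('m \<times> 'n \<Rightarrow>\<^sub>0 int) set"
where
  "tensor_relations S ra la M N =
     {frag_of (m \<otimes>\<^bsub>M\<^esub> m', n) - frag_of (m, n) - frag_of (m', n) | m m' n.
        m \<in> carrier M \<and> m' \<in> carrier M \<and> n \<in> carrier N} \<union>
     {frag_of (m, n \<otimes>\<^bsub>N\<^esub> n') - frag_of (m, n) - frag_of (m, n') | m n n'.
        m \<in> carrier M \<and> n \<in> carrier N \<and> n' \<in> carrier N} \<union>
     {frag_of (ra s m, n) - frag_of (m, la s n) | s m n.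
        s \<in> S \<and> m \<in> carrier M \<and> n \<in> carrier N}"

text \<open>The tensor product of the abelian groups \<open>M\<close> and \<open>N\<close>, balanced over the scalars \<open>S\<close>, which act by
  \<open>ra\<close> on \<open>M\<close> (from the right, as \<open>ra s m = m \<cdot> s\<close>) and by \<open>la\<close> on \<open>N\<close> (from the left).\<close>

definition tensor ::
  "'s set \<Rightarrow> ('s \<Rightarrow> 'm \<Rightarrow> 'm) \<Rightarrow> ('s \<Rightarrow> 'n \<Rightarrow> 'n) \<Rightarrow> ('m, 'x) monoid_scheme \<Rightarrow> ('n, 'y) monoid_scheme
    \<Rightarrow> ('m \<times> 'n \<Rightarrow>\<^sub>0 int) set monoid"
where
  "tensor S ra la M N = (let E = free_Abelian_group (carrier M \<times> carrier N) in
     E Mod generate E (tensor_relations S ra la M N))"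

text \<open>The class of \<open>i\<close>; as \<open>\<one>\<close> of a quotient group is the subgroup divided out, this is the coset of
  the generator \<open>frag_of i\<close>.\<close>

definition pure_tensor :: "('i \<Rightarrow>\<^sub>0 int) set monoid \<Rightarrow> 'i \<Rightarrow> ('i \<Rightarrow>\<^sub>0 int) set" where
  "pure_tensor T i = (\<lambda>p. p + frag_of i) ` \<one>\<^bsub>T\<^esub>"

text \<open>The additive map on a tensor product induced by a balanced biadditive map \<open>\<phi>\<close> into the abelian
  group \<open>G\<close>, evaluated on a representative.\<close>

definition tensor_lift ::
  "('g, 'x) monoid_scheme \<Rightarrow> ('i \<Rightarrow> 'g) \<Rightarrow> ('i \<Rightarrow>\<^sub>0 int) set \<Rightarrow> 'g"
where
  "tensor_lift G \<phi> X = (let p = (SOME p. p \<in> X) in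
     finprod G (\<lambda>i. \<phi> i [^]\<^bsub>G\<^esub> Poly_Mapping.lookup p i) (Poly_Mapping.keys p))"

definition k_algebra :: "('k, 'x) ring_scheme \<Rightarrow> ('k, 'a, 'y) module_scheme \<Rightarrow> bool" where
  "k_algebra k A \<longleftrightarrow> module k A \<and> ring A \<and>
     (\<forall>c\<in>carrier k. \<forall>x\<in>carrier A. \<forall>y\<in>carrier A.
        (c \<odot>\<^bsub>A\<^esub> x) \<otimes>\<^bsub>A\<^esub> y = c \<odot>\<^bsub>A\<^esub> (x \<otimes>\<^bsub>A\<^esub> y) \<and> x \<otimes>\<^bsub>A\<^esub> (c \<odot>\<^bsub>A\<^esub> y) = c \<odot>\<^bsub>A\<^esub> (x \<otimes>\<^bsub>A\<^esub> y))"

definition k_algebra_hom ::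
  "('k, 'x) ring_scheme \<Rightarrow> ('k, 'a, 'y) module_scheme \<Rightarrow> ('k, 'b, 'z) module_scheme \<Rightarrow> ('a \<Rightarrow> 'b) set"
where
  "k_algebra_hom k A B =
     {f \<in> ring_hom A B. \<forall>c\<in>carrier k. \<forall>x\<in>carrier A. f (c \<odot>\<^bsub>A\<^esub> x) = c \<odot>\<^bsub>B\<^esub> f x}"

definition opposite :: "('r, 'x) ring_scheme \<Rightarrow> ('r, 'x) ring_scheme" where
  "opposite R = R \<lparr> mult := (\<lambda>x y. y \<otimes>\<^bsub>R\<^esub> x) \<rparr>"

type_synonym 'r env = "('r \<times> 'r \<Rightarrow>\<^sub>0 int) set"

definition env_group :: "('k, 'x) ring_scheme \<Rightarrow> ('k, 'r) module \<Rightarrow> 'r env monoid" where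
  "env_group k R =
     tensor (carrier k) (smult R) (smult (opposite R)) (add_monoid R) (add_monoid (opposite R))"

definition enveloping :: "('k, 'x) ring_scheme \<Rightarrow> ('k, 'r) module \<Rightarrow> ('k, 'r env) module" where
  "enveloping k R = (let T = env_group k R in
     \<lparr> carrier = carrier T,
       mult = (\<lambda>z w. tensor_lift T (\<lambda>(a, b). tensor_lift T (\<lambda>(c, d).
                pure_tensor T (a \<otimes>\<^bsub>R\<^esub> c, b \<otimes>\<^bsub>opposite R\<^esub> d)) w) z),
       one = pure_tensor T (\<one>\<^bsub>R\<^esub>, \<one>\<^bsub>R\<^esub>),
       zero = \<one>\<^bsub>T\<^esub>,
       add = monoid.mult T,
       smult = (\<lambda>c. tensor_lift T (\<lambda>(a, b). pure_tensor T (c \<odot>\<^bsub>R\<^esub> a, b))) \<rparr>)"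

text \<open>The canonical maps \<open>r \<mapsto> r \<otimes> 1\<close> and \<open>r \<mapsto> 1 \<otimes> r\<close> from \<open>R\<close>, resp. its opposite, to the
  enveloping algebra.\<close>

definition env_left :: "('k, 'x) ring_scheme \<Rightarrow> ('k, 'r) module \<Rightarrow> 'r \<Rightarrow> 'r env" where
  "env_left k R r = pure_tensor (env_group k R) (r, \<one>\<^bsub>R\<^esub>)"

definition env_right :: "('k, 'x) ring_scheme \<Rightarrow> ('k, 'r) module \<Rightarrow> 'r \<Rightarrow> 'r env" where
  "env_right k R r = pure_tensor (env_group k R) (\<one>\<^bsub>R\<^esub>, r)"


section \<open>The monoidal category of modules over the enveloping algebra\<close>

definition encoding :: "'u set set \<Rightarrow> 'a set \<Rightarrow> 'a \<Rightarrow> 'u" where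
  "encoding U A = (SOME e. inj_on e A \<and> e ` A \<in> U)"

definition decoding :: "'u set set \<Rightarrow> 'a set \<Rightarrow> 'u \<Rightarrow> 'a" where
  "decoding U A = inv_into A (encoding U A)"

definition bimod_tensor ::
  "('k, 'x) ring_scheme \<Rightarrow> ('k, 'r) module \<Rightarrow> ('r env, 'u) lmod \<Rightarrow> ('r env, 'u) lmod
    \<Rightarrow> ('u \<times> 'u \<Rightarrow>\<^sub>0 int) set monoid"
where
  "bimod_tensor k R M N = tensor (carrier R)
     (\<lambda>r. scal M (env_right k R r)) (\<lambda>r. scal N (env_left k R r)) M N"

text \<open>The module \<open>M \<otimes>\<^sub>R N\<close>, on a copy of the above group inside the universe, with the action
  \<open>(r \<otimes> s) \<cdot> (m \<otimes> n) = (r \<otimes> 1) m \<otimes> (1 \<otimes> s) n\<close>.\<close>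

definition bimod_tens ::
  "'u set set \<Rightarrow> ('k, 'x) ring_scheme \<Rightarrow> ('k, 'r) module
    \<Rightarrow> ('r env, 'u) lmod \<Rightarrow> ('r env, 'u) lmod \<Rightarrow> ('r env, 'u) lmod"
where
  "bimod_tens U k R M N =
     (let T = bimod_tensor k R M N; e = encoding U (carrier T); d = decoding U (carrier T) in
     \<lparr> carrier = e ` carrier T, mult = (\<lambda>x y. e (d x \<otimes>\<^bsub>T\<^esub> d y)), one = e \<one>\<^bsub>T\<^esub>,
       scal = (\<lambda>z\<in>carrier (enveloping k R). \<lambda>x\<in>e ` carrier T.
         e (tensor_lift T (\<lambda>(r, s). tensor_lift T (\<lambda>(m, n).
              pure_tensor T (scal M (env_left k R r) m, scal N (env_right k R s) n)) (d x)) z)) \<rparr>)"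

definition bimod_pure ::
  "'u set set \<Rightarrow> ('k, 'x) ring_scheme \<Rightarrow> ('k, 'r) module
    \<Rightarrow> ('r env, 'u) lmod \<Rightarrow> ('r env, 'u) lmod \<Rightarrow> 'u \<Rightarrow> 'u \<Rightarrow> 'u"
where
  "bimod_pure U k R M N m n = (let T = bimod_tensor k R M N in
     encoding U (carrier T) (pure_tensor T (m, n)))"

text \<open>The map from \<open>M \<otimes>\<^sub>R N\<close> to \<open>P\<close> determined by \<open>m \<otimes> n \<mapsto> \<phi> m n\<close>.\<close>

definition bimod_lift ::
  "'u set set \<Rightarrow> ('k, 'x) ring_scheme \<Rightarrow> ('k, 'r) module
    \<Rightarrow> ('r env, 'u) lmod \<Rightarrow> ('r env, 'u) lmod \<Rightarrow> ('r env, 'u) lmod \<Rightarrow> ('u \<Rightarrow> 'u \<Rightarrow> 'u) \<Rightarrow> 'u \<Rightarrow> 'u"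
where
  "bimod_lift U k R M N P \<phi> = (\<lambda>x\<in>carrier (bimod_tens U k R M N).
     tensor_lift P (\<lambda>(m, n). \<phi> m n) (decoding U (carrier (bimod_tensor k R M N)) x))"

text \<open>The bimodule \<open>R\<close>, i.e. \<open>(r \<otimes> s) \<cdot> x = r x s\<close>.\<close>

definition bimod_unit ::
  "'u set set \<Rightarrow> ('k, 'x) ring_scheme \<Rightarrow> ('k, 'r) module \<Rightarrow> ('r env, 'u) lmod"
where
  "bimod_unit U k R = (let e = encoding U (carrier R); d = decoding U (carrier R) in
     \<lparr> carrier = e ` carrier R, mult = (\<lambda>x y. e (d x \<oplus>\<^bsub>R\<^esub> d y)), one = e \<zero>\<^bsub>R\<^esub>,
       scal = (\<lambda>z\<in>carrier (enveloping k R). \<lambda>x\<in>e ` carrier R.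
         e (tensor_lift (add_monoid R) (\<lambda>(r, s). r \<otimes>\<^bsub>R\<^esub> d x \<otimes>\<^bsub>R\<^esub> s) z)) \<rparr>)"

definition bimod_cat ::
  "'u set set \<Rightarrow> ('k, 'x) ring_scheme \<Rightarrow> ('k, 'r) module
    \<Rightarrow> (('r env, 'u) lmod, (('r env, 'u) lmod, 'u \<Rightarrow> 'u) arrow) moncat"
where
  "bimod_cat U k R =
     (let tens = bimod_tens U k R; pur = bimod_pure U k R; lift = bimod_lift U k R;
          I = bimod_unit U k R; d = decoding U (carrier R) in
     cat.extend (module_cat U (enveloping k R)) (moncat.fields
       tens
       (\<lambda>f g. Arrow (tens (src f) (src g)) (tens (tgt f) (tgt g))
          (lift (src f) (src g) (tens (tgt f) (tgt g))
             (\<lambda>m n. pur (tgt f) (tgt g) (fn f m) (fn g n))))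
       I
       (\<lambda>L M N. Arrow (tens (tens L M) N) (tens L (tens M N))
          (lift (tens L M) N (tens L (tens M N)) (\<lambda>x n.
             lift L M (tens L (tens M N)) (\<lambda>l m. pur L (tens M N) l (pur M N m n)) x)))
       (\<lambda>M. Arrow (tens I M) M (lift I M M (\<lambda>r m. scal M (env_left k R (d r)) m)))
       (\<lambda>M. Arrow (tens M I) M (lift M I M (\<lambda>m r. scal M (env_right k R (d r)) m)))))"


section \<open>Bialgebroids\<close>

text \<open>An \<open>R\<^sup>e\<close>-ring given by the algebra \<open>alg\<close> and the map \<open>env_map\<close> from the enveloping algebra,
  together with a monoidal category \<open>mon\<close>.\<close>

record ('k, 'r, 'h, 'u) bialgebroid_data =
  alg :: "('k, 'h) module"
  env_map :: "'r env \<Rightarrow> 'h"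
  mon :: "(('h, 'u) lmod, (('h, 'u) lmod, 'u \<Rightarrow> 'u) arrow) moncat"

definition restrict_scalars ::
  "('e, 'x) ring_scheme \<Rightarrow> ('e \<Rightarrow> 'h) \<Rightarrow> ('h, 'u) lmod \<Rightarrow> ('e, 'u) lmod"
where
  "restrict_scalars E f M = \<lparr> carrier = carrier M, mult = monoid.mult M, one = \<one>\<^bsub>M\<^esub>,
     scal = (\<lambda>z\<in>carrier E. \<lambda>x\<in>carrier M. scal M (f z) x) \<rparr>"

definition restriction_ftor ::
  "('e, 'x) ring_scheme \<Rightarrow> ('e \<Rightarrow> 'h)
    \<Rightarrow> (('h, 'u) lmod, (('h, 'u) lmod, 'u \<Rightarrow> 'u) arrow,
        ('e, 'u) lmod, (('e, 'u) lmod, 'u \<Rightarrow> 'u) arrow) ftor"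
where
  "restriction_ftor E f = \<lparr> FO = restrict_scalars E f,
     FA = (\<lambda>g. Arrow (restrict_scalars E f (src g)) (restrict_scalars E f (tgt g)) (fn g)) \<rparr>"

definition bialgebroid ::
  "'u set set \<Rightarrow> ('k, 'x) ring_scheme \<Rightarrow> ('k, 'r) module \<Rightarrow> ('k, 'r, 'h, 'u) bialgebroid_data \<Rightarrow> bool"
where
  "bialgebroid U k R H \<longleftrightarrow>
     k_algebra k (alg H) \<and> env_map H \<in> k_algebra_hom k (enveloping k R) (alg H) \<and>
     monoidal_category (mon H) \<and> cat.truncate (mon H) = module_cat U (alg H) \<and>
     strict_monoidal (mon H) (bimod_cat U k R) (restriction_ftor (enveloping k R) (env_map H))"

definition underlying ::
  "'u set set \<Rightarrow> ('k, 'x) ring_scheme \<Rightarrow> ('k, 'r) module \<Rightarrow> ('k, 'r, 'h, 'u) bialgebroid_data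
    \<Rightarrow> (('h, 'u) lmod, (('h, 'u) lmod, 'u \<Rightarrow> 'u) arrow,
        ('r env, 'u) lmod, (('r env, 'u) lmod, 'u \<Rightarrow> 'u) arrow) monftor"
where
  "underlying U k R H = strict_monftor (mon H) (bimod_cat U k R)
     (restriction_ftor (enveloping k R) (env_map H))"

definition hopf ::
  "'u set set \<Rightarrow> ('k, 'x) ring_scheme \<Rightarrow> ('k, 'r) module \<Rightarrow> ('k, 'r, 'h, 'u) bialgebroid_data \<Rightarrow> bool"
where
  "hopf U k R H \<longleftrightarrow> bialgebroid U k R H \<and>
     preserves_right_inner_homs (mon H) (bimod_cat U k R) (underlying U k R H)"

definition anti_hopf ::
  "'u set set \<Rightarrow> ('k, 'x) ring_scheme \<Rightarrow> ('k, 'r) module \<Rightarrow> ('k, 'r, 'h, 'u) bialgebroid_data \<Rightarrow> bool"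
where
  "anti_hopf U k R H \<longleftrightarrow> bialgebroid U k R H \<and>
     preserves_left_inner_homs (mon H) (bimod_cat U k R) (underlying U k R H)"

definition left_op_module ::
  "('k, 'x) ring_scheme \<Rightarrow> ('k, 'r) module \<Rightarrow> ('k, 'r, 'h, 'u) bialgebroid_data \<Rightarrow> ('r, 'h) lmod"
where
  "left_op_module k R H = module_along (\<lambda>r. env_map H (env_right k R r)) (alg H)"

definition left_finite ::
  "('k, 'x) ring_scheme \<Rightarrow> ('k, 'r) module \<Rightarrow> ('k, 'r, 'h, 'u) bialgebroid_data \<Rightarrow> bool"
where
  "left_finite k R H \<longleftrightarrow> fg_projective (opposite R) (left_op_module k R H)"

definition right_finite ::
  "('k, 'x) ring_scheme \<Rightarrow> ('k, 'r) module \<Rightarrow> ('k, 'r, 'h, 'u) bialgebroid_data \<Rightarrow> bool"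
where
  "right_finite k R H \<longleftrightarrow>
     fg_projective R (module_along (\<lambda>r. env_map H (env_left k R r)) (alg H))"

text \<open>\<open>D\<close> is a bialgebroid structure on the group of maps \<open>H \<rightarrow> R\<close> that are left linear over the opposite
  of \<open>R\<close> (which acts on \<open>R\<close> by right multiplication), and its module category is monoidally
  equivalent to the left weak centralizer, compatibly with the underlying monoidal functors.\<close>

definition left_skew_dual ::
  "'u set set \<Rightarrow> ('k, 'x) ring_scheme \<Rightarrow> ('k, 'r) module \<Rightarrow> ('k, 'r, 'h, 'u) bialgebroid_data
    \<Rightarrow> ('k, 'r, 'h \<Rightarrow> 'r, 'u) bialgebroid_data \<Rightarrow> bool"
where
  "left_skew_dual U k R H D \<longleftrightarrow> bialgebroid U k R D \<and>
     carrier (alg D) =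
       lmod_hom (opposite R) (left_op_module k R H) (module_along (\<lambda>r. r) (opposite R)) \<and>
     (\<forall>f\<in>carrier (alg D). \<forall>g\<in>carrier (alg D).
        f \<oplus>\<^bsub>alg D\<^esub> g = (\<lambda>h\<in>carrier (alg H). f h \<oplus>\<^bsub>R\<^esub> g h)) \<and>
     (let Re = bimod_cat U k R; W = weak_centralizer (mon H) Re (underlying U k R H) in
      \<exists>K. is_monftor (mon D) W K \<and> is_equivalence (mon D) W K \<and>
          monftor_eq_on (mon D)
            (monftor_comp Re (wc_underlying (mon H) Re (underlying U k R H)) K)
            (underlying U k R D))"

end

theory Submission imports Defs begin

text \<open>
  Write \<open>\<W>\<close> for the left weak centralizer of the underlying functor of \<open>H\<close>, and \<open>V\<close> for the regular
  \<open>H\<close>-module with generator \<open>u\<close>. Right inner homs of \<open>D\<close>-modules are right inner homs in \<open>\<W>\<close>, to be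
  compared with those of bimodules.

  If \<open>H\<close> is anti-Hopf and right finite, every half-braiding \<open>\<sigma>\<close> is invertible at \<open>V\<close>: the left inner hom
  \<open>V\<^sup>*\<close> from \<open>V\<close> to the unit object is, as a bimodule, the \<open>R\<close>-linear dual of \<open>V\<close>, and evaluation, a dual
  basis and the component of \<open>\<sigma>\<close> at \<open>V\<^sup>*\<close> yield an inverse, as for the dual of an object with a dual.

  Let \<open>(X, \<sigma>)\<close> and \<open>(Y, \<tau>)\<close> be objects of \<open>\<W>\<close> and let \<open>\<epsilon> : Z \<otimes> X \<rightarrow> Y\<close> be the right inner hom of the
  bimodules \<open>X\<close> and \<open>Y\<close>. For \<open>e\<close> in \<open>Z\<close> the map sending \<open>x\<close> to \<open>\<tau> (\<epsilon> (e \<otimes> \<sigma>\<inverse> (u \<otimes> x)))\<close> is a right \<open>R\<close>-linear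
  map from \<open>X\<close> to \<open>V \<otimes> Y\<close>. As \<open>H\<close> is left finite, it is of the form \<open>(V \<otimes> \<epsilon>) (\<delta> e \<otimes> x)\<close> for a unique
  element \<open>\<delta> e\<close> of \<open>V \<otimes> Z\<close>. The map \<open>\<delta>\<close> is a coaction, hence gives a half-braiding on \<open>Z\<close>. For this
  half-braiding \<open>\<epsilon>\<close> is a morphism in \<open>\<W>\<close>, and a bimodule map \<open>P \<rightarrow> Z\<close> is a morphism in \<open>\<W>\<close> as soon as the
  corresponding \<open>P \<otimes> X \<rightarrow> Y\<close> is one. So \<open>Z\<close> is also the inner hom in \<open>\<W>\<close>.
\<close>

section \<open>Tensor products over a ring\<close>

text \<open>All inner homs are given only by universal properties, while the argument needs their
  elements. The bridge is the free \<open>E\<close>-module of rank one: maps out of it pick out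
  elements, so a right inner hom consists of the right linear maps X \<rightarrow> Y and a left one
  of the left linear maps. Evaluation at x is linear on one side only, hence no arrow of the
  category. Tensor products of maps are therefore formed for a right linear map on the left factor
  and a left linear map on the right factor. Left finiteness makes V \<otimes> _ commute with the
  inner hom: V is finitely generated projective on the side over which V \<otimes> Z is balanced.
  The inverse of \<sigma> is needed because a morphism Z \<otimes> X \<rightarrow> Y prescribes only
  the composite of both half-braidings, and the one of X has to be undone to isolate that of Z.
  Preservation of inner homs speaks only about inner hom-functors that exist. Before the anti-Hopf
  property can be applied to V, its functors on H-modules and on bimodules have to be constructed
  within the universe, which explains the cardinality estimates.\<close>

lemma hom_closed: "f \<in> hom G H \<Longrightarrow> x \<in> carrier G \<Longrightarrow> f x \<in> carrier H"
  by (auto simp: hom_def)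

lemma hom_trans: "g \<in> hom H K \<Longrightarrow> f \<in> hom G H \<Longrightarrow> (\<lambda>x. g (f x)) \<in> hom G K"
  by (auto simp: hom_def)

lemma comm_group_hom_one: "f \<in> hom G H \<Longrightarrow> comm_group G \<Longrightarrow> comm_group H \<Longrightarrow> f \<one>\<^bsub>G\<^esub> = \<one>\<^bsub>H\<^esub>"
  by (rule hom_one) (auto simp: comm_group_def)

lemma hom_finprod:
  assumes "f \<in> hom G H" "comm_group G" "comm_group H" "g \<in> A \<rightarrow> carrier G"
  shows "f (finprod G g A) = finprod H (\<lambda>x. f (g x)) A"
proof -
  interpret G: comm_group G by fact
  interpret H: comm_group H by fact
  show ?thesis using assms(4)
  proof (induction A rule: infinite_finite_induct)
    case (insert x A)
    then show ?case using assms(1)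
      by (simp add: Pi_iff hom_mult hom_closed)
  qed (use assms in \<open>simp_all add: comm_group_hom_one\<close>)
qed

lemma hom_sum_hom:
  assumes "f \<in> hom G H" "g \<in> hom G H" "comm_group H"
  shows "(\<lambda>x. f x \<otimes>\<^bsub>H\<^esub> g x) \<in> hom G H"
proof -
  interpret H: comm_group H by fact
  show ?thesis using assms
    by (auto simp: hom_def Pi_iff H.m_ac)
qed

lemma hom_finprod_hom:
  assumes "\<And>i. i \<in> A \<Longrightarrow> f i \<in> hom G H" "comm_group H"
  shows "(\<lambda>x. finprod H (\<lambda>i. f i x) A) \<in> hom G H"
proof -
  interpret H: comm_group H by fact
  have "finprod H (\<lambda>i. f i (x \<otimes>\<^bsub>G\<^esub> y)) A = finprod H (\<lambda>i. f i x) A \<otimes>\<^bsub>H\<^esub> finprod H (\<lambda>i. f i y) A"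
    if "x \<in> carrier G" "y \<in> carrier G" for x y
  proof -
    have "finprod H (\<lambda>i. f i (x \<otimes>\<^bsub>G\<^esub> y)) A = finprod H (\<lambda>i. f i x \<otimes>\<^bsub>H\<^esub> f i y) A"
      using assms(1) that by (intro H.finprod_cong') (auto simp: hom_mult[of _ G H] hom_closed[of _ G H])
    then show ?thesis using assms(1) that by (simp add: Pi_iff hom_closed[of _ G H])
  qed
  then show ?thesis using assms(1) by (auto intro!: homI H.finprod_closed simp: hom_closed[of _ G H])
qed

section \<open>Universal property, generation and size of balanced tensor products\<close>

definition balanced ::
  "'s set \<Rightarrow> ('s \<Rightarrow> 'm \<Rightarrow> 'm) \<Rightarrow> ('s \<Rightarrow> 'n \<Rightarrow> 'n) \<Rightarrow> ('m, 'x) monoid_scheme \<Rightarrow> ('n, 'y) monoid_scheme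
    \<Rightarrow> ('g, 'z) monoid_scheme \<Rightarrow> ('m \<Rightarrow> 'n \<Rightarrow> 'g) \<Rightarrow> bool"
where
  "balanced S ra la M N G \<phi> \<longleftrightarrow>
     (\<forall>m\<in>carrier M. \<phi> m \<in> hom N G) \<and>
     (\<forall>n\<in>carrier N. (\<lambda>m. \<phi> m n) \<in> hom M G) \<and>
     (\<forall>s\<in>S. \<forall>m\<in>carrier M. \<forall>n\<in>carrier N. \<phi> (ra s m) n = \<phi> m (la s n))"

lemma balancedI:
  assumes "\<And>m. m \<in> carrier M \<Longrightarrow> \<phi> m \<in> hom N G" "\<And>n. n \<in> carrier N \<Longrightarrow> (\<lambda>m. \<phi> m n) \<in> hom M G"
    "\<And>s m n. s \<in> S \<Longrightarrow> m \<in> carrier M \<Longrightarrow> n \<in> carrier N \<Longrightarrow> \<phi> (ra s m) n = \<phi> m (la s n)"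
  shows "balanced S ra la M N G \<phi>"
  using assms by (auto simp: balanced_def)

lemma balancedI2:
  assumes "\<And>m n. m \<in> carrier M \<Longrightarrow> n \<in> carrier N \<Longrightarrow> \<phi> m n \<in> carrier G"
    "\<And>m n n'. m \<in> carrier M \<Longrightarrow> n \<in> carrier N \<Longrightarrow> n' \<in> carrier N \<Longrightarrow> \<phi> m (n \<otimes>\<^bsub>N\<^esub> n') = \<phi> m n \<otimes>\<^bsub>G\<^esub> \<phi> m n'"
    "\<And>m m' n. m \<in> carrier M \<Longrightarrow> m' \<in> carrier M \<Longrightarrow> n \<in> carrier N \<Longrightarrow> \<phi> (m \<otimes>\<^bsub>M\<^esub> m') n = \<phi> m n \<otimes>\<^bsub>G\<^esub> \<phi> m' n"
    "\<And>s m n. s \<in> S \<Longrightarrow> m \<in> carrier M \<Longrightarrow> n \<in> carrier N \<Longrightarrow> \<phi> (ra s m) n = \<phi> m (la s n)"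
  shows "balanced S ra la M N G \<phi>"
  using assms by (auto simp: balanced_def hom_def)

lemma balancedD:
  assumes "balanced S ra la M N G \<phi>"
  shows "m \<in> carrier M \<Longrightarrow> n \<in> carrier N \<Longrightarrow> \<phi> m n \<in> carrier G"
    "m \<in> carrier M \<Longrightarrow> n \<in> carrier N \<Longrightarrow> n' \<in> carrier N \<Longrightarrow> \<phi> m (n \<otimes>\<^bsub>N\<^esub> n') = \<phi> m n \<otimes>\<^bsub>G\<^esub> \<phi> m n'"
    "m \<in> carrier M \<Longrightarrow> m' \<in> carrier M \<Longrightarrow> n \<in> carrier N \<Longrightarrow> \<phi> (m \<otimes>\<^bsub>M\<^esub> m') n = \<phi> m n \<otimes>\<^bsub>G\<^esub> \<phi> m' n"
    "s \<in> S \<Longrightarrow> m \<in> carrier M \<Longrightarrow> n \<in> carrier N \<Longrightarrow> \<phi> (ra s m) n = \<phi> m (la s n)"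
  using assms by (auto simp: balanced_def hom_def)

locale tensor_product =
  fixes S :: "'s set" and ra :: "'s \<Rightarrow> 'm \<Rightarrow> 'm" and la :: "'s \<Rightarrow> 'n \<Rightarrow> 'n"
    and M :: "('m, 'x) monoid_scheme" and N :: "('n, 'y) monoid_scheme"
  assumes M: "comm_group M" and N: "comm_group N"
    and ra: "s \<in> S \<Longrightarrow> m \<in> carrier M \<Longrightarrow> ra s m \<in> carrier M"
    and la: "s \<in> S \<Longrightarrow> n \<in> carrier N \<Longrightarrow> la s n \<in> carrier N"
begin

interpretation M: comm_group M by (rule M)
interpretation N: comm_group N by (rule N)

abbreviation "F \<equiv> free_Abelian_group (carrier M \<times> carrier N)"
abbreviation "rel \<equiv> tensor_relations S ra la M N"
abbreviation "K \<equiv> generate F rel"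
abbreviation "T \<equiv> tensor S ra la M N"

interpretation F: comm_group F by (rule abelian_free_Abelian_group)

lemma rel_carrier: "rel \<subseteq> carrier F"
  unfolding tensor_relations_def by (auto dest!: subsetD[OF keys_diff] simp: ra la)

lemma K_subgroup: "subgroup K F"
  by (rule F.generate_is_subgroup[OF rel_carrier])

lemma K_normal: "K \<lhd> F"
  by (simp add: F.normal_iff_subgroup K_subgroup)

lemma T_eq: "T = F Mod K"
  by (simp add: tensor_def Let_def)

lemma comm_group_tensor: "comm_group T"
  unfolding T_eq by (rule F.abelian_FactGroup[OF K_subgroup])

lemma pure_tensor_eq: "pure_tensor T i = K #>\<^bsub>F\<^esub> frag_of i"
  unfolding pure_tensor_def T_eq r_coset_def by auto

lemma coset_hom: "(\<lambda>a. K #>\<^bsub>F\<^esub> a) \<in> hom F T"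
  unfolding T_eq by (rule normal.r_coset_hom_Mod[OF K_normal])

lemma pure_closed: "m \<in> carrier M \<Longrightarrow> n \<in> carrier N \<Longrightarrow> pure_tensor T (m, n) \<in> carrier T"
  unfolding pure_tensor_eq by (rule hom_closed[OF coset_hom]) simp

lemma coset_rel:
  assumes "x \<in> carrier F" "y \<in> carrier F" "x - y \<in> rel"
  shows "K #>\<^bsub>F\<^esub> x = K #>\<^bsub>F\<^esub> y"
proof -
  have "x - y \<in> K" using assms(3) by (rule generate.incl)
  then have "x \<in> K #>\<^bsub>F\<^esub> y" unfolding r_coset_def by (auto intro!: bexI[of _ "x - y"])
  then show ?thesis by (rule F.repr_independence[OF _ assms(2) K_subgroup, symmetric])
qed

lemma pure_add:
  assumes "m \<in> carrier M" "n \<in> carrier N"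
  shows "m' \<in> carrier M \<Longrightarrow> pure_tensor T (m \<otimes>\<^bsub>M\<^esub> m', n) = pure_tensor T (m, n) \<otimes>\<^bsub>T\<^esub> pure_tensor T (m', n)"
    "n' \<in> carrier N \<Longrightarrow> pure_tensor T (m, n \<otimes>\<^bsub>N\<^esub> n') = pure_tensor T (m, n) \<otimes>\<^bsub>T\<^esub> pure_tensor T (m, n')"
proof -
  have *: "pure_tensor T a = pure_tensor T b \<otimes>\<^bsub>T\<^esub> pure_tensor T c"
    if "a \<in> carrier M \<times> carrier N" "b \<in> carrier M \<times> carrier N" "c \<in> carrier M \<times> carrier N"
      and "frag_of a - frag_of b - frag_of c \<in> rel" for a b c
  proof -
    have fc: "frag_of a \<in> carrier F" "frag_of b \<in> carrier F" "frag_of c \<in> carrier F" using that by auto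
    have "K #>\<^bsub>F\<^esub> frag_of a = K #>\<^bsub>F\<^esub> (frag_of b \<otimes>\<^bsub>F\<^esub> frag_of c)"
      using that(4) by (intro coset_rel F.m_closed fc) (simp add: diff_diff_add)
    then show ?thesis using hom_mult[OF coset_hom, of "frag_of b" "frag_of c"] that
      by (simp add: pure_tensor_eq)
  qed
  show "pure_tensor T (m \<otimes>\<^bsub>M\<^esub> m', n) = pure_tensor T (m, n) \<otimes>\<^bsub>T\<^esub> pure_tensor T (m', n)" if "m' \<in> carrier M"
    using assms that by (intro *) (auto simp: tensor_relations_def)
  show "pure_tensor T (m, n \<otimes>\<^bsub>N\<^esub> n') = pure_tensor T (m, n) \<otimes>\<^bsub>T\<^esub> pure_tensor T (m, n')" if "n' \<in> carrier N"
    using assms that by (intro *) (auto simp: tensor_relations_def)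
qed

lemma pure_balanced:
  assumes "s \<in> S" "m \<in> carrier M" "n \<in> carrier N"
  shows "pure_tensor T (ra s m, n) = pure_tensor T (m, la s n)"
  unfolding pure_tensor_eq using assms by (intro coset_rel) (auto simp: tensor_relations_def ra la)

text \<open>The inverse of a pure tensor is again pure (invert its first factor), and zero is a pure
  tensor. Hence no case for inverses is needed: the proof carries \<open>P\<close> for a coset and
  for its inverse simultaneously through the induction over differences of generators.\<close>

lemma tensor_induct [consumes 1, case_names pure add]:
  assumes t: "t \<in> carrier T"
    and p: "\<And>m n. m \<in> carrier M \<Longrightarrow> n \<in> carrier N \<Longrightarrow> P (pure_tensor T (m, n))"
    and a: "\<And>s t. s \<in> carrier T \<Longrightarrow> t \<in> carrier T \<Longrightarrow> P s \<Longrightarrow> P t \<Longrightarrow> P (s \<otimes>\<^bsub>T\<^esub> t)"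
  shows "P t"
proof -
  interpret T: comm_group T by (rule comm_group_tensor)
  have one: "pure_tensor T (\<one>\<^bsub>M\<^esub>, n) = \<one>\<^bsub>T\<^esub>" if "n \<in> carrier N" for n
    using pure_add(1)[of "\<one>\<^bsub>M\<^esub>" n "\<one>\<^bsub>M\<^esub>"] that pure_closed[of "\<one>\<^bsub>M\<^esub>" n]
    by (simp add: T.l_cancel_one')
  have inv: "inv\<^bsub>T\<^esub> pure_tensor T (m, n) = pure_tensor T (inv\<^bsub>M\<^esub> m, n)"
    if "m \<in> carrier M" "n \<in> carrier N" for m n
    using pure_add(1)[of "inv\<^bsub>M\<^esub> m" n m] that by (intro T.inv_equality) (simp_all add: one pure_closed)
  have *: "P (K #>\<^bsub>F\<^esub> x) \<and> P (inv\<^bsub>T\<^esub> (K #>\<^bsub>F\<^esub> x))" if "Poly_Mapping.keys x \<subseteq> carrier M \<times> carrier N" for x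
    using that
  proof (induction rule: free_Abelian_group_induct[consumes 1, case_names zero diff frag])
    case zero
    have "K #>\<^bsub>F\<^esub> 0 = \<one>\<^bsub>T\<^esub>"
      using comm_group_hom_one[OF coset_hom abelian_free_Abelian_group comm_group_tensor] by simp
    then show ?case using one[OF N.one_closed] p[of "\<one>\<^bsub>M\<^esub>" "\<one>\<^bsub>N\<^esub>"] by simp
  next
    case (diff x y)
    have c: "K #>\<^bsub>F\<^esub> x \<in> carrier T" "K #>\<^bsub>F\<^esub> y \<in> carrier T"
      using diff by (auto intro!: hom_closed[OF coset_hom])
    have eq: "K #>\<^bsub>F\<^esub> (x - y) = (K #>\<^bsub>F\<^esub> x) \<otimes>\<^bsub>T\<^esub> inv\<^bsub>T\<^esub> (K #>\<^bsub>F\<^esub> y)"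
    proof -
      have "K #>\<^bsub>F\<^esub> ((x - y) \<otimes>\<^bsub>F\<^esub> y) = (K #>\<^bsub>F\<^esub> (x - y)) \<otimes>\<^bsub>T\<^esub> (K #>\<^bsub>F\<^esub> y)"
        using diff keys_diff[of x y] by (intro hom_mult[OF coset_hom]) auto
      moreover have "K #>\<^bsub>F\<^esub> (x - y) \<in> carrier T"
        using diff keys_diff[of x y] by (intro hom_closed[OF coset_hom]) auto
      ultimately show ?thesis using c by (simp add: T.m_assoc)
    qed
    show ?case unfolding eq using diff c
      by (auto simp: T.inv_mult intro!: a)
  next
    case (frag i)
    then show ?case using p inv[of "fst i" "snd i"] by (auto simp: pure_tensor_eq[symmetric])
  qed
  from t obtain x where "x \<in> carrier F" "t = K #>\<^bsub>F\<^esub> x" unfolding T_eq carrier_FactGroup by auto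
  then show ?thesis using * by auto
qed

lemma tensor_hom_eqI:
  assumes "f \<in> hom T G" "g \<in> hom T G"
    "\<And>m n. m \<in> carrier M \<Longrightarrow> n \<in> carrier N \<Longrightarrow> f (pure_tensor T (m, n)) = g (pure_tensor T (m, n))"
    "t \<in> carrier T"
  shows "f t = g t"
  using assms(4) by (induction rule: tensor_induct) (simp_all add: assms(3) hom_mult[OF assms(1)] hom_mult[OF assms(2)])

text \<open>The formula in \<open>tensor_lift\<close>, read on the free abelian group, is a
  homomorphism \<open>h\<close> that kills the relations and thus the subgroup they generate. So its
  value does not depend on the representative chosen by \<open>SOME\<close>.\<close>

lemma tensor_lift:
  assumes G: "comm_group G" and b: "balanced S ra la M N G \<phi>"
  shows "tensor_lift G (\<lambda>(m, n). \<phi> m n) \<in> hom T G"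
    "\<And>m n. m \<in> carrier M \<Longrightarrow> n \<in> carrier N \<Longrightarrow> tensor_lift G (\<lambda>(m, n). \<phi> m n) (pure_tensor T (m, n)) = \<phi> m n"
proof -
  interpret G: comm_group G by (rule G)
  let ?f = "\<lambda>(m, n). \<phi> m n"
  define h where "h p = finprod G (\<lambda>i. ?f i [^]\<^bsub>G\<^esub> Poly_Mapping.lookup p i) (Poly_Mapping.keys p)" for p :: "'m \<times> 'n \<Rightarrow>\<^sub>0 int"
  have fc: "?f i \<in> carrier G" if "i \<in> carrier M \<times> carrier N" for i
    using that balancedD(1)[OF b] by auto
  \<comment> \<open>The sum may be taken over any finite set containing the support. This makes
    \<open>h x\<close>, \<open>h y\<close> and \<open>h (x + y)\<close> comparable, as they have
    different supports.\<close>
  have h_big: "h p = finprod G (\<lambda>i. ?f i [^]\<^bsub>G\<^esub> Poly_Mapping.lookup p i) A"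
    if "finite A" "Poly_Mapping.keys p \<subseteq> A" "A \<subseteq> carrier M \<times> carrier N" for p A
    unfolding h_def using that
    by (intro G.finprod_mono_neutral_cong_left) (use fc in \<open>auto simp: in_keys_iff intro!: G.int_pow_closed balancedD(1)[OF b]\<close>)
  have h: "h \<in> hom F G"
  proof (rule homI)
    fix x y assume xy: "x \<in> carrier F" "y \<in> carrier F"
    let ?A = "Poly_Mapping.keys x \<union> Poly_Mapping.keys y"
    have A: "finite ?A" "?A \<subseteq> carrier M \<times> carrier N" "Poly_Mapping.keys (x + y) \<subseteq> ?A"
      using xy keys_add[of x y] by auto
    have fp: "(\<lambda>i. ?f i [^]\<^bsub>G\<^esub> Poly_Mapping.lookup p i) \<in> ?A \<rightarrow> carrier G" for p :: "'m \<times> 'n \<Rightarrow>\<^sub>0 int"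
      using A(2) fc by blast
    have "h (x + y) = finprod G (\<lambda>i. ?f i [^]\<^bsub>G\<^esub> Poly_Mapping.lookup x i \<otimes>\<^bsub>G\<^esub> ?f i [^]\<^bsub>G\<^esub> Poly_Mapping.lookup y i) ?A"
      unfolding h_big[OF A(1,3,2)] using fp[of x] fp[of y] A(2) fc
      by (intro G.finprod_cong' refl Pi_I G.m_closed)
        (auto simp: Poly_Mapping.lookup_add G.int_pow_mult Pi_iff simp del: Un_iff)
    also have "\<dots> = h x \<otimes>\<^bsub>G\<^esub> h y"
      using fp[of x] fp[of y] A(1,2) by (simp add: h_big[of ?A x] h_big[of ?A y])
    finally show "h (x \<otimes>\<^bsub>F\<^esub> y) = h x \<otimes>\<^bsub>G\<^esub> h y" by simp
  qed (use fc in \<open>auto simp: h_def intro!: G.finprod_closed\<close>)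
  have h_frag: "h (frag_of (m, n)) = \<phi> m n" if "m \<in> carrier M" "n \<in> carrier N" for m n
    unfolding h_def using fc[of "(m, n)"] that by (simp add: G.finprod_insert)
  have h_diff: "h (x - y) = h x \<otimes>\<^bsub>G\<^esub> inv\<^bsub>G\<^esub> h y" if "x \<in> carrier F" "y \<in> carrier F" for x y
  proof -
    have "x - y \<in> carrier F" using that keys_diff[of x y] by auto
    then have "h ((x - y) \<otimes>\<^bsub>F\<^esub> y) = h (x - y) \<otimes>\<^bsub>G\<^esub> h y" using that by (intro hom_mult[OF h]) auto
    then show ?thesis using that \<open>x - y \<in> carrier F\<close> hom_closed[OF h] by (simp add: G.m_assoc)
  qed
  have h_rel: "h x = \<one>\<^bsub>G\<^esub>" if "x \<in> rel" for x
  proof -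
    have d: "frag_of a - frag_of c \<in> carrier F" if "a \<in> carrier M \<times> carrier N" "c \<in> carrier M \<times> carrier N" for a c
      using that keys_diff[of "frag_of a" "frag_of c"] by auto
    from that show ?thesis
      unfolding tensor_relations_def
    proof (elim UnE CollectE exE conjE, goal_cases)
      case (1 m m' n)
      then show ?case using d[of "(m \<otimes>\<^bsub>M\<^esub> m', n)" "(m, n)"] balancedD(1,3)[OF b]
        by (simp add: h_diff h_frag del: carrier_free_Abelian_group_iff) (simp add: G.m_ac G.inv_mult G.m_lcomm)
    next
      case (2 m n n')
      then show ?case using d[of "(m, n \<otimes>\<^bsub>N\<^esub> n')" "(m, n)"] balancedD(1,2)[OF b]
        by (simp add: h_diff h_frag del: carrier_free_Abelian_group_iff) (simp add: G.m_ac G.inv_mult G.m_lcomm)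
    next
      case (3 s m n)
      then show ?case using balancedD(1,4)[OF b]
        by (simp add: h_diff h_frag ra la del: carrier_free_Abelian_group_iff)
    qed
  qed
  have h_K: "h x = \<one>\<^bsub>G\<^esub>" if "x \<in> K" for x
    using that
  proof (induction rule: generate.induct)
    case one then show ?case using comm_group_hom_one[OF h abelian_free_Abelian_group G] by simp
  next
    case (incl x) then show ?case by (rule h_rel)
  next
    case (inv x)
    then have "x \<in> carrier F" using rel_carrier by (rule subsetD[rotated])
    then have "h (inv\<^bsub>F\<^esub> x) = inv\<^bsub>G\<^esub> h x"
      by (metis F.is_group G.is_group group_hom.hom_inv group_hom_axioms.intro group_hom_def h)
    then show ?case using h_rel[OF inv] by simp
  next
    case (eng x y)
    then have "x \<in> carrier F" "y \<in> carrier F" using F.generate_in_carrier[OF rel_carrier] by auto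
    then show ?case using eng hom_mult[OF h, of x y] by simp
  qed
  have val: "tensor_lift G ?f (K #>\<^bsub>F\<^esub> x) = h x" if x: "x \<in> carrier F" for x
  proof -
    have "x \<in> K #>\<^bsub>F\<^esub> x" using F.rcos_self[OF x K_subgroup] .
    then have "(SOME p. p \<in> K #>\<^bsub>F\<^esub> x) \<in> K #>\<^bsub>F\<^esub> x" by (rule someI)
    then obtain y where y: "y \<in> K" "(SOME p. p \<in> K #>\<^bsub>F\<^esub> x) = y \<otimes>\<^bsub>F\<^esub> x" unfolding r_coset_def by auto
    then have "y \<in> carrier F" using F.generate_in_carrier[OF rel_carrier] by auto
    then have "h (y \<otimes>\<^bsub>F\<^esub> x) = h x"
      using hom_mult[OF h, of y x] h_K[OF y(1)] x hom_closed[OF h x] by (metis G.l_one)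
    then show ?thesis unfolding tensor_lift_def Let_def y(2) h_def .
  qed
  show "tensor_lift G ?f \<in> hom T G"
  proof (rule homI)
    fix x assume "x \<in> carrier T"
    then show "tensor_lift G ?f x \<in> carrier G" unfolding T_eq carrier_FactGroup
      using val hom_closed[OF h] by auto
  next
    fix x y assume "x \<in> carrier T" "y \<in> carrier T"
    then obtain a c where a: "a \<in> carrier F" "x = K #>\<^bsub>F\<^esub> a" and c: "c \<in> carrier F" "y = K #>\<^bsub>F\<^esub> c"
      unfolding T_eq carrier_FactGroup by auto
    show "tensor_lift G ?f (x \<otimes>\<^bsub>T\<^esub> y) = tensor_lift G ?f x \<otimes>\<^bsub>G\<^esub> tensor_lift G ?f y"
      unfolding a(2) c(2) hom_mult[OF coset_hom a(1) c(1), symmetric]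
      using val[OF a(1)] val[OF c(1)] val[of "a \<otimes>\<^bsub>F\<^esub> c"] hom_mult[OF h a(1) c(1)] F.m_closed[OF a(1) c(1)] by metis
  qed
  fix m n assume "m \<in> carrier M" "n \<in> carrier N"
  then show "tensor_lift G ?f (pure_tensor T (m, n)) = \<phi> m n"
    unfolding pure_tensor_eq using val[of "frag_of (m, n)"] h_frag[of m n] by simp
qed

text \<open>A free abelian group on an infinite set has the cardinality of that set, and the tensor
  product is a quotient of one. This is what keeps tensor products inside a universe.\<close>

lemma tensor_lepoll:
  assumes "carrier M \<lesssim> A" "carrier N \<lesssim> A" "infinite A"
  shows "carrier T \<lesssim> A"
proof -
  have AA: "A \<times> A \<lesssim> A"
    using card_of_Times_same_infinite[OF assms(3)]
    by (meson lepoll_def card_of_ordLeq ordIso_iff_ordLeq)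
  have "carrier M \<times> carrier N \<lesssim> A"
    using lepoll_trans[OF times_lepoll_mono[OF assms(1,2)] AA] .
  then obtain j where j: "inj_on j (carrier M \<times> carrier N)" "j ` (carrier M \<times> carrier N) \<subseteq> A" by (auto simp: lepoll_def)
  have "carrier T \<lesssim> carrier F" unfolding T_eq carrier_FactGroup by (rule image_lepoll)
  also have "carrier F \<lesssim> carrier (free_Abelian_group A)"
    unfolding lepoll_def
  proof (intro exI conjI)
    let ?f = "frag_extend (\<lambda>i. frag_of (j i))" and ?g = "frag_extend (\<lambda>i. frag_of (inv_into (carrier M \<times> carrier N) j i))"
    have "?g (?f x) = x" if "x \<in> carrier F" for x
    proof -
      have "?g (?f x) = frag_extend (\<lambda>i. frag_of (inv_into (carrier M \<times> carrier N) j (j i))) x"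
        using frag_extend_compose[of "\<lambda>i. frag_of (inv_into (carrier M \<times> carrier N) j i)" j x] by (simp add: o_def)
      also have "\<dots> = frag_extend frag_of x"
        using that j(1) by (intro frag_extend_eq) (auto simp: inv_into_f_f)
      finally show ?thesis by (simp add: frag_expansion[symmetric])
    qed
    then show "inj_on ?f (carrier F)" by (rule inj_on_inverseI)
    show "?f ` carrier F \<subseteq> carrier (free_Abelian_group A)"
      using j(2) by (force dest!: subsetD[OF keys_frag_extend])
  qed
  also have "\<dots> \<approx> A" by (rule eqpoll_free_Abelian_group_infinite[OF assms(3)])
  finally show ?thesis .
qed

end

section \<open>The enveloping algebra\<close>

lemma module_universe_lepoll_self:
  assumes "module_universe S U"
  obtains B where "B \<in> U" "infinite B" "S \<lesssim> B"
proof -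
  obtain A where A: "A \<in> U" "infinite A" using assms by (auto simp: module_universe_def)
  then obtain a where a: "a \<in> A" by fastforce
  have "\<not> A \<subseteq> {a}" using A(2) finite_subset by blast
  then obtain b where ab: "a \<in> A" "b \<in> A" "a \<noteq> b" using a by auto
  \<comment> \<open>A point goes to its indicator function with the two values \<open>a\<close> and
    \<open>b\<close>.\<close>
  have 1: "S \<lesssim> (S \<rightarrow>\<^sub>E A)" unfolding lepoll_def
    by (rule exI[of _ "\<lambda>s. \<lambda>t\<in>S. if t = s then a else b"])
      (use ab in \<open>auto simp: inj_on_def fun_eq_iff restrict_def split: if_splits\<close>)
  obtain B where B: "B \<in> U" "(S \<rightarrow>\<^sub>E A) \<lesssim> B" using assms A by (auto simp: module_universe_def)
  have SB: "S \<lesssim> B" using lepoll_trans[OF 1 B(2)] .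
  show thesis
  proof (cases "infinite B")
    case True then show thesis using that B SB by blast
  next
    case False
    then have "S \<lesssim> A" using lepoll_trans[OF SB finite_lepoll_infinite[OF A(2)]] by blast
    then show thesis using that A by blast
  qed
qed

lemma lepoll_total: "A \<lesssim> B \<or> B \<lesssim> A"
  unfolding lepoll_def card_of_ordLeq
  by (rule ordLeq_total) (rule card_of_Well_order)+

text \<open>Any two sets are comparable in cardinality, so the largest of \<open>A\<close>,
  \<open>B\<close> and an infinite member of \<open>U\<close> serves as a common bound.\<close>

lemma module_universe_bound:
  assumes "module_universe S U" "A \<in> U" "B \<in> U"
  obtains D where "D \<in> U" "infinite D" "A \<lesssim> D" "B \<lesssim> D"
proof -
  obtain J where J: "J \<in> U" "infinite J" using assms by (auto simp: module_universe_def)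
  have *: "\<exists>D\<in>U. infinite D \<and> A \<lesssim> D \<and> C \<lesssim> D" if C: "C \<in> U" "infinite C" and A: "A \<in> U" for A C
  proof (cases "A \<lesssim> C")
    case False
    then have "C \<lesssim> A" using lepoll_total by blast
    then have "infinite A" using C(2) infinite_le_lepoll lepoll_trans by blast
    then show ?thesis using A \<open>C \<lesssim> A\<close> by blast
  qed (use C in blast)
  obtain D where D: "D \<in> U" "infinite D" "A \<lesssim> D" using *[OF J assms(2)] by blast
  obtain D' where D': "D' \<in> U" "infinite D'" "B \<lesssim> D'" "D \<lesssim> D'" using *[OF D(1,2) assms(3)] by blast
  show thesis using that[OF D'(1,2) lepoll_trans[OF D(3) D'(4)] D'(3)] .
qed

lemma encoding:
  assumes U: "module_universe S U" and "A \<lesssim> B" "B \<in> U"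
  shows "inj_on (encoding U A) A" "encoding U A ` A \<in> U"
proof -
  obtain f where f: "inj_on f A" "f ` A \<subseteq> B" using assms(2) by (auto simp: lepoll_def)
  have "f ` A \<lesssim> B" using f(2) by (rule subset_imp_lepoll)
  then have "f ` A \<in> U" using U assms(3) by (auto simp: module_universe_def)
  then have "inj_on (encoding U A) A \<and> encoding U A ` A \<in> U"
    unfolding encoding_def using f(1) by (intro someI[of "\<lambda>e. inj_on e A \<and> e ` A \<in> U" f]) auto
  then show "inj_on (encoding U A) A" "encoding U A ` A \<in> U" by auto
qed

lemma decoding_encoding: "inj_on (encoding U A) A \<Longrightarrow> x \<in> A \<Longrightarrow> decoding U A (encoding U A x) = x"
  by (simp add: decoding_def inv_into_f_f)

lemma left_moduleD:
  assumes "left_module A M"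
  shows "ring A" "comm_group M"
    "a \<in> carrier A \<Longrightarrow> x \<in> carrier M \<Longrightarrow> scal M a x \<in> carrier M"
    "a \<in> carrier A \<Longrightarrow> x \<in> carrier M \<Longrightarrow> y \<in> carrier M \<Longrightarrow> scal M a (x \<otimes>\<^bsub>M\<^esub> y) = scal M a x \<otimes>\<^bsub>M\<^esub> scal M a y"
    "a \<in> carrier A \<Longrightarrow> b \<in> carrier A \<Longrightarrow> x \<in> carrier M \<Longrightarrow> scal M (a \<oplus>\<^bsub>A\<^esub> b) x = scal M a x \<otimes>\<^bsub>M\<^esub> scal M b x"
    "a \<in> carrier A \<Longrightarrow> b \<in> carrier A \<Longrightarrow> x \<in> carrier M \<Longrightarrow> scal M (a \<otimes>\<^bsub>A\<^esub> b) x = scal M a (scal M b x)"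
    "x \<in> carrier M \<Longrightarrow> scal M \<one>\<^bsub>A\<^esub> x = x"
  using assms by (auto simp: left_module_def)

lemma left_module_scal_hom: "left_module A M \<Longrightarrow> a \<in> carrier A \<Longrightarrow> scal M a \<in> hom M M"
  by (auto simp: hom_def left_moduleD)

lemma opposite_simps [simp]:
  "carrier (opposite R) = carrier R" "\<one>\<^bsub>opposite R\<^esub> = \<one>\<^bsub>R\<^esub>" "\<zero>\<^bsub>opposite R\<^esub> = \<zero>\<^bsub>R\<^esub>"
  "ring.add (opposite R) = ring.add R" "x \<otimes>\<^bsub>opposite R\<^esub> y = y \<otimes>\<^bsub>R\<^esub> x"
  by (simp_all add: opposite_def)

lemma smult_opposite [simp]: "smult (opposite R) = smult R"
  by (simp add: opposite_def)

section \<open>The enveloping algebra on pure tensors\<close>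

locale env_algebra =
  fixes k :: "'k ring" and R :: "('k, 'r) module"
  assumes k: "cring k" and kR: "k_algebra k R"
begin

sublocale R: ring R using kR by (simp add: k_algebra_def)
sublocale kR: Module.module k R using kR by (simp add: k_algebra_def)

lemma comm_group_R: "comm_group (add_monoid R)"
  by (rule R.a_comm_group)

lemma smult_mult:
  assumes "c \<in> carrier k" "x \<in> carrier R" "y \<in> carrier R"
  shows "(c \<odot>\<^bsub>R\<^esub> x) \<otimes>\<^bsub>R\<^esub> y = c \<odot>\<^bsub>R\<^esub> (x \<otimes>\<^bsub>R\<^esub> y)" "x \<otimes>\<^bsub>R\<^esub> (c \<odot>\<^bsub>R\<^esub> y) = c \<odot>\<^bsub>R\<^esub> (x \<otimes>\<^bsub>R\<^esub> y)"
  using kR assms by (auto simp: k_algebra_def)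

abbreviation "ET \<equiv> env_group k R"
abbreviation "E \<equiv> enveloping k R"
abbreviation "pe a b \<equiv> pure_tensor ET (a, b)"

sublocale ET: tensor_product "carrier k" "smult R" "smult R" "add_monoid R" "add_monoid R"
  by unfold_locales (auto simp: comm_group_R)

lemma ET_eq: "ET = ET.T"
  by (simp add: env_group_def)

lemma E_simps: "carrier E = carrier ET" "ring.add E = monoid.mult ET" "\<one>\<^bsub>E\<^esub> = pe \<one>\<^bsub>R\<^esub> \<one>\<^bsub>R\<^esub>" "\<zero>\<^bsub>E\<^esub> = \<one>\<^bsub>ET\<^esub>"
  by (simp_all add: enveloping_def Let_def)

lemma comm_group_ET: "comm_group ET"
  unfolding ET_eq by (rule ET.comm_group_tensor)

lemma pe_closed [simp]: "a \<in> carrier R \<Longrightarrow> b \<in> carrier R \<Longrightarrow> pe a b \<in> carrier E"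
  unfolding E_simps using ET.pure_closed[of a b] unfolding ET_eq by simp

lemma pe_add:
  "a \<in> carrier R \<Longrightarrow> a' \<in> carrier R \<Longrightarrow> b \<in> carrier R \<Longrightarrow> pe (a \<oplus>\<^bsub>R\<^esub> a') b = pe a b \<otimes>\<^bsub>ET\<^esub> pe a' b"
  "a \<in> carrier R \<Longrightarrow> b' \<in> carrier R \<Longrightarrow> b \<in> carrier R \<Longrightarrow> pe a (b \<oplus>\<^bsub>R\<^esub> b') = pe a b \<otimes>\<^bsub>ET\<^esub> pe a b'"
  using ET.pure_add[of a b] unfolding ET_eq by simp_all

lemma pe_balanced:
  "c \<in> carrier k \<Longrightarrow> a \<in> carrier R \<Longrightarrow> b \<in> carrier R \<Longrightarrow> pe (c \<odot>\<^bsub>R\<^esub> a) b = pe a (c \<odot>\<^bsub>R\<^esub> b)"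
  using ET.pure_balanced[of c a b] unfolding ET_eq by simp

lemma env_induct [consumes 1, case_names pure add]:
  assumes "z \<in> carrier E"
    "\<And>a b. a \<in> carrier R \<Longrightarrow> b \<in> carrier R \<Longrightarrow> P (pe a b)"
    "\<And>z w. z \<in> carrier E \<Longrightarrow> w \<in> carrier E \<Longrightarrow> P z \<Longrightarrow> P w \<Longrightarrow> P (z \<oplus>\<^bsub>E\<^esub> w)"
  shows "P z"
  using ET.tensor_induct[of z P] assms unfolding E_simps ET_eq by simp

abbreviation "env_balanced G \<phi> \<equiv> balanced (carrier k) (smult R) (smult R) (add_monoid R) (add_monoid R) G \<phi>"

lemma env_lift:
  assumes "comm_group G" "env_balanced G \<phi>"
  shows "tensor_lift G (\<lambda>(a, b). \<phi> a b) \<in> hom ET G"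
    "a \<in> carrier R \<Longrightarrow> b \<in> carrier R \<Longrightarrow> tensor_lift G (\<lambda>(a, b). \<phi> a b) (pe a b) = \<phi> a b"
  using ET.tensor_lift[OF assms] unfolding ET_eq by simp_all

text \<open>The product is defined by two nested lifts over chosen representatives. To evaluate it,
  the inner map must be balanced in (c, d), and then the resulting function of (a, b) must be
  balanced too; the latter is tested on pure tensors. The second components multiply in the opposite
  ring.\<close>

lemma env_mult:
  assumes "a \<in> carrier R" "b \<in> carrier R" "c \<in> carrier R" "d \<in> carrier R"
  shows "pe a b \<otimes>\<^bsub>E\<^esub> pe c d = pe (a \<otimes>\<^bsub>R\<^esub> c) (d \<otimes>\<^bsub>R\<^esub> b)"
proof -
  interpret ETg: comm_group ET by (rule comm_group_ET)
  have inner: "env_balanced ET (\<lambda>c d. pe (a \<otimes>\<^bsub>R\<^esub> c) (d \<otimes>\<^bsub>R\<^esub> b))" if "a \<in> carrier R" "b \<in> carrier R" for a b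
    using that by (intro balancedI2) (auto simp: R.r_distr R.l_distr pe_add smult_mult pe_balanced simp flip: E_simps)
  define I where "I a b = tensor_lift ET (\<lambda>(c, d). pe (a \<otimes>\<^bsub>R\<^esub> c) (d \<otimes>\<^bsub>R\<^esub> b))" for a b
  have I: "I a b \<in> hom ET ET" "\<And>c d. c \<in> carrier R \<Longrightarrow> d \<in> carrier R \<Longrightarrow> I a b (pe c d) = pe (a \<otimes>\<^bsub>R\<^esub> c) (d \<otimes>\<^bsub>R\<^esub> b)"
    if "a \<in> carrier R" "b \<in> carrier R" for a b
    unfolding I_def using env_lift[OF comm_group_ET inner[OF that]] by auto
  note eqI = ET.tensor_hom_eqI[folded ET_eq, where G = ET]
  have outer: "env_balanced ET (\<lambda>a b. I a b w)" if w: "w \<in> carrier ET" for w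
  proof (rule balancedI2)
    fix a b assume ab: "a \<in> carrier (add_monoid R)" "b \<in> carrier (add_monoid R)"
    then show "I a b w \<in> carrier ET" using hom_closed[OF I(1) w] by simp
    have ab': "a \<in> carrier R" "b \<in> carrier R" using ab by auto
    show "I a (b \<otimes>\<^bsub>add_monoid R\<^esub> b') w = I a b w \<otimes>\<^bsub>ET\<^esub> I a b' w" if "b' \<in> carrier (add_monoid R)" for b'
    proof -
      have b': "b' \<in> carrier R" using that by simp
      have "I a (b \<oplus>\<^bsub>R\<^esub> b') w = (\<lambda>w. I a b w \<otimes>\<^bsub>ET\<^esub> I a b' w) w"
        by (rule eqI[OF _ hom_sum_hom[OF _ _ comm_group_ET] _ w])
          (use ab' b' in \<open>simp_all add: I(1) R.a_closed\<close>, simp add: I(2) R.r_distr pe_add)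
      then show ?thesis by simp
    qed
    show "I (a \<otimes>\<^bsub>add_monoid R\<^esub> a') b w = I a b w \<otimes>\<^bsub>ET\<^esub> I a' b w" if "a' \<in> carrier (add_monoid R)" for a'
    proof -
      have a': "a' \<in> carrier R" using that by simp
      have "I (a \<oplus>\<^bsub>R\<^esub> a') b w = (\<lambda>w. I a b w \<otimes>\<^bsub>ET\<^esub> I a' b w) w"
        by (rule eqI[OF _ hom_sum_hom[OF _ _ comm_group_ET] _ w])
          (use ab' a' in \<open>simp_all add: I(1) R.a_closed\<close>, simp add: I(2) R.l_distr pe_add)
      then show ?thesis by simp
    qed
    show "I (s \<odot>\<^bsub>R\<^esub> a) b w = I a (s \<odot>\<^bsub>R\<^esub> b) w" if s: "s \<in> carrier k" for s
      by (rule eqI[of "I (s \<odot>\<^bsub>R\<^esub> a) b" "I a (s \<odot>\<^bsub>R\<^esub> b)", OF _ _ _ w])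
        (use ab' s in \<open>simp_all add: I(1)\<close>, simp add: I(2) smult_mult pe_balanced)
  qed
  have "pe a b \<otimes>\<^bsub>E\<^esub> pe c d = tensor_lift ET (\<lambda>(a, b). I a b (pe c d)) (pe a b)"
    by (simp add: enveloping_def Let_def I_def)
  also have "\<dots> = I a b (pe c d)"
    using env_lift(2)[OF comm_group_ET outer[of "pe c d"]] assms by (simp flip: E_simps)
  finally show ?thesis using I assms by simp
qed

abbreviation "eL \<equiv> env_left k R"
abbreviation "eR \<equiv> env_right k R"

lemma eL_closed [simp]: "a \<in> carrier R \<Longrightarrow> eL a \<in> carrier E"
  by (simp add: env_left_def)

lemma eR_closed [simp]: "a \<in> carrier R \<Longrightarrow> eR a \<in> carrier E"
  by (simp add: env_right_def)

lemma env_simps: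
  assumes "a \<in> carrier R" "b \<in> carrier R"
  shows "eL a \<otimes>\<^bsub>E\<^esub> eR b = pe a b" "eR b \<otimes>\<^bsub>E\<^esub> eL a = pe a b"
    "eL (a \<otimes>\<^bsub>R\<^esub> b) = eL a \<otimes>\<^bsub>E\<^esub> eL b" "eR (a \<otimes>\<^bsub>R\<^esub> b) = eR b \<otimes>\<^bsub>E\<^esub> eR a"
    "eL (a \<oplus>\<^bsub>R\<^esub> b) = eL a \<oplus>\<^bsub>E\<^esub> eL b" "eR (a \<oplus>\<^bsub>R\<^esub> b) = eR a \<oplus>\<^bsub>E\<^esub> eR b"
  using assms by (simp_all add: env_left_def env_right_def env_mult pe_add E_simps(2))

lemma env_one: "eL \<one>\<^bsub>R\<^esub> = \<one>\<^bsub>E\<^esub>" "eR \<one>\<^bsub>R\<^esub> = \<one>\<^bsub>E\<^esub>"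
  by (simp_all add: env_left_def env_right_def E_simps)

lemma env_k: "c \<in> carrier k \<Longrightarrow> eL (c \<odot>\<^bsub>R\<^esub> \<one>\<^bsub>R\<^esub>) = eR (c \<odot>\<^bsub>R\<^esub> \<one>\<^bsub>R\<^esub>)"
  by (simp add: env_left_def env_right_def pe_balanced)

end

section \<open>Bimodules\<close>

lemma lmod_homD:
  assumes "f \<in> lmod_hom A M N"
  shows "f \<in> hom M N" "f \<in> extensional (carrier M)"
    "a \<in> carrier A \<Longrightarrow> x \<in> carrier M \<Longrightarrow> f (scal M a x) = scal N a (f x)"
    "x \<in> carrier M \<Longrightarrow> f x \<in> carrier N"
  using assms by (auto simp: lmod_hom_def hom_def)

lemma module_cat_simps [simp]:
  "Obj (module_cat U A) = {M. left_module A M \<and> carrier M \<in> U}"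
  "Dom (module_cat U A) = src" "Cod (module_cat U A) = tgt"
  "Arr (module_cat U A) = {Arrow M N f | M N f. M \<in> Obj (module_cat U A) \<and> N \<in> Obj (module_cat U A) \<and> f \<in> lmod_hom A M N}"
  "Idn (module_cat U A) M = Arrow M M (\<lambda>x\<in>carrier M. x)"
  "Cmp (module_cat U A) g f = Arrow (src f) (tgt g) (compose (carrier (src f)) (fn g) (fn f))"
  by (simp_all add: module_cat_def Let_def)

lemma module_cat_homset:
  "f \<in> homset (module_cat U A) M N \<longleftrightarrow>
     M \<in> Obj (module_cat U A) \<and> N \<in> Obj (module_cat U A) \<and> fn f \<in> lmod_hom A M N \<and> f = Arrow M N (fn f)"
  by (cases f) (auto simp: homset_def)

text \<open>That bimodules form a monoidal category is an assumption of the locale. It will be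
  supplied by the strict monoidality that is part of the notion of a bialgebroid.\<close>

locale bimods = env_algebra k R
  for k :: "'k ring" and R :: "('k, 'r) module" +
  fixes U :: "'u set set"
  assumes U: "module_universe (carrier R) U" and mon: "monoidal_category (bimod_cat U k R)"
begin

abbreviation "C \<equiv> bimod_cat U k R"

sublocale C: monoidal_category C by (rule mon)

text \<open>For a bimodule \<open>M\<close>, \<open>la M r x\<close> is \<open>r x\<close> and \<open>ra M r x\<close> is \<open>x r\<close>; \<open>llin\<close> and \<open>rlin\<close> are the corresponding
  one-sided linear maps. Pure tensors are denoted by \<open>pt\<close>, tensor products of maps by \<open>tm\<close>, and the
  functions \<open>as\<close>, \<open>ai\<close>, \<open>lu\<close>, \<open>ru\<close> are the associativity (and its inverse) and unit constraints.\<close>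

abbreviation "tens \<equiv> bimod_tens U k R"
abbreviation "pt \<equiv> bimod_pure U k R"
abbreviation "I \<equiv> bimod_unit U k R"
abbreviation "la M r \<equiv> scal M (eL r)"
abbreviation "ra M r \<equiv> scal M (eR r)"

lemma C_simps [simp]:
  "TensO C = tens" "UnitO C = I"
  "Dom C = src" "Cod C = tgt"
  "Obj C = {M. left_module E M \<and> carrier M \<in> U}"
  "Idn C M = Arrow M M (\<lambda>x\<in>carrier M. x)"
  "Cmp C g f = Arrow (src f) (tgt g) (compose (carrier (src f)) (fn g) (fn f))"
  "TensA C f g = Arrow (tens (src f) (src g)) (tens (tgt f) (tgt g))
          (bimod_lift U k R (src f) (src g) (tens (tgt f) (tgt g)) (\<lambda>m n. pt (tgt f) (tgt g) (fn f m) (fn g n)))"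
  by (simp_all add: bimod_cat_def Let_def cat.extend_def moncat.fields_def)

lemma C_homset:
  "f \<in> homset C M N \<longleftrightarrow> M \<in> Obj C \<and> N \<in> Obj C \<and> fn f \<in> lmod_hom E M N \<and> f = Arrow M N (fn f)"
  using module_cat_homset[of f U E M N]
  by (simp add: homset_def bimod_cat_def Let_def cat.extend_def moncat.fields_def)

definition bm :: "('r env, 'u) lmod \<Rightarrow> bool" where
  "bm M \<longleftrightarrow> left_module E M \<and> carrier M \<in> U"

lemma bm_Obj: "M \<in> Obj C \<longleftrightarrow> bm M"
  by (simp add: bm_def)

lemma bm_tens [simp]: "bm M \<Longrightarrow> bm N \<Longrightarrow> bm (tens M N)"
  using C.TensO_closed[of M N] by (simp add: bm_def)

lemma bm_I [simp]: "bm I"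
  using C.UnitO_closed by (simp add: bm_def)

lemma ring_E: "ring E"
  using bm_I by (auto simp: bm_def left_module_def)

lemma bm_lmod: "bm M \<Longrightarrow> left_module E M"
  by (simp add: bm_def)

lemma bm_group [simp]: "bm M \<Longrightarrow> comm_group M"
  by (auto simp: bm_def left_module_def)

lemma bm_m_closed [simp]: "bm M \<Longrightarrow> x \<in> carrier M \<Longrightarrow> y \<in> carrier M \<Longrightarrow> x \<otimes>\<^bsub>M\<^esub> y \<in> carrier M"
  using comm_groupE(1)[OF bm_group] .

lemma act_closed [simp]:
  "bm M \<Longrightarrow> r \<in> carrier R \<Longrightarrow> x \<in> carrier M \<Longrightarrow> la M r x \<in> carrier M"
  "bm M \<Longrightarrow> r \<in> carrier R \<Longrightarrow> x \<in> carrier M \<Longrightarrow> ra M r x \<in> carrier M"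
  by (auto intro!: left_moduleD(3)[OF bm_lmod])

lemma act_hom:
  "bm M \<Longrightarrow> r \<in> carrier R \<Longrightarrow> la M r \<in> hom M M"
  "bm M \<Longrightarrow> r \<in> carrier R \<Longrightarrow> ra M r \<in> hom M M"
  by (auto intro!: left_module_scal_hom[OF bm_lmod])

lemma act_add:
  assumes "bm M" "r \<in> carrier R" "x \<in> carrier M"
  shows "y \<in> carrier M \<Longrightarrow> la M r (x \<otimes>\<^bsub>M\<^esub> y) = la M r x \<otimes>\<^bsub>M\<^esub> la M r y"
    "y \<in> carrier M \<Longrightarrow> ra M r (x \<otimes>\<^bsub>M\<^esub> y) = ra M r x \<otimes>\<^bsub>M\<^esub> ra M r y"
    "s \<in> carrier R \<Longrightarrow> la M (r \<oplus>\<^bsub>R\<^esub> s) x = la M r x \<otimes>\<^bsub>M\<^esub> la M s x"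
    "s \<in> carrier R \<Longrightarrow> ra M (r \<oplus>\<^bsub>R\<^esub> s) x = ra M r x \<otimes>\<^bsub>M\<^esub> ra M s x"
  using assms by (auto simp: left_moduleD[OF bm_lmod] env_simps)

lemma act_mult:
  assumes "bm M" "r \<in> carrier R" "s \<in> carrier R" "x \<in> carrier M"
  shows "la M (r \<otimes>\<^bsub>R\<^esub> s) x = la M r (la M s x)"
    "ra M (r \<otimes>\<^bsub>R\<^esub> s) x = ra M s (ra M r x)"
    "ra M s (la M r x) = la M r (ra M s x)"
    "scal M (pe r s) x = la M r (ra M s x)"
  using assms left_moduleD(6)[OF bm_lmod[OF assms(1)], of "eL r" "eR s" x]
    left_moduleD(6)[OF bm_lmod[OF assms(1)], of "eR s" "eL r" x]
  by (auto simp: left_moduleD(6)[OF bm_lmod] env_simps)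

lemma act_one: "bm M \<Longrightarrow> x \<in> carrier M \<Longrightarrow> la M \<one>\<^bsub>R\<^esub> x = x" "bm M \<Longrightarrow> x \<in> carrier M \<Longrightarrow> ra M \<one>\<^bsub>R\<^esub> x = x"
  by (auto simp: left_moduleD[OF bm_lmod] env_one)

text \<open>A scalar \<open>c\<close> of \<open>k\<close> acts through the element \<open>c'\<close>
  of \<open>R\<close>, and \<open>c'\<close> \<otimes> 1 equals 1 \<otimes> \<open>c'\<close> in the
  enveloping algebra. Hence \<open>k\<close> acts alike from both sides. All balancedness over
  \<open>k\<close> below rests on moving \<open>c\<close> between the two sides in this way.\<close>

lemma act_k:
  assumes "bm M" "c \<in> carrier k" "r \<in> carrier R" "x \<in> carrier M"
  defines "c' \<equiv> c \<odot>\<^bsub>R\<^esub> \<one>\<^bsub>R\<^esub>"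
  shows "la M (c \<odot>\<^bsub>R\<^esub> r) x = la M r (la M c' x)" "la M c' x = ra M c' x"
    "ra M (c \<odot>\<^bsub>R\<^esub> r) x = ra M r (ra M c' x)" "c' \<in> carrier R"
proof -
  show c': "c' \<in> carrier R" using assms by simp
  have "c \<odot>\<^bsub>R\<^esub> r = r \<otimes>\<^bsub>R\<^esub> c'" "c \<odot>\<^bsub>R\<^esub> r = c' \<otimes>\<^bsub>R\<^esub> r" using assms by (simp_all add: smult_mult)
  then show "la M (c \<odot>\<^bsub>R\<^esub> r) x = la M r (la M c' x)" "ra M (c \<odot>\<^bsub>R\<^esub> r) x = ra M r (ra M c' x)"
    using assms c' by (metis act_mult(1), metis act_mult(2))
  show "la M c' x = ra M c' x" using assms by (simp add: env_k)
qed

section \<open>One-sided linear maps of bimodules\<close>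

definition llin :: "('r env, 'u) lmod \<Rightarrow> ('r env, 'u) lmod \<Rightarrow> ('u \<Rightarrow> 'u) \<Rightarrow> bool" where
  "llin M N f \<longleftrightarrow> f \<in> hom M N \<and> (\<forall>r\<in>carrier R. \<forall>x\<in>carrier M. f (la M r x) = la N r (f x))"

definition rlin :: "('r env, 'u) lmod \<Rightarrow> ('r env, 'u) lmod \<Rightarrow> ('u \<Rightarrow> 'u) \<Rightarrow> bool" where
  "rlin M N f \<longleftrightarrow> f \<in> hom M N \<and> (\<forall>r\<in>carrier R. \<forall>x\<in>carrier M. f (ra M r x) = ra N r (f x))"

lemma llin_hom: "llin M N f \<Longrightarrow> f \<in> hom M N" by (simp add: llin_def)
lemma rlin_hom: "rlin M N f \<Longrightarrow> f \<in> hom M N" by (simp add: rlin_def)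
lemma llinD: "llin M N f \<Longrightarrow> r \<in> carrier R \<Longrightarrow> x \<in> carrier M \<Longrightarrow> f (la M r x) = la N r (f x)" by (simp add: llin_def)
lemma rlinD: "rlin M N f \<Longrightarrow> r \<in> carrier R \<Longrightarrow> x \<in> carrier M \<Longrightarrow> f (ra M r x) = ra N r (f x)" by (simp add: rlin_def)
lemma llin_closed: "llin M N f \<Longrightarrow> x \<in> carrier M \<Longrightarrow> f x \<in> carrier N" by (auto simp: llin_def hom_def)
lemma rlin_closed: "rlin M N f \<Longrightarrow> x \<in> carrier M \<Longrightarrow> f x \<in> carrier N" by (auto simp: rlin_def hom_def)

lemma llinI: "f \<in> hom M N \<Longrightarrow> (\<And>r x. r \<in> carrier R \<Longrightarrow> x \<in> carrier M \<Longrightarrow> f (la M r x) = la N r (f x)) \<Longrightarrow> llin M N f"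
  by (simp add: llin_def)
lemma rlinI: "f \<in> hom M N \<Longrightarrow> (\<And>r x. r \<in> carrier R \<Longrightarrow> x \<in> carrier M \<Longrightarrow> f (ra M r x) = ra N r (f x)) \<Longrightarrow> rlin M N f"
  by (simp add: rlin_def)

lemma llin_id: "llin M M (\<lambda>x. x)" by (simp add: llin_def hom_def)
lemma rlin_id: "rlin M M (\<lambda>x. x)" by (simp add: rlin_def hom_def)

lemma llin_comp: "llin N P g \<Longrightarrow> llin M N f \<Longrightarrow> llin M P (\<lambda>x. g (f x))"
  by (auto simp: llin_def hom_def Pi_iff)
lemma rlin_comp: "rlin N P g \<Longrightarrow> rlin M N f \<Longrightarrow> rlin M P (\<lambda>x. g (f x))"
  by (auto simp: rlin_def hom_def Pi_iff)

text \<open>The elements \<open>pe a b\<close> generate \<open>E\<close> additively and act by the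
  left action of \<open>a\<close> and the right action of \<open>b\<close>.\<close>

lemma lmod_hom_iff:
  assumes M: "bm M" and N: "bm N"
  shows "f \<in> lmod_hom E M N \<longleftrightarrow> llin M N f \<and> rlin M N f \<and> f \<in> extensional (carrier M)"
proof safe
  assume f: "llin M N f" "rlin M N f" "f \<in> extensional (carrier M)"
  have "f (scal M z x) = scal N z (f x)" if z: "z \<in> carrier E" and x: "x \<in> carrier M" for z x
    using z
  proof (induction rule: env_induct)
    case (pure a b)
    then show ?case using x M N f by (simp add: act_mult llinD rlinD llin_closed)
  next
    case (add z w)
    then show ?case using x M N f
      by (simp add: left_moduleD[OF bm_lmod] llin_closed hom_mult[OF llin_hom[OF f(1)]])
  qed
  then show "f \<in> lmod_hom E M N" using f by (simp add: lmod_hom_def llin_def)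
qed (auto simp: lmod_hom_def llin_def rlin_def)

section \<open>The tensor product of two bimodules, on its copy in the universe\<close>

definition bal :: "('r env, 'u) lmod \<Rightarrow> ('r env, 'u) lmod \<Rightarrow> ('g, 'z) monoid_scheme \<Rightarrow> ('u \<Rightarrow> 'u \<Rightarrow> 'g) \<Rightarrow> bool" where
  "bal M N G \<phi> \<longleftrightarrow> balanced (carrier R) (ra M) (la N) M N G \<phi>"

lemma tensor_product: "bm M \<Longrightarrow> bm N \<Longrightarrow> tensor_product (carrier R) (ra M) (la N) M N"
  by (rule tensor_product.intro) auto

lemma bimod_tensor_eq: "bimod_tensor k R M N = tensor (carrier R) (ra M) (la N) M N"
  by (simp add: bimod_tensor_def)

context
  fixes M N assumes M: "bm M" and N: "bm N"
begin

interpretation T: tensor_product "carrier R" "ra M" "la N" M N by (rule tensor_product[OF M N])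

abbreviation "BT \<equiv> bimod_tensor k R M N"
abbreviation "enc \<equiv> encoding U (carrier BT)"
abbreviation "dec \<equiv> decoding U (carrier BT)"

lemma T_eq: "BT = T.T"
  by (simp add: bimod_tensor_eq)

lemma e_inj: "inj_on enc (carrier BT)"
proof -
  obtain B where "B \<in> U" "infinite B" "carrier M \<lesssim> B" "carrier N \<lesssim> B"
    using module_universe_bound[OF U, of "carrier M" "carrier N"] M N by (auto simp: bm_def)
  then show ?thesis using encoding(1)[OF U T.tensor_lepoll] by (simp add: T_eq)
qed

lemma d_e [simp]: "x \<in> carrier BT \<Longrightarrow> dec (enc x) = x"
  using decoding_encoding[OF e_inj] .

lemma tens_simps: "carrier (tens M N) = enc ` carrier BT" "x \<otimes>\<^bsub>tens M N\<^esub> y = enc (dec x \<otimes>\<^bsub>BT\<^esub> dec y)"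
  by (simp_all add: bimod_tens_def Let_def)

lemma comm_group_T: "comm_group BT"
  unfolding T_eq by (rule T.comm_group_tensor)

lemma e_hom: "enc \<in> hom BT (tens M N)"
  by (auto simp: hom_def tens_simps)

lemma d_hom: "dec \<in> hom (tens M N) BT"
proof -
  interpret TT: comm_group BT by (rule comm_group_T)
  show ?thesis by (auto simp: hom_def tens_simps)
qed

lemma pt_eq: "pt M N m n = enc (pure_tensor BT (m, n))"
  by (simp add: bimod_pure_def Let_def)

lemma pure_T: "m \<in> carrier M \<Longrightarrow> n \<in> carrier N \<Longrightarrow> pure_tensor BT (m, n) \<in> carrier BT"
  unfolding T_eq by (rule T.pure_closed)

lemma pt_closed [simp]: "m \<in> carrier M \<Longrightarrow> n \<in> carrier N \<Longrightarrow> pt M N m n \<in> carrier (tens M N)"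
  unfolding pt_eq by (rule hom_closed[OF e_hom pure_T])

lemma pt_bal: "bal M N (tens M N) (pt M N)"
  unfolding bal_def pt_eq
  by (rule balancedI2)
    (use M N in \<open>simp_all add: hom_closed[OF e_hom] pure_T T.pure_add[folded T_eq] hom_mult[OF e_hom] T.pure_balanced[folded T_eq]\<close>)

lemma pt_add:
  assumes "m \<in> carrier M" "n \<in> carrier N"
  shows "n' \<in> carrier N \<Longrightarrow> pt M N m (n \<otimes>\<^bsub>N\<^esub> n') = pt M N m n \<otimes>\<^bsub>tens M N\<^esub> pt M N m n'"
    "m' \<in> carrier M \<Longrightarrow> pt M N (m \<otimes>\<^bsub>M\<^esub> m') n = pt M N m n \<otimes>\<^bsub>tens M N\<^esub> pt M N m' n"
    "r \<in> carrier R \<Longrightarrow> pt M N (ra M r m) n = pt M N m (la N r n)"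
  using balancedD[OF pt_bal[unfolded bal_def]] assms by auto

lemma pt_hom: "m \<in> carrier M \<Longrightarrow> pt M N m \<in> hom N (tens M N)" "n \<in> carrier N \<Longrightarrow> (\<lambda>m. pt M N m n) \<in> hom M (tens M N)"
  by (auto intro!: homI simp: pt_add)

lemma tens_induct [consumes 1, case_names pure add]:
  assumes t: "t \<in> carrier (tens M N)"
    and p: "\<And>m n. m \<in> carrier M \<Longrightarrow> n \<in> carrier N \<Longrightarrow> P (pt M N m n)"
    and a: "\<And>s t. s \<in> carrier (tens M N) \<Longrightarrow> t \<in> carrier (tens M N) \<Longrightarrow> P s \<Longrightarrow> P t \<Longrightarrow> P (s \<otimes>\<^bsub>tens M N\<^esub> t)"
  shows "P t"
proof -
  have "P (enc x)" if "x \<in> carrier T.T" for x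
    using that
  proof (induction rule: T.tensor_induct)
    case (pure m n) then show ?case using p[of m n] by (simp add: pt_eq T_eq)
  next
    case (add x y)
    have "P (enc x \<otimes>\<^bsub>tens M N\<^esub> enc y)" using add hom_closed[OF e_hom] by (intro a) (simp_all add: T_eq)
    then show ?case using hom_mult[OF e_hom, of x y] add by (simp add: T_eq)
  qed
  then show ?thesis using t unfolding tens_simps by (auto simp: T_eq)
qed

lemma tens_eqI:
  assumes "f \<in> hom (tens M N) G" "g \<in> hom (tens M N) G"
    "\<And>m n. m \<in> carrier M \<Longrightarrow> n \<in> carrier N \<Longrightarrow> f (pt M N m n) = g (pt M N m n)"
    "t \<in> carrier (tens M N)"
  shows "f t = g t"
  using assms(4) by (induction rule: tens_induct) (simp_all add: assms(3) hom_mult[OF assms(1)] hom_mult[OF assms(2)])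

lemma lift:
  assumes "bm P" "bal M N P \<phi>"
  shows "bimod_lift U k R M N P \<phi> \<in> hom (tens M N) P"
    "bimod_lift U k R M N P \<phi> \<in> extensional (carrier (tens M N))"
    "m \<in> carrier M \<Longrightarrow> n \<in> carrier N \<Longrightarrow> bimod_lift U k R M N P \<phi> (pt M N m n) = \<phi> m n"
proof -
  note l = T.tensor_lift[OF bm_group[OF assms(1)] assms(2)[unfolded bal_def], folded T_eq]
  note h = hom_trans[OF l(1) d_hom]
  show "bimod_lift U k R M N P \<phi> \<in> hom (tens M N) P"
    unfolding bimod_lift_def
    by (rule homI) (use hom_closed[OF h] hom_mult[OF h] bm_m_closed[OF bm_tens[OF M N]] in \<open>simp_all\<close>)
  show "bimod_lift U k R M N P \<phi> \<in> extensional (carrier (tens M N))"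
    by (simp add: bimod_lift_def)
  show "bimod_lift U k R M N P \<phi> (pt M N m n) = \<phi> m n" if "m \<in> carrier M" "n \<in> carrier N"
    using that pt_closed[OF that] l(2) pure_T by (simp add: bimod_lift_def pt_eq)
qed

text \<open>Again a nested lift. The point is that the outer map is balanced over \<open>k\<close>:
  a scalar next to \<open>r\<close> acts on \<open>m\<close> from the right as well, crosses the
  tensor sign over \<open>R\<close>, and arrives next to \<open>s\<close>.\<close>

lemma tens_scal:
  assumes rs: "r \<in> carrier R" "s \<in> carrier R" and m: "m \<in> carrier M" and n: "n \<in> carrier N"
  shows "scal (tens M N) (pe r s) (pt M N m n) = pt M N (la M r m) (ra N s n)"
proof -
  have inner: "balanced (carrier R) (ra M) (la N) M N BT (\<lambda>m n. pure_tensor BT (la M r m, ra N s n))"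
    if "r \<in> carrier R" "s \<in> carrier R" for r s
    by (rule balancedI2)
      (use that M N in \<open>simp_all add: pure_T T.pure_add[folded T_eq] T.pure_balanced[folded T_eq] act_add flip: act_mult(3)\<close>)
  define L where "L r s = tensor_lift BT (\<lambda>(m, n). pure_tensor BT (la M r m, ra N s n))" for r s
  have L: "L r s \<in> hom BT BT" "\<And>m n. m \<in> carrier M \<Longrightarrow> n \<in> carrier N \<Longrightarrow> L r s (pure_tensor BT (m, n)) = pure_tensor BT (la M r m, ra N s n)"
    if "r \<in> carrier R" "s \<in> carrier R" for r s
    unfolding L_def using T.tensor_lift[OF comm_group_T inner[OF that], folded T_eq] by auto
  let ?p = "pure_tensor BT (m, n)"
  have p: "?p \<in> carrier BT" by (rule pure_T[OF m n])
  have outer: "env_balanced BT (\<lambda>r s. L r s ?p)"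
  proof (rule balancedI2)
    fix r s assume "r \<in> carrier (add_monoid R)" "s \<in> carrier (add_monoid R)"
    then have rs: "r \<in> carrier R" "s \<in> carrier R" by auto
    show "L r s ?p \<in> carrier BT" using hom_closed[OF L(1)[OF rs] p] .
    show "L r (s \<otimes>\<^bsub>add_monoid R\<^esub> s') ?p = L r s ?p \<otimes>\<^bsub>BT\<^esub> L r s' ?p" if "s' \<in> carrier (add_monoid R)" for s'
      using that rs m n M N by (simp add: L act_add T.pure_add[folded T_eq])
    show "L (r \<otimes>\<^bsub>add_monoid R\<^esub> r') s ?p = L r s ?p \<otimes>\<^bsub>BT\<^esub> L r' s ?p" if "r' \<in> carrier (add_monoid R)" for r'
      using that rs m n M N by (simp add: L act_add T.pure_add[folded T_eq])
    show "L (c \<odot>\<^bsub>R\<^esub> r) s ?p = L r (c \<odot>\<^bsub>R\<^esub> s) ?p" if c: "c \<in> carrier k" for c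
    proof -
      let ?c = "c \<odot>\<^bsub>R\<^esub> \<one>\<^bsub>R\<^esub>"
      have c': "?c \<in> carrier R" using c by simp
      have "la M (c \<odot>\<^bsub>R\<^esub> r) m = ra M ?c (la M r m)"
        using act_k(1,2)[OF M c rs(1) m] c' M m rs by (simp add: act_mult)
      moreover have "la N ?c (ra N s n) = ra N (c \<odot>\<^bsub>R\<^esub> s) n"
        using act_k(2,3)[OF N c rs(2) n] c' N n rs by (simp flip: act_mult(3))
      ultimately show ?thesis
        using rs m n M N c c' by (simp add: L kR.smult_closed T.pure_balanced[folded T_eq])
    qed
  qed
  have z: "pe r s \<in> carrier E" "pt M N m n \<in> enc ` carrier BT" using rs m n by (auto simp: tens_simps[symmetric])
  have "scal (tens M N) (pe r s) (pt M N m n) = enc (tensor_lift BT (\<lambda>(r, s). L r s (dec (pt M N m n))) (pe r s))"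
    using z by (simp add: bimod_tens_def Let_def L_def)
  also have "dec (pt M N m n) = ?p" by (simp add: pt_eq p)
  also have "tensor_lift BT (\<lambda>(r, s). L r s ?p) (pe r s) = L r s ?p"
    using env_lift(2)[OF comm_group_T outer rs] .
  finally show ?thesis using L rs m n by (simp add: pt_eq)
qed

lemma tens_act:
  assumes r: "r \<in> carrier R" and m: "m \<in> carrier M" and n: "n \<in> carrier N"
  shows "la (tens M N) r (pt M N m n) = pt M N (la M r m) n"
    "ra (tens M N) r (pt M N m n) = pt M N m (ra N r n)"
  using tens_scal[OF r R.one_closed m n] tens_scal[OF R.one_closed r m n] m n M N
  by (simp_all add: env_left_def[symmetric] env_right_def[symmetric] act_one)

end

end

context category begin

lemma inverse_arrows_unique:
  assumes "inverse_arrows C f g" "inverse_arrows C f g'" shows "g = g'"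
proof -
  have f: "f \<in> homset C (Dom C f) (Cod C f)" using assms by (auto simp: inverse_arrows_def homset_def)
  have g: "g \<in> homset C (Cod C f) (Dom C f)" "g' \<in> homset C (Cod C f) (Dom C f)"
    using assms by (auto simp: inverse_arrows_def)
  have "g = (g' \<bullet> f) \<bullet> g" using assms Idn_Cmp[OF g(1)] by (simp add: inverse_arrows_def)
  also have "\<dots> = g' \<bullet> (f \<bullet> g)" by (rule Cmp_assoc[OF g(1) f g(2)])
  also have "\<dots> = g'" using assms Cmp_Idn[OF g(2)] by (simp add: inverse_arrows_def)
  finally show ?thesis .
qed

lemma inv_arrow_eq: "inverse_arrows C f g \<Longrightarrow> inv_arrow C f = g"
  unfolding inv_arrow_def using inverse_arrows_unique by blast

lemma inv_arrow: "iso_arrow C f \<Longrightarrow> inverse_arrows C f (inv_arrow C f)"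
  using inv_arrow_eq by (auto simp: iso_arrow_def)

end

context bimods begin

section \<open>Tensor products of one-sided linear maps\<close>

lemma balI:
  assumes "\<And>m. m \<in> carrier M \<Longrightarrow> \<phi> m \<in> hom N P" "\<And>n. n \<in> carrier N \<Longrightarrow> (\<lambda>m. \<phi> m n) \<in> hom M P"
    "\<And>r m n. r \<in> carrier R \<Longrightarrow> m \<in> carrier M \<Longrightarrow> n \<in> carrier N \<Longrightarrow> \<phi> (ra M r m) n = \<phi> m (la N r n)"
  shows "bal M N P \<phi>"
  unfolding bal_def using assms by (rule balancedI)

abbreviation "bl \<equiv> bimod_lift U k R"

lemma tens_act_eqI:
  assumes "bm M" "bm N" "bm P" "f \<in> hom (tens M N) P" and h: "h \<in> hom P P" and g: "g \<in> hom (tens M N) (tens M N)"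
    "\<And>m n. m \<in> carrier M \<Longrightarrow> n \<in> carrier N \<Longrightarrow> f (g (pt M N m n)) = h (f (pt M N m n))"
    "t \<in> carrier (tens M N)"
  shows "f (g t) = h (f t)"
  by (rule tens_eqI[OF assms(1,2) hom_trans[OF assms(4) g(1)] hom_trans[OF h assms(4)] g(2) g(3)])

lemma tens_llinI:
  assumes "bm M" "bm N" "bm P" "f \<in> hom (tens M N) P"
    "\<And>r m n. r \<in> carrier R \<Longrightarrow> m \<in> carrier M \<Longrightarrow> n \<in> carrier N \<Longrightarrow> f (pt M N (la M r m) n) = la P r (f (pt M N m n))"
  shows "llin (tens M N) P f"
proof (rule llinI[OF assms(4)])
  fix r t assume r: "r \<in> carrier R" and t: "t \<in> carrier (tens M N)"
  show "f (la (tens M N) r t) = la P r (f t)"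
    by (rule tens_act_eqI[OF assms(1-4) act_hom(1)[OF assms(3) r] act_hom(1)[OF bm_tens[OF assms(1,2)] r] _ t])
      (use assms r in \<open>simp add: tens_act\<close>)
qed

lemma tens_rlinI:
  assumes "bm M" "bm N" "bm P" "f \<in> hom (tens M N) P"
    "\<And>r m n. r \<in> carrier R \<Longrightarrow> m \<in> carrier M \<Longrightarrow> n \<in> carrier N \<Longrightarrow> f (pt M N m (ra N r n)) = ra P r (f (pt M N m n))"
  shows "rlin (tens M N) P f"
proof (rule rlinI[OF assms(4)])
  fix r t assume r: "r \<in> carrier R" and t: "t \<in> carrier (tens M N)"
  show "f (ra (tens M N) r t) = ra P r (f t)"
    by (rule tens_act_eqI[OF assms(1-4) act_hom(2)[OF assms(3) r] act_hom(2)[OF bm_tens[OF assms(1,2)] r] _ t])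
      (use assms r in \<open>simp add: tens_act\<close>)
qed

text \<open>The map f \<otimes> g. For it to be well defined \<open>f\<close> has to be right linear
  and \<open>g\<close> left linear, nothing more; linearity on the outer sides is inherited
  separately. Evaluations, which are linear on one side only, can thus be tensored with
  identities.\<close>

definition tm where
  "tm M N M' N' f g = bl M N (tens M' N') (\<lambda>m n. pt M' N' (f m) (g n))"

lemma tm_bal:
  assumes "bm M" "bm N" "bm M'" "bm N'" "rlin M M' f" "llin N N' g"
  shows "bal M N (tens M' N') (\<lambda>m n. pt M' N' (f m) (g n))"
proof (rule balI)
  fix m assume mn: "m \<in> carrier M"
  show "(\<lambda>n. pt M' N' (f m) (g n)) \<in> hom N (tens M' N')"
    by (rule hom_trans[OF pt_hom(1) llin_hom]) (use assms mn in \<open>auto simp: rlin_closed\<close>)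
next
  fix n assume mn: "n \<in> carrier N"
  show "(\<lambda>m. pt M' N' (f m) (g n)) \<in> hom M (tens M' N')"
    by (rule hom_trans[OF pt_hom(2) rlin_hom]) (use assms mn in \<open>auto simp: llin_closed\<close>)
qed (use assms in \<open>simp add: rlinD llinD pt_add rlin_closed llin_closed\<close>)

context
  fixes M N M' N' f g
  assumes a: "bm M" "bm N" "bm M'" "bm N'" "rlin M M' f" "llin N N' g"
begin

lemma tm_hom: "tm M N M' N' f g \<in> hom (tens M N) (tens M' N')"
  unfolding tm_def using a by (intro lift(1) tm_bal) auto

lemma tm_ext: "tm M N M' N' f g \<in> extensional (carrier (tens M N))"
  unfolding tm_def using a by (intro lift(2) tm_bal) auto

lemma tm_closed: "t \<in> carrier (tens M N) \<Longrightarrow> tm M N M' N' f g t \<in> carrier (tens M' N')"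
  by (rule hom_closed[OF tm_hom])

lemma tm_pt: "m \<in> carrier M \<Longrightarrow> n \<in> carrier N \<Longrightarrow> tm M N M' N' f g (pt M N m n) = pt M' N' (f m) (g n)"
  unfolding tm_def using a by (intro lift(3) tm_bal) auto

lemma tm_llin: "llin M M' f \<Longrightarrow> llin (tens M N) (tens M' N') (tm M N M' N' f g)"
  using a by (intro tens_llinI tm_hom) (auto simp: tm_pt llinD tens_act llin_closed rlin_closed)

lemma tm_rlin: "rlin N N' g \<Longrightarrow> rlin (tens M N) (tens M' N') (tm M N M' N' f g)"
  using a by (intro tens_rlinI tm_hom) (auto simp: tm_pt rlinD tens_act llin_closed rlin_closed)

end

lemma tm_lmod:
  assumes "bm M" "bm N" "bm M'" "bm N'" "f \<in> lmod_hom E M M'" "g \<in> lmod_hom E N N'"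
  shows "tm M N M' N' f g \<in> lmod_hom E (tens M N) (tens M' N')"
  using assms by (auto simp: lmod_hom_iff intro!: tm_llin tm_rlin tm_ext)

lemma tm_comp:
  assumes "bm M" "bm N" "bm M'" "bm N'" "bm M''" "bm N''" "rlin M M' f" "llin N N' g" "rlin M' M'' f'" "llin N' N'' g'"
    "t \<in> carrier (tens M N)"
  shows "tm M' N' M'' N'' f' g' (tm M N M' N' f g t) = tm M N M'' N'' (\<lambda>x. f' (f x)) (\<lambda>x. g' (g x)) t"
proof -
  note c = rlin_comp[OF assms(9,7)] llin_comp[OF assms(10,8)]
  show ?thesis
    by (rule tens_eqI[OF assms(1,2) hom_trans[OF tm_hom tm_hom] tm_hom _ assms(11)])
      (use assms c in \<open>simp_all add: tm_pt rlin_closed llin_closed\<close>)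
qed

lemma tm_cong:
  assumes "bm M" "bm N" "bm M'" "bm N'" "rlin M M' f" "llin N N' g" "rlin M M' f'" "llin N N' g'"
    "\<And>m. m \<in> carrier M \<Longrightarrow> f m = f' m" "\<And>n. n \<in> carrier N \<Longrightarrow> g n = g' n" "t \<in> carrier (tens M N)"
  shows "tm M N M' N' f g t = tm M N M' N' f' g' t"
  by (rule tens_eqI[OF assms(1,2) tm_hom tm_hom _ assms(11)]) (use assms in \<open>simp_all add: tm_pt\<close>)

lemma hom_id: "(\<lambda>x. x) \<in> hom G G"
  by (simp add: hom_def)

lemma tm_id: "bm M \<Longrightarrow> bm N \<Longrightarrow> t \<in> carrier (tens M N) \<Longrightarrow> tm M N M N (\<lambda>x. x) (\<lambda>x. x) t = t"
  by (rule tens_eqI[of M N _ "tens M N" "\<lambda>x. x", OF _ _ tm_hom hom_id]) (auto simp: tm_pt llin_id rlin_id)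

lemma iso_arrow_inverse:
  assumes "iso_arrow C (Arrow M N f)" "Arrow M N f \<in> homset C M N"
  defines "g \<equiv> fn (inv_arrow C (Arrow M N f))"
  shows "inv_arrow C (Arrow M N f) = Arrow N M g" "g \<in> lmod_hom E N M"
    "\<And>x. x \<in> carrier M \<Longrightarrow> g (f x) = x" "\<And>y. y \<in> carrier N \<Longrightarrow> f (g y) = y"
proof -
  have i: "inverse_arrows C (Arrow M N f) (inv_arrow C (Arrow M N f))" by (rule C.inv_arrow[OF assms(1)])
  then have "inv_arrow C (Arrow M N f) \<in> homset C N M" by (simp add: inverse_arrows_def)
  then show *: "inv_arrow C (Arrow M N f) = Arrow N M g" "g \<in> lmod_hom E N M"
    using C_homset[of "inv_arrow C (Arrow M N f)" N M] by (auto simp: g_def)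
  have "compose (carrier M) g f = (\<lambda>x\<in>carrier M. x)" "compose (carrier N) f g = (\<lambda>x\<in>carrier N. x)"
    using i unfolding *(1) by (auto simp: inverse_arrows_def)
  then show "\<And>x. x \<in> carrier M \<Longrightarrow> g (f x) = x" "\<And>y. y \<in> carrier N \<Longrightarrow> f (g y) = y"
    by (metis compose_eq restrict_apply')+
qed

section \<open>The constraints of the monoidal category of bimodules, on pure tensors\<close>

definition as where "as L M N = fn (Assoc C L M N)"
definition ai where "ai L M N = fn (inv_arrow C (Assoc C L M N))"

lemma as_def2: "as L M N = bl (tens L M) N (tens L (tens M N)) (\<lambda>x n.
    bl L M (tens L (tens M N)) (\<lambda>l m. pt L (tens M N) l (pt M N m n)) x)"
  by (simp add: as_def bimod_cat_def Let_def cat.extend_def moncat.fields_def)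

context
  fixes L M N assumes LMN: "bm L" "bm M" "bm N"
begin

lemma Assoc_eq: "Assoc C L M N = Arrow (tens (tens L M) N) (tens L (tens M N)) (as L M N)"
  using C.Assoc_hom[of L M N] LMN C_homset[of "Assoc C L M N"] by (auto simp: as_def bm_def)

lemma as_lmod: "as L M N \<in> lmod_hom E (tens (tens L M) N) (tens L (tens M N))"
  using C.Assoc_hom[of L M N] LMN C_homset[of "Assoc C L M N"] by (auto simp: as_def bm_def)

text \<open>The associator is a lift of a lift: for fixed \<open>n\<close> the inner map is balanced
  over L and M, and its dependence on \<open>n\<close> is additive and balanced, which is tested on
  pure tensors of L and M.\<close>

lemma as_pt:
  assumes "l \<in> carrier L" "m \<in> carrier M" "n \<in> carrier N"
  shows "as L M N (pt (tens L M) N (pt L M l m) n) = pt L (tens M N) l (pt M N m n)"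
proof -
  let ?P = "tens L (tens M N)"
  let ?i = "\<lambda>n. bl L M ?P (\<lambda>l m. pt L (tens M N) l (pt M N m n))"
  have "bal L M ?P (\<lambda>l m. pt L (tens M N) l (pt M N m n))" if "n \<in> carrier N" for n
    using LMN that
    by (intro balI) (auto intro!: hom_trans[OF pt_hom(1) pt_hom(2)] pt_hom(2) simp: pt_add tens_act)
  note i = lift[OF _ _ _ this]
  have "bal (tens L M) N ?P (\<lambda>x n. ?i n x)"
  proof (rule balI)
    fix n assume n: "n \<in> carrier N"
    show "?i n \<in> hom (tens L M) ?P" using LMN n by (intro i) auto
    fix r t assume r: "r \<in> carrier R" and t: "t \<in> carrier (tens L M)"
    have "(\<lambda>t. ?i n (ra (tens L M) r t)) t = ?i (la N r n) t"
      by (rule tens_eqI[OF LMN(1,2) hom_trans[OF i(1) act_hom(2)] i(1) _ t])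
        (use LMN r n in \<open>simp_all add: i(3) tens_act pt_add\<close>)
    then show "?i n (ra (tens L M) r t) = ?i (la N r n) t" .
  next
    fix t assume t: "t \<in> carrier (tens L M)"
    have "?i (n \<otimes>\<^bsub>N\<^esub> n') t = (\<lambda>t. ?i n t \<otimes>\<^bsub>?P\<^esub> ?i n' t) t" if "n \<in> carrier N" "n' \<in> carrier N" for n n'
      by (rule tens_eqI[OF LMN(1,2) i(1) hom_sum_hom[OF i(1) i(1)] _ t])
        (use LMN that in \<open>simp_all add: i(3) pt_add\<close>)
    then show "(\<lambda>n. ?i n t) \<in> hom N ?P" using LMN t hom_closed[OF i(1) t] by (intro homI) auto
  qed
  from lift(3)[OF _ _ _ this, of "pt L M l m" n] show ?thesis
    using LMN assms by (simp add: as_def2 i(3))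
qed

lemma as_hom: "as L M N \<in> hom (tens (tens L M) N) (tens L (tens M N))"
  by (rule lmod_homD(1)[OF as_lmod])

lemma ai_props:
  "inv_arrow C (Assoc C L M N) = Arrow (tens L (tens M N)) (tens (tens L M) N) (ai L M N)"
  "ai L M N \<in> lmod_hom E (tens L (tens M N)) (tens (tens L M) N)"
  "t \<in> carrier (tens (tens L M) N) \<Longrightarrow> ai L M N (as L M N t) = t"
  "t' \<in> carrier (tens L (tens M N)) \<Longrightarrow> as L M N (ai L M N t') = t'"
  using iso_arrow_inverse[of "tens (tens L M) N" "tens L (tens M N)" "as L M N", folded Assoc_eq]
    C.Assoc_iso[of L M N] C.Assoc_hom[of L M N] LMN
  by (auto simp: ai_def bm_def)

lemma ai_hom: "ai L M N \<in> hom (tens L (tens M N)) (tens (tens L M) N)"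
  by (rule lmod_homD(1)[OF ai_props(2)])

lemma ai_pt:
  assumes "l \<in> carrier L" "m \<in> carrier M" "n \<in> carrier N"
  shows "ai L M N (pt L (tens M N) l (pt M N m n)) = pt (tens L M) N (pt L M l m) n"
  using as_pt[OF assms] ai_props(3)[of "pt (tens L M) N (pt L M l m) n"] LMN assms by simp

end

abbreviation "\<iota> \<equiv> encoding U (carrier R)"

lemma \<iota>_inj: "inj_on \<iota> (carrier R)"
proof -
  obtain B where "B \<in> U" "carrier R \<lesssim> B" using module_universe_lepoll_self[OF U] .
  then show ?thesis using encoding(1)[OF U] by blast
qed

lemma I_carrier: "carrier I = \<iota> ` carrier R"
  by (simp add: bimod_unit_def Let_def)

lemma \<iota>_closed [simp]: "r \<in> carrier R \<Longrightarrow> \<iota> r \<in> carrier I"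
  by (simp add: I_carrier)

lemma d_\<iota> [simp]: "r \<in> carrier R \<Longrightarrow> decoding U (carrier R) (\<iota> r) = r"
  by (rule decoding_encoding[OF \<iota>_inj])

lemma \<iota>_hom: "\<iota> \<in> hom (add_monoid R) I"
  by (auto simp: hom_def bimod_unit_def Let_def)

lemma I_act:
  assumes "r \<in> carrier R" "x \<in> carrier R"
  shows "la I r (\<iota> x) = \<iota> (r \<otimes>\<^bsub>R\<^esub> x)" "ra I r (\<iota> x) = \<iota> (x \<otimes>\<^bsub>R\<^esub> r)"
proof -
  have b: "env_balanced (add_monoid R) (\<lambda>r s. r \<otimes>\<^bsub>R\<^esub> x \<otimes>\<^bsub>R\<^esub> s)"
    by (rule balancedI2) (use assms in \<open>auto simp: R.l_distr R.r_distr smult_mult\<close>)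
  have "scal I (pe r s) (\<iota> x) = \<iota> (r \<otimes>\<^bsub>R\<^esub> x \<otimes>\<^bsub>R\<^esub> s)" if "r \<in> carrier R" "s \<in> carrier R" for r s
    using that assms env_lift(2)[OF comm_group_R b that] by (simp add: bimod_unit_def Let_def)
  then show "la I r (\<iota> x) = \<iota> (r \<otimes>\<^bsub>R\<^esub> x)" "ra I r (\<iota> x) = \<iota> (x \<otimes>\<^bsub>R\<^esub> r)"
    using assms by (simp_all add: env_left_def env_right_def)
qed

definition lu where "lu M = fn (LUnit C M)"
definition ru where "ru M = fn (RUnit C M)"

lemma lu_def2: "lu M = bl I M M (\<lambda>r m. la M (decoding U (carrier R) r) m)"
  and ru_def2: "ru M = bl M I M (\<lambda>m r. ra M (decoding U (carrier R) r) m)"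
  by (simp_all add: lu_def ru_def bimod_cat_def Let_def cat.extend_def moncat.fields_def)

abbreviation "one_I \<equiv> \<iota> \<one>\<^bsub>R\<^esub>"

context
  fixes M assumes M: "bm M"
begin

lemma LUnit_eq: "LUnit C M = Arrow (tens I M) M (lu M)" "lu M \<in> lmod_hom E (tens I M) M"
  using C.LUnit_hom[of M] M C_homset[of "LUnit C M"] by (auto simp: lu_def bm_def)

lemma RUnit_eq: "RUnit C M = Arrow (tens M I) M (ru M)" "ru M \<in> lmod_hom E (tens M I) M"
  using C.RUnit_hom[of M] M C_homset[of "RUnit C M"] by (auto simp: ru_def bm_def)

lemma lu_hom: "lu M \<in> hom (tens I M) M" and ru_hom: "ru M \<in> hom (tens M I) M"
  using LUnit_eq RUnit_eq lmod_homD by blast+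

lemma \<iota>_add: "a \<in> carrier R \<Longrightarrow> b \<in> carrier R \<Longrightarrow> \<iota> a \<otimes>\<^bsub>I\<^esub> \<iota> b = \<iota> (a \<oplus>\<^bsub>R\<^esub> b)"
  using hom_mult[OF \<iota>_hom] by simp

lemma lu_pt:
  assumes "r \<in> carrier R" "m \<in> carrier M"
  shows "lu M (pt I M (\<iota> r) m) = la M r m"
proof -
  have "bal I M M (\<lambda>r m. la M (decoding U (carrier R) r) m)"
    by (rule balI) (use M in \<open>auto simp: I_carrier act_hom I_act act_mult \<iota>_add act_add intro!: homI\<close>)
  from lift(3)[OF _ _ _ this] show ?thesis using assms M by (simp add: lu_def2)
qed

lemma ru_pt:
  assumes "r \<in> carrier R" "m \<in> carrier M"
  shows "ru M (pt M I m (\<iota> r)) = ra M r m"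
proof -
  have "bal M I M (\<lambda>m r. ra M (decoding U (carrier R) r) m)"
    by (rule balI) (use M in \<open>auto simp: I_carrier act_hom I_act act_mult \<iota>_add act_add intro!: homI\<close>)
  from lift(3)[OF _ _ _ this] show ?thesis using assms M by (simp add: ru_def2)
qed

lemma lu_inv:
  assumes "t \<in> carrier (tens I M)" shows "pt I M one_I (lu M t) = t"
proof -
  have "(\<lambda>t. pt I M one_I (lu M t)) t = (\<lambda>t. t) t"
  proof (rule tens_eqI[OF bm_I M hom_trans[OF pt_hom(1) lu_hom] hom_id _ assms])
    fix i m assume "i \<in> carrier I" and m: "m \<in> carrier M"
    then obtain r where r: "r \<in> carrier R" "i = \<iota> r" by (auto simp: I_carrier)
    have "pt I M one_I (la M r m) = pt I M (ra I r one_I) m" using r m M by (simp add: pt_add)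
    then show "pt I M one_I (lu M (pt I M i m)) = pt I M i m" using r m by (simp add: lu_pt I_act)
  qed (use M in auto)
  then show ?thesis .
qed

lemma ru_inv:
  assumes "t \<in> carrier (tens M I)" shows "pt M I (ru M t) one_I = t"
proof -
  have "(\<lambda>t. pt M I (ru M t) one_I) t = (\<lambda>t. t) t"
  proof (rule tens_eqI[OF M bm_I hom_trans[OF pt_hom(2) ru_hom] hom_id _ assms])
    fix m i assume "i \<in> carrier I" and m: "m \<in> carrier M"
    then obtain r where r: "r \<in> carrier R" "i = \<iota> r" by (auto simp: I_carrier)
    have "pt M I (ra M r m) one_I = pt M I m (la I r one_I)" using r m M by (simp add: pt_add)
    then show "pt M I (ru M (pt M I m i)) one_I = pt M I m i" using r m by (simp add: ru_pt I_act)
  qed (use M in auto)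
  then show ?thesis .
qed

end

end

section \<open>Free modules of rank one and universal properties of inner homs\<close>

definition lcopy :: "('m \<Rightarrow> 'n) \<Rightarrow> ('s, 'm) lmod \<Rightarrow> ('s, 'n) lmod" where
  "lcopy e M = (let d = inv_into (carrier M) e in
     \<lparr> carrier = e ` carrier M, mult = (\<lambda>x y. e (d x \<otimes>\<^bsub>M\<^esub> d y)), one = e \<one>\<^bsub>M\<^esub>,
       scal = (\<lambda>a x. e (scal M a (d x))) \<rparr>)"

lemma lcopy_simps:
  assumes "inj_on e (carrier M)"
  shows "carrier (lcopy e M) = e ` carrier M"
    "x \<in> carrier M \<Longrightarrow> y \<in> carrier M \<Longrightarrow> e x \<otimes>\<^bsub>lcopy e M\<^esub> e y = e (x \<otimes>\<^bsub>M\<^esub> y)"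
    "\<one>\<^bsub>lcopy e M\<^esub> = e \<one>\<^bsub>M\<^esub>"
    "x \<in> carrier M \<Longrightarrow> scal (lcopy e M) a (e x) = e (scal M a x)"
  using assms by (simp_all add: lcopy_def Let_def)

lemma left_module_lcopy:
  assumes M: "left_module A M" and e: "inj_on e (carrier M)"
  shows "left_module A (lcopy e M)"
proof -
  note s = lcopy_simps[OF e]
  interpret M: comm_group M using M by (rule left_moduleD)
  have "comm_group (lcopy e M)"
  proof (rule comm_groupI)
    fix x assume "x \<in> carrier (lcopy e M)"
    then obtain a where a: "a \<in> carrier M" "x = e a" by (auto simp: s)
    then have "e (inv\<^bsub>M\<^esub> a) \<otimes>\<^bsub>lcopy e M\<^esub> x = \<one>\<^bsub>lcopy e M\<^esub>" by (simp add: s)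
    then show "\<exists>y\<in>carrier (lcopy e M). y \<otimes>\<^bsub>lcopy e M\<^esub> x = \<one>\<^bsub>lcopy e M\<^esub>" using a by (intro bexI[of _ "e (inv\<^bsub>M\<^esub> a)"]) (auto simp: s(1))
  qed (auto simp: s M.m_ac)
  then show ?thesis
    unfolding left_module_def using left_moduleD[OF M] by (auto simp: s)
qed

text \<open>A copy of the regular module with generator \<open>q\<close>. Elements \<open>w\<close>
  of a module W correspond to the maps \<open>ext1 A Q q W w\<close> from Q to W with q \<mapsto> w,
  which turns universal properties for maps into statements about elements.\<close>

definition free1 :: "('s, 'x) ring_scheme \<Rightarrow> ('s, 'm) lmod \<Rightarrow> 'm \<Rightarrow> bool" where
  "free1 A Q q \<longleftrightarrow> left_module A Q \<and> q \<in> carrier Q \<and> bij_betw (\<lambda>a. scal Q a q) (carrier A) (carrier Q)"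

lemma free1_exists:
  assumes A: "ring A" and U: "module_universe S U" and "carrier A \<lesssim> B" "B \<in> U"
  obtains Q q where "free1 A Q q" "carrier Q \<in> U"
proof -
  interpret A: ring A by (rule A)
  let ?M = "module_along (\<lambda>a. a) A" and ?e = "encoding U (carrier A)"
  have M: "left_module A ?M"
  proof -
    have "comm_group ?M"
      by (rule comm_groupI) (auto simp: module_along_def A.a_ac intro: A.l_neg bexI[of _ "\<ominus>\<^bsub>A\<^esub> _"])
    then show ?thesis using A unfolding left_module_def by (simp add: module_along_def A.l_distr A.r_distr A.m_assoc)
  qed
  have e: "inj_on ?e (carrier A)" "?e ` carrier A \<in> U" using encoding[OF U assms(3,4)] by auto
  have c: "carrier ?M = carrier A" by (simp add: module_along_def)
  note s = lcopy_simps[of ?e ?M, unfolded c, OF e(1)]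
  have "scal (lcopy ?e ?M) a (?e \<one>\<^bsub>A\<^esub>) = ?e a" if "a \<in> carrier A" for a
    using that by (simp add: s) (simp add: module_along_def)
  then have "bij_betw (\<lambda>a. scal (lcopy ?e ?M) a (?e \<one>\<^bsub>A\<^esub>)) (carrier A) (carrier (lcopy ?e ?M))"
    using e(1) by (simp add: bij_betw_def s cong: inj_on_cong image_cong)
  then have "free1 A (lcopy ?e ?M) (?e \<one>\<^bsub>A\<^esub>)"
    unfolding free1_def using left_module_lcopy[OF M, of ?e] e by (simp add: s c)
  then show thesis using that e(2) by (simp add: s)
qed

definition ext1 :: "('s, 'x) ring_scheme \<Rightarrow> ('s, 'm) lmod \<Rightarrow> 'm \<Rightarrow> ('s, 'n) lmod \<Rightarrow> 'n \<Rightarrow> 'm \<Rightarrow> 'n" where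
  "ext1 A Q q W w = (\<lambda>x\<in>carrier Q. scal W (inv_into (carrier A) (\<lambda>a. scal Q a q) x) w)"

context
  fixes A :: "('s, 'x) ring_scheme" and Q :: "('s, 'm) lmod" and q
  assumes F: "free1 A Q q"
begin

lemma free1D: "left_module A Q" "q \<in> carrier Q" "ring A"
  using F by (auto simp: free1_def left_module_def)

lemma free1_cases:
  assumes "x \<in> carrier Q" obtains a where "a \<in> carrier A" "x = scal Q a q"
  using F assms by (auto simp: free1_def bij_betw_def)

lemma ext1_scal: "a \<in> carrier A \<Longrightarrow> ext1 A Q q W w (scal Q a q) = scal W a w"
  using F inv_into_f_f[of "\<lambda>a. scal Q a q" "carrier A" a]
  by (auto simp: free1_def ext1_def bij_betw_def left_moduleD)

lemma ext1:
  assumes W: "left_module A W" and w: "w \<in> carrier W"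
  shows "ext1 A Q q W w \<in> lmod_hom A Q W" "ext1 A Q q W w q = w"
proof -
  interpret A: ring A by (rule free1D(3))
  note Q = left_moduleD[OF free1D(1)]
  have cl: "ext1 A Q q W w x \<in> carrier W" if "x \<in> carrier Q" for x
    using that by (elim free1_cases) (simp add: ext1_scal left_moduleD[OF W] w)
  have "ext1 A Q q W w (x \<otimes>\<^bsub>Q\<^esub> y) = ext1 A Q q W w x \<otimes>\<^bsub>W\<^esub> ext1 A Q q W w y" if xy: "x \<in> carrier Q" "y \<in> carrier Q" for x y
  proof -
    obtain a b where ab: "a \<in> carrier A" "b \<in> carrier A" "x = scal Q a q" "y = scal Q b q"
      using xy by (auto elim!: free1_cases)
    then have "x \<otimes>\<^bsub>Q\<^esub> y = scal Q (a \<oplus>\<^bsub>A\<^esub> b) q" using Q free1D(2) by simp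
    then show ?thesis using ab by (simp add: ext1_scal left_moduleD[OF W] w)
  qed
  moreover have "ext1 A Q q W w (scal Q c x) = scal W c (ext1 A Q q W w x)" if c: "c \<in> carrier A" and x: "x \<in> carrier Q" for c x
  proof -
    obtain a where a: "a \<in> carrier A" "x = scal Q a q" using x by (auto elim!: free1_cases)
    then have "scal Q c x = scal Q (c \<otimes>\<^bsub>A\<^esub> a) q" using Q(6) free1D(2) c by simp
    then show ?thesis using a c by (simp add: ext1_scal left_moduleD[OF W] w)
  qed
  ultimately show "ext1 A Q q W w \<in> lmod_hom A Q W"
    using cl unfolding lmod_hom_def by (simp add: hom_def) (simp add: ext1_def)
  show "ext1 A Q q W w q = w"
    using ext1_scal[OF A.one_closed, of W w] Q(7)[OF free1D(2)] left_moduleD(7)[OF W w] by simp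
qed

lemma free1_hom_eq:
  assumes "f \<in> lmod_hom A Q W" "g \<in> lmod_hom A Q W" "f q = g q" "x \<in> carrier Q"
  shows "f x = g x"
  using assms(4) by (rule free1_cases) (simp add: lmod_homD(3)[OF assms(1)] lmod_homD(3)[OF assms(2)] free1D assms(3))

end

lemma lmod_hom_comp:
  "f \<in> lmod_hom A M N \<Longrightarrow> g \<in> lmod_hom A N P \<Longrightarrow> compose (carrier M) g f \<in> lmod_hom A M P"
  if "left_module A M"
  using that by (auto simp: lmod_hom_def hom_def Pi_iff compose_def comm_groupE(1) left_moduleD)

lemma ext1_natural:
  assumes F: "free1 A Q q" and "left_module A W" "left_module A W'" "g \<in> lmod_hom A W W'" "w \<in> carrier W" "x \<in> carrier Q"
  shows "g (ext1 A Q q W w x) = ext1 A Q q W' (g w) x"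
proof -
  have "compose (carrier Q) g (ext1 A Q q W w) x = ext1 A Q q W' (g w) x"
  proof (rule free1_hom_eq[OF F _ _ _ assms(6)])
    show "compose (carrier Q) g (ext1 A Q q W w) \<in> lmod_hom A Q W'"
      by (rule lmod_hom_comp[OF free1D(1)[OF F] ext1(1)[OF F assms(2,5)] assms(4)])
    show "ext1 A Q q W' (g w) \<in> lmod_hom A Q W'"
      by (rule ext1(1)[OF F assms(3) lmod_homD(4)[OF assms(4,5)]])
    show "compose (carrier Q) g (ext1 A Q q W w) q = ext1 A Q q W' (g w) q"
      using free1D(2)[OF F] ext1(2)[OF F assms(2,5)] ext1(2)[OF F assms(3) lmod_homD(4)[OF assms(4,5)]] by (simp add: compose_eq)
  qed
  then show ?thesis using assms(6) by (simp add: compose_eq)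
qed

section \<open>Elements of inner homs of bimodules\<close>

context bimods begin

text \<open>The couniversal property of \<epsilon> : V \<otimes> X \<rightarrow> Y for a single Y.
  Equality of arrows out of a tensor product is replaced by equality of functions on pure
  tensors.\<close>

definition right_univ where
  "right_univ X Y V \<epsilon> \<longleftrightarrow> bm V \<and> \<epsilon> \<in> lmod_hom E (tens V X) Y \<and>
     (\<forall>W f. bm W \<longrightarrow> f \<in> lmod_hom E (tens W X) Y \<longrightarrow>
        (\<exists>!g. g \<in> lmod_hom E W V \<and> (\<forall>w\<in>carrier W. \<forall>x\<in>carrier X. \<epsilon> (pt V X (g w) x) = f (pt W X w x))))"

definition left_univ where
  "left_univ X Y V \<epsilon> \<longleftrightarrow> bm V \<and> \<epsilon> \<in> lmod_hom E (tens X V) Y \<and>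
     (\<forall>W f. bm W \<longrightarrow> f \<in> lmod_hom E (tens X W) Y \<longrightarrow>
        (\<exists>!g. g \<in> lmod_hom E W V \<and> (\<forall>w\<in>carrier W. \<forall>x\<in>carrier X. \<epsilon> (pt X V x (g w)) = f (pt X W x w))))"

lemma E_free:
  obtains Q q where "free1 E Q q" "bm Q"
proof -
  obtain B where B: "B \<in> U" "infinite B" "carrier R \<lesssim> B" using module_universe_lepoll_self[OF U] .
  have "carrier E \<lesssim> B" using ET.tensor_lepoll[of B] B by (simp add: E_simps ET_eq)
  then obtain Q q where "free1 E Q q" "carrier Q \<in> U" using free1_exists[OF ring_E U _ B(1)] by blast
  then show thesis using that by (auto simp: bm_def free1_def)
qed

lemma id_lmod: "bm X \<Longrightarrow> (\<lambda>x\<in>carrier X. x) \<in> lmod_hom E X X"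
  by (auto simp: lmod_hom_iff llin_def rlin_def hom_def)

lemma lmod_llin: "f \<in> lmod_hom E M N \<Longrightarrow> bm M \<Longrightarrow> bm N \<Longrightarrow> llin M N f"
  and lmod_rlin: "f \<in> lmod_hom E M N \<Longrightarrow> bm M \<Longrightarrow> bm N \<Longrightarrow> rlin M N f"
  by (simp_all add: lmod_hom_iff)

lemma ext_lmod: "bm M \<Longrightarrow> bm N \<Longrightarrow> llin M N f \<Longrightarrow> rlin M N f \<Longrightarrow> (\<lambda>x\<in>carrier M. f x) \<in> lmod_hom E M N"
  by (auto simp: lmod_hom_iff llin_def rlin_def hom_def)

lemma lmod_eqI: "f \<in> lmod_hom A M N \<Longrightarrow> g \<in> lmod_hom A M N \<Longrightarrow> (\<And>x. x \<in> carrier M \<Longrightarrow> f x = g x) \<Longrightarrow> f = g"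
  by (auto intro: extensionalityI[OF lmod_homD(2) lmod_homD(2)])

lemma right_univD:
  assumes "right_univ X Y V \<epsilon>"
  shows "bm V" "\<epsilon> \<in> lmod_hom E (tens V X) Y"
    "bm X \<Longrightarrow> bm Y \<Longrightarrow> llin (tens V X) Y \<epsilon>" "bm X \<Longrightarrow> bm Y \<Longrightarrow> rlin (tens V X) Y \<epsilon>"
  using assms by (auto simp: right_univ_def lmod_llin lmod_rlin)

lemma left_univD:
  assumes "left_univ X Y V \<epsilon>"
  shows "bm V" "\<epsilon> \<in> lmod_hom E (tens X V) Y"
    "bm X \<Longrightarrow> bm Y \<Longrightarrow> llin (tens X V) Y \<epsilon>" "bm X \<Longrightarrow> bm Y \<Longrightarrow> rlin (tens X V) Y \<epsilon>"
  using assms by (auto simp: left_univ_def lmod_llin lmod_rlin)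

lemma right_univ_ex1:
  assumes "right_univ X Y V \<epsilon>" "bm W" "f \<in> lmod_hom E (tens W X) Y"
  shows "\<exists>!g. g \<in> lmod_hom E W V \<and> (\<forall>w\<in>carrier W. \<forall>x\<in>carrier X. \<epsilon> (pt V X (g w) x) = f (pt W X w x))"
  using assms unfolding right_univ_def by blast

lemma left_univ_ex1:
  assumes "left_univ X Y V \<epsilon>" "bm W" "f \<in> lmod_hom E (tens X W) Y"
  shows "\<exists>!g. g \<in> lmod_hom E W V \<and> (\<forall>w\<in>carrier W. \<forall>x\<in>carrier X. \<epsilon> (pt X V x (g w)) = f (pt X W x w))"
  using assms unfolding left_univ_def by blast

lemma right_univ_unique:
  assumes V: "right_univ X Y V \<epsilon>" and X: "bm X" and Y: "bm Y" and W: "bm W"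
    and g: "g \<in> lmod_hom E W V" "g' \<in> lmod_hom E W V"
    and eq: "\<And>w x. w \<in> carrier W \<Longrightarrow> x \<in> carrier X \<Longrightarrow> \<epsilon> (pt V X (g w) x) = \<epsilon> (pt V X (g' w) x)"
  shows "g = g'"
proof -
  note \<epsilon> = right_univD[OF V]
  note r = lmod_rlin[OF g(2) W \<epsilon>(1)] lmod_llin[OF g(2) W \<epsilon>(1)]
  let ?f = "\<lambda>t\<in>carrier (tens W X). \<epsilon> (tm W X V X g' (\<lambda>x. x) t)"
  have "?f \<in> lmod_hom E (tens W X) Y"
    by (intro ext_lmod llin_comp[OF \<epsilon>(3)] rlin_comp[OF \<epsilon>(4)] tm_llin tm_rlin)
      (use X Y W \<epsilon>(1) r in \<open>auto simp: llin_id rlin_id\<close>)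
  then have "\<exists>!g. g \<in> lmod_hom E W V \<and> (\<forall>w\<in>carrier W. \<forall>x\<in>carrier X. \<epsilon> (pt V X (g w) x) = ?f (pt W X w x))"
    by (rule right_univ_ex1[OF V W])
  moreover have "?f (pt W X w x) = \<epsilon> (pt V X (g' w) x)" if "w \<in> carrier W" "x \<in> carrier X" for w x
    using that W X \<epsilon>(1) r by (simp add: tm_pt llin_id)
  ultimately show ?thesis using g eq by (elim ex1E) (metis (no_types, lifting))
qed

lemma left_univ_unique:
  assumes V: "left_univ X Y V \<epsilon>" and X: "bm X" and Y: "bm Y" and W: "bm W"
    and g: "g \<in> lmod_hom E W V" "g' \<in> lmod_hom E W V"
    and eq: "\<And>w x. w \<in> carrier W \<Longrightarrow> x \<in> carrier X \<Longrightarrow> \<epsilon> (pt X V x (g w)) = \<epsilon> (pt X V x (g' w))"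
  shows "g = g'"
proof -
  note \<epsilon> = left_univD[OF V]
  note r = lmod_rlin[OF g(2) W \<epsilon>(1)] lmod_llin[OF g(2) W \<epsilon>(1)]
  let ?f = "\<lambda>t\<in>carrier (tens X W). \<epsilon> (tm X W X V (\<lambda>x. x) g' t)"
  have "?f \<in> lmod_hom E (tens X W) Y"
    by (intro ext_lmod llin_comp[OF \<epsilon>(3)] rlin_comp[OF \<epsilon>(4)] tm_llin tm_rlin)
      (use X Y W \<epsilon>(1) r in \<open>auto simp: llin_id rlin_id\<close>)
  then have "\<exists>!g. g \<in> lmod_hom E W V \<and> (\<forall>w\<in>carrier W. \<forall>x\<in>carrier X. \<epsilon> (pt X V x (g w)) = ?f (pt X W x w))"
    by (rule left_univ_ex1[OF V W])
  moreover have "?f (pt X W x w) = \<epsilon> (pt X V x (g' w))" if "w \<in> carrier W" "x \<in> carrier X" for w x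
    using that W X \<epsilon>(1) r by (simp add: tm_pt rlin_id)
  ultimately show ?thesis using g eq by (elim ex1E) (metis (no_types, lifting))
qed

text \<open>Elements of V are the bimodule maps from the free bimodule Q to V, so uniqueness for
  maps applies once the hypothesis is extended from \<open>e\<close> to all multiples of
  \<open>e\<close>. That works because \<epsilon>(a e b \<otimes> x) = a \<epsilon>(e \<otimes> b
  x).\<close>

lemma right_univ_inj:
  assumes V: "right_univ X Y V \<epsilon>" and X: "bm X" and Y: "bm Y" and e: "e \<in> carrier V" "e' \<in> carrier V"
    and eq: "\<And>x. x \<in> carrier X \<Longrightarrow> \<epsilon> (pt V X e x) = \<epsilon> (pt V X e' x)"
  shows "e = e'"
proof -
  note \<epsilon> = right_univD[OF V]
  obtain Q q where Q: "free1 E Q q" "bm Q" by (rule E_free)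
  have sc: "\<epsilon> (pt V X (scal V z e) x) = \<epsilon> (pt V X (scal V z e') x)" if "z \<in> carrier E" "x \<in> carrier X" for z x
    using that
  proof (induction arbitrary: x rule: env_induct)
    case (pure a b)
    have "\<epsilon> (pt V X (scal V (pe a b) e) x) = la Y a (\<epsilon> (pt V X e (la X b x)))" if "e \<in> carrier V" for e
    proof -
      have "pt V X (scal V (pe a b) e) x = la (tens V X) a (pt V X e (la X b x))"
        using that pure \<epsilon>(1) X by (simp add: act_mult(4) tens_act(1)[OF \<epsilon>(1) X, symmetric] pt_add(3)[OF \<epsilon>(1) X])
      then show ?thesis using llinD[OF \<epsilon>(3)[OF X Y]] pure that \<epsilon>(1) X by simp
    qed
    then show ?case using e eq pure X by simp
  next
    case (add z w)
    have "\<epsilon> (pt V X (scal V (z \<oplus>\<^bsub>E\<^esub> w) e) x) = \<epsilon> (pt V X (scal V z e) x) \<otimes>\<^bsub>Y\<^esub> \<epsilon> (pt V X (scal V w e) x)" if "e \<in> carrier V" for e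
      using add that \<epsilon>(1) X left_moduleD[OF bm_lmod[OF \<epsilon>(1)]] by (simp add: pt_add hom_mult[OF lmod_homD(1)[OF \<epsilon>(2)]])
    then show ?case using e add by simp
  qed
  note x = ext1[OF Q(1) bm_lmod[OF \<epsilon>(1)]]
  have "ext1 E Q q V e = ext1 E Q q V e'"
  proof (rule right_univ_unique[OF V X Y Q(2) x(1)[OF e(1)] x(1)[OF e(2)]])
    fix w x assume "w \<in> carrier Q" "x \<in> carrier X"
    then show "\<epsilon> (pt V X (ext1 E Q q V e w) x) = \<epsilon> (pt V X (ext1 E Q q V e' w) x)"
      by (elim free1_cases[OF Q(1)]) (simp add: sc ext1_scal[OF Q(1)])
  qed
  then show ?thesis using x(2)[OF e(1)] x(2)[OF e(2)] by metis
qed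

text \<open>As for right inner homs, now with \<epsilon>(x \<otimes> a e b) = \<epsilon>(x a
  \<otimes> e) b.\<close>

lemma left_univ_inj:
  assumes V: "left_univ X Y V \<epsilon>" and X: "bm X" and Y: "bm Y" and e: "e \<in> carrier V" "e' \<in> carrier V"
    and eq: "\<And>x. x \<in> carrier X \<Longrightarrow> \<epsilon> (pt X V x e) = \<epsilon> (pt X V x e')"
  shows "e = e'"
proof -
  note \<epsilon> = left_univD[OF V]
  obtain Q q where Q: "free1 E Q q" "bm Q" by (rule E_free)
  have sc: "\<epsilon> (pt X V x (scal V z e)) = \<epsilon> (pt X V x (scal V z e'))" if "z \<in> carrier E" "x \<in> carrier X" for z x
    using that
  proof (induction arbitrary: x rule: env_induct)
    case (pure a b)
    have "\<epsilon> (pt X V x (scal V (pe a b) e)) = ra Y b (\<epsilon> (pt X V (ra X a x) e))" if "e \<in> carrier V" for e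
    proof -
      have "pt X V x (scal V (pe a b) e) = ra (tens X V) b (pt X V (ra X a x) e)"
        using that pure \<epsilon>(1) X by (simp add: act_mult tens_act pt_add)
      then show ?thesis using rlinD[OF \<epsilon>(4)[OF X Y]] pure that \<epsilon>(1) X by simp
    qed
    then show ?case using e eq pure X by simp
  next
    case (add z w)
    have "\<epsilon> (pt X V x (scal V (z \<oplus>\<^bsub>E\<^esub> w) e)) = \<epsilon> (pt X V x (scal V z e)) \<otimes>\<^bsub>Y\<^esub> \<epsilon> (pt X V x (scal V w e))" if "e \<in> carrier V" for e
      using add that \<epsilon>(1) X left_moduleD[OF bm_lmod[OF \<epsilon>(1)]] by (simp add: pt_add hom_mult[OF lmod_homD(1)[OF \<epsilon>(2)]])
    then show ?case using e add by simp
  qed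
  note x = ext1[OF Q(1) bm_lmod[OF \<epsilon>(1)]]
  have "ext1 E Q q V e = ext1 E Q q V e'"
  proof (rule left_univ_unique[OF V X Y Q(2) x(1)[OF e(1)] x(1)[OF e(2)]])
    fix w x assume "w \<in> carrier Q" "x \<in> carrier X"
    then show "\<epsilon> (pt X V x (ext1 E Q q V e w)) = \<epsilon> (pt X V x (ext1 E Q q V e' w))"
      by (elim free1_cases[OF Q(1)]) (simp add: sc ext1_scal[OF Q(1)])
  qed
  then show ?thesis using x(2)[OF e(1)] x(2)[OF e(2)] by metis
qed

lemma pt_tens_hom:
  assumes "f \<in> hom (tens M N) P" "bm M" "bm N"
  shows "m \<in> carrier M \<Longrightarrow> (\<lambda>n. f (pt M N m n)) \<in> hom N P" "n \<in> carrier N \<Longrightarrow> (\<lambda>m. f (pt M N m n)) \<in> hom M P"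
  using hom_trans[OF assms(1) pt_hom(1)[OF assms(2,3)]] hom_trans[OF assms(1) pt_hom(2)[OF assms(2,3)]] by auto

text \<open>A map on Q \<times> X is prescribed by its values at the multiples of \<open>q\<close>
  by pure tensors. The function \<open>c\<close> reads off the coefficient of an element of Q, and
  the lift of \<psi> in (a, b) is pulled back along \<open>c\<close>.\<close>

lemma free1_bimap:
  assumes Q: "free1 E Q q" "bm Q" and Y: "bm Y"
    and b: "\<And>x. x \<in> carrier X \<Longrightarrow> env_balanced Y (\<lambda>a b. \<psi> a b x)"
    and X: "\<And>a b. a \<in> carrier R \<Longrightarrow> b \<in> carrier R \<Longrightarrow> \<psi> a b \<in> hom X Y" "bm X"
  obtains f where "\<And>x. x \<in> carrier X \<Longrightarrow> (\<lambda>z. f z x) \<in> hom Q Y" "\<And>z. z \<in> carrier Q \<Longrightarrow> f z \<in> hom X Y"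
    "\<And>a b x. a \<in> carrier R \<Longrightarrow> b \<in> carrier R \<Longrightarrow> x \<in> carrier X \<Longrightarrow> f (scal Q (pe a b) q) x = \<psi> a b x"
proof -
  define c where "c = inv_into (carrier E) (\<lambda>a. scal Q a q)"
  have bij: "bij_betw (\<lambda>a. scal Q a q) (carrier E) (carrier Q)" using Q(1) by (simp add: free1_def)
  have c: "c (scal Q z q) = z" if "z \<in> carrier E" for z
    unfolding c_def using inv_into_f_f[of "\<lambda>a. scal Q a q" "carrier E" z] bij that by (auto simp: bij_betw_def)
  note lm = left_moduleD[OF bm_lmod[OF Q(2)]]
  have q: "q \<in> carrier Q" using Q(1) by (simp add: free1_def)
  interpret RE: ring E by (rule ring_E)
  have ch: "c \<in> hom Q ET"
  proof (rule homI)
    fix x y assume "x \<in> carrier Q" "y \<in> carrier Q"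
    then obtain z w where zw: "z \<in> carrier E" "w \<in> carrier E" "x = scal Q z q" "y = scal Q w q" by (auto elim!: free1_cases[OF Q(1)])
    then have "x \<otimes>\<^bsub>Q\<^esub> y = scal Q (z \<oplus>\<^bsub>E\<^esub> w) q" using q by (simp add: lm)
    then have "c (x \<otimes>\<^bsub>Q\<^esub> y) = z \<oplus>\<^bsub>E\<^esub> w" using zw by (simp add: c)
    then show "c (x \<otimes>\<^bsub>Q\<^esub> y) = c x \<otimes>\<^bsub>ET\<^esub> c y" using zw by (simp add: c E_simps(2))
  qed (auto elim!: free1_cases[OF Q(1)] simp: c E_simps(1)[symmetric])
  define L where "L x = tensor_lift Y (\<lambda>(a, b). \<psi> a b x)" for x
  have L: "L x \<in> hom ET Y" "\<And>a b. a \<in> carrier R \<Longrightarrow> b \<in> carrier R \<Longrightarrow> L x (pe a b) = \<psi> a b x" if "x \<in> carrier X" for x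
    unfolding L_def using env_lift[OF bm_group[OF Y] b[OF that]] by auto
  have LX: "(\<lambda>x. L x z) \<in> hom X Y" if "z \<in> carrier E" for z
    using that
  proof (induction rule: env_induct)
    case (pure a b)
    then show ?case using X(1)[OF pure] L(2) X(2) by (auto simp: hom_def)
  next
    case (add z w)
    have "L x (z \<oplus>\<^bsub>E\<^esub> w) = L x z \<otimes>\<^bsub>Y\<^esub> L x w" if "x \<in> carrier X" for x
      using hom_mult[OF L(1)[OF that]] add(1,2) by (simp add: E_simps)
    moreover have "(\<lambda>x. L x z \<otimes>\<^bsub>Y\<^esub> L x w) \<in> hom X Y" using add(3,4) Y by (simp add: hom_sum_hom)
    ultimately show ?case using X(2) by (auto simp: hom_def)
  qed
  show thesis
  proof
    show "(\<lambda>z. L x (c z)) \<in> hom Q Y" if "x \<in> carrier X" for x by (rule hom_trans[OF L(1)[OF that] ch])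
    show "(\<lambda>x. L x (c z)) \<in> hom X Y" if "z \<in> carrier Q" for z
      using LX hom_closed[OF ch that] by (simp add: E_simps)
    show "L x (c (scal Q (pe a b) q)) = \<psi> a b x" if "a \<in> carrier R" "b \<in> carrier R" "x \<in> carrier X" for a b x
      using that by (simp add: c L)
  qed
qed

lemma free1_induct [consumes 3, case_names scal add]:
  assumes Q: "free1 E Q q" "bm Q" and "z \<in> carrier Q"
    and "\<And>a b. a \<in> carrier R \<Longrightarrow> b \<in> carrier R \<Longrightarrow> P (scal Q (pe a b) q)"
    and "\<And>z w. z \<in> carrier Q \<Longrightarrow> w \<in> carrier Q \<Longrightarrow> P z \<Longrightarrow> P w \<Longrightarrow> P (z \<otimes>\<^bsub>Q\<^esub> w)"
  shows "P z"
proof -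
  note lm = left_moduleD[OF bm_lmod[OF Q(2)]]
  have q: "q \<in> carrier Q" using Q(1) by (simp add: free1_def)
  obtain a where a: "a \<in> carrier E" "z = scal Q a q" using free1_cases[OF Q(1) assms(3)] .
  from a(1) have "P (scal Q a q)"
    by (induction rule: env_induct) (use assms(4,5) q in \<open>simp_all add: lm\<close>)
  then show ?thesis using a by simp
qed

lemma free1_pe:
  assumes Q: "free1 E Q q" "bm Q" and "a \<in> carrier R" "b \<in> carrier R" "r \<in> carrier R"
  shows "la Q r (scal Q (pe a b) q) = scal Q (pe (r \<otimes>\<^bsub>R\<^esub> a) b) q" "ra Q r (scal Q (pe a b) q) = scal Q (pe a (b \<otimes>\<^bsub>R\<^esub> r)) q"
proof -
  have q: "q \<in> carrier Q" using Q(1) by (simp add: free1_def)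
  show "la Q r (scal Q (pe a b) q) = scal Q (pe (r \<otimes>\<^bsub>R\<^esub> a) b) q" "ra Q r (scal Q (pe a b) q) = scal Q (pe a (b \<otimes>\<^bsub>R\<^esub> r)) q"
    using assms q left_moduleD(6)[OF bm_lmod[OF Q(2)], symmetric]
    by (simp_all add: env_mult env_left_def env_right_def)
qed

text \<open>Together with \<open>right_univ_inj\<close> this identifies V with the right linear maps
  X \<rightarrow> Y. The universal property is applied to the free bimodule Q and the map that sends
  (a \<otimes> b) q \<otimes> x to a \<kappa>(b x); the element is the image of
  \<open>q\<close>.\<close>

lemma right_univ_surj:
  assumes V: "right_univ X Y V \<epsilon>" and X: "bm X" and Y: "bm Y" and \<kappa>: "rlin X Y \<kappa>"
  obtains e where "e \<in> carrier V" "\<And>x. x \<in> carrier X \<Longrightarrow> \<epsilon> (pt V X e x) = \<kappa> x"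
proof -
  note \<epsilon> = right_univD[OF V]
  obtain Q q where Q: "free1 E Q q" "bm Q" by (rule E_free)
  have q: "q \<in> carrier Q" using Q(1) by (simp add: free1_def)
  have h: "(\<lambda>x. la Y a (\<kappa> (la X b x))) \<in> hom X Y" if "a \<in> carrier R" "b \<in> carrier R" for a b
    by (rule hom_trans[OF act_hom(1)[OF Y that(1)] hom_trans[OF rlin_hom[OF \<kappa>] act_hom(1)[OF X that(2)]]])
  have cl: "\<kappa> x \<in> carrier Y" if "x \<in> carrier X" for x using rlin_closed[OF \<kappa> that] .
  \<comment> \<open>Balanced over \<open>k\<close> because a scalar can be written on the right of
    \<kappa>(b x) and then passes through the right linear \<kappa>.\<close>
  have b: "env_balanced Y (\<lambda>a b. la Y a (\<kappa> (la X b x)))" if x: "x \<in> carrier X" for x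
  proof (rule balancedI2)
    fix c a b assume c: "c \<in> carrier k" and "a \<in> carrier (add_monoid R)" "b \<in> carrier (add_monoid R)"
    then have ab: "a \<in> carrier R" "b \<in> carrier R" by auto
    let ?c = "c \<odot>\<^bsub>R\<^esub> \<one>\<^bsub>R\<^esub>"
    have c': "?c \<in> carrier R" using c by simp
    have "la Y (c \<odot>\<^bsub>R\<^esub> a) (\<kappa> (la X b x)) = la Y a (ra Y ?c (\<kappa> (la X b x)))"
      using act_k(1,2)[OF Y c] ab x X cl by simp
    also have "\<dots> = la Y a (\<kappa> (ra X ?c (la X b x)))" using rlinD[OF \<kappa> c'] ab x X by simp
    also have "ra X ?c (la X b x) = la X (c \<odot>\<^bsub>R\<^esub> b) x" using act_k(1,2)[OF X c ab(2) x] ab x X c' by (simp add: act_mult(3))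
    finally show "la Y (c \<odot>\<^bsub>R\<^esub> a) (\<kappa> (la X b x)) = la Y a (\<kappa> (la X (c \<odot>\<^bsub>R\<^esub> b) x))" .
  qed (use x X Y cl in \<open>auto simp: act_add hom_mult[OF rlin_hom[OF \<kappa>]]\<close>)
  obtain f where f: "\<And>x. x \<in> carrier X \<Longrightarrow> (\<lambda>z. f z x) \<in> hom Q Y" "\<And>z. z \<in> carrier Q \<Longrightarrow> f z \<in> hom X Y"
    "\<And>a b x. a \<in> carrier R \<Longrightarrow> b \<in> carrier R \<Longrightarrow> x \<in> carrier X \<Longrightarrow> f (scal Q (pe a b) q) x = la Y a (\<kappa> (la X b x))"
    using free1_bimap[OF Q Y b h X] by blast
  have bal: "bal Q X Y f"
  proof (rule balI[OF f(2) f(1)])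
    fix r z x assume r: "r \<in> carrier R" and z: "z \<in> carrier Q" and x: "x \<in> carrier X"
    from Q z show "f (ra Q r z) x = f z (la X r x)"
    proof (induction rule: free1_induct)
      case (scal a b)
      then show ?case using r x X by (simp add: free1_pe[OF Q] f(3) act_mult)
    next
      case (add z w)
      then show ?case using r x X Q(2) by (simp add: act_add hom_mult[OF f(1)])
    qed
  qed
  note l = lift[OF Q(2) X Y bal]
  have "bl Q X Y f \<in> lmod_hom E (tens Q X) Y"
    unfolding lmod_hom_iff[OF bm_tens[OF Q(2) X] Y]
  proof (intro conjI l(2) tens_llinI[OF Q(2) X Y l(1)] tens_rlinI[OF Q(2) X Y l(1)])
    fix r z x assume r: "r \<in> carrier R" and z: "z \<in> carrier Q" and x: "x \<in> carrier X"
    from Q z have "f (la Q r z) x = la Y r (f z x)"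
    proof (induction rule: free1_induct)
      case (scal a b)
      then show ?case using r x X Y cl by (simp add: free1_pe[OF Q] f(3) act_mult)
    next
      case (add z w)
      then show ?case using r x X Y Q(2) hom_closed[OF f(1)[OF x]] by (simp add: act_add hom_mult[OF f(1)])
    qed
    then show "bl Q X Y f (pt Q X (la Q r z) x) = la Y r (bl Q X Y f (pt Q X z x))" using r z x Q(2) by (simp add: l(3))
    from Q z have "f z (ra X r x) = ra Y r (f z x)"
    proof (induction rule: free1_induct)
      case (scal a b)
      then show ?case using r x X Y cl rlinD[OF \<kappa> r] by (simp add: f(3) act_mult(3)[OF Y] act_mult(3)[OF X, symmetric])
    next
      case (add z w)
      then show ?case using r x X Y Q(2) hom_closed[OF f(1)[OF x]] by (simp add: act_add hom_mult[OF f(1)])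
    qed
    then show "bl Q X Y f (pt Q X z (ra X r x)) = ra Y r (bl Q X Y f (pt Q X z x))" using r z x X by (simp add: l(3))
  qed
  from right_univ_ex1[OF V Q(2) this] obtain g where g: "g \<in> lmod_hom E Q V"
    "\<forall>w\<in>carrier Q. \<forall>x\<in>carrier X. \<epsilon> (pt V X (g w) x) = bl Q X Y f (pt Q X w x)" by blast
  have q1: "scal Q (pe \<one>\<^bsub>R\<^esub> \<one>\<^bsub>R\<^esub>) q = q" using left_moduleD(7)[OF bm_lmod[OF Q(2)] q] by (simp add: E_simps)
  show thesis
  proof
    show "g q \<in> carrier V" using lmod_homD(4)[OF g(1) q] .
    show "\<epsilon> (pt V X (g q) x) = \<kappa> x" if x: "x \<in> carrier X" for x
      using g(2) q x l(3)[OF q x] f(3)[OF R.one_closed R.one_closed x] X Y cl by (simp add: q1 act_one)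
  qed
qed

text \<open>The mirror image: x \<otimes> (a \<otimes> b) q goes to \<kappa>(x a) b, so a left inner
  hom consists of the left linear maps X \<rightarrow> Y.\<close>

lemma left_univ_surj:
  assumes V: "left_univ X Y V \<epsilon>" and X: "bm X" and Y: "bm Y" and \<kappa>: "llin X Y \<kappa>"
  obtains e where "e \<in> carrier V" "\<And>x. x \<in> carrier X \<Longrightarrow> \<epsilon> (pt X V x e) = \<kappa> x"
proof -
  note \<epsilon> = left_univD[OF V]
  obtain Q q where Q: "free1 E Q q" "bm Q" by (rule E_free)
  have q: "q \<in> carrier Q" using Q(1) by (simp add: free1_def)
  have h: "(\<lambda>x. ra Y b (\<kappa> (ra X a x))) \<in> hom X Y" if "a \<in> carrier R" "b \<in> carrier R" for a b
    by (rule hom_trans[OF act_hom(2)[OF Y that(2)] hom_trans[OF llin_hom[OF \<kappa>] act_hom(2)[OF X that(1)]]])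
  have cl: "\<kappa> x \<in> carrier Y" if "x \<in> carrier X" for x using llin_closed[OF \<kappa> that] .
  have b: "env_balanced Y (\<lambda>a b. ra Y b (\<kappa> (ra X a x)))" if x: "x \<in> carrier X" for x
  proof (rule balancedI2)
    fix c a b assume c: "c \<in> carrier k" and "a \<in> carrier (add_monoid R)" "b \<in> carrier (add_monoid R)"
    then have ab: "a \<in> carrier R" "b \<in> carrier R" by auto
    let ?c = "c \<odot>\<^bsub>R\<^esub> \<one>\<^bsub>R\<^esub>"
    have c': "?c \<in> carrier R" using c by simp
    have "ra Y (c \<odot>\<^bsub>R\<^esub> b) (\<kappa> (ra X a x)) = ra Y b (la Y ?c (\<kappa> (ra X a x)))"
      using act_k(3)[OF Y c ab(2) cl] act_k(2)[OF Y c ab(2) cl] ab x X by simp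
    also have "\<dots> = ra Y b (\<kappa> (la X ?c (ra X a x)))" using llinD[OF \<kappa> c'] ab x X by simp
    also have "la X ?c (ra X a x) = ra X (c \<odot>\<^bsub>R\<^esub> a) x" using act_k(3)[OF X c ab(1) x] act_k(2)[OF X c ab(1) x] act_mult(3)[OF X c' ab(1) x] by simp
    finally show "ra Y b (\<kappa> (ra X (c \<odot>\<^bsub>R\<^esub> a) x)) = ra Y (c \<odot>\<^bsub>R\<^esub> b) (\<kappa> (ra X a x))" by simp
  qed (use x X Y cl in \<open>auto simp: act_add hom_mult[OF llin_hom[OF \<kappa>]]\<close>)
  obtain f where f: "\<And>x. x \<in> carrier X \<Longrightarrow> (\<lambda>z. f z x) \<in> hom Q Y" "\<And>z. z \<in> carrier Q \<Longrightarrow> f z \<in> hom X Y"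
    "\<And>a b x. a \<in> carrier R \<Longrightarrow> b \<in> carrier R \<Longrightarrow> x \<in> carrier X \<Longrightarrow> f (scal Q (pe a b) q) x = ra Y b (\<kappa> (ra X a x))"
    using free1_bimap[OF Q Y b h X] by blast
  have bal: "bal X Q Y (\<lambda>x z. f z x)"
  proof (rule balI[OF f(1) f(2)])
    fix r x z assume r: "r \<in> carrier R" and z: "z \<in> carrier Q" and x: "x \<in> carrier X"
    from Q z show "f z (ra X r x) = f (la Q r z) x"
    proof (induction rule: free1_induct)
      case (scal a b)
      then show ?case using r x X by (simp add: free1_pe[OF Q] f(3) act_mult)
    next
      case (add z w)
      then show ?case using r x X Q(2) by (simp add: act_add hom_mult[OF f(1)])
    qed
  qed
  let ?f = "bl X Q Y (\<lambda>x z. f z x)"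
  note l = lift[OF X Q(2) Y bal]
  have "?f \<in> lmod_hom E (tens X Q) Y"
    unfolding lmod_hom_iff[OF bm_tens[OF X Q(2)] Y]
  proof (intro conjI l(2) tens_llinI[OF X Q(2) Y l(1)] tens_rlinI[OF X Q(2) Y l(1)])
    fix r x z assume r: "r \<in> carrier R" and z: "z \<in> carrier Q" and x: "x \<in> carrier X"
    from Q z have "f (ra Q r z) x = ra Y r (f z x)"
    proof (induction rule: free1_induct)
      case (scal a b)
      then show ?case using r x X Y cl by (simp add: free1_pe[OF Q] f(3) act_mult)
    next
      case (add z w)
      then show ?case using r x X Y Q(2) hom_closed[OF f(1)[OF x]] by (simp add: act_add hom_mult[OF f(1)])
    qed
    then show "?f (pt X Q x (ra Q r z)) = ra Y r (?f (pt X Q x z))" using r z x Q(2) by (simp add: l(3))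
    from Q z have "f z (la X r x) = la Y r (f z x)"
    proof (induction rule: free1_induct)
      case (scal a b)
      then show ?case using r x X Y cl llinD[OF \<kappa> r] by (simp add: f(3) act_mult(3))
    next
      case (add z w)
      then show ?case using r x X Y Q(2) hom_closed[OF f(1)[OF x]] by (simp add: act_add hom_mult[OF f(1)])
    qed
    then show "?f (pt X Q (la X r x) z) = la Y r (?f (pt X Q x z))" using r z x X by (simp add: l(3))
  qed
  from left_univ_ex1[OF V Q(2) this] obtain g where g: "g \<in> lmod_hom E Q V"
    "\<forall>w\<in>carrier Q. \<forall>x\<in>carrier X. \<epsilon> (pt X V x (g w)) = ?f (pt X Q x w)" by blast
  have q1: "scal Q (pe \<one>\<^bsub>R\<^esub> \<one>\<^bsub>R\<^esub>) q = q" using left_moduleD(7)[OF bm_lmod[OF Q(2)] q] by (simp add: E_simps)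
  show thesis
  proof
    show "g q \<in> carrier V" using lmod_homD(4)[OF g(1) q] .
    show "\<epsilon> (pt X V x (g q)) = \<kappa> x" if x: "x \<in> carrier X" for x
      using g(2) q x l(3)[OF x q] f(3)[OF R.one_closed R.one_closed x] X Y cl by (simp add: q1 act_one)
  qed
qed

end

lemma lmod_inverse:
  assumes "f \<in> lmod_hom A M N" "left_module A M" "left_module A N" "g \<in> extensional (carrier N)"
    "\<And>y. y \<in> carrier N \<Longrightarrow> g y \<in> carrier M" "\<And>y. y \<in> carrier N \<Longrightarrow> f (g y) = y" "\<And>x. x \<in> carrier M \<Longrightarrow> g (f x) = x"
  shows "g \<in> lmod_hom A N M"
proof -
  have "g (x \<otimes>\<^bsub>N\<^esub> y) = g x \<otimes>\<^bsub>M\<^esub> g y" if "x \<in> carrier N" "y \<in> carrier N" for x y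
    using that assms(5,6,7) hom_mult[OF lmod_homD(1)[OF assms(1)], of "g x" "g y"]
      comm_groupE(1)[OF left_moduleD(2)[OF assms(2)]] by metis
  moreover have "g (scal N a x) = scal M a (g x)" if "x \<in> carrier N" "a \<in> carrier A" for x a
    using that assms(5,6,7) lmod_homD(3)[OF assms(1) that(2), of "g x"] left_moduleD(3)[OF assms(2) that(2)] by metis
  ultimately show ?thesis using assms(4,5) by (auto simp: lmod_hom_def hom_def)
qed

section \<open>Arrows between tensor products and equality on triple tensors\<close>

context bimods begin

lemma TensA_Arrow [simp]:
  "TensA C (Arrow M M' f) (Arrow N N' g) = Arrow (tens M N) (tens M' N') (tm M N M' N' f g)"
  by (simp add: tm_def)

abbreviation "idr M \<equiv> (\<lambda>x\<in>carrier M. x)"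

lemma lin_idr: "llin M M (idr M)" "rlin M M (idr M)" if "bm M"
  using that by (auto simp: llin_def rlin_def hom_def)

lemma tm_idr:
  assumes "bm M" "bm N" "t \<in> carrier (tens M N)"
  shows "bm N' \<Longrightarrow> llin N N' g \<Longrightarrow> tm M N M N' (idr M) g t = tm M N M N' (\<lambda>x. x) g t"
    "bm M' \<Longrightarrow> rlin M M' f \<Longrightarrow> tm M N M' N f (idr N) t = tm M N M' N f (\<lambda>x. x) t"
    "tm M N M N (idr M) (idr N) t = t"
proof -
  show "bm N' \<Longrightarrow> llin N N' g \<Longrightarrow> tm M N M N' (idr M) g t = tm M N M N' (\<lambda>x. x) g t"
    by (rule tm_cong) (use assms in \<open>auto simp: lin_idr rlin_id\<close>)
  show "bm M' \<Longrightarrow> rlin M M' f \<Longrightarrow> tm M N M' N f (idr N) t = tm M N M' N f (\<lambda>x. x) t"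
    by (rule tm_cong) (use assms in \<open>auto simp: lin_idr llin_id\<close>)
  have "tm M N M N (idr M) (idr N) t = tm M N M N (\<lambda>x. x) (\<lambda>x. x) t"
    by (rule tm_cong) (use assms in \<open>auto simp: lin_idr llin_id rlin_id\<close>)
  then show "tm M N M N (idr M) (idr N) t = t" using assms by (simp add: tm_id)
qed

lemma tens3_eqI:
  assumes "bm L" "bm M" "bm N" "f \<in> hom (tens L (tens M N)) G" "g \<in> hom (tens L (tens M N)) G" "comm_group G"
    "\<And>l m n. l \<in> carrier L \<Longrightarrow> m \<in> carrier M \<Longrightarrow> n \<in> carrier N \<Longrightarrow> f (pt L (tens M N) l (pt M N m n)) = g (pt L (tens M N) l (pt M N m n))"
    "t \<in> carrier (tens L (tens M N))"
  shows "f t = g t"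
proof (rule tens_eqI[OF assms(1) bm_tens[OF assms(2,3)] assms(4,5) _ assms(8)])
  fix l s assume l: "l \<in> carrier L" and s: "s \<in> carrier (tens M N)"
  show "f (pt L (tens M N) l s) = g (pt L (tens M N) l s)"
    by (rule tens_eqI[OF assms(2,3) pt_tens_hom(1)[OF assms(4,1) bm_tens[OF assms(2,3)] l] pt_tens_hom(1)[OF assms(5,1) bm_tens[OF assms(2,3)] l] _ s])
      (rule assms(7)[OF l])
qed

lemma tens3_eqI':
  assumes "bm L" "bm M" "bm N" "f \<in> hom (tens (tens L M) N) G" "g \<in> hom (tens (tens L M) N) G" "comm_group G"
    "\<And>l m n. l \<in> carrier L \<Longrightarrow> m \<in> carrier M \<Longrightarrow> n \<in> carrier N \<Longrightarrow> f (pt (tens L M) N (pt L M l m) n) = g (pt (tens L M) N (pt L M l m) n)"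
    "t \<in> carrier (tens (tens L M) N)"
  shows "f t = g t"
proof (rule tens_eqI[OF bm_tens[OF assms(1,2)] assms(3) assms(4,5) _ assms(8)])
  fix s n assume n: "n \<in> carrier N" and s: "s \<in> carrier (tens L M)"
  show "f (pt (tens L M) N s n) = g (pt (tens L M) N s n)"
    by (rule tens_eqI[OF assms(1,2) pt_tens_hom(2)[OF assms(4) bm_tens[OF assms(1,2)] assms(3) n] pt_tens_hom(2)[OF assms(5) bm_tens[OF assms(1,2)] assms(3) n] _ s])
      (rule assms(7)[OF _ _ n])
qed

lemma tm_idr_eq:
  assumes "bm M" "bm N"
  shows "bm N' \<Longrightarrow> llin N N' g \<Longrightarrow> tm M N M N' (idr M) g = tm M N M N' (\<lambda>x. x) g"
    "bm M' \<Longrightarrow> rlin M M' f \<Longrightarrow> tm M N M' N f (idr N) = tm M N M' N f (\<lambda>x. x)"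
  using assms
  by (auto intro!: extensionalityI[OF tm_ext tm_ext] simp: lin_idr llin_id rlin_id tm_idr)

lemma C_homset_Arrow: "bm M \<Longrightarrow> bm N \<Longrightarrow> Arrow M N f \<in> homset C M N \<longleftrightarrow> f \<in> lmod_hom E M N"
  by (simp add: C_homset bm_def)

end

declare (in bimods) C_simps(8) [simp del]

section \<open>Modules over a bialgebroid\<close>

locale bialg = bimods k R U
  for k :: "'k ring" and R :: "('k, 'r) module" and U :: "'u set set" +
  fixes H :: "('k, 'r, 'h, 'u) bialgebroid_data"
  assumes bialgebroid: "bialgebroid U k R H"
begin

abbreviation "A \<equiv> alg H"
abbreviation "HC \<equiv> mon H"
abbreviation "Rs \<equiv> restrict_scalars E (env_map H)"
abbreviation "HI \<equiv> UnitO HC"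
abbreviation "ht \<equiv> TensO HC"
abbreviation "F \<equiv> underlying U k R H"
abbreviation "\<rho>F \<equiv> restriction_ftor E (env_map H)"

lemma monH: "monoidal_category HC" and truncH: "cat.truncate HC = module_cat U A"
  and strictH: "strict_monoidal HC C \<rho>F" and homH: "env_map H \<in> k_algebra_hom k E A" and kA: "k_algebra k A"
  using bialgebroid by (auto simp: bialgebroid_def)

sublocale HC: monoidal_category HC by (rule monH)

sublocale A: ring A using kA by (simp add: k_algebra_def)

lemma HC_simps [simp]:
  "Obj HC = {M. left_module A M \<and> carrier M \<in> U}"
  "Dom HC = src" "Cod HC = tgt"
  "Idn HC M = Arrow M M (\<lambda>x\<in>carrier M. x)"
  "Cmp HC g f = Arrow (src f) (tgt g) (compose (carrier (src f)) (fn g) (fn f))"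
  using arg_cong[OF truncH, of Obj] arg_cong[OF truncH, of Dom] arg_cong[OF truncH, of Cod] arg_cong[OF truncH, of Idn]
    arg_cong[OF truncH, of Cmp]
  by (simp_all add: cat.truncate_def fun_eq_iff module_cat_def Let_def)

lemma HC_homset:
  "f \<in> homset HC M N \<longleftrightarrow> M \<in> Obj HC \<and> N \<in> Obj HC \<and> fn f \<in> lmod_hom A M N \<and> f = Arrow M N (fn f)"
proof -
  have "Arr HC = Arr (module_cat U A)" using arg_cong[OF truncH, of Arr] by (simp add: cat.truncate_def)
  then have "homset HC M N = homset (module_cat U A) M N" by (simp add: homset_def)
  then show ?thesis using module_cat_homset[of f U A M N] by simp
qed

definition hm :: "('h, 'u) lmod \<Rightarrow> bool" where
  "hm M \<longleftrightarrow> left_module A M \<and> carrier M \<in> U"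

lemma hm_Obj: "M \<in> Obj HC \<longleftrightarrow> hm M"
  by (simp add: hm_def)

lemma hm_lmod: "hm M \<Longrightarrow> left_module A M"
  by (simp add: hm_def)

lemma homset_Arrow: "hm M \<Longrightarrow> hm N \<Longrightarrow> Arrow M N f \<in> homset HC M N \<longleftrightarrow> f \<in> lmod_hom A M N"
  by (simp add: HC_homset hm_def)

lemma HC_Arr: "Arrow M N f \<in> Arr HC \<longleftrightarrow> hm M \<and> hm N \<and> f \<in> lmod_hom A M N"
  using HC_homset[of "Arrow M N f" M N] by (auto simp: homset_def hm_def)

lemma hm_ht [simp]: "hm M \<Longrightarrow> hm N \<Longrightarrow> hm (ht M N)"
  using HC.TensO_closed[of M N] by (simp add: hm_def)

lemma hm_HI [simp]: "hm HI"
  using HC.UnitO_closed by (simp add: hm_def)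

lemma Rs_simps [simp]:
  "carrier (Rs M) = carrier M" "monoid.mult (Rs M) = monoid.mult M" "\<one>\<^bsub>Rs M\<^esub> = \<one>\<^bsub>M\<^esub>"
  by (simp_all add: restrict_scalars_def)

lemma Rs_scal: "z \<in> carrier E \<Longrightarrow> x \<in> carrier M \<Longrightarrow> scal (Rs M) z x = scal M (env_map H z) x"
  by (simp add: restrict_scalars_def)

lemma hom_Rs [simp]: "hom (Rs M) N = hom M N" "hom N (Rs M) = hom N M"
  by (simp_all add: hom_def)

lemma env_map_closed [simp]: "z \<in> carrier E \<Longrightarrow> env_map H z \<in> carrier A"
  using homH by (auto simp: k_algebra_hom_def ring_hom_def)

lemma ftorH: "is_ftor HC C \<rho>F"
  using strictH by (simp add: strict_monoidal_def)

lemma bm_Rs [simp]: "hm M \<Longrightarrow> bm (Rs M)"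
  using ftorH hm_Obj bm_Obj unfolding is_ftor_def by (auto simp: restriction_ftor_def simp del: HC_simps C_simps)

lemma Rs_lmod: "f \<in> lmod_hom A M N \<Longrightarrow> left_module A M \<Longrightarrow> f \<in> lmod_hom E (Rs M) (Rs N)"
  by (auto simp: lmod_hom_def Rs_scal left_moduleD hom_def Pi_iff)

lemma Rs_lin:
  assumes "f \<in> lmod_hom A M N" "hm M" "hm N"
  shows "llin (Rs M) (Rs N) f" "rlin (Rs M) (Rs N) f"
  using Rs_lmod[OF assms(1) hm_lmod[OF assms(2)]] assms by (auto simp: lmod_hom_iff)

lemma strictD:
  shows "hm M \<Longrightarrow> hm N \<Longrightarrow> Rs (ht M N) = tens (Rs M) (Rs N)"
    "f \<in> Arr HC \<Longrightarrow> g \<in> Arr HC \<Longrightarrow> FA \<rho>F (TensA HC f g) = TensA C (FA \<rho>F f) (FA \<rho>F g)"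
    "Rs HI = I"
    "hm L \<Longrightarrow> hm M \<Longrightarrow> hm N \<Longrightarrow> FA \<rho>F (Assoc HC L M N) = Assoc C (Rs L) (Rs M) (Rs N)"
    "hm M \<Longrightarrow> FA \<rho>F (LUnit HC M) = LUnit C (Rs M)" "hm M \<Longrightarrow> FA \<rho>F (RUnit HC M) = RUnit C (Rs M)"
  using strictH unfolding strict_monoidal_def hm_Obj[symmetric]
  by (simp_all add: restriction_ftor_def del: HC_simps)

lemma carrier_ht [simp]: "hm M \<Longrightarrow> hm N \<Longrightarrow> carrier (ht M N) = carrier (tens (Rs M) (Rs N))"
  using strictD(1)[of M N] Rs_simps(1)[of "ht M N"] by simp

lemma mult_ht [simp]: "hm M \<Longrightarrow> hm N \<Longrightarrow> monoid.mult (ht M N) = monoid.mult (tens (Rs M) (Rs N))"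
  using strictD(1)[of M N] Rs_simps(2)[of "ht M N"] by simp

lemma hom_ht [simp]: "hm M \<Longrightarrow> hm N \<Longrightarrow> hom (ht M N) P = hom (tens (Rs M) (Rs N)) P"
  "hm M \<Longrightarrow> hm N \<Longrightarrow> hom P (ht M N) = hom P (tens (Rs M) (Rs N))"
  by (simp_all add: hom_def)

lemma carrier_HI [simp]: "carrier HI = carrier I"
  using strictD(3) Rs_simps(1)[of HI] by simp

lemma FA_\<rho>F: "FA \<rho>F f = Arrow (Rs (src f)) (Rs (tgt f)) (fn f)"
  by (simp add: restriction_ftor_def)

text \<open>The underlying functor keeps the function of an arrow. Strictness therefore shows that
  the tensor product of H-linear maps has \<open>tm\<close> as its function, and that this function
  is H-linear.\<close>

lemma TensA_HC:
  assumes "hm M" "hm N" "hm M'" "hm N'" "f \<in> lmod_hom A M M'" "g \<in> lmod_hom A N N'"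
  defines "f' \<equiv> Arrow M M' f" and "g' \<equiv> Arrow N N' g"
  shows "TensA HC f' g' = Arrow (ht M N) (ht M' N') (tm (Rs M) (Rs N) (Rs M') (Rs N') f g)"
    "tm (Rs M) (Rs N) (Rs M') (Rs N') f g \<in> lmod_hom A (ht M N) (ht M' N')"
proof -
  have "TensA HC f' g' \<in> homset HC (ht M N) (ht M' N')"
    using assms by (intro HC.TensA_hom) (auto simp: homset_Arrow f'_def g'_def)
  then have *: "fn (TensA HC f' g') \<in> lmod_hom A (ht M N) (ht M' N')" "TensA HC f' g' = Arrow (ht M N) (ht M' N') (fn (TensA HC f' g'))"
    unfolding HC_homset by auto
  have "fn (FA \<rho>F (TensA HC f' g')) = tm (Rs M) (Rs N) (Rs M') (Rs N') f g"
    using assms by (subst strictD(2)) (auto simp: f'_def g'_def HC_Arr FA_\<rho>F)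
  then have "fn (TensA HC f' g') = tm (Rs M) (Rs N) (Rs M') (Rs N') f g" by (simp add: FA_\<rho>F)
  then show "TensA HC f' g' = Arrow (ht M N) (ht M' N') (tm (Rs M) (Rs N) (Rs M') (Rs N') f g)"
    "tm (Rs M) (Rs N) (Rs M') (Rs N') f g \<in> lmod_hom A (ht M N) (ht M' N')"
    using * by auto
qed

text \<open>H-linearity of the associator comes from strictness: it is the function of an associator
  of H-modules. Its inverse function is then H-linear as well.\<close>

lemma Assoc_HC:
  assumes "hm L" "hm M" "hm N"
  shows "as (Rs L) (Rs M) (Rs N) \<in> lmod_hom A (ht (ht L M) N) (ht L (ht M N))"
    "ai (Rs L) (Rs M) (Rs N) \<in> lmod_hom A (ht L (ht M N)) (ht (ht L M) N)"
proof -
  let ?a = "Assoc HC L M N"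
  have a: "fn ?a \<in> lmod_hom A (ht (ht L M) N) (ht L (ht M N))"
    using HC.Assoc_hom[of L M N] assms HC_homset unfolding hm_Obj by blast
  have "fn (FA \<rho>F ?a) = as (Rs L) (Rs M) (Rs N)" using strictD(4)[OF assms] by (simp add: as_def)
  then show *: "as (Rs L) (Rs M) (Rs N) \<in> lmod_hom A (ht (ht L M) N) (ht L (ht M N))" using a by (simp add: FA_\<rho>F)
  note i = ai_props[of "Rs L" "Rs M" "Rs N"]
  show "ai (Rs L) (Rs M) (Rs N) \<in> lmod_hom A (ht L (ht M N)) (ht (ht L M) N)"
    by (rule lmod_inverse[OF *])
      (use assms i(3,4) lmod_homD(2)[OF i(2)] lmod_homD(4)[OF i(2)] in \<open>simp_all add: hm_lmod strictD(1)\<close>)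
qed

lemma lu_HC: "hm M \<Longrightarrow> lu (Rs M) \<in> lmod_hom A (ht HI M) M" and ru_HC: "hm M \<Longrightarrow> ru (Rs M) \<in> lmod_hom A (ht M HI) M"
proof -
  assume M: "hm M"
  have "fn (LUnit HC M) \<in> lmod_hom A (ht HI M) M" "fn (RUnit HC M) \<in> lmod_hom A (ht M HI) M"
    using HC.LUnit_hom[of M] HC.RUnit_hom[of M] M HC_homset unfolding hm_Obj by blast+
  moreover have "fn (FA \<rho>F (LUnit HC M)) = lu (Rs M)" "fn (FA \<rho>F (RUnit HC M)) = ru (Rs M)"
    using strictD(5,6)[OF M] by (simp_all add: lu_def ru_def)
  ultimately show "lu (Rs M) \<in> lmod_hom A (ht HI M) M" "ru (Rs M) \<in> lmod_hom A (ht M HI) M" by (simp_all add: FA_\<rho>F)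
qed

section \<open>Objects of the weak centralizer as families of functions\<close>

lemma F_simps [simp]:
  "FO F = Rs" "FA F f = Arrow (Rs (src f)) (Rs (tgt f)) (fn f)"
  "Xi F M N = Idn C (Rs (ht M N))" "Xi0 F = Idn C (Rs HI)"
  by (simp_all add: underlying_def strict_monftor_def restriction_ftor_def)

text \<open>The conditions on objects of the weak centralizer, in terms of pure tensors.\<close>

definition halfbraid :: "('r env, 'u) lmod \<Rightarrow> (('h, 'u) lmod \<Rightarrow> 'u \<Rightarrow> 'u) \<Rightarrow> bool" where
  "halfbraid X s \<longleftrightarrow> bm X \<and>
     (\<forall>W. hm W \<longrightarrow> s W \<in> lmod_hom E (tens X (Rs W)) (tens (Rs W) X)) \<and>
     (\<forall>W W' f x w. hm W \<longrightarrow> hm W' \<longrightarrow> f \<in> lmod_hom A W W' \<longrightarrow> x \<in> carrier X \<longrightarrow> w \<in> carrier W \<longrightarrow>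
        s W' (pt X (Rs W') x (f w)) = tm (Rs W) X (Rs W') X f (\<lambda>x. x) (s W (pt X (Rs W) x w))) \<and>
     (\<forall>W W' x w w'. hm W \<longrightarrow> hm W' \<longrightarrow> x \<in> carrier X \<longrightarrow> w \<in> carrier W \<longrightarrow> w' \<in> carrier W' \<longrightarrow>
        as (Rs W) (Rs W') X (s (ht W W') (pt X (tens (Rs W) (Rs W')) x (pt (Rs W) (Rs W') w w')))
        = tm (Rs W) X (Rs W) (tens (Rs W') X) (\<lambda>x. x) (\<lambda>x. s W' (pt X (Rs W') x w')) (s W (pt X (Rs W) x w))) \<and>
     (\<forall>x\<in>carrier X. lu X (s HI (pt X I x one_I)) = x)"

lemma halfbraidD:
  assumes "halfbraid X s"
  shows "bm X" "hm W \<Longrightarrow> s W \<in> lmod_hom E (tens X (Rs W)) (tens (Rs W) X)"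
    "hm W \<Longrightarrow> s W \<in> hom (tens X (Rs W)) (tens (Rs W) X)"
    "hm W \<Longrightarrow> llin (tens X (Rs W)) (tens (Rs W) X) (s W)"
    "hm W \<Longrightarrow> rlin (tens X (Rs W)) (tens (Rs W) X) (s W)"
    "hm W \<Longrightarrow> hm W' \<Longrightarrow> f \<in> lmod_hom A W W' \<Longrightarrow> x \<in> carrier X \<Longrightarrow> w \<in> carrier W \<Longrightarrow>
        s W' (pt X (Rs W') x (f w)) = tm (Rs W) X (Rs W') X f (\<lambda>x. x) (s W (pt X (Rs W) x w))"
    "hm W \<Longrightarrow> hm W' \<Longrightarrow> x \<in> carrier X \<Longrightarrow> w \<in> carrier W \<Longrightarrow> w' \<in> carrier W' \<Longrightarrow>
        as (Rs W) (Rs W') X (s (ht W W') (pt X (tens (Rs W) (Rs W')) x (pt (Rs W) (Rs W') w w')))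
        = tm (Rs W) X (Rs W) (tens (Rs W') X) (\<lambda>x. x) (\<lambda>x. s W' (pt X (Rs W') x w')) (s W (pt X (Rs W) x w))"
    "x \<in> carrier X \<Longrightarrow> lu X (s HI (pt X I x one_I)) = x"
  using assms by (auto simp: halfbraid_def lmod_hom_iff intro: llin_hom)

text \<open>Cut down to objects because the components of an object of the weak centralizer are
  required to be extensional. Distinct \<open>s\<close> that agree on modules thus give the same
  object.\<close>

definition wc_arr where
  "wc_arr X s = (\<lambda>W\<in>Obj HC. Arrow (tens X (Rs W)) (tens (Rs W) X) (s W))"

lemma llin_pt: "bm X \<Longrightarrow> bm W \<Longrightarrow> w \<in> carrier W \<Longrightarrow> llin X (tens X W) (\<lambda>x. pt X W x w)"
  by (auto intro!: llinI pt_hom simp: tens_act)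

lemma rlin_pt: "bm X \<Longrightarrow> bm W \<Longrightarrow> x \<in> carrier X \<Longrightarrow> rlin W (tens X W) (\<lambda>w. pt X W x w)"
  by (auto intro!: rlinI pt_hom simp: tens_act)

text \<open>Both sides are arrows between triple tensor products, so they agree iff their functions
  agree on pure tensors. There the inverse associator can be evaluated and disappears, since the
  last factor \<open>w\<close> is held fixed; this is why \<open>halfbraid\<close> contains only one
  associator.\<close>

lemma wc_mult_eq:
  assumes X: "bm X" and s: "\<And>W. hm W \<Longrightarrow> s W \<in> lmod_hom E (tens X (Rs W)) (tens (Rs W) X)" and V: "hm V" and W: "hm W"
  defines "\<sigma> \<equiv> wc_arr X s"
  shows "Assoc C (FO F V) (FO F W) X \<bullet>\<^bsub>C\<^esub> (Xi F V W \<star>\<^bsub>C\<^esub> Idn C X) \<bullet>\<^bsub>C\<^esub> \<sigma> (V \<boxtimes>\<^bsub>HC\<^esub> W)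
        = (Idn C (FO F V) \<star>\<^bsub>C\<^esub> \<sigma> W) \<bullet>\<^bsub>C\<^esub> Assoc C (FO F V) X (FO F W) \<bullet>\<^bsub>C\<^esub>
          (\<sigma> V \<star>\<^bsub>C\<^esub> Idn C (FO F W)) \<bullet>\<^bsub>C\<^esub> inv_arrow C (Assoc C X (FO F V) (FO F W)) \<bullet>\<^bsub>C\<^esub>
          (Idn C X \<star>\<^bsub>C\<^esub> Xi F V W) \<longleftrightarrow>
     (\<forall>x\<in>carrier X. \<forall>v\<in>carrier V. \<forall>w\<in>carrier W.
        as (Rs V) (Rs W) X (s (ht V W) (pt X (tens (Rs V) (Rs W)) x (pt (Rs V) (Rs W) v w)))
        = tm (Rs V) X (Rs V) (tens (Rs W) X) (\<lambda>x. x) (\<lambda>x. s W (pt X (Rs W) x w)) (s V (pt X (Rs V) x v)))"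
    (is "?eq \<longleftrightarrow> ?R")
proof -
  let ?V = "Rs V" and ?W = "Rs W"
  let ?S = "tens X (tens ?V ?W)"
  have o: "V \<in> Obj HC" "W \<in> Obj HC" "ht V W \<in> Obj HC" using V W hm_ht[OF V W] by (simp_all add: hm_def)
  have b: "bm ?V" "bm ?W" "bm X" using V W X by auto
  note sV = s[OF V] and sW = s[OF W] and sVW = s[OF hm_ht[OF V W], unfolded strictD(1)[OF V W]]
  note lin = lmod_llin[OF sW] lmod_rlin[OF sW] lmod_llin[OF sV] lmod_rlin[OF sV] lmod_llin[OF sVW] lmod_rlin[OF sVW]
  let ?f = "\<lambda>t. as ?V ?W X (s (ht V W) t)"
  let ?g = "\<lambda>t. tm ?V (tens X ?W) ?V (tens ?W X) (\<lambda>x. x) (s W) (as ?V X ?W (tm (tens X ?V) ?W (tens ?V X) ?W (s V) (\<lambda>x. x) (ai X ?V ?W t)))"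
  have sc: "s (ht V W) t \<in> carrier (tens (tens ?V ?W) X)" if "t \<in> carrier ?S" for t using lmod_homD(4)[OF sVW that] .
  have c1: "ai X ?V ?W t \<in> carrier (tens (tens X ?V) ?W)" if "t \<in> carrier ?S" for t
    using hom_closed[OF ai_hom that] b by simp
  have c2: "tm (tens X ?V) ?W (tens ?V X) ?W (s V) (\<lambda>x. x) (ai X ?V ?W t) \<in> carrier (tens (tens ?V X) ?W)" if "t \<in> carrier ?S" for t
    using tm_closed[OF _ _ _ _ _ _ c1[OF that]] b lin by (simp add: llin_id)
  have c3: "as ?V X ?W (tm (tens X ?V) ?W (tens ?V X) ?W (s V) (\<lambda>x. x) (ai X ?V ?W t)) \<in> carrier (tens ?V (tens X ?W))" if "t \<in> carrier ?S" for t
    using hom_closed[OF as_hom c2[OF that]] b by simp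
  have fh: "?f \<in> hom ?S (tens ?V (tens ?W X))"
    by (rule hom_trans[OF as_hom lmod_homD(1)[OF sVW]]) (use b in auto)
  have gh: "?g \<in> hom ?S (tens ?V (tens ?W X))"
    by (rule hom_trans[OF tm_hom hom_trans[OF as_hom hom_trans[OF tm_hom ai_hom]]]) (use b lin in \<open>auto simp: rlin_id llin_id\<close>)
  have "?eq \<longleftrightarrow> (\<forall>t\<in>carrier ?S. ?f t = ?g t)"
  proof -
    have L: "Assoc C (FO F V) (FO F W) X \<bullet>\<^bsub>C\<^esub> (Xi F V W \<star>\<^bsub>C\<^esub> Idn C X) \<bullet>\<^bsub>C\<^esub> \<sigma> (V \<boxtimes>\<^bsub>HC\<^esub> W)
      = Arrow ?S (tens ?V (tens ?W X)) (\<lambda>t\<in>carrier ?S. ?f t)"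
      using o V W b by (auto simp: \<sigma>_def wc_arr_def strictD(1) Assoc_eq compose_def tm_idr(3)[OF _ _ sc] cong: restrict_cong simp del: HC_simps)
    have R: "(Idn C (FO F V) \<star>\<^bsub>C\<^esub> \<sigma> W) \<bullet>\<^bsub>C\<^esub> Assoc C (FO F V) X (FO F W) \<bullet>\<^bsub>C\<^esub>
          (\<sigma> V \<star>\<^bsub>C\<^esub> Idn C (FO F W)) \<bullet>\<^bsub>C\<^esub> inv_arrow C (Assoc C X (FO F V) (FO F W)) \<bullet>\<^bsub>C\<^esub>
          (Idn C X \<star>\<^bsub>C\<^esub> Xi F V W) = Arrow ?S (tens ?V (tens ?W X)) (\<lambda>t\<in>carrier ?S. ?g t)" (is "?L = _")
    proof -
      have m: "tm (tens X ?V) ?W (tens ?V X) ?W (s V) (idr ?W) (ai X ?V ?W t) = tm (tens X ?V) ?W (tens ?V X) ?W (s V) (\<lambda>x. x) (ai X ?V ?W t)" if "t \<in> carrier ?S" for t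
        by (rule tm_idr(2)) (use b lin c1[OF that] in auto)
      have m': "tm ?V (tens X ?W) ?V (tens ?W X) (idr ?V) (s W) t = tm ?V (tens X ?W) ?V (tens ?W X) (\<lambda>x. x) (s W) t" if "t \<in> carrier (tens ?V (tens X ?W))" for t
        by (rule tm_idr(1)) (use b lin that in auto)
      note i = ai_props(1)[OF b(3,1,2), unfolded Assoc_eq[OF b(3,1,2)]]
      let ?h = "\<lambda>t. tm ?V (tens X ?W) ?V (tens ?W X) (idr ?V) (s W) (as ?V X ?W (tm (tens X ?V) ?W (tens ?V X) ?W (s V) (idr ?W) (ai X ?V ?W t)))"
      have h: "?h t = ?g t" if "t \<in> carrier ?S" for t
        unfolding m[OF that] m'[OF c3[OF that]] ..
      have "?L = Arrow ?S (tens ?V (tens ?W X)) (\<lambda>t\<in>carrier ?S. ?h t)"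
        using o V W b i by (auto simp: \<sigma>_def wc_arr_def strictD(1) Assoc_eq compose_def tm_idr(3) cong: restrict_cong simp del: HC_simps)
      also have "(\<lambda>t\<in>carrier ?S. ?h t) = (\<lambda>t\<in>carrier ?S. ?g t)" by (rule restrict_ext) (rule h)
      finally show ?thesis .
    qed
    show ?thesis unfolding L R by (auto simp: fun_eq_iff restrict_def)
  qed
  also have "\<dots> \<longleftrightarrow> (\<forall>x\<in>carrier X. \<forall>v\<in>carrier V. \<forall>w\<in>carrier W. ?f (pt X (tens ?V ?W) x (pt ?V ?W v w)) = ?g (pt X (tens ?V ?W) x (pt ?V ?W v w)))"
    using tens3_eqI[OF b(3,1,2) fh gh] b by auto
  also have "\<dots> \<longleftrightarrow> ?R"
  proof -
    have key: "?g (pt X (tens ?V ?W) x (pt ?V ?W v w)) = tm ?V X ?V (tens ?W X) (\<lambda>x. x) (\<lambda>x. s W (pt X ?W x w)) (s V (pt X ?V x v))"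
      if x: "x \<in> carrier X" and v: "v \<in> carrier V" and w: "w \<in> carrier W" for x v w
    proof -
      let ?t = "s V (pt X ?V x v)"
      let ?p = "\<lambda>t. tm ?V (tens X ?W) ?V (tens ?W X) (\<lambda>x. x) (s W) (as ?V X ?W (pt (tens ?V X) ?W t w))"
      let ?q = "tm ?V X ?V (tens ?W X) (\<lambda>x. x) (\<lambda>x. s W (pt X ?W x w))"
      have w': "w \<in> carrier ?W" using w by simp
      \<comment> \<open>With \<open>w\<close> fixed, the second braiding is only left linear in
        \<open>x\<close>. That is exactly what is required of the right-hand factor of a
        \<open>tm\<close>.\<close>
      have l: "llin X (tens ?W X) (\<lambda>x. s W (pt X ?W x w))" using llin_comp[OF lin(1) llin_pt[OF b(3,2) w']] b by simp
      have c: "?t \<in> carrier (tens ?V X)" using lmod_homD(4)[OF sV] x v b by simp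
      have "?g (pt X (tens ?V ?W) x (pt ?V ?W v w)) = ?p ?t"
        using x v w b lin by (simp add: ai_pt tm_pt llin_id)
      also have "?p ?t = ?q ?t"
      proof (rule tens_eqI[where f = ?p and g = ?q, OF b(1,3) _ _ _ c])
        show "?p \<in> hom (tens ?V X) (tens ?V (tens ?W X))"
          by (rule hom_trans[OF tm_hom hom_trans[OF as_hom pt_hom(2)]]) (use b w' lin in \<open>auto simp: rlin_id\<close>)
        show "?q \<in> hom (tens ?V X) (tens ?V (tens ?W X))" by (rule tm_hom) (use b l in \<open>auto simp: rlin_id\<close>)
        show "?p (pt ?V X m n) = ?q (pt ?V X m n)" if "m \<in> carrier ?V" "n \<in> carrier X" for m n
          using that w b lin l by (simp add: as_pt tm_pt rlin_id)
      qed
      finally show ?thesis .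
    qed
    show ?thesis by (intro ball_cong refl) (simp only: key)
  qed
  finally show ?thesis .
qed

lemma wc_nat_eq:
  assumes X: "bm X" and s: "\<And>W. hm W \<Longrightarrow> s W \<in> lmod_hom E (tens X (Rs W)) (tens (Rs W) X)" and V: "hm V" and W: "hm W"
    and f: "f \<in> lmod_hom A V W"
  defines "\<sigma> \<equiv> wc_arr X s" and "f' \<equiv> Arrow V W f"
  shows "\<sigma> W \<bullet>\<^bsub>C\<^esub> (Idn C X \<star>\<^bsub>C\<^esub> FA F f') = (FA F f' \<star>\<^bsub>C\<^esub> Idn C X) \<bullet>\<^bsub>C\<^esub> \<sigma> V \<longleftrightarrow>
    (\<forall>x\<in>carrier X. \<forall>w\<in>carrier V. s W (pt X (Rs W) x (f w)) = tm (Rs V) X (Rs W) X f (\<lambda>x. x) (s V (pt X (Rs V) x w)))"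
    (is "?eq \<longleftrightarrow> ?R")
proof -
  let ?V = "Rs V" and ?W = "Rs W"
  let ?S = "tens X ?V"
  have o: "V \<in> Obj HC" "W \<in> Obj HC" using V W by (simp_all add: hm_def)
  have b: "bm ?V" "bm ?W" "bm X" using V W X by auto
  note sV = s[OF V] and sW = s[OF W] and fl = Rs_lin[OF f V W]
  have c1: "s V t \<in> carrier (tens ?V X)" if "t \<in> carrier ?S" for t using lmod_homD(4)[OF sV that] .
  let ?f = "\<lambda>t. s W (tm X ?V X ?W (\<lambda>x. x) f t)" and ?g = "\<lambda>t. tm ?V X ?W X f (\<lambda>x. x) (s V t)"
  have fh: "?f \<in> hom ?S (tens ?W X)"
    by (rule hom_trans[OF lmod_homD(1)[OF sW] tm_hom]) (use b fl in \<open>auto simp: rlin_id\<close>)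
  have gh: "?g \<in> hom ?S (tens ?W X)"
    by (rule hom_trans[OF tm_hom lmod_homD(1)[OF sV]]) (use b fl in \<open>auto simp: llin_id\<close>)
  have "?eq \<longleftrightarrow> (\<forall>t\<in>carrier ?S. ?f t = ?g t)"
  proof -
    have L: "\<sigma> W \<bullet>\<^bsub>C\<^esub> (Idn C X \<star>\<^bsub>C\<^esub> FA F f') = Arrow ?S (tens ?W X) (\<lambda>t\<in>carrier ?S. ?f t)"
      using o b fl by (auto simp: \<sigma>_def f'_def wc_arr_def compose_def tm_idr cong: restrict_cong simp del: HC_simps)
    have R: "(FA F f' \<star>\<^bsub>C\<^esub> Idn C X) \<bullet>\<^bsub>C\<^esub> \<sigma> V = Arrow ?S (tens ?W X) (\<lambda>t\<in>carrier ?S. ?g t)"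
      using o b fl c1 by (auto simp: \<sigma>_def f'_def wc_arr_def compose_def tm_idr(2)[OF _ _ c1] cong: restrict_cong simp del: HC_simps)
    show ?thesis unfolding L R by (auto simp: fun_eq_iff restrict_def)
  qed
  also have "\<dots> \<longleftrightarrow> (\<forall>x\<in>carrier X. \<forall>v\<in>carrier V. ?f (pt X ?V x v) = ?g (pt X ?V x v))"
    using tens_eqI[OF b(3,1) fh gh] b by auto
  also have "\<dots> \<longleftrightarrow> ?R"
    using b fl by (simp add: tm_pt rlin_id)
  finally show ?thesis .
qed

lemma wc_unit_eq:
  assumes X: "bm X" and s: "\<And>W. hm W \<Longrightarrow> s W \<in> lmod_hom E (tens X (Rs W)) (tens (Rs W) X)"
  defines "\<sigma> \<equiv> wc_arr X s"
  shows "LUnit C X \<bullet>\<^bsub>C\<^esub> (Xi0 F \<star>\<^bsub>C\<^esub> Idn C X) \<bullet>\<^bsub>C\<^esub> \<sigma> (UnitO HC) = RUnit C X \<bullet>\<^bsub>C\<^esub> (Idn C X \<star>\<^bsub>C\<^esub> Xi0 F) \<longleftrightarrow>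
    (\<forall>x\<in>carrier X. lu X (s HI (pt X I x one_I)) = x)"
    (is "?eq \<longleftrightarrow> ?R")
proof -
  let ?S = "tens X I"
  have o: "HI \<in> Obj HC" using hm_HI by (simp add: hm_def)
  have b: "bm I" "bm X" using X by auto
  note sI = s[OF hm_HI, unfolded strictD(3)]
  have c1: "s HI t \<in> carrier (tens I X)" if "t \<in> carrier ?S" for t using lmod_homD(4)[OF sI that] .
  have eq: "?eq \<longleftrightarrow> (\<forall>t\<in>carrier ?S. lu X (s HI t) = ru X t)"
  proof -
    have L: "LUnit C X \<bullet>\<^bsub>C\<^esub> (Xi0 F \<star>\<^bsub>C\<^esub> Idn C X) \<bullet>\<^bsub>C\<^esub> \<sigma> (UnitO HC) = Arrow ?S X (\<lambda>t\<in>carrier ?S. lu X (s HI t))"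
      using o b c1 by (auto simp: \<sigma>_def wc_arr_def strictD(3) LUnit_eq compose_def tm_idr(3)[OF _ _ c1] cong: restrict_cong simp del: HC_simps)
    have R: "RUnit C X \<bullet>\<^bsub>C\<^esub> (Idn C X \<star>\<^bsub>C\<^esub> Xi0 F) = Arrow ?S X (\<lambda>t\<in>carrier ?S. ru X t)"
      using o b by (auto simp: strictD(3) RUnit_eq compose_def tm_idr(3) cong: restrict_cong simp del: HC_simps)
    show ?thesis unfolding L R by (auto simp: fun_eq_iff restrict_def)
  qed
  show ?thesis unfolding eq
  proof
    assume *: "\<forall>t\<in>carrier ?S. lu X (s HI t) = ru X t"
    show ?R using * X by (auto simp: ru_pt act_one)
  next
    assume *: ?R
    show "\<forall>t\<in>carrier ?S. lu X (s HI t) = ru X t"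
    proof
      fix t assume t: "t \<in> carrier ?S"
      have "ru X t \<in> carrier X" using hom_closed[OF ru_hom[OF X] t] .
      then have "lu X (s HI (pt X I (ru X t) one_I)) = ru X t" using * by blast
      then show "lu X (s HI t) = ru X t" using ru_inv[OF X t] by simp
    qed
  qed
qed

text \<open>Each of the categorical axioms has been matched with its version on pure tensors. From
  here on the weak centralizer is handled through \<open>halfbraid\<close> alone.\<close>

lemma wc_objects_iff:
  "(X, \<sigma>) \<in> wc_objects HC C F \<longleftrightarrow> (\<exists>s. halfbraid X s \<and> \<sigma> = wc_arr X s)"
proof
  assume w: "(X, \<sigma>) \<in> wc_objects HC C F"
  then have X: "bm X" and ext: "\<sigma> \<in> extensional (Obj HC)"
    and h: "\<And>V. V \<in> Obj HC \<Longrightarrow> \<sigma> V \<in> homset C (tens X (Rs V)) (tens (Rs V) X)"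
    unfolding wc_objects_def bm_Obj by (auto simp del: HC_simps simp: bm_Obj simp del: C_simps(5))
  define s where "s V = fn (\<sigma> V)" for V
  have s: "\<And>W. hm W \<Longrightarrow> s W \<in> lmod_hom E (tens X (Rs W)) (tens (Rs W) X)"
    using h C_homset unfolding hm_Obj s_def by blast
  have \<sigma>: "\<sigma> = wc_arr X s"
    by (rule extensionalityI[OF ext]) (use h C_homset in \<open>auto simp: wc_arr_def s_def simp del: HC_simps C_simps\<close>)
  have "halfbraid X s"
    unfolding halfbraid_def
  proof (intro conjI allI impI)
    fix W W' f x w assume a: "hm W" "hm W'" "f \<in> lmod_hom A W W'" "x \<in> carrier X" "w \<in> carrier W"
    have "\<sigma> W' \<bullet>\<^bsub>C\<^esub> (Idn C X \<star>\<^bsub>C\<^esub> FA F (Arrow W W' f)) = (FA F (Arrow W W' f) \<star>\<^bsub>C\<^esub> Idn C X) \<bullet>\<^bsub>C\<^esub> \<sigma> W"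
      using w homset_Arrow[OF a(1,2), of f] a(3) unfolding wc_objects_def by blast
    from iffD1[OF wc_nat_eq[OF X s a(1-3)] this[unfolded \<sigma>]] a(4,5)
    show "s W' (pt X (Rs W') x (f w)) = tm (Rs W) X (Rs W') X f (\<lambda>x. x) (s W (pt X (Rs W) x w))" by blast
  next
    fix W W' x w w' assume a: "hm W" "hm W'" "x \<in> carrier X" "w \<in> carrier W" "w' \<in> carrier W'"
    from w[unfolded wc_objects_def \<sigma> mem_Collect_eq prod.case] a(1,2)[folded hm_Obj]
    have "Assoc C (FO F W) (FO F W') X \<bullet>\<^bsub>C\<^esub> (Xi F W W' \<star>\<^bsub>C\<^esub> Idn C X) \<bullet>\<^bsub>C\<^esub> wc_arr X s (W \<boxtimes>\<^bsub>HC\<^esub> W')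
        = (Idn C (FO F W) \<star>\<^bsub>C\<^esub> wc_arr X s W') \<bullet>\<^bsub>C\<^esub> Assoc C (FO F W) X (FO F W') \<bullet>\<^bsub>C\<^esub>
          (wc_arr X s W \<star>\<^bsub>C\<^esub> Idn C (FO F W')) \<bullet>\<^bsub>C\<^esub> inv_arrow C (Assoc C X (FO F W) (FO F W')) \<bullet>\<^bsub>C\<^esub>
          (Idn C X \<star>\<^bsub>C\<^esub> Xi F W W')" by blast
    from iffD1[OF wc_mult_eq[OF X s a(1,2)] this] a(3-5)
    show "as (Rs W) (Rs W') X (s (ht W W') (pt X (tens (Rs W) (Rs W')) x (pt (Rs W) (Rs W') w w')))
        = tm (Rs W) X (Rs W) (tens (Rs W') X) (\<lambda>x. x) (\<lambda>x. s W' (pt X (Rs W') x w')) (s W (pt X (Rs W) x w))" by blast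
  next
    from w[unfolded wc_objects_def \<sigma> mem_Collect_eq prod.case]
    have "LUnit C X \<bullet>\<^bsub>C\<^esub> (Xi0 F \<star>\<^bsub>C\<^esub> Idn C X) \<bullet>\<^bsub>C\<^esub> wc_arr X s (UnitO HC) = RUnit C X \<bullet>\<^bsub>C\<^esub> (Idn C X \<star>\<^bsub>C\<^esub> Xi0 F)" by blast
    from iffD1[OF wc_unit_eq[OF X s] this]
    show "\<forall>x\<in>carrier X. lu X (s HI (pt X I x one_I)) = x" .
  qed (use X s in auto)
  with \<sigma> show "\<exists>s. halfbraid X s \<and> \<sigma> = wc_arr X s" by blast
next
  assume "\<exists>s. halfbraid X s \<and> \<sigma> = wc_arr X s"
  then obtain s where hb: "halfbraid X s" and \<sigma>: "\<sigma> = wc_arr X s" by blast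
  note X = halfbraidD(1)[OF hb] and s = halfbraidD(2)[OF hb]
  show "(X, \<sigma>) \<in> wc_objects HC C F"
    unfolding wc_objects_def mem_Collect_eq prod.case
  proof (intro conjI ballI allI)
    show "X \<in> Obj C" using X unfolding bm_Obj .
    show "\<sigma> \<in> extensional (Obj HC)" unfolding \<sigma> wc_arr_def by simp
    show "\<sigma> V \<in> homset C (X \<boxtimes>\<^bsub>C\<^esub> FO F V) (FO F V \<boxtimes>\<^bsub>C\<^esub> X)" if "V \<in> Obj HC" for V
      using that s X by (simp add: \<sigma> wc_arr_def hm_Obj C_homset_Arrow del: HC_simps)
    show "\<sigma> W \<bullet>\<^bsub>C\<^esub> (Idn C X \<star>\<^bsub>C\<^esub> FA F f) = (FA F f \<star>\<^bsub>C\<^esub> Idn C X) \<bullet>\<^bsub>C\<^esub> \<sigma> V" if f: "f \<in> homset HC V W" for V W f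
    proof -
      obtain g where vw: "hm V" "hm W" "g \<in> lmod_hom A V W" and g: "f = Arrow V W g" using f unfolding HC_homset hm_Obj by blast
      show ?thesis unfolding \<sigma> g
        by (rule iffD2[OF wc_nat_eq[OF X s vw]]) (use halfbraidD(6)[OF hb vw] in blast)+
    qed
    show "Assoc C (FO F V) (FO F W) X \<bullet>\<^bsub>C\<^esub> (Xi F V W \<star>\<^bsub>C\<^esub> Idn C X) \<bullet>\<^bsub>C\<^esub> \<sigma> (V \<boxtimes>\<^bsub>HC\<^esub> W)
        = (Idn C (FO F V) \<star>\<^bsub>C\<^esub> \<sigma> W) \<bullet>\<^bsub>C\<^esub> Assoc C (FO F V) X (FO F W) \<bullet>\<^bsub>C\<^esub>
          (\<sigma> V \<star>\<^bsub>C\<^esub> Idn C (FO F W)) \<bullet>\<^bsub>C\<^esub> inv_arrow C (Assoc C X (FO F V) (FO F W)) \<bullet>\<^bsub>C\<^esub>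
          (Idn C X \<star>\<^bsub>C\<^esub> Xi F V W)" if "V \<in> Obj HC" "W \<in> Obj HC" for V W
      unfolding \<sigma> by (rule iffD2[OF wc_mult_eq[OF X s that[unfolded hm_Obj]]]) (use halfbraidD(7)[OF hb that[unfolded hm_Obj]] in blast)+
    show "LUnit C X \<bullet>\<^bsub>C\<^esub> (Xi0 F \<star>\<^bsub>C\<^esub> Idn C X) \<bullet>\<^bsub>C\<^esub> \<sigma> (UnitO HC) = RUnit C X \<bullet>\<^bsub>C\<^esub> (Idn C X \<star>\<^bsub>C\<^esub> Xi0 F)"
      unfolding \<sigma> by (rule iffD2[OF wc_unit_eq[OF X s]]) (use halfbraidD(8)[OF hb] in blast)+
  qed
qed

end

section \<open>Existence of inner homs\<close>

text \<open>Couniversal arrows chosen for every object assemble into an adjoint; functoriality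
  follows from uniqueness of factorizations. Preservation of inner homs quantifies over inner
  hom-functors, so actual functors have to be produced.\<close>

lemma (in category) right_adjoint_exists:
  fixes F :: "('o, 'a, 'o, 'a) ftor"
  assumes F: "is_ftor C C F"
    and ex: "\<And>Y. Y \<in> Obj C \<Longrightarrow> \<exists>V \<epsilon>. V \<in> Obj C \<and> \<epsilon> \<in> homset C (FO F V) Y \<and>
      (\<forall>W\<in>Obj C. \<forall>f\<in>homset C (FO F W) Y. \<exists>!g. g \<in> homset C W V \<and> \<epsilon> \<bullet> FA F g = f)"
  shows "\<exists>G \<epsilon>. right_adjoint C C F G \<epsilon>"
proof -
  define P where "P Y V \<epsilon> \<longleftrightarrow> V \<in> Obj C \<and> \<epsilon> \<in> homset C (FO F V) Y \<and>
      (\<forall>W\<in>Obj C. \<forall>f\<in>homset C (FO F W) Y. \<exists>!g. g \<in> homset C W V \<and> \<epsilon> \<bullet> FA F g = f)" for Y V \<epsilon>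
  have "\<forall>Y. \<exists>V \<epsilon>. Y \<in> Obj C \<longrightarrow> P Y V \<epsilon>" using ex unfolding P_def by blast
  then obtain V \<epsilon> where V\<epsilon>: "\<And>Y. Y \<in> Obj C \<Longrightarrow> P Y (V Y) (\<epsilon> Y)" by metis
  have V: "V Y \<in> Obj C" and \<epsilon>: "\<epsilon> Y \<in> homset C (FO F (V Y)) Y"
    and u: "\<And>W f. W \<in> Obj C \<Longrightarrow> f \<in> homset C (FO F W) Y \<Longrightarrow> \<exists>!g. g \<in> homset C W (V Y) \<and> \<epsilon> Y \<bullet> FA F g = f"
    if "Y \<in> Obj C" for Y using V\<epsilon>[OF that] unfolding P_def by blast+
  have ho: "f \<in> homset C M N \<Longrightarrow> M \<in> Obj C \<and> N \<in> Obj C" for f M N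
    using Dom_closed Cod_closed by (auto simp: homset_def)
  define L where "L h = (THE g. g \<in> homset C (V (Dom C h)) (V (Cod C h)) \<and> \<epsilon> (Cod C h) \<bullet> FA F g = h \<bullet> \<epsilon> (Dom C h))" for h
  have hd: "f \<in> homset C M N \<Longrightarrow> Dom C f = M \<and> Cod C f = N" for f M N by (simp add: homset_def)
  have Lu: "\<exists>!g. g \<in> homset C (V M) (V N) \<and> \<epsilon> N \<bullet> FA F g = h \<bullet> \<epsilon> M" if h: "h \<in> homset C M N" for h M N
    using ho[OF h] by (intro u Cmp_hom[OF \<epsilon> h]) (auto simp: V)
  have Lh: "L h \<in> homset C (V M) (V N) \<and> \<epsilon> N \<bullet> FA F (L h) = h \<bullet> \<epsilon> M" if h: "h \<in> homset C M N" for h M N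
    using theI'[OF Lu[OF h]] hd[OF h] by (simp add: L_def)
  have Leq: "L h = g" if h: "h \<in> homset C M N" and "g \<in> homset C (V M) (V N)" "\<epsilon> N \<bullet> FA F g = h \<bullet> \<epsilon> M" for h M N g
    using that Lh[OF h] Lu[OF h] by blast
  have Fh: "f \<in> homset C M N \<Longrightarrow> FA F f \<in> homset C (FO F M) (FO F N)" for f M N using F by (simp add: is_ftor_def)
  have Fc: "FA F (g \<bullet> f) = FA F g \<bullet> FA F f" if "f \<in> homset C K M" "g \<in> homset C M N" for f g K M N
    using F that unfolding is_ftor_def by blast
  have Fi: "M \<in> Obj C \<Longrightarrow> FA F (Idn C M) = Idn C (FO F M)" for M using F by (simp add: is_ftor_def)
  have "is_ftor C C \<lparr> FO = V, FA = L \<rparr>"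
    unfolding is_ftor_def
  proof (intro conjI category_axioms ballI allI; simp only: ftor.simps)
    fix M assume M: "M \<in> Obj C"
    show "V M \<in> Obj C" using V[OF M] .
    show "L (Idn C M) = Idn C (V M)"
      by (rule Leq[OF Idn_hom[OF M] Idn_hom[OF V[OF M]]])
        (use M V in \<open>simp add: Fi Cmp_Idn[OF \<epsilon>[OF M]] Idn_Cmp[OF \<epsilon>[OF M]]\<close>)
  next
    fix M N h assume h: "h \<in> homset C M N"
    show "L h \<in> homset C (V M) (V N)" using Lh[OF h] by blast
    fix K f assume f: "f \<in> homset C N K"
    note l = Lh[OF h] Lh[OF f]
    have ob: "M \<in> Obj C" "N \<in> Obj C" "K \<in> Obj C" using ho[OF h] ho[OF f] by auto
    have t: "FA F (L h) \<in> homset C (FO F (V M)) (FO F (V N))" "FA F (L f) \<in> homset C (FO F (V N)) (FO F (V K))"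
      using l Fh by blast+
    show "L (f \<bullet> h) = L f \<bullet> L h"
    proof (rule Leq[OF Cmp_hom[OF h f]])
      show "L f \<bullet> L h \<in> homset C (V M) (V K)" using Cmp_hom l by blast
      have "\<epsilon> K \<bullet> FA F (L f \<bullet> L h) = \<epsilon> K \<bullet> FA F (L f) \<bullet> FA F (L h)" by (simp only: Fc[OF conjunct1[OF l(1)] conjunct1[OF l(2)]])
      also have "\<dots> = (\<epsilon> K \<bullet> FA F (L f)) \<bullet> FA F (L h)" using Cmp_assoc[OF t \<epsilon>[OF ob(3)]] by simp
      also have "\<dots> = (f \<bullet> \<epsilon> N) \<bullet> FA F (L h)" using l by simp
      also have "\<dots> = f \<bullet> (\<epsilon> N \<bullet> FA F (L h))" by (rule Cmp_assoc[OF t(1) \<epsilon>[OF ob(2)] f])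
      also have "\<dots> = f \<bullet> (h \<bullet> \<epsilon> M)" using l by simp
      also have "\<dots> = (f \<bullet> h) \<bullet> \<epsilon> M" using Cmp_assoc[OF \<epsilon>[OF ob(1)] h f] by simp
      finally show "\<epsilon> K \<bullet> FA F (L f \<bullet> L h) = (f \<bullet> h) \<bullet> \<epsilon> M" .
    qed
  qed
  then have "right_adjoint C C F \<lparr> FO = V, FA = L \<rparr> \<epsilon>"
    unfolding right_adjoint_def ftor.simps using F \<epsilon> u Lh by blast
  then show ?thesis by blast
qed

section \<open>Inner homs as modules of linear maps\<close>

definition hom_lmod :: "('s, 'x) ring_scheme \<Rightarrow> ('s, 'm) lmod \<Rightarrow> ('s, 'n) lmod \<Rightarrow> ('s \<Rightarrow> 'm \<Rightarrow> 'm) \<Rightarrow> ('s, 'm \<Rightarrow> 'n) lmod" where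
  "hom_lmod A T Y \<tau> = \<lparr> carrier = lmod_hom A T Y, mult = (\<lambda>f g. \<lambda>t\<in>carrier T. f t \<otimes>\<^bsub>Y\<^esub> g t),
     one = (\<lambda>t\<in>carrier T. \<one>\<^bsub>Y\<^esub>), scal = (\<lambda>a f. \<lambda>t\<in>carrier T. f (\<tau> a t)) \<rparr>"

lemma scal_one: "left_module A M \<Longrightarrow> a \<in> carrier A \<Longrightarrow> scal M a \<one>\<^bsub>M\<^esub> = \<one>\<^bsub>M\<^esub>"
  by (rule comm_group_hom_one[OF left_module_scal_hom left_moduleD(2) left_moduleD(2)])

lemma restrict_lmod:
  assumes T: "left_module A T" and "\<And>t. t \<in> carrier T \<Longrightarrow> f t \<in> carrier Y"
    and "\<And>s t. s \<in> carrier T \<Longrightarrow> t \<in> carrier T \<Longrightarrow> f (s \<otimes>\<^bsub>T\<^esub> t) = f s \<otimes>\<^bsub>Y\<^esub> f t"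
    and "\<And>a t. a \<in> carrier A \<Longrightarrow> t \<in> carrier T \<Longrightarrow> f (scal T a t) = scal Y a (f t)"
  shows "(\<lambda>t\<in>carrier T. f t) \<in> lmod_hom A T Y"
  using assms(2-4) left_moduleD(3)[OF T] comm_groupE(1)[OF left_moduleD(2)[OF T]]
  unfolding lmod_hom_def hom_def by simp

text \<open>Scalars act by precomposition with a right action \<tau> on T, so the maps form a left
  module. It will be applied to T = X \<otimes> Q with Q the regular module, where \<tau>
  \<open>a\<close> is right multiplication by \<open>a\<close> on Q.\<close>

lemma left_module_hom:
  assumes T: "left_module A T" and Y: "left_module A Y"
    and \<tau>: "\<And>a. a \<in> carrier A \<Longrightarrow> \<tau> a \<in> lmod_hom A T T"
    and \<tau>_add: "\<And>a b t. a \<in> carrier A \<Longrightarrow> b \<in> carrier A \<Longrightarrow> t \<in> carrier T \<Longrightarrow> \<tau> (a \<oplus>\<^bsub>A\<^esub> b) t = \<tau> a t \<otimes>\<^bsub>T\<^esub> \<tau> b t"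
    and \<tau>_mult: "\<And>a b t. a \<in> carrier A \<Longrightarrow> b \<in> carrier A \<Longrightarrow> t \<in> carrier T \<Longrightarrow> \<tau> (a \<otimes>\<^bsub>A\<^esub> b) t = \<tau> b (\<tau> a t)"
    and \<tau>_one: "\<And>t. t \<in> carrier T \<Longrightarrow> \<tau> \<one>\<^bsub>A\<^esub> t = t"
  shows "left_module A (hom_lmod A T Y \<tau>)"
proof -
  interpret A: ring A using T by (rule left_moduleD)
  interpret T: comm_group T using T by (rule left_moduleD)
  interpret Y: comm_group Y using Y by (rule left_moduleD)
  let ?M = "hom_lmod A T Y \<tau>"
  note Ys = left_moduleD(3,4)[OF Y]
  have add: "(\<lambda>t\<in>carrier T. f t \<otimes>\<^bsub>Y\<^esub> g t) \<in> lmod_hom A T Y" if f: "f \<in> lmod_hom A T Y" and g: "g \<in> lmod_hom A T Y" for f g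
  proof (rule restrict_lmod[OF T])
    note c = lmod_homD(4)[OF f] lmod_homD(4)[OF g]
    show "f t \<otimes>\<^bsub>Y\<^esub> g t \<in> carrier Y" if "t \<in> carrier T" for t using c that by simp
    show "f (s \<otimes>\<^bsub>T\<^esub> t) \<otimes>\<^bsub>Y\<^esub> g (s \<otimes>\<^bsub>T\<^esub> t) = f s \<otimes>\<^bsub>Y\<^esub> g s \<otimes>\<^bsub>Y\<^esub> (f t \<otimes>\<^bsub>Y\<^esub> g t)" if "s \<in> carrier T" "t \<in> carrier T" for s t
      using c that by (simp add: hom_mult[OF lmod_homD(1)[OF f]] hom_mult[OF lmod_homD(1)[OF g]] Y.m_ac)
    show "f (scal T a t) \<otimes>\<^bsub>Y\<^esub> g (scal T a t) = scal Y a (f t \<otimes>\<^bsub>Y\<^esub> g t)" if "a \<in> carrier A" "t \<in> carrier T" for a t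
      using c that by (simp add: lmod_homD(3)[OF f] lmod_homD(3)[OF g] Ys)
  qed
  have one: "(\<lambda>t\<in>carrier T. \<one>\<^bsub>Y\<^esub>) \<in> lmod_hom A T Y"
    by (rule restrict_lmod[OF T]) (simp_all add: scal_one[OF Y])
  have inv: "(\<lambda>t\<in>carrier T. inv\<^bsub>Y\<^esub> f t) \<in> lmod_hom A T Y" if f: "f \<in> lmod_hom A T Y" for f
  proof (rule restrict_lmod[OF T])
    note c = lmod_homD(4)[OF f]
    have i: "scal Y a (inv\<^bsub>Y\<^esub> y) = inv\<^bsub>Y\<^esub> scal Y a y" if a: "a \<in> carrier A" and y: "y \<in> carrier Y" for a y
    proof -
      have "scal Y a (inv\<^bsub>Y\<^esub> y) \<otimes>\<^bsub>Y\<^esub> scal Y a y = \<one>\<^bsub>Y\<^esub>"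
        using Ys(2)[OF a Y.inv_closed[OF y] y] y scal_one[OF Y a] by simp
      then show ?thesis using Y.inv_equality Ys(1)[OF a] y by simp
    qed
    show "inv\<^bsub>Y\<^esub> f t \<in> carrier Y" if "t \<in> carrier T" for t using c that by simp
    show "inv\<^bsub>Y\<^esub> f (s \<otimes>\<^bsub>T\<^esub> t) = inv\<^bsub>Y\<^esub> f s \<otimes>\<^bsub>Y\<^esub> inv\<^bsub>Y\<^esub> f t" if "s \<in> carrier T" "t \<in> carrier T" for s t
      using c that by (simp add: hom_mult[OF lmod_homD(1)[OF f]] Y.inv_mult)
    show "inv\<^bsub>Y\<^esub> f (scal T a t) = scal Y a (inv\<^bsub>Y\<^esub> f t)" if "a \<in> carrier A" "t \<in> carrier T" for a t
      using c that by (simp add: lmod_homD(3)[OF f] i)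
  qed
  have sc: "(\<lambda>t\<in>carrier T. f (\<tau> a t)) \<in> lmod_hom A T Y" if f: "f \<in> lmod_hom A T Y" and a: "a \<in> carrier A" for f a
    using lmod_hom_comp[OF T \<tau>[OF a] f] by (simp add: compose_def)
  have "comm_group ?M"
  proof (rule comm_groupI)
    fix f assume f: "f \<in> carrier ?M"
    then have f': "f \<in> lmod_hom A T Y" by (simp add: hom_lmod_def)
    show "\<exists>g\<in>carrier ?M. g \<otimes>\<^bsub>?M\<^esub> f = \<one>\<^bsub>?M\<^esub>"
      using inv[OF f'] lmod_homD(4)[OF f'] by (intro bexI[of _ "\<lambda>t\<in>carrier T. inv\<^bsub>Y\<^esub> f t"]) (auto simp: hom_lmod_def)
    show "\<one>\<^bsub>?M\<^esub> \<otimes>\<^bsub>?M\<^esub> f = f"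
      using lmod_homD(4)[OF f'] by (intro extensionalityI[OF _ lmod_homD(2)[OF f']]) (auto simp: hom_lmod_def)
    fix g assume g: "g \<in> carrier ?M"
    then have g': "g \<in> lmod_hom A T Y" by (simp add: hom_lmod_def)
    show "f \<otimes>\<^bsub>?M\<^esub> g \<in> carrier ?M" using add[OF f' g'] by (simp add: hom_lmod_def)
    show "f \<otimes>\<^bsub>?M\<^esub> g = g \<otimes>\<^bsub>?M\<^esub> f"
      unfolding hom_lmod_def lmod.simps monoid.simps
      by (rule restrict_ext) (rule Y.m_comm[OF lmod_homD(4)[OF f'] lmod_homD(4)[OF g']])
    fix h assume "h \<in> carrier ?M"
    then have h': "h \<in> lmod_hom A T Y" by (simp add: hom_lmod_def)
    show "f \<otimes>\<^bsub>?M\<^esub> g \<otimes>\<^bsub>?M\<^esub> h = f \<otimes>\<^bsub>?M\<^esub> (g \<otimes>\<^bsub>?M\<^esub> h)"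
      unfolding hom_lmod_def lmod.simps monoid.simps
      by (rule restrict_ext) (simp add: Y.m_assoc lmod_homD(4)[OF f'] lmod_homD(4)[OF g'] lmod_homD(4)[OF h'])
  qed (use one in \<open>simp add: hom_lmod_def\<close>)
  then show ?thesis
    unfolding left_module_def
  proof (intro conjI A.ring_axioms ballI)
    fix a f assume a: "a \<in> carrier A" and "f \<in> carrier ?M"
    then have f: "f \<in> lmod_hom A T Y" by (simp add: hom_lmod_def)
    show "scal ?M a f \<in> carrier ?M" using sc[OF f a] by (simp add: hom_lmod_def)
    fix g assume "g \<in> carrier ?M"
    show "scal ?M a (f \<otimes>\<^bsub>?M\<^esub> g) = scal ?M a f \<otimes>\<^bsub>?M\<^esub> scal ?M a g"
      unfolding hom_lmod_def lmod.simps monoid.simps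
      by (rule restrict_ext) (simp add: lmod_homD(4)[OF \<tau>[OF a]])
  next
    fix a b f assume a: "a \<in> carrier A" and b: "b \<in> carrier A" and "f \<in> carrier ?M"
    then have f: "f \<in> lmod_hom A T Y" by (simp add: hom_lmod_def)
    note c = lmod_homD(4)[OF \<tau>[OF a]] lmod_homD(4)[OF \<tau>[OF b]]
    show "scal ?M (a \<oplus>\<^bsub>A\<^esub> b) f = scal ?M a f \<otimes>\<^bsub>?M\<^esub> scal ?M b f"
      unfolding hom_lmod_def lmod.simps monoid.simps
      by (rule restrict_ext) (simp add: c a b \<tau>_add hom_mult[OF lmod_homD(1)[OF f]])
    show "scal ?M (a \<otimes>\<^bsub>A\<^esub> b) f = scal ?M a (scal ?M b f)"
      unfolding hom_lmod_def lmod.simps monoid.simps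
      by (rule restrict_ext) (simp add: c a b \<tau>_mult)
  next
    fix f assume "f \<in> carrier ?M"
    then have f: "f \<in> lmod_hom A T Y" by (simp add: hom_lmod_def)
    show "scal ?M \<one>\<^bsub>A\<^esub> f = f"
      using \<tau>_one by (intro extensionalityI[OF _ lmod_homD(2)[OF f]]) (auto simp: hom_lmod_def)
  qed
qed

text \<open>Treats X \<otimes> _ on H-modules and on bimodules at once: \<open>A\<close> is H or
  \<open>E\<close>, \<open>Rz\<close> is restriction of scalars or the identity, and
  \<open>xt\<close> is the functor. By \<open>card\<close> the linear maps from \<open>xt Q\<close>
  to Y fit into the universe.\<close>

locale left_tensor = bimods k R U
  for k :: "'k ring" and R :: "('k, 'r) module" and U :: "'u set set" +
  fixes A :: "('s, 'x) ring_scheme" and Rz :: "('s, 'u) lmod \<Rightarrow> ('r env, 'u) lmod" and \<eta> :: "'r env \<Rightarrow> 's"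
    and X :: "('r env, 'u) lmod" and xt :: "('s, 'u) lmod \<Rightarrow> ('s, 'u) lmod" and Q :: "('s, 'u) lmod" and q :: 'u
  assumes X: "bm X" and \<eta>: "z \<in> carrier E \<Longrightarrow> \<eta> z \<in> carrier A"
    and bm_Rz: "left_module A W \<Longrightarrow> carrier W \<in> U \<Longrightarrow> bm (Rz W)"
    and Rz_carrier [simp]: "carrier (Rz W) = carrier W" and Rz_mult [simp]: "monoid.mult (Rz W) = monoid.mult W"
    and Rz_scal: "z \<in> carrier E \<Longrightarrow> x \<in> carrier W \<Longrightarrow> scal (Rz W) z x = scal W (\<eta> z) x"
    and xt: "left_module A W \<Longrightarrow> carrier W \<in> U \<Longrightarrow> left_module A (xt W) \<and> carrier (xt W) \<in> U"
    and Rz_xt: "left_module A W \<Longrightarrow> carrier W \<in> U \<Longrightarrow> Rz (xt W) = tens X (Rz W)"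
    and xtm: "left_module A W \<Longrightarrow> carrier W \<in> U \<Longrightarrow> left_module A W' \<Longrightarrow> carrier W' \<in> U \<Longrightarrow> f \<in> lmod_hom A W W'
      \<Longrightarrow> tm X (Rz W) X (Rz W') (\<lambda>x. x) f \<in> lmod_hom A (xt W) (xt W')"
    and Q: "free1 A Q q" "carrier Q \<in> U"
    and card: "left_module A (Y :: ('s, 'u) lmod) \<Longrightarrow> carrier Y \<in> U \<Longrightarrow> \<exists>B\<in>U. lmod_hom A (xt Q) Y \<lesssim> B"
begin

definition obj :: "('s, 'u) lmod \<Rightarrow> bool" where "obj W \<longleftrightarrow> left_module A W \<and> carrier W \<in> U"

lemma objD: "obj W \<Longrightarrow> left_module A W" "obj W \<Longrightarrow> carrier W \<in> U" "obj W \<Longrightarrow> bm (Rz W)" "obj W \<Longrightarrow> obj (xt W)"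
  "obj W \<Longrightarrow> Rz (xt W) = tens X (Rz W)"
  using xt by (auto simp: obj_def bm_Rz Rz_xt)

lemma objQ: "obj Q" "q \<in> carrier Q" "q \<in> carrier (Rz Q)"
  using Q free1D[OF Q(1)] by (auto simp: obj_def)

lemma xt_simps [simp]:
  "obj W \<Longrightarrow> carrier (xt W) = carrier (tens X (Rz W))" "obj W \<Longrightarrow> monoid.mult (xt W) = monoid.mult (tens X (Rz W))"
  using objD(5)[of W] Rz_carrier[of "xt W"] Rz_mult[of "xt W"] by simp_all

lemma hom_Rz [simp]: "hom (Rz M) N = hom M N" "hom N (Rz M) = hom N M"
  by (simp_all add: hom_def)

lemma hom_xt [simp]: "obj M \<Longrightarrow> hom (xt M) N = hom (tens X (Rz M)) N" "obj M \<Longrightarrow> hom N (xt M) = hom N (tens X (Rz M))"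
  by (simp_all add: hom_def)

lemma Rz_llin:
  assumes "obj W" "obj W'" "f \<in> lmod_hom A W W'" shows "llin (Rz W) (Rz W') f"
  using lmod_homD(1,3,4)[OF assms(3)] \<eta> by (auto intro!: llinI simp: Rz_scal)

abbreviation "pz W \<equiv> pt X (Rz W)"
abbreviation "tz W W' f \<equiv> tm X (Rz W) X (Rz W') (\<lambda>x. x) f"

lemma tz:
  assumes "obj W" "obj W'" "f \<in> lmod_hom A W W'"
  shows "tz W W' f \<in> lmod_hom A (xt W) (xt W')" "x \<in> carrier X \<Longrightarrow> w \<in> carrier W \<Longrightarrow> tz W W' f (pz W x w) = pz W' x (f w)"
    "tz W W' f \<in> hom (tens X (Rz W)) (tens X (Rz W'))" "t \<in> carrier (tens X (Rz W)) \<Longrightarrow> tz W W' f t \<in> carrier (tens X (Rz W'))"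
  using assms xtm tm_pt[OF X objD(3)[OF assms(1)] X objD(3)[OF assms(2)] rlin_id Rz_llin[OF assms]] tm_hom[OF X objD(3)[OF assms(1)] X objD(3)[OF assms(2)] rlin_id Rz_llin[OF assms]]
  by (auto simp: obj_def hom_def)

abbreviation "rq W w \<equiv> ext1 A Q q W w"
definition "\<tau> a = tz Q Q (rq Q (scal Q a q))"

lemma rq: "obj W \<Longrightarrow> w \<in> carrier W \<Longrightarrow> rq W w \<in> lmod_hom A Q W" "obj W \<Longrightarrow> w \<in> carrier W \<Longrightarrow> rq W w q = w"
  "a \<in> carrier A \<Longrightarrow> rq W w (scal Q a q) = scal W a w"
  using ext1[OF Q(1) objD(1)] ext1_scal[OF Q(1)] by auto

lemma scq: "a \<in> carrier A \<Longrightarrow> scal Q a q \<in> carrier Q"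
  using left_moduleD(3)[OF objD(1)[OF objQ(1)]] objQ(2) by blast

lemma xt_hom_eqI:
  assumes "obj W" "f \<in> hom (tens X (Rz W)) G" "g \<in> hom (tens X (Rz W)) G"
    "\<And>x w. x \<in> carrier X \<Longrightarrow> w \<in> carrier W \<Longrightarrow> f (pz W x w) = g (pz W x w)" "t \<in> carrier (tens X (Rz W))"
  shows "f t = g t"
  using tens_eqI[OF X objD(3)[OF assms(1)] assms(2,3) _ assms(5)] assms(4) by auto

lemma xtQ_eqI:
  assumes "f \<in> hom (tens X (Rz Q)) G" "g \<in> hom (tens X (Rz Q)) G"
    "\<And>x a. x \<in> carrier X \<Longrightarrow> a \<in> carrier A \<Longrightarrow> f (pz Q x (scal Q a q)) = g (pz Q x (scal Q a q))" "t \<in> carrier (tens X (Rz Q))"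
  shows "f t = g t"
proof (rule xt_hom_eqI[OF objQ(1) assms(1,2) _ assms(4)])
  fix x w assume "x \<in> carrier X" "w \<in> carrier Q"
  then show "f (pz Q x w) = g (pz Q x w)" by (elim free1_cases[OF Q(1)]) (simp add: assms(3))
qed

lemma pz_closed [simp]: "obj W \<Longrightarrow> x \<in> carrier X \<Longrightarrow> w \<in> carrier W \<Longrightarrow> pz W x w \<in> carrier (tens X (Rz W))"
  by (simp add: X objD)

lemma pz_add:
  assumes "obj W" "x \<in> carrier X" "w \<in> carrier W"
  shows "w' \<in> carrier W \<Longrightarrow> pz W x (w \<otimes>\<^bsub>W\<^esub> w') = pz W x w \<otimes>\<^bsub>tens X (Rz W)\<^esub> pz W x w'"
  "x' \<in> carrier X \<Longrightarrow> pz W (x \<otimes>\<^bsub>X\<^esub> x') w = pz W x w \<otimes>\<^bsub>tens X (Rz W)\<^esub> pz W x' w"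
  using pt_add(1,2)[OF X objD(3)[OF assms(1)] assms(2), of w] assms(3) by simp_all

interpretation A: ring A using free1D(3)[OF Q(1)] .

lemma \<tau>:
  assumes a: "a \<in> carrier A"
  shows "\<tau> a \<in> lmod_hom A (xt Q) (xt Q)" "x \<in> carrier X \<Longrightarrow> w \<in> carrier Q \<Longrightarrow> \<tau> a (pz Q x w) = pz Q x (rq Q (scal Q a q) w)"
    "\<tau> a \<in> hom (tens X (Rz Q)) (tens X (Rz Q))" "t \<in> carrier (tens X (Rz Q)) \<Longrightarrow> \<tau> a t \<in> carrier (tens X (Rz Q))"
  using tz[OF objQ(1) objQ(1) rq(1)[OF objQ(1) scq[OF a]]] by (simp_all add: \<tau>_def)

lemma \<tau>_laws:
  assumes a: "a \<in> carrier A" and t: "t \<in> carrier (tens X (Rz Q))"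
  shows "b \<in> carrier A \<Longrightarrow> \<tau> (a \<oplus>\<^bsub>A\<^esub> b) t = \<tau> a t \<otimes>\<^bsub>tens X (Rz Q)\<^esub> \<tau> b t"
    "b \<in> carrier A \<Longrightarrow> \<tau> (a \<otimes>\<^bsub>A\<^esub> b) t = \<tau> b (\<tau> a t)" "\<tau> \<one>\<^bsub>A\<^esub> t = t"
proof -
  note lm = left_moduleD[OF objD(1)[OF objQ(1)]]
  have g: "comm_group (tens X (Rz Q))" using X objD(3)[OF objQ(1)] by simp
  have m: "scal Q a (scal Q b q) = scal Q (a \<otimes>\<^bsub>A\<^esub> b) q" if "a \<in> carrier A" "b \<in> carrier A" for a b
    using lm(6)[OF that objQ(2)] by simp
  show "\<tau> (a \<oplus>\<^bsub>A\<^esub> b) t = \<tau> a t \<otimes>\<^bsub>tens X (Rz Q)\<^esub> \<tau> b t" if b: "b \<in> carrier A"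
    by (rule xtQ_eqI[where f = "\<tau> (a \<oplus>\<^bsub>A\<^esub> b)", OF \<tau>(3) hom_sum_hom[OF \<tau>(3)[OF a] \<tau>(3)[OF b] g] _ t])
      (use a b in \<open>simp_all add: \<tau> scq rq lm(3) lm(4) lm(5) objQ pz_add\<close>)
  show "\<tau> (a \<otimes>\<^bsub>A\<^esub> b) t = \<tau> b (\<tau> a t)" if b: "b \<in> carrier A"
    by (rule xtQ_eqI[where f = "\<tau> (a \<otimes>\<^bsub>A\<^esub> b)", OF \<tau>(3) hom_trans[OF \<tau>(3)[OF b] \<tau>(3)[OF a]] _ t])
      (use a b in \<open>simp_all add: \<tau> scq rq m A.m_assoc\<close>)
  show "\<tau> \<one>\<^bsub>A\<^esub> t = t"
    by (rule xtQ_eqI[where f = "\<tau> \<one>\<^bsub>A\<^esub>" and g = "\<lambda>t. t", OF \<tau>(3) hom_id _ t]) (simp_all add: \<tau> scq rq m)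
qed

text \<open>The inner hom of X and Y is forced: its elements are the maps Q \<rightarrow> V, hence
  the linear maps X \<otimes> Q \<rightarrow> Y. V is a copy of this module inside the universe,
  decoded by \<open>d\<close>, and the counit evaluates at x \<otimes> q.\<close>

lemma hom_obj_exists:
  assumes Y: "obj Y"
  shows "\<exists>V \<epsilon>. obj V \<and> \<epsilon> \<in> lmod_hom A (xt V) Y \<and> (\<forall>W f. obj W \<longrightarrow> f \<in> lmod_hom A (xt W) Y \<longrightarrow>
      (\<exists>!g. g \<in> lmod_hom A W V \<and> (\<forall>w\<in>carrier W. \<forall>x\<in>carrier X. \<epsilon> (pz V x (g w)) = f (pz W x w))))"
proof -
  let ?T = "xt Q"
  define Hm where "Hm = hom_lmod A ?T Y \<tau>"
  note qs = objQ objD[OF objQ(1)]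
  have Hm: "left_module A Hm" unfolding Hm_def
    by (rule left_module_hom[OF objD(1)[OF qs(7)] objD(1)[OF Y]]) (use qs(1) in \<open>auto simp: \<tau> \<tau>_laws(1,2) \<tau>_laws(3)[OF A.one_closed]\<close>)
  have Hc: "carrier Hm = lmod_hom A ?T Y" by (simp add: Hm_def hom_lmod_def)
  obtain B where "B \<in> U" "carrier Hm \<lesssim> B" using card[OF objD(1,2)[OF Y]] unfolding Hc by blast
  define e where "e = encoding U (carrier Hm)"
  have e: "inj_on e (carrier Hm)" "e ` carrier Hm \<in> U" unfolding e_def using encoding[OF U] \<open>B \<in> U\<close> \<open>carrier Hm \<lesssim> B\<close> by blast+
  define V where "V = lcopy e Hm"
  define d where "d = inv_into (carrier Hm) e"
  note s = lcopy_simps[OF e(1), folded V_def]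
  have V: "obj V" using left_module_lcopy[OF Hm e(1)] e(2) by (simp add: obj_def V_def[symmetric] s)
  have de: "d (e f) = f" if "f \<in> carrier Hm" for f using that e(1) by (simp add: d_def)
  have ed: "e (d v) = v" "d v \<in> lmod_hom A ?T Y" if "v \<in> carrier V" for v using that de by (auto simp: s Hc)
  have d_add: "d (v \<otimes>\<^bsub>V\<^esub> w) = (\<lambda>t\<in>carrier ?T. d v t \<otimes>\<^bsub>Y\<^esub> d w t)" if vw: "v \<in> carrier V" "w \<in> carrier V" for v w
  proof -
    obtain f g where fg: "f \<in> carrier Hm" "g \<in> carrier Hm" "v = e f" "w = e g" using vw unfolding s(1) by blast
    have "f \<otimes>\<^bsub>Hm\<^esub> g \<in> carrier Hm" using fg comm_groupE(1)[OF left_moduleD(2)[OF Hm]] by blast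
    then have "d (v \<otimes>\<^bsub>V\<^esub> w) = f \<otimes>\<^bsub>Hm\<^esub> g" using fg by (simp add: s de)
    then show ?thesis using fg by (simp add: de) (simp add: Hm_def hom_lmod_def)
  qed
  have d_scal: "d (scal V a v) = (\<lambda>t\<in>carrier ?T. d v (\<tau> a t))" if va: "v \<in> carrier V" "a \<in> carrier A" for v a
  proof -
    obtain f where fg: "f \<in> carrier Hm" "v = e f" using va unfolding s(1) by blast
    have "scal Hm a f \<in> carrier Hm" using fg left_moduleD(3)[OF Hm va(2)] by blast
    then have "d (scal V a v) = scal Hm a f" using fg by (simp add: s de)
    then show ?thesis using fg by (simp add: de) (simp add: Hm_def hom_lmod_def)
  qed
  have dh: "d v \<in> hom (tens X (Rz Q)) Y" if "v \<in> carrier V" for v using lmod_homD(1)[OF ed(2)[OF that]] qs(1) by simp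
  have dc: "d v t \<in> carrier Y" if "v \<in> carrier V" "t \<in> carrier (tens X (Rz Q))" for v t using hom_closed[OF dh] that by blast
  have pq: "x \<in> carrier X \<Longrightarrow> pz Q x q \<in> carrier (tens X (Rz Q))" for x using qs by simp
  define \<epsilon> where "\<epsilon> = bl X (Rz V) (Rz Y) (\<lambda>x v. d v (pz Q x q))"
  have b: "bal X (Rz V) (Rz Y) (\<lambda>x v. d v (pz Q x q))"
  proof (rule balI)
    fix x assume "x \<in> carrier X"
    then show "(\<lambda>v. d v (pz Q x q)) \<in> hom (Rz V) (Rz Y)"
      using qs by (auto intro!: homI simp: dc d_add)
  next
    fix v assume "v \<in> carrier (Rz V)"
    then show "(\<lambda>x. d v (pz Q x q)) \<in> hom X (Rz Y)"
      using pt_tens_hom(2)[OF dh X qs(6)] qs(2) by simp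
  next
    fix r x v assume r: "r \<in> carrier R" and x: "x \<in> carrier X" and v: "v \<in> carrier (Rz V)"
    have "la (Rz V) r v = scal V (\<eta> (eL r)) v" using r v by (simp add: Rz_scal)
    then have "d (la (Rz V) r v) (pz Q x q) = d v (\<tau> (\<eta> (eL r)) (pz Q x q))" using r v \<eta> x pq qs(1) by (simp add: d_scal)
    also have "\<tau> (\<eta> (eL r)) (pz Q x q) = pz Q x (la (Rz Q) r q)" using r \<eta> x qs scq by (simp add: \<tau> rq Rz_scal)
    also have "\<dots> = pz Q (ra X r x) q" using pt_add(3)[OF X qs(6) x qs(3) r] by simp
    finally show "d v (pz Q (ra X r x) q) = d (la (Rz V) r v) (pz Q x q)" by simp
  qed
  note \<epsilon> = lift[OF X objD(3)[OF V] objD(3)[OF Y] b, folded \<epsilon>_def]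
  have \<epsilon>p: "\<epsilon> (pz V x v) = d v (pz Q x q)" if "x \<in> carrier X" "v \<in> carrier V" for x v using \<epsilon>(3) that by simp
  have \<epsilon>h: "\<epsilon> \<in> hom (tens X (Rz V)) Y" using \<epsilon>(1) by simp
  \<comment> \<open>Precomposing the counit with X \<otimes> (q \<mapsto> v) gives back the linear
    map coded by \<open>v\<close>. Since x \<otimes> v is the image of x \<otimes> q, the counit
    inherits linearity from the maps \<open>d v\<close>.\<close>
  have \<epsilon>T: "\<epsilon> (tz Q V (rq V v) t) = d v t" if v: "v \<in> carrier V" and t: "t \<in> carrier (tens X (Rz Q))" for v t
    by (rule xtQ_eqI[OF hom_trans[OF \<epsilon>h tz(3)[OF qs(1) V rq(1)[OF V v]]] dh[OF v] _ t])
      (use v V qs left_moduleD(3)[OF objD(1)[OF V]] rq(1)[OF V v] in \<open>simp add: tz scq rq \<epsilon>p d_scal \<tau>\<close>)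
  have \<epsilon>A: "\<epsilon> \<in> lmod_hom A (xt V) Y"
    unfolding lmod_hom_def
  proof (intro CollectI IntI conjI ballI)
    show "\<epsilon> \<in> hom (xt V) Y" "\<epsilon> \<in> extensional (carrier (xt V))" using \<epsilon>h \<epsilon>(2) V by simp_all
    fix a t assume a: "a \<in> carrier A" and t: "t \<in> carrier (xt V)"
    then have t': "t \<in> carrier (tens X (Rz V))" using V by simp
    have sh: "scal (xt V) a \<in> hom (tens X (Rz V)) (tens X (Rz V))"
      using left_module_scal_hom[OF objD(1)[OF objD(4)[OF V]] a] V by simp
    have "(\<lambda>t. \<epsilon> (scal (xt V) a t)) t = (\<lambda>t. scal Y a (\<epsilon> t)) t"
    proof (rule xt_hom_eqI[OF V hom_trans[OF \<epsilon>h sh] hom_trans[OF left_module_scal_hom[OF objD(1)[OF Y] a] \<epsilon>h] _ t'])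
      fix x v assume x: "x \<in> carrier X" and v: "v \<in> carrier V"
      note z = tz[OF qs(1) V rq(1)[OF V v]]
      have "pz V x v = tz Q V (rq V v) (pz Q x q)" using x v V qs by (simp add: z rq)
      then have "scal (xt V) a (pz V x v) = tz Q V (rq V v) (scal ?T a (pz Q x q))"
        using lmod_homD(3)[OF z(1) a] x pq qs(1) by simp
      moreover have "scal ?T a (pz Q x q) \<in> carrier (tens X (Rz Q))"
        using left_moduleD(3)[OF objD(1)[OF qs(7)] a] x pq qs(1) by simp
      ultimately have "\<epsilon> (scal (xt V) a (pz V x v)) = d v (scal ?T a (pz Q x q))" by (simp add: \<epsilon>T v)
      also have "\<dots> = scal Y a (d v (pz Q x q))" using lmod_homD(3)[OF ed(2)[OF v] a] x pq qs(1) by simp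
      finally show "\<epsilon> (scal (xt V) a (pz V x v)) = scal Y a (\<epsilon> (pz V x v))" using x v by (simp add: \<epsilon>p)
    qed
    then show "\<epsilon> (scal (xt V) a t) = scal Y a (\<epsilon> t)" .
  qed
  have "\<exists>!g. g \<in> lmod_hom A W V \<and> (\<forall>w\<in>carrier W. \<forall>x\<in>carrier X. \<epsilon> (pz V x (g w)) = f (pz W x w))"
    if W: "obj W" and f: "f \<in> lmod_hom A (xt W) Y" for W f
  proof -
    have fh: "f \<in> hom (tens X (Rz W)) Y" using lmod_homD(1)[OF f] W by simp
    \<comment> \<open>The factorization sends \<open>w\<close> to the code of f composed with X
      \<otimes> (q \<mapsto> w), whose value at x \<otimes> q is f(x \<otimes> w).\<close>
    define G where "G w = compose (carrier ?T) f (tz Q W (rq W w))" for w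
    have G: "G w \<in> lmod_hom A ?T Y" if "w \<in> carrier W" for w
      unfolding G_def by (rule lmod_hom_comp[OF objD(1)[OF qs(7)] tz(1)[OF qs(1) W rq(1)[OF W that]] f])
    have Gv: "G w t = f (tz Q W (rq W w) t)" if "t \<in> carrier (tens X (Rz Q))" for t w using that qs(1) by (simp add: G_def compose_eq)
    have Gh: "G w \<in> hom (tens X (Rz Q)) Y" if "w \<in> carrier W" for w using lmod_homD(1)[OF G[OF that]] qs(1) by simp
    have Gp: "G w (pz Q x (scal Q a q)) = f (pz W x (scal W a w))" if "x \<in> carrier X" "a \<in> carrier A" "w \<in> carrier W" for w x a
      using that qs tz(2)[OF qs(1) W rq(1)[OF W that(3)]] by (simp add: Gv scq rq)
    define g where "g = (\<lambda>w\<in>carrier W. e (G w))"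
    note lmW = left_moduleD[OF objD(1)[OF W]]
    have gc: "g w \<in> carrier V" "d (g w) = G w" if "w \<in> carrier W" for w using that G[OF that] by (auto simp: g_def s Hc de)
    have g: "g \<in> lmod_hom A W V"
      unfolding lmod_hom_def
    proof (intro CollectI IntI conjI ballI homI)
      fix w w' assume w: "w \<in> carrier W" "w' \<in> carrier W"
      have ww: "w \<otimes>\<^bsub>W\<^esub> w' \<in> carrier W" using w comm_groupE(1)[OF lmW(2)] by blast
      have Yg: "comm_group Y" using left_moduleD(2)[OF objD(1)[OF Y]] .
      have "G (w \<otimes>\<^bsub>W\<^esub> w') t = G w t \<otimes>\<^bsub>Y\<^esub> G w' t" if t: "t \<in> carrier (tens X (Rz Q))" for t
        by (rule xtQ_eqI[where f = "G (w \<otimes>\<^bsub>W\<^esub> w')", OF Gh[OF ww] hom_sum_hom[OF Gh[OF w(1)] Gh[OF w(2)] Yg] _ t])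
          (use w ww W lmW in \<open>simp add: Gp pz_add hom_mult[OF fh]\<close>)
      then have "d (g (w \<otimes>\<^bsub>W\<^esub> w')) = d (g w \<otimes>\<^bsub>V\<^esub> g w')"
        using w ww qs(1) by (simp add: gc d_add) (intro extensionalityI[OF lmod_homD(2)[OF G[OF ww]]]; simp)
      moreover have "g w \<otimes>\<^bsub>V\<^esub> g w' \<in> carrier V" using gc(1) w comm_groupE(1)[OF left_moduleD(2)[OF objD(1)[OF V]]] by blast
      ultimately show "g (w \<otimes>\<^bsub>W\<^esub> w') = g w \<otimes>\<^bsub>V\<^esub> g w'" using ed(1) gc(1)[OF ww] by metis
    next
      fix a w assume a: "a \<in> carrier A" and w: "w \<in> carrier W"
      have aw: "scal W a w \<in> carrier W" using lmW(3)[OF a w] .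
      have "G (scal W a w) t = G w (\<tau> a t)" if t: "t \<in> carrier (tens X (Rz Q))" for t
      proof (rule xtQ_eqI[OF Gh[OF aw] hom_trans[OF Gh[OF w] \<tau>(3)[OF a]] _ t])
        fix x b assume x: "x \<in> carrier X" and b: "b \<in> carrier A"
        have "scal Q b (scal Q a q) = scal Q (b \<otimes>\<^bsub>A\<^esub> a) q" using left_moduleD(6)[OF qs(4) b a qs(2)] by simp
        then show "G (scal W a w) (pz Q x (scal Q b q)) = G w (\<tau> a (pz Q x (scal Q b q)))"
          using x a b w aw lmW(6)[OF b a w] by (simp add: \<tau> scq rq Gp)
      qed
      then have "d (g (scal W a w)) = d (scal V a (g w))"
        using w aw qs(1) a by (simp add: gc d_scal) (intro extensionalityI[OF lmod_homD(2)[OF G[OF aw]]]; simp)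
      moreover have "scal V a (g w) \<in> carrier V" using gc(1)[OF w] left_moduleD(3)[OF objD(1)[OF V] a] by blast
      ultimately show "g (scal W a w) = scal V a (g w)" using ed(1) gc(1)[OF aw] by metis
    qed (use gc in \<open>auto simp: g_def\<close>)
    show ?thesis
    proof (rule ex1I[of _ g])
      have "\<epsilon> (pz V x (g w)) = f (pz W x w)" if "x \<in> carrier X" "w \<in> carrier W" for x w
        using that gc Gp[of x "\<one>\<^bsub>A\<^esub>" w] lmW(7) left_moduleD(7)[OF qs(4) qs(2)] by (simp add: \<epsilon>p)
      then show "g \<in> lmod_hom A W V \<and> (\<forall>w\<in>carrier W. \<forall>x\<in>carrier X. \<epsilon> (pz V x (g w)) = f (pz W x w))" using g by blast
    next
      fix g' assume g': "g' \<in> lmod_hom A W V \<and> (\<forall>w\<in>carrier W. \<forall>x\<in>carrier X. \<epsilon> (pz V x (g' w)) = f (pz W x w))"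
      show "g' = g"
      proof (rule lmod_eqI[OF conjunct1[OF g'] g])
        fix w assume w: "w \<in> carrier W"
        have g'w: "g' w \<in> carrier V" if "w \<in> carrier W" for w using lmod_homD(4)[OF conjunct1[OF g']] that .
        have "d (g' w) t = G w t" if t: "t \<in> carrier (tens X (Rz Q))" for t
        proof (rule xtQ_eqI[OF dh[OF g'w[OF w]] Gh[OF w] _ t])
          fix x a assume x: "x \<in> carrier X" and a: "a \<in> carrier A"
          have aw: "scal W a w \<in> carrier W" using lmW(3)[OF a w] .
          have "d (g' w) (pz Q x (scal Q a q)) = d (scal V a (g' w)) (pz Q x q)"
            using x a g'w[OF w] pq qs by (simp add: d_scal \<tau> rq scq)
          also have "scal V a (g' w) = g' (scal W a w)" using lmod_homD(3)[OF conjunct1[OF g'] a w] by simp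
          also have "d (g' (scal W a w)) (pz Q x q) = f (pz W x (scal W a w))" using g' aw x g'w[OF aw] by (simp flip: \<epsilon>p)
          finally show "d (g' w) (pz Q x (scal Q a q)) = G w (pz Q x (scal Q a q))" using x a w by (simp add: Gp)
        qed
        then have "d (g' w) = d (g w)"
          using w qs(1) ed(2)[OF g'w[OF w]] G[OF w] by (intro lmod_eqI[OF ed(2)[OF g'w[OF w]] ed(2)[OF gc(1)[OF w]]]) (simp add: gc)
        then show "g' w = g w" using ed(1) g'w[OF w] gc(1)[OF w] by metis
      qed
    qed
  qed
  then show ?thesis using V \<epsilon>A by blast
qed

end

text \<open>The functors \<open>X \<otimes> _\<close> and \<open>_ \<otimes> X\<close>, on modules over \<open>H\<close> or on bimodules, where \<open>pu W x w\<close> is \<open>x \<otimes> w\<close>,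
  resp. \<open>w \<otimes> x\<close>. Right adjoints are translated into universal properties of functions.\<close>

locale module_functor = category M
  for M :: "(('s, 'u) lmod, (('s, 'u) lmod, 'u \<Rightarrow> 'u) arrow, 'm) cat_scheme" (structure) +
  fixes B :: "('s, 'x) ring_scheme" and TO :: "('s, 'u) lmod \<Rightarrow> ('s, 'u) lmod"
    and TA :: "(('s, 'u) lmod, 'u \<Rightarrow> 'u) arrow \<Rightarrow> (('s, 'u) lmod, 'u \<Rightarrow> 'u) arrow"
    and S :: "'u set" and pu :: "('s, 'u) lmod \<Rightarrow> 'u \<Rightarrow> 'u \<Rightarrow> 'u"
  assumes M_homset: "f \<in> homset M V W \<longleftrightarrow> V \<in> Obj M \<and> W \<in> Obj M \<and> fn f \<in> lmod_hom B V W \<and> f = Arrow V W (fn f)"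
    and M_Cmp: "g \<bullet> f = Arrow (src f) (tgt g) (compose (carrier (src f)) (fn g) (fn f))"
    and TO_closed: "V \<in> Obj M \<Longrightarrow> TO V \<in> Obj M"
    and TA_hom: "f \<in> homset M W V \<Longrightarrow> TA f \<in> homset M (TO W) (TO V)"
    and TA_pu: "f \<in> homset M W V \<Longrightarrow> w \<in> carrier W \<Longrightarrow> x \<in> S \<Longrightarrow> fn (TA f) (pu W x w) = pu V x (fn f w)"
    and pu_closed: "W \<in> Obj M \<Longrightarrow> w \<in> carrier W \<Longrightarrow> x \<in> S \<Longrightarrow> pu W x w \<in> carrier (TO W)"
    and pu_eqI: "W \<in> Obj M \<Longrightarrow> Y \<in> Obj M \<Longrightarrow> h \<in> lmod_hom B (TO W) Y \<Longrightarrow> h' \<in> lmod_hom B (TO W) Y \<Longrightarrow>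
      (\<And>w x. w \<in> carrier W \<Longrightarrow> x \<in> S \<Longrightarrow> h (pu W x w) = h' (pu W x w)) \<Longrightarrow> h = h'"
begin

definition univ where
  "univ Y V \<epsilon> \<longleftrightarrow> V \<in> Obj M \<and> \<epsilon> \<in> lmod_hom B (TO V) Y \<and>
     (\<forall>W f. W \<in> Obj M \<longrightarrow> f \<in> lmod_hom B (TO W) Y \<longrightarrow>
        (\<exists>!g. g \<in> lmod_hom B W V \<and> (\<forall>w\<in>carrier W. \<forall>x\<in>S. \<epsilon> (pu V x (g w)) = f (pu W x w))))"

lemma Arrow_hom: "V \<in> Obj M \<Longrightarrow> W \<in> Obj M \<Longrightarrow> Arrow V W f \<in> homset M V W \<longleftrightarrow> f \<in> lmod_hom B V W"
  by (simp add: M_homset)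

lemma homsetE:
  assumes "a \<in> homset M V W" obtains f where "a = Arrow V W f" "f \<in> lmod_hom B V W" "V \<in> Obj M" "W \<in> Obj M"
  using assms unfolding M_homset by metis

text \<open>Arrows out of \<open>TO W\<close> are determined by their values on the generators
  \<open>pu W x w\<close>, and there \<open>TA\<close> acts by applying \<open>g\<close> to
  \<open>w\<close>.\<close>

lemma factor_iff:
  assumes Y: "Y \<in> Obj M" and W: "W \<in> Obj M" and V: "V \<in> Obj M"
    and g: "g \<in> lmod_hom B W V" and \<epsilon>: "\<epsilon> \<in> lmod_hom B (TO V) Y" and f: "f \<in> lmod_hom B (TO W) Y"
  shows "Arrow (TO V) Y \<epsilon> \<bullet> TA (Arrow W V g) = Arrow (TO W) Y f \<longleftrightarrow>
    (\<forall>w\<in>carrier W. \<forall>x\<in>S. \<epsilon> (pu V x (g w)) = f (pu W x w))"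
proof -
  have g': "Arrow W V g \<in> homset M W V" using g W V by (simp add: Arrow_hom)
  obtain h where h: "TA (Arrow W V g) = Arrow (TO W) (TO V) h" using TA_hom[OF g'] by (rule homsetE)
  have hp: "h (pu W x w) = pu V x (g w)" if "w \<in> carrier W" "x \<in> S" for w x using TA_pu[OF g' that] h by simp
  have "Arrow (TO V) Y \<epsilon> \<bullet> TA (Arrow W V g) \<in> homset M (TO W) Y"
    using Cmp_hom[OF TA_hom[OF g'], of "Arrow (TO V) Y \<epsilon>" Y] \<epsilon> Y V by (simp add: Arrow_hom TO_closed)
  then have c: "compose (carrier (TO W)) \<epsilon> h \<in> lmod_hom B (TO W) Y" unfolding M_homset h M_Cmp by simp
  have "Arrow (TO V) Y \<epsilon> \<bullet> TA (Arrow W V g) = Arrow (TO W) Y f \<longleftrightarrow> compose (carrier (TO W)) \<epsilon> h = f"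
    unfolding h M_Cmp by simp
  also have "\<dots> \<longleftrightarrow> (\<forall>w\<in>carrier W. \<forall>x\<in>S. compose (carrier (TO W)) \<epsilon> h (pu W x w) = f (pu W x w))"
    using pu_eqI[OF W Y c f] by blast
  finally show ?thesis using pu_closed[OF W] hp by (simp add: compose_def)
qed

lemma univ_iff:
  assumes Y: "Y \<in> Obj M" and V: "V \<in> Obj M" and \<epsilon>: "\<epsilon> \<in> lmod_hom B (TO V) Y"
  shows "univ Y V \<epsilon> \<longleftrightarrow>
    (\<forall>W\<in>Obj M. \<forall>a\<in>homset M (TO W) Y. \<exists>!b. b \<in> homset M W V \<and> Arrow (TO V) Y \<epsilon> \<bullet> TA b = a)" (is "_ \<longleftrightarrow> ?R")
proof -
  have *: "(\<exists>!b. b \<in> homset M W V \<and> Arrow (TO V) Y \<epsilon> \<bullet> TA b = Arrow (TO W) Y f) \<longleftrightarrow>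
      (\<exists>!g. g \<in> lmod_hom B W V \<and> (\<forall>w\<in>carrier W. \<forall>x\<in>S. \<epsilon> (pu V x (g w)) = f (pu W x w)))" (is "(\<exists>!b. ?P b) \<longleftrightarrow> (\<exists>!g. ?Q g)")
    if W: "W \<in> Obj M" and f: "f \<in> lmod_hom B (TO W) Y" for W f
  proof -
    have PQ: "?P (Arrow W V g) \<longleftrightarrow> ?Q g" for g using factor_iff[OF Y W V _ \<epsilon> f] Arrow_hom[OF W V] by blast
    have P: "\<exists>g. b = Arrow W V g" if "?P b" for b using that by (auto elim: homsetE)
    show ?thesis
    proof
      assume "\<exists>!b. ?P b"
      then obtain b where b: "?P b" "\<And>b'. ?P b' \<Longrightarrow> b' = b" by blast
      obtain g where g: "b = Arrow W V g" using P[OF b(1)] by blast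
      have "?Q g" using b(1) unfolding g PQ .
      moreover have "g' = g" if "?Q g'" for g' using b(2)[OF iffD2[OF PQ that]] g by simp
      ultimately show "\<exists>!g. ?Q g" by blast
    next
      assume "\<exists>!g. ?Q g"
      then obtain g where g: "?Q g" "\<And>g'. ?Q g' \<Longrightarrow> g' = g" by blast
      have "b = Arrow W V g" if b: "?P b" for b
      proof -
        obtain g' where g': "b = Arrow W V g'" using P[OF b] by blast
        show ?thesis using g(2)[OF iffD1[OF PQ b[unfolded g']]] g' by simp
      qed
      with iffD2[OF PQ g(1)] show "\<exists>!b. ?P b" by blast
    qed
  qed
  have "?R \<longleftrightarrow> (\<forall>W\<in>Obj M. \<forall>f\<in>lmod_hom B (TO W) Y. \<exists>!b. b \<in> homset M W V \<and> Arrow (TO V) Y \<epsilon> \<bullet> TA b = Arrow (TO W) Y f)"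
  proof (intro iffI ballI)
    fix W f assume ?R and W: "W \<in> Obj M" and f: "f \<in> lmod_hom B (TO W) Y"
    then show "\<exists>!b. b \<in> homset M W V \<and> Arrow (TO V) Y \<epsilon> \<bullet> TA b = Arrow (TO W) Y f"
      using Arrow_hom[OF TO_closed[OF W] Y] by blast
  next
    fix W a assume r: "\<forall>W\<in>Obj M. \<forall>f\<in>lmod_hom B (TO W) Y. \<exists>!b. b \<in> homset M W V \<and> Arrow (TO V) Y \<epsilon> \<bullet> TA b = Arrow (TO W) Y f"
      and W: "W \<in> Obj M" and "a \<in> homset M (TO W) Y"
    then obtain f where f: "a = Arrow (TO W) Y f" "f \<in> lmod_hom B (TO W) Y" by (auto elim: homsetE)
    show "\<exists>!b. b \<in> homset M W V \<and> Arrow (TO V) Y \<epsilon> \<bullet> TA b = a" unfolding f(1) using r W f(2) by blast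
  qed
  also have "\<dots> \<longleftrightarrow> univ Y V \<epsilon>" unfolding univ_def using V \<epsilon> * by (simp add: Ball_def)
  finally show ?thesis by simp
qed

lemma adjoint_univ:
  assumes ad: "right_adjoint M M \<lparr> FO = TO, FA = TA \<rparr> G \<epsilon>" and Y: "Y \<in> Obj M"
  shows "univ Y (FO G Y) (fn (\<epsilon> Y))" "\<epsilon> Y = Arrow (TO (FO G Y)) Y (fn (\<epsilon> Y))"
proof -
  have V: "FO G Y \<in> Obj M" using ad Y unfolding right_adjoint_def is_ftor_def by blast
  have "\<epsilon> Y \<in> homset M (TO (FO G Y)) Y" using ad Y unfolding right_adjoint_def by simp
  then have e: "fn (\<epsilon> Y) \<in> lmod_hom B (TO (FO G Y)) Y" "\<epsilon> Y = Arrow (TO (FO G Y)) Y (fn (\<epsilon> Y))" unfolding M_homset by auto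
  show "\<epsilon> Y = Arrow (TO (FO G Y)) Y (fn (\<epsilon> Y))" by (rule e(2))
  show "univ Y (FO G Y) (fn (\<epsilon> Y))"
    unfolding univ_iff[OF Y V e(1)] e(2)[symmetric] using ad Y unfolding right_adjoint_def ftor.simps by blast
qed

lemma adjoint_exists:
  assumes F: "is_ftor M M \<lparr> FO = TO, FA = TA \<rparr>" and ex: "\<And>Y. Y \<in> Obj M \<Longrightarrow> \<exists>V \<epsilon>. univ Y V \<epsilon>"
  shows "\<exists>G \<epsilon>. right_adjoint M M \<lparr> FO = TO, FA = TA \<rparr> G \<epsilon>"
proof (rule right_adjoint_exists[OF F])
  fix Y assume Y: "Y \<in> Obj M"
  obtain V \<epsilon> where u: "univ Y V \<epsilon>" using ex[OF Y] by blast
  then have V: "V \<in> Obj M" and \<epsilon>: "\<epsilon> \<in> lmod_hom B (TO V) Y" by (auto simp: univ_def)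
  show "\<exists>V \<epsilon>. V \<in> Obj M \<and> \<epsilon> \<in> homset M (FO \<lparr> FO = TO, FA = TA \<rparr> V) Y \<and>
      (\<forall>W\<in>Obj M. \<forall>f\<in>homset M (FO \<lparr> FO = TO, FA = TA \<rparr> W) Y. \<exists>!g. g \<in> homset M W V \<and> \<epsilon> \<bullet> FA \<lparr> FO = TO, FA = TA \<rparr> g = f)"
    unfolding ftor.simps
    using iffD1[OF univ_iff[OF Y V \<epsilon>] u] V iffD2[OF Arrow_hom[OF TO_closed[OF V] Y] \<epsilon>] by blast
qed

text \<open>The comparison morphism in the definition of preservation is a definite description of
  an arrow. Here it is exhibited as an arrow carried by a function \<phi> that is characterized on
  generators.\<close>

lemma adjoint_comparison:
  assumes ad: "right_adjoint M M \<lparr> FO = TO, FA = TA \<rparr> G \<epsilon>" and Y: "Y \<in> Obj M" and W: "W \<in> Obj M" and f: "f \<in> lmod_hom B (TO W) Y"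
  shows "\<exists>\<phi>\<in>lmod_hom B W (FO G Y). (\<forall>w\<in>carrier W. \<forall>x\<in>S. fn (\<epsilon> Y) (pu (FO G Y) x (\<phi> w)) = f (pu W x w)) \<and>
    (THE a. a \<in> homset M W (FO G Y) \<and> \<epsilon> Y \<bullet> TA a = Arrow (TO W) Y f) = Arrow W (FO G Y) \<phi>"
proof -
  note u = adjoint_univ[OF ad Y]
  have V: "FO G Y \<in> Obj M" and e: "fn (\<epsilon> Y) \<in> lmod_hom B (TO (FO G Y)) Y" using u(1) by (auto simp: univ_def)
  have f': "Arrow (TO W) Y f \<in> homset M (TO W) Y" using Arrow_hom[OF TO_closed[OF W] Y] f by blast
  have ex1: "\<exists>!a. a \<in> homset M W (FO G Y) \<and> \<epsilon> Y \<bullet> TA a = Arrow (TO W) Y f"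
    using u(1) W f' unfolding univ_iff[OF Y V e] u(2)[symmetric] by blast
  let ?a = "THE a. a \<in> homset M W (FO G Y) \<and> \<epsilon> Y \<bullet> TA a = Arrow (TO W) Y f"
  have a: "?a \<in> homset M W (FO G Y)" "\<epsilon> Y \<bullet> TA ?a = Arrow (TO W) Y f" using theI'[OF ex1] by auto
  obtain \<phi> where \<phi>: "?a = Arrow W (FO G Y) \<phi>" "\<phi> \<in> lmod_hom B W (FO G Y)" using a(1) by (rule homsetE)
  show ?thesis
    using \<phi> iffD1[OF factor_iff[OF Y W V \<phi>(2) e f, folded u(2)] a(2)[unfolded \<phi>(1)]] by blast
qed

end

context monoidal_category begin

lemma tensor_ftor:
  assumes X: "X \<in> Obj C"
  shows "is_ftor C C \<lparr> FO = (\<lambda>W. X \<boxtimes> W), FA = (\<lambda>f. Idn C X \<star> f) \<rparr>"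
proof -
  note iX = Idn_hom[OF X]
  have "Idn C X \<star> (g \<bullet> f) = (Idn C X \<star> g) \<bullet> (Idn C X \<star> f)" if "f \<in> homset C K M" "g \<in> homset C M N" for f g K M N
    using interchange[OF iX iX that] Cmp_Idn[OF iX] by simp
  then show ?thesis
    unfolding is_ftor_def using category_axioms X TensO_closed TensA_hom[OF iX] TensA_Idn by auto
qed

end

section \<open>Inner hom-functors of bimodules in terms of universal elements\<close>

context bimods begin

lemma left_module_functor:
  assumes X: "bm X"
  shows "module_functor C E (\<lambda>W. tens X W) (\<lambda>f. Idn C X \<star>\<^bsub>C\<^esub> f) (carrier X) (\<lambda>W x w. pt X W x w)"
proof (intro module_functor.intro module_functor_axioms.intro C.category_axioms)
  note XO = X[folded bm_Obj]
  show "(f \<in> homset C V W) = (V \<in> Obj C \<and> W \<in> Obj C \<and> fn f \<in> lmod_hom E V W \<and> f = Arrow V W (fn f))" for f V W by (rule C_homset)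
  show "g \<bullet>\<^bsub>C\<^esub> f = Arrow (src f) (tgt g) (compose (carrier (src f)) (fn g) (fn f))" for g f by simp
  show "tens X V \<in> Obj C" if "V \<in> Obj C" for V using that X bm_tens unfolding bm_Obj by blast
  show "Idn C X \<star>\<^bsub>C\<^esub> f \<in> homset C (tens X W) (tens X V)" if f: "f \<in> homset C W V" for f W V
    using C.TensA_hom[OF C.Idn_hom[OF XO] f] by (simp only: C_simps(1))
  show "fn (Idn C X \<star>\<^bsub>C\<^esub> f) (pt X W x w) = pt X V x (fn f w)" if f: "f \<in> homset C W V" and w: "w \<in> carrier W" "x \<in> carrier X" for f W V w x
  proof -
    have b: "bm W" "bm V" and g: "fn f \<in> lmod_hom E W V" "f = Arrow W V (fn f)" using f unfolding C_homset bm_Obj by auto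
    show ?thesis
      by (subst g(2)) (use w X b lmod_llin[OF g(1) b] lin_idr(2)[OF X] in \<open>simp add: tm_pt\<close>)
  qed
  show "pt X W x w \<in> carrier (tens X W)" if "W \<in> Obj C" "w \<in> carrier W" "x \<in> carrier X" for W w x
    using that X unfolding bm_Obj by simp
  show "f = g" if "W \<in> Obj C" and f: "f \<in> lmod_hom E (tens X W) Y" and g: "g \<in> lmod_hom E (tens X W) Y"
    and eq: "\<And>w x. w \<in> carrier W \<Longrightarrow> x \<in> carrier X \<Longrightarrow> f (pt X W x w) = g (pt X W x w)" for W Y f g
  proof (rule lmod_eqI[OF f g])
    fix t assume "t \<in> carrier (tens X W)"
    then show "f t = g t"
      by (rule tens_eqI[OF X _ lmod_homD(1)[OF f] lmod_homD(1)[OF g], rotated -1]) (use that(1) eq in \<open>auto simp: bm_def\<close>)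
  qed
qed

lemma right_module_functor:
  assumes X: "bm X"
  shows "module_functor C E (\<lambda>W. tens W X) (\<lambda>f. f \<star>\<^bsub>C\<^esub> Idn C X) (carrier X) (\<lambda>W x w. pt W X w x)"
proof (intro module_functor.intro module_functor_axioms.intro C.category_axioms)
  note XO = X[folded bm_Obj]
  show "(f \<in> homset C V W) = (V \<in> Obj C \<and> W \<in> Obj C \<and> fn f \<in> lmod_hom E V W \<and> f = Arrow V W (fn f))" for f V W by (rule C_homset)
  show "g \<bullet>\<^bsub>C\<^esub> f = Arrow (src f) (tgt g) (compose (carrier (src f)) (fn g) (fn f))" for g f by simp
  show "tens V X \<in> Obj C" if "V \<in> Obj C" for V using that X bm_tens unfolding bm_Obj by blast
  show "f \<star>\<^bsub>C\<^esub> Idn C X \<in> homset C (tens W X) (tens V X)" if f: "f \<in> homset C W V" for f W V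
    using C.TensA_hom[OF f C.Idn_hom[OF XO]] by (simp only: C_simps(1))
  show "fn (f \<star>\<^bsub>C\<^esub> Idn C X) (pt W X w x) = pt V X (fn f w) x" if f: "f \<in> homset C W V" and w: "w \<in> carrier W" "x \<in> carrier X" for f W V w x
  proof -
    have b: "bm W" "bm V" and g: "fn f \<in> lmod_hom E W V" "f = Arrow W V (fn f)" using f unfolding C_homset bm_Obj by auto
    show ?thesis
      by (subst g(2)) (use w X b lmod_rlin[OF g(1) b] lin_idr(1)[OF X] in \<open>simp add: tm_pt\<close>)
  qed
  show "pt W X w x \<in> carrier (tens W X)" if "W \<in> Obj C" "w \<in> carrier W" "x \<in> carrier X" for W w x
    using that X unfolding bm_Obj by simp
  show "f = g" if "W \<in> Obj C" and f: "f \<in> lmod_hom E (tens W X) Y" and g: "g \<in> lmod_hom E (tens W X) Y"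
    and eq: "\<And>w x. w \<in> carrier W \<Longrightarrow> x \<in> carrier X \<Longrightarrow> f (pt W X w x) = g (pt W X w x)" for W Y f g
  proof (rule lmod_eqI[OF f g])
    fix t assume "t \<in> carrier (tens W X)"
    then show "f t = g t"
      by (rule tens_eqI[OF _ X lmod_homD(1)[OF f] lmod_homD(1)[OF g], rotated -1]) (use that(1) eq in \<open>auto simp: bm_def\<close>)
  qed
qed

lemma left_univ_iff: "bm X \<Longrightarrow> module_functor.univ C E (\<lambda>W. tens X W) (carrier X) (\<lambda>W x w. pt X W x w) Y V \<epsilon> \<longleftrightarrow> left_univ X Y V \<epsilon>"
  and right_univ_iff: "bm X \<Longrightarrow> module_functor.univ C E (\<lambda>W. tens W X) (carrier X) (\<lambda>W x w. pt W X w x) Y V \<epsilon> \<longleftrightarrow> right_univ X Y V \<epsilon>"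
  unfolding module_functor.univ_def[OF left_module_functor] module_functor.univ_def[OF right_module_functor] left_univ_def right_univ_def bm_Obj
  by (rule refl)+

lemma right_inner_hom_univ: "right_inner_hom C X G \<epsilon> \<Longrightarrow> bm X \<Longrightarrow> bm Y \<Longrightarrow> right_univ X Y (FO G Y) (fn (\<epsilon> Y))"
  using module_functor.adjoint_univ(1)[OF right_module_functor] by (simp add: right_inner_hom_def right_univ_iff bm_def)

lemma left_inner_hom_univ: "left_inner_hom C X G \<epsilon> \<Longrightarrow> bm X \<Longrightarrow> bm Y \<Longrightarrow> left_univ X Y (FO G Y) (fn (\<epsilon> Y))"
  using module_functor.adjoint_univ(1)[OF left_module_functor] by (simp add: left_inner_hom_def left_univ_iff bm_def)

lemma left_comparison:
  assumes "left_inner_hom C X G \<epsilon>" "bm X" "bm Y" "bm W" "f \<in> lmod_hom E (tens X W) Y"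
  shows "\<exists>\<phi>\<in>lmod_hom E W (FO G Y). (\<forall>w\<in>carrier W. \<forall>x\<in>carrier X. fn (\<epsilon> Y) (pt X (FO G Y) x (\<phi> w)) = f (pt X W x w)) \<and>
    (THE a. a \<in> homset C W (FO G Y) \<and> \<epsilon> Y \<bullet>\<^bsub>C\<^esub> (Idn C X \<star>\<^bsub>C\<^esub> a) = Arrow (tens X W) Y f) = Arrow W (FO G Y) \<phi>"
  using module_functor.adjoint_comparison[OF left_module_functor[OF assms(2)] assms(1)[unfolded left_inner_hom_def C_simps(1)]]
    assms(3-5) unfolding bm_Obj by blast

lemma right_comparison:
  assumes "right_inner_hom C X G \<epsilon>" "bm X" "bm Y" "bm W" "f \<in> lmod_hom E (tens W X) Y"
  shows "\<exists>\<phi>\<in>lmod_hom E W (FO G Y). (\<forall>w\<in>carrier W. \<forall>x\<in>carrier X. fn (\<epsilon> Y) (pt (FO G Y) X (\<phi> w) x) = f (pt W X w x)) \<and>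
    (THE a. a \<in> homset C W (FO G Y) \<and> \<epsilon> Y \<bullet>\<^bsub>C\<^esub> (a \<star>\<^bsub>C\<^esub> Idn C X) = Arrow (tens W X) Y f) = Arrow W (FO G Y) \<phi>"
  using module_functor.adjoint_comparison[OF right_module_functor[OF assms(2)] assms(1)[unfolded right_inner_hom_def C_simps(1)]]
    assms(3-5) unfolding bm_Obj by blast

lemma left_inner_hom_exists:
  assumes X: "bm X" and ex: "\<And>Y. bm Y \<Longrightarrow> \<exists>V \<epsilon>. left_univ X Y V \<epsilon>"
  shows "\<exists>G \<epsilon>. left_inner_hom C X G \<epsilon>"
  using module_functor.adjoint_exists[OF left_module_functor[OF X] C.tensor_ftor[of X, unfolded C_simps(1)]] X ex
  unfolding left_inner_hom_def left_univ_iff[OF X] bm_Obj C_simps(1) by blast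

end

section \<open>Inner hom-functors of modules over the bialgebroid\<close>

context bialg begin

definition left_univH where
  "left_univH X Y V \<epsilon> \<longleftrightarrow> hm V \<and> \<epsilon> \<in> lmod_hom A (ht X V) Y \<and>
     (\<forall>W f. hm W \<longrightarrow> f \<in> lmod_hom A (ht X W) Y \<longrightarrow>
        (\<exists>!g. g \<in> lmod_hom A W V \<and> (\<forall>w\<in>carrier W. \<forall>x\<in>carrier X. \<epsilon> (pt (Rs X) (Rs V) x (g w)) = f (pt (Rs X) (Rs W) x w))))"

definition right_univH where
  "right_univH X Y V \<epsilon> \<longleftrightarrow> hm V \<and> \<epsilon> \<in> lmod_hom A (ht V X) Y \<and>
     (\<forall>W f. hm W \<longrightarrow> f \<in> lmod_hom A (ht W X) Y \<longrightarrow>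
        (\<exists>!g. g \<in> lmod_hom A W V \<and> (\<forall>w\<in>carrier W. \<forall>x\<in>carrier X. \<epsilon> (pt (Rs V) (Rs X) (g w) x) = f (pt (Rs W) (Rs X) w x))))"

lemma idr_lmod: "hm X \<Longrightarrow> (\<lambda>x\<in>carrier X. x) \<in> lmod_hom A X X"
  using HC_homset[of "Idn HC X" X X] HC.Idn_hom[of X] by (simp add: hm_def)

lemma left_module_functorH:
  assumes X: "hm X"
  shows "module_functor HC A (\<lambda>W. ht X W) (\<lambda>f. Idn HC X \<star>\<^bsub>HC\<^esub> f) (carrier X) (\<lambda>W x w. pt (Rs X) (Rs W) x w)"
proof (intro module_functor.intro module_functor_axioms.intro HC.category_axioms)
  note XO = X[folded hm_Obj]
  show "(f \<in> homset HC V W) = (V \<in> Obj HC \<and> W \<in> Obj HC \<and> fn f \<in> lmod_hom A V W \<and> f = Arrow V W (fn f))" for f V W by (rule HC_homset)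
  show "g \<bullet>\<^bsub>HC\<^esub> f = Arrow (src f) (tgt g) (compose (carrier (src f)) (fn g) (fn f))" for g f by simp
  show "ht X V \<in> Obj HC" if "V \<in> Obj HC" for V by (rule HC.TensO_closed[OF XO that])
  show "Idn HC X \<star>\<^bsub>HC\<^esub> f \<in> homset HC (ht X W) (ht X V)" if "f \<in> homset HC W V" for f W V
    by (rule HC.TensA_hom[OF HC.Idn_hom[OF XO] that])
  show "fn (Idn HC X \<star>\<^bsub>HC\<^esub> f) (pt (Rs X) (Rs W) x w) = pt (Rs X) (Rs V) x (fn f w)"
    if f: "f \<in> homset HC W V" and w: "w \<in> carrier W" "x \<in> carrier X" for f W V w x
  proof -
    have b: "hm W" "hm V" and g: "fn f \<in> lmod_hom A W V" "f = Arrow W V (fn f)" using f unfolding HC_homset hm_Obj by auto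
    show ?thesis
      by (subst g(2)) (use w X b TensA_HC(1)[OF X b(1) X b(2) idr_lmod[OF X] g(1)] Rs_lin[OF g(1) b] lin_idr(2)[OF bm_Rs[OF X]] in \<open>simp add: tm_pt\<close>)
  qed
  show "pt (Rs X) (Rs W) x w \<in> carrier (ht X W)" if "W \<in> Obj HC" "w \<in> carrier W" "x \<in> carrier X" for W w x
    using that X unfolding hm_Obj by simp
  show "f = g" if "W \<in> Obj HC" and f: "f \<in> lmod_hom A (ht X W) Y" and g: "g \<in> lmod_hom A (ht X W) Y"
    and eq: "\<And>w x. w \<in> carrier W \<Longrightarrow> x \<in> carrier X \<Longrightarrow> f (pt (Rs X) (Rs W) x w) = g (pt (Rs X) (Rs W) x w)" for W Y f g
  proof (rule lmod_eqI[OF f g])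
    have W: "hm W" using that(1) unfolding hm_Obj .
    fix t assume "t \<in> carrier (ht X W)"
    then have t: "t \<in> carrier (tens (Rs X) (Rs W))" using X W by simp
    have h: "f \<in> hom (tens (Rs X) (Rs W)) Y" "g \<in> hom (tens (Rs X) (Rs W)) Y" using lmod_homD(1)[OF f] lmod_homD(1)[OF g] X W by simp_all
    show "f t = g t" by (rule tens_eqI[OF bm_Rs[OF X] bm_Rs[OF W] h _ t]) (use eq in simp)
  qed
qed

lemma right_module_functorH:
  assumes X: "hm X"
  shows "module_functor HC A (\<lambda>W. ht W X) (\<lambda>f. f \<star>\<^bsub>HC\<^esub> Idn HC X) (carrier X) (\<lambda>W x w. pt (Rs W) (Rs X) w x)"
proof (intro module_functor.intro module_functor_axioms.intro HC.category_axioms)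
  note XO = X[folded hm_Obj]
  show "(f \<in> homset HC V W) = (V \<in> Obj HC \<and> W \<in> Obj HC \<and> fn f \<in> lmod_hom A V W \<and> f = Arrow V W (fn f))" for f V W by (rule HC_homset)
  show "g \<bullet>\<^bsub>HC\<^esub> f = Arrow (src f) (tgt g) (compose (carrier (src f)) (fn g) (fn f))" for g f by simp
  show "ht V X \<in> Obj HC" if "V \<in> Obj HC" for V by (rule HC.TensO_closed[OF that XO])
  show "f \<star>\<^bsub>HC\<^esub> Idn HC X \<in> homset HC (ht W X) (ht V X)" if "f \<in> homset HC W V" for f W V
    by (rule HC.TensA_hom[OF that HC.Idn_hom[OF XO]])
  show "fn (f \<star>\<^bsub>HC\<^esub> Idn HC X) (pt (Rs W) (Rs X) w x) = pt (Rs V) (Rs X) (fn f w) x"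
    if f: "f \<in> homset HC W V" and w: "w \<in> carrier W" "x \<in> carrier X" for f W V w x
  proof -
    have b: "hm W" "hm V" and g: "fn f \<in> lmod_hom A W V" "f = Arrow W V (fn f)" using f unfolding HC_homset hm_Obj by auto
    show ?thesis
      by (subst g(2)) (use w X b TensA_HC(1)[OF b(1) X b(2) X g(1) idr_lmod[OF X]] Rs_lin[OF g(1) b] lin_idr(1)[OF bm_Rs[OF X]] in \<open>simp add: tm_pt\<close>)
  qed
  show "pt (Rs W) (Rs X) w x \<in> carrier (ht W X)" if "W \<in> Obj HC" "w \<in> carrier W" "x \<in> carrier X" for W w x
    using that X unfolding hm_Obj by simp
  show "f = g" if "W \<in> Obj HC" and f: "f \<in> lmod_hom A (ht W X) Y" and g: "g \<in> lmod_hom A (ht W X) Y"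
    and eq: "\<And>w x. w \<in> carrier W \<Longrightarrow> x \<in> carrier X \<Longrightarrow> f (pt (Rs W) (Rs X) w x) = g (pt (Rs W) (Rs X) w x)" for W Y f g
  proof (rule lmod_eqI[OF f g])
    have W: "hm W" using that(1) unfolding hm_Obj .
    fix t assume "t \<in> carrier (ht W X)"
    then have t: "t \<in> carrier (tens (Rs W) (Rs X))" using X W by simp
    have h: "f \<in> hom (tens (Rs W) (Rs X)) Y" "g \<in> hom (tens (Rs W) (Rs X)) Y" using lmod_homD(1)[OF f] lmod_homD(1)[OF g] X W by simp_all
    show "f t = g t" by (rule tens_eqI[OF bm_Rs[OF W] bm_Rs[OF X] h _ t]) (use eq in simp)
  qed
qed

lemma left_univH_iff: "hm X \<Longrightarrow> module_functor.univ HC A (\<lambda>W. ht X W) (carrier X) (\<lambda>W x w. pt (Rs X) (Rs W) x w) Y V \<epsilon> \<longleftrightarrow> left_univH X Y V \<epsilon>"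
  and right_univH_iff: "hm X \<Longrightarrow> module_functor.univ HC A (\<lambda>W. ht W X) (carrier X) (\<lambda>W x w. pt (Rs W) (Rs X) w x) Y V \<epsilon> \<longleftrightarrow> right_univH X Y V \<epsilon>"
  unfolding module_functor.univ_def[OF left_module_functorH] module_functor.univ_def[OF right_module_functorH] left_univH_def right_univH_def hm_Obj
  by (rule refl)+

lemma left_inner_hom_univH:
  assumes "left_inner_hom HC X G \<epsilon>" "hm X" "hm Y"
  shows "left_univH X Y (FO G Y) (fn (\<epsilon> Y))" "\<epsilon> Y = Arrow (ht X (FO G Y)) Y (fn (\<epsilon> Y))"
  using module_functor.adjoint_univ[OF left_module_functorH[OF assms(2)]] assms unfolding left_inner_hom_def left_univH_iff[OF assms(2)] hm_Obj by blast+

lemma right_inner_hom_univH: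
  assumes "right_inner_hom HC X G \<epsilon>" "hm X" "hm Y"
  shows "right_univH X Y (FO G Y) (fn (\<epsilon> Y))" "\<epsilon> Y = Arrow (ht (FO G Y) X) Y (fn (\<epsilon> Y))"
  using module_functor.adjoint_univ[OF right_module_functorH[OF assms(2)]] assms unfolding right_inner_hom_def right_univH_iff[OF assms(2)] hm_Obj by blast+

lemma left_inner_hom_existsH:
  assumes X: "hm X" and ex: "\<And>Y. hm Y \<Longrightarrow> \<exists>V \<epsilon>. left_univH X Y V \<epsilon>"
  shows "\<exists>G \<epsilon>. left_inner_hom HC X G \<epsilon>"
  using module_functor.adjoint_exists[OF left_module_functorH[OF X] HC.tensor_ftor[of X]] X ex
  unfolding left_inner_hom_def left_univH_iff[OF X] hm_Obj by blast

text \<open>The structure maps of the strict underlying functor are identities. The morphism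
  inducing the comparison is therefore carried by the counit itself.\<close>

lemma FA_inv_Xi:
  assumes P: "hm P" and Q: "hm Q" and Y: "hm Y" and e: "e \<in> lmod_hom A (ht P Q) Y"
  shows "FA F (Arrow (ht P Q) Y e) \<bullet>\<^bsub>C\<^esub> inv_arrow C (Xi F P Q) = Arrow (tens (Rs P) (Rs Q)) (Rs Y) e"
    "e \<in> lmod_hom E (tens (Rs P) (Rs Q)) (Rs Y)"
proof -
  let ?T = "tens (Rs P) (Rs Q)"
  have T: "bm ?T" using P Q by simp
  show e': "e \<in> lmod_hom E ?T (Rs Y)" using Rs_lmod[OF e] P Q by (simp add: strictD(1) hm_lmod)
  have i: "Idn C ?T \<in> homset C ?T ?T" by (rule C.Idn_hom) (use T in \<open>simp only: bm_Obj\<close>)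
  have "inv_arrow C (Xi F P Q) = Idn C ?T"
    by (rule C.inv_arrow_eq, unfold inverse_arrows_def F_simps strictD(1)[OF P Q]) (use i C.Idn_Cmp[OF i] in \<open>auto simp: homset_def\<close>)
  moreover have "Arrow ?T (Rs Y) e \<in> homset C ?T (Rs Y)" using e' T Y by (simp add: C_homset_Arrow)
  ultimately show "FA F (Arrow (ht P Q) Y e) \<bullet>\<^bsub>C\<^esub> inv_arrow C (Xi F P Q) = Arrow ?T (Rs Y) e"
    using C.Cmp_Idn[of "Arrow ?T (Rs Y) e" ?T "Rs Y"] strictD(1)[OF P Q] by (simp del: C_simps(6,7))
qed

end

section \<open>Dual bases of finitely generated projective modules\<close>

lemma free_lmod_simps:
  "carrier (free_lmod A n) = {..<n} \<rightarrow>\<^sub>E carrier A"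
  "x \<otimes>\<^bsub>free_lmod A n\<^esub> y = (\<lambda>i\<in>{..<n}. x i \<oplus>\<^bsub>A\<^esub> y i)"
  "scal (free_lmod A n) a x = (\<lambda>i\<in>{..<n}. a \<otimes>\<^bsub>A\<^esub> x i)"
  "\<one>\<^bsub>free_lmod A n\<^esub> = (\<lambda>i\<in>{..<n}. \<zero>\<^bsub>A\<^esub>)"
  by (simp_all add: free_lmod_def)

lemma comm_group_free_lmod:
  assumes "ring A" shows "comm_group (free_lmod A n)"
proof -
  interpret A: ring A by (rule assms)
  show ?thesis
  proof (rule comm_groupI)
    fix x assume "x \<in> carrier (free_lmod A n)"
    then have x: "x \<in> {..<n} \<rightarrow>\<^sub>E carrier A" by (simp add: free_lmod_simps)
    then have xc: "x i \<in> carrier A" if "i < n" for i using that by auto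
    have "(\<lambda>i\<in>{..<n}. \<ominus>\<^bsub>A\<^esub> x i) \<otimes>\<^bsub>free_lmod A n\<^esub> x = \<one>\<^bsub>free_lmod A n\<^esub>"
      unfolding free_lmod_simps by (rule restrict_ext) (simp add: xc A.l_neg)
    then show "\<exists>y\<in>carrier (free_lmod A n). y \<otimes>\<^bsub>free_lmod A n\<^esub> x = \<one>\<^bsub>free_lmod A n\<^esub>"
      by (intro bexI[of _ "\<lambda>i\<in>{..<n}. \<ominus>\<^bsub>A\<^esub> x i"]) (simp_all add: free_lmod_simps(1) xc)
    show "\<one>\<^bsub>free_lmod A n\<^esub> \<otimes>\<^bsub>free_lmod A n\<^esub> x = x"
      unfolding free_lmod_simps
      by (rule extensionalityI[OF restrict_extensional]) (use x in \<open>auto simp: PiE_def xc\<close>)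
    fix y assume "y \<in> carrier (free_lmod A n)"
    then have yc: "y i \<in> carrier A" if "i < n" for i using that by (auto simp: free_lmod_simps)
    show "x \<otimes>\<^bsub>free_lmod A n\<^esub> y \<in> carrier (free_lmod A n)" by (simp add: free_lmod_simps xc yc)
    show "x \<otimes>\<^bsub>free_lmod A n\<^esub> y = y \<otimes>\<^bsub>free_lmod A n\<^esub> x"
      unfolding free_lmod_simps by (rule restrict_ext) (rule A.a_comm; simp add: xc yc)
    fix z assume "z \<in> carrier (free_lmod A n)"
    then have zc: "z i \<in> carrier A" if "i < n" for i using that by (auto simp: free_lmod_simps)
    show "x \<otimes>\<^bsub>free_lmod A n\<^esub> y \<otimes>\<^bsub>free_lmod A n\<^esub> z = x \<otimes>\<^bsub>free_lmod A n\<^esub> (y \<otimes>\<^bsub>free_lmod A n\<^esub> z)"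
      unfolding free_lmod_simps by (rule restrict_ext) (simp add: xc yc zc A.a_assoc)
  qed (simp add: free_lmod_simps)
qed

lemma free_lmod_expand:
  assumes A: "ring A" and x: "x \<in> carrier (free_lmod A n)"
  shows "x = finprod (free_lmod A n) (\<lambda>j. scal (free_lmod A n) (x j) (\<lambda>i\<in>{..<n}. if i = j then \<one>\<^bsub>A\<^esub> else \<zero>\<^bsub>A\<^esub>)) {..<n}"
    (is "x = finprod ?F ?t {..<n}")
proof -
  interpret A: ring A by (rule A)
  interpret F: comm_group ?F by (rule comm_group_free_lmod[OF A])
  have xj: "x j \<in> carrier A" if "j < n" for j using x that by (auto simp: free_lmod_simps)
  have t: "?t \<in> {..<n} \<rightarrow> carrier ?F" using xj by (auto simp: free_lmod_simps)
  have c: "finprod ?F ?t {..<n} \<in> carrier ?F" using t by (rule F.finprod_closed)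
  show ?thesis
  proof (rule extensionalityI[of _ "{..<n}"])
    show "x \<in> extensional {..<n}" "finprod ?F ?t {..<n} \<in> extensional {..<n}"
      using x c by (auto simp: free_lmod_simps PiE_def)
    fix i assume i: "i \<in> {..<n}"
    have h: "(\<lambda>y. y i) \<in> hom ?F (add_monoid A)" using i by (auto simp: hom_def free_lmod_simps)
    have "finprod ?F ?t {..<n} i = finprod (add_monoid A) (\<lambda>j. ?t j i) {..<n}"
      using hom_finprod[OF h F.comm_group_axioms A.a_comm_group t] .
    also have "\<dots> = finsum A (\<lambda>j. if i = j then x j else \<zero>\<^bsub>A\<^esub>) {..<n}"
      unfolding finsum_def using i xj by (intro comm_monoid.finprod_cong'[OF A.a_comm_monoid]) (auto simp: free_lmod_simps)
    also have "\<dots> = x i" using i xj A.add.finprod_singleton[of i "{..<n}" x] by auto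
    finally show "x i = finprod ?F ?t {..<n} i" by simp
  qed
qed

text \<open>The dual basis lemma. With \<open>i\<close> embedding P into a free module and
  \<open>p\<close> a retraction, \<open>h j\<close> is the image of the j-th unit vector under
  \<open>p\<close> and \<open>\<pi> j\<close> is the j-th coordinate of \<open>i\<close>.\<close>

lemma fg_projective_dual_basis:
  assumes "fg_projective A P"
  obtains n :: nat and h \<pi> where "\<forall>j<n. h j \<in> carrier P" "\<forall>j<n. \<pi> j \<in> hom P (add_monoid A)"
    "\<forall>j<n. \<forall>a\<in>carrier A. \<forall>x\<in>carrier P. \<pi> j (scal P a x) = a \<otimes>\<^bsub>A\<^esub> \<pi> j x"
    "\<forall>x\<in>carrier P. x = finprod P (\<lambda>j. scal P (\<pi> j x) (h j)) {..<n}"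
proof -
  from assms obtain n i p where P: "left_module A P" and i: "i \<in> lmod_hom A P (free_lmod A n)"
    and p: "p \<in> lmod_hom A (free_lmod A n) P" and pi: "\<And>x. x \<in> carrier P \<Longrightarrow> p (i x) = x"
    unfolding fg_projective_def by blast
  interpret A: ring A using P by (rule left_moduleD)
  let ?F = "free_lmod A n"
  define b where "b j = (\<lambda>i\<in>{..<n}. if i = j then \<one>\<^bsub>A\<^esub> else \<zero>\<^bsub>A\<^esub>)" for j
  have b: "b j \<in> carrier ?F" for j by (auto simp: b_def free_lmod_simps)
  note ic = lmod_homD(4)[OF i]
  have ij: "i x j \<in> carrier A" if "x \<in> carrier P" "j < n" for x j using ic[OF that(1)] that(2) by (auto simp: free_lmod_simps)
  show thesis
  proof (rule that[of n "\<lambda>j. p (b j)" "\<lambda>j x. i x j"]; intro allI impI ballI)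
    show "p (b j) \<in> carrier P" for j using lmod_homD(4)[OF p b] .
    show "(\<lambda>x. i x j) \<in> hom P (add_monoid A)" if "j < n" for j
      using ij that by (auto intro!: homI simp: hom_mult[OF lmod_homD(1)[OF i]] free_lmod_simps)
    show "i (scal P a x) j = a \<otimes>\<^bsub>A\<^esub> i x j" if "j < n" "a \<in> carrier A" "x \<in> carrier P" for j a x
      using that by (simp add: lmod_homD(3)[OF i] free_lmod_simps)
    fix x assume x: "x \<in> carrier P"
    have sb: "scal ?F (i x j) (b j) \<in> carrier ?F" if "j < n" for j
      using A.m_closed[OF ij[OF x that]] b[of j] by (auto simp: free_lmod_simps)
    have "x = p (i x)" using pi[OF x] by simp
    also have "i x = finprod ?F (\<lambda>j. scal ?F (i x j) (b j)) {..<n}"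
      unfolding b_def by (rule free_lmod_expand[OF A.ring_axioms ic[OF x]])
    also have "p \<dots> = finprod P (\<lambda>j. p (scal ?F (i x j) (b j))) {..<n}"
      using sb by (intro hom_finprod[OF lmod_homD(1)[OF p] comm_group_free_lmod[OF A.ring_axioms] left_moduleD(2)[OF P]]) auto
    also have "\<dots> = finprod P (\<lambda>j. scal P (i x j) (p (b j))) {..<n}"
    proof -
      interpret P: comm_group P using P by (rule left_moduleD)
      show ?thesis using ij[OF x] lmod_homD(4)[OF p b] left_moduleD(3)[OF P]
        by (intro P.finprod_cong') (auto simp: lmod_homD(3)[OF p _ b])
    qed
    finally show "x = finprod P (\<lambda>j. scal P (i x j) (p (b j))) {..<n}" .
  qed
qed

context bimods begin

lemma left_univ_iso:
  assumes u: "left_univ X Y V' \<epsilon>'" and X: "bm X" and Y: "bm Y" and V: "bm V"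
    and \<phi>: "\<phi> \<in> lmod_hom E V V'" and \<psi>: "\<psi> \<in> lmod_hom E V' V"
    and inv: "\<And>y. y \<in> carrier V' \<Longrightarrow> \<phi> (\<psi> y) = y" "\<And>x. x \<in> carrier V \<Longrightarrow> \<psi> (\<phi> x) = x"
    and \<epsilon>: "\<epsilon> \<in> lmod_hom E (tens X V) Y"
    and eq: "\<And>x v. x \<in> carrier X \<Longrightarrow> v \<in> carrier V \<Longrightarrow> \<epsilon>' (pt X V' x (\<phi> v)) = \<epsilon> (pt X V x v)"
  shows "left_univ X Y V \<epsilon>"
  unfolding left_univ_def
proof (intro conjI allI impI V \<epsilon>)
  fix W f assume W: "bm W" and f: "f \<in> lmod_hom E (tens X W) Y"
  obtain g where g: "g \<in> lmod_hom E W V'" "\<forall>w\<in>carrier W. \<forall>x\<in>carrier X. \<epsilon>' (pt X V' x (g w)) = f (pt X W x w)"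
    and un: "\<And>g'. g' \<in> lmod_hom E W V' \<Longrightarrow> \<forall>w\<in>carrier W. \<forall>x\<in>carrier X. \<epsilon>' (pt X V' x (g' w)) = f (pt X W x w) \<Longrightarrow> g' = g"
    using left_univ_ex1[OF u W f] by (metis (no_types, lifting))
  note c = lmod_hom_comp[OF bm_lmod[OF W]]
  show "\<exists>!g. g \<in> lmod_hom E W V \<and> (\<forall>w\<in>carrier W. \<forall>x\<in>carrier X. \<epsilon> (pt X V x (g w)) = f (pt X W x w))"
  proof (rule ex1I[of _ "compose (carrier W) \<psi> g"])
    have "\<epsilon> (pt X V x (\<psi> (g w))) = f (pt X W x w)" if "w \<in> carrier W" "x \<in> carrier X" for w x
      using that g inv(1) eq lmod_homD(4)[OF g(1)] lmod_homD(4)[OF \<psi>] by metis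
    then show "compose (carrier W) \<psi> g \<in> lmod_hom E W V \<and> (\<forall>w\<in>carrier W. \<forall>x\<in>carrier X. \<epsilon> (pt X V x (compose (carrier W) \<psi> g w)) = f (pt X W x w))"
      using c[OF g(1) \<psi>] by (simp add: compose_eq)
  next
    fix g' assume g': "g' \<in> lmod_hom E W V \<and> (\<forall>w\<in>carrier W. \<forall>x\<in>carrier X. \<epsilon> (pt X V x (g' w)) = f (pt X W x w))"
    have "compose (carrier W) \<phi> g' = g"
      using g' by (intro un c[OF _ \<phi>]) (auto simp: compose_eq eq lmod_homD(4))
    then have "g w = \<phi> (g' w)" if "w \<in> carrier W" for w using that by (auto simp: compose_eq)
    then show "g' = compose (carrier W) \<psi> g"
      using g' lmod_homD(4)[OF conjunct1[OF g']]
      by (intro lmod_eqI[OF conjunct1[OF g'] c[OF g(1) \<psi>]]) (simp add: compose_eq inv(2))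
  qed
qed

end

section \<open>The regular module and the left inner homs from it\<close>

locale bialg_reg = bialg k R U H
  for k :: "'k ring" and R :: "('k, 'r) module" and U :: "'u set set" and H :: "('k, 'r, 'h, 'u) bialgebroid_data" +
  fixes V :: "('h, 'u) lmod" and u :: 'u
  assumes Vfree: "free1 (alg H) V u" and VU: "carrier V \<in> U" and UH: "module_universe (carrier (alg H)) U"
begin

lemma hmV [simp]: "hm V" and u_closed [simp]: "u \<in> carrier V"
  using Vfree VU by (auto simp: hm_def free1_def)

lemma V_cases:
  assumes "v \<in> carrier V" obtains a where "a \<in> carrier A" "v = scal V a u"
  using free1_cases[OF Vfree assms] .

lemma powers:
  assumes "B \<in> U" obtains B' where "B' \<in> U" "(carrier A \<rightarrow>\<^sub>E B) \<lesssim> B'"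
  using UH assms by (auto simp: module_universe_def)

lemma scal_u: "a \<in> carrier A \<Longrightarrow> scal V a u \<in> carrier V"
  using left_moduleD(3)[OF hm_lmod[OF hmV]] by simp

text \<open>An H-linear map V \<otimes> V \<rightarrow> Y is determined by its values at au
  \<otimes> bu with a, b in H. The set of these maps thus embeds into a power of Y taken twice with
  exponent H, and the universe is closed under such powers.\<close>

lemma left_univH_exists:
  assumes Y: "hm Y"
  shows "\<exists>W \<epsilon>. left_univH V Y W \<epsilon>"
proof -
  have card: "\<exists>B\<in>U. lmod_hom A (ht V V) Y \<lesssim> B" if Y: "left_module A (Y :: ('h, 'u) lmod)" "carrier Y \<in> U" for Y
  proof -
    obtain B1 where B1: "B1 \<in> U" "(carrier A \<rightarrow>\<^sub>E carrier Y) \<lesssim> B1" using powers[OF Y(2)] .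
    obtain B2 where B2: "B2 \<in> U" "(carrier A \<rightarrow>\<^sub>E B1) \<lesssim> B2" using powers[OF B1(1)] .
    have "lmod_hom A (ht V V) Y \<lesssim> (carrier A \<rightarrow>\<^sub>E (carrier A \<rightarrow>\<^sub>E carrier Y))"
      unfolding lepoll_def
    proof (intro exI conjI)
      let ?i = "\<lambda>f. \<lambda>a\<in>carrier A. \<lambda>b\<in>carrier A. f (pt (Rs V) (Rs V) (scal V a u) (scal V b u))"
      show "inj_on ?i (lmod_hom A (ht V V) Y)"
      proof (rule inj_onI)
        fix f g assume f: "f \<in> lmod_hom A (ht V V) Y" and g: "g \<in> lmod_hom A (ht V V) Y" and eq: "?i f = ?i g"
        have eq': "f (pt (Rs V) (Rs V) (scal V a u) (scal V b u)) = g (pt (Rs V) (Rs V) (scal V a u) (scal V b u))"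
          if "a \<in> carrier A" "b \<in> carrier A" for a b
          using fun_cong[OF fun_cong[OF eq, of a], of b] that by simp
        show "f = g"
        proof (rule lmod_eqI[OF f g])
          fix t assume "t \<in> carrier (ht V V)"
          then have t: "t \<in> carrier (tens (Rs V) (Rs V))" by simp
          have fg: "f \<in> hom (tens (Rs V) (Rs V)) Y" "g \<in> hom (tens (Rs V) (Rs V)) Y"
            using lmod_homD(1)[OF f] lmod_homD(1)[OF g] by simp_all
          show "f t = g t"
          proof (rule tens_eqI[OF bm_Rs[OF hmV] bm_Rs[OF hmV] fg _ t])
            fix m n assume "m \<in> carrier (Rs V)" "n \<in> carrier (Rs V)"
            then obtain a b where "a \<in> carrier A" "m = scal V a u" "b \<in> carrier A" "n = scal V b u" by (auto elim!: V_cases)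
            then show "f (pt (Rs V) (Rs V) m n) = g (pt (Rs V) (Rs V) m n)" using eq' by simp
          qed
        qed
      qed
      show "?i ` lmod_hom A (ht V V) Y \<subseteq> (carrier A \<rightarrow>\<^sub>E (carrier A \<rightarrow>\<^sub>E carrier Y))"
      proof (rule image_subsetI)
        fix f assume f: "f \<in> lmod_hom A (ht V V) Y"
        show "?i f \<in> carrier A \<rightarrow>\<^sub>E (carrier A \<rightarrow>\<^sub>E carrier Y)" using lmod_homD(4)[OF f] scal_u by auto
      qed
    qed
    also have "\<dots> \<lesssim> (carrier A \<rightarrow>\<^sub>E B1)" by (rule lepoll_funcset_right[OF B1(2)])
    finally show ?thesis using B2 lepoll_trans by blast
  qed
  interpret LT: left_tensor k R U A Rs "env_map H" "Rs V" "ht V" V u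
  proof (unfold_locales, goal_cases)
    case (3 W) then have "hm W" by (simp add: hm_def) then show ?case by simp
  next
    case (7 W)
    then have "hm W" by (simp add: hm_def)
    then have "hm (ht V W)" by simp
    then show ?case unfolding hm_def .
  next
    case (8 W) then have "hm W" by (simp add: hm_def) then show ?case by (rule strictD(1)[OF hmV])
  next
    case (9 W W' f)
    then have W: "hm W" "hm W'" by (auto simp: hm_def)
    have "idr V \<in> lmod_hom A V V" using HC.Idn_hom[of V] hmV unfolding HC_homset hm_Obj by simp
    then have "tm (Rs V) (Rs W) (Rs V) (Rs W') (idr V) f \<in> lmod_hom A (ht V W) (ht V W')" using W 9 by (intro TensA_HC(2)) auto
    then show ?case using tm_idr_eq(1)[of "Rs V" "Rs W" "Rs W'" f, simplified] W Rs_lin[OF 9(5) W] by simp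
  qed (use Vfree VU card in \<open>simp_all add: Rs_scal\<close>)
  have "LT.obj W \<longleftrightarrow> hm W" for W by (simp add: LT.obj_def hm_def)
  then show ?thesis using LT.hom_obj_exists[of Y] Y unfolding left_univH_def Rs_simps by simp
qed

text \<open>A bimodule map on V \<otimes> Q is determined by its values at v \<otimes> q, because
  multiples of \<open>q\<close> can be traded for right scalars on v and on the result. One power
  with exponent H is therefore large enough.\<close>

lemma left_univ_exists:
  assumes Y: "bm Y"
  shows "\<exists>W \<epsilon>. left_univ (Rs V) Y W \<epsilon>"
proof -
  obtain Q q where Q: "free1 E Q q" "bm Q" by (rule E_free)
  have q: "q \<in> carrier Q" using Q(1) by (simp add: free1_def)
  have card: "\<exists>B\<in>U. lmod_hom E (tens (Rs V) Q) Y \<lesssim> B" if Y: "bm Y" for Y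
  proof -
    obtain B1 where B1: "B1 \<in> U" "(carrier A \<rightarrow>\<^sub>E carrier Y) \<lesssim> B1" using powers Y by (auto simp: bm_def)
    have "lmod_hom E (tens (Rs V) Q) Y \<lesssim> (carrier A \<rightarrow>\<^sub>E carrier Y)"
      unfolding lepoll_def
    proof (intro exI conjI)
      let ?i = "\<lambda>f. \<lambda>a\<in>carrier A. f (pt (Rs V) Q (scal V a u) q)"
      show "inj_on ?i (lmod_hom E (tens (Rs V) Q) Y)"
      proof (rule inj_onI)
        fix f g assume f: "f \<in> lmod_hom E (tens (Rs V) Q) Y" and g: "g \<in> lmod_hom E (tens (Rs V) Q) Y" and eq: "?i f = ?i g"
        have eq': "f (pt (Rs V) Q v q) = g (pt (Rs V) Q v q)" if v: "v \<in> carrier V" for v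
        proof -
          obtain a where "a \<in> carrier A" "v = scal V a u" using V_cases[OF v] .
          then show ?thesis using fun_cong[OF eq, of a] by simp
        qed
        have p: "f (pt (Rs V) Q v (scal Q (pe a b) q)) = ra Y b (f (pt (Rs V) Q (ra (Rs V) a v) q))"
          if f: "f \<in> lmod_hom E (tens (Rs V) Q) Y" and v: "v \<in> carrier V" and ab: "a \<in> carrier R" "b \<in> carrier R" for f v a b
        proof -
          have "pt (Rs V) Q v (scal Q (pe a b) q) = ra (tens (Rs V) Q) b (pt (Rs V) Q (ra (Rs V) a v) q)"
          proof -
            have "pt (Rs V) Q v (la Q a (ra Q b q)) = pt (Rs V) Q (ra (Rs V) a v) (ra Q b q)"
              using pt_add(3)[OF bm_Rs[OF hmV] Q(2), of v "ra Q b q" a] v ab q Q(2) by simp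
            also have "\<dots> = ra (tens (Rs V) Q) b (pt (Rs V) Q (ra (Rs V) a v) q)"
              using tens_act(2)[OF bm_Rs[OF hmV] Q(2) ab(2), of "ra (Rs V) a v" q] act_closed(2)[OF bm_Rs[OF hmV] ab(1), of v] v q by simp
            finally show ?thesis using act_mult(4)[OF Q(2) ab q] by simp
          qed
          then show ?thesis
            using rlinD[OF lmod_rlin[OF f bm_tens[OF bm_Rs[OF hmV] Q(2)] Y] ab(2)] act_closed(2)[OF bm_Rs[OF hmV] ab(1), of v] v q Q(2) by simp
        qed
        have fgh: "f \<in> hom (tens (Rs V) Q) Y" "g \<in> hom (tens (Rs V) Q) Y" using lmod_homD(1)[OF f] lmod_homD(1)[OF g] .
        show "f = g"
        proof (rule lmod_eqI[OF f g])
          fix t assume t: "t \<in> carrier (tens (Rs V) Q)"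
          show "f t = g t"
          proof (rule tens_eqI[OF bm_Rs[OF hmV] Q(2) fgh _ t])
            fix v z assume "v \<in> carrier (Rs V)" and z: "z \<in> carrier Q"
            then have v: "v \<in> carrier V" by simp
            from Q z show "f (pt (Rs V) Q v z) = g (pt (Rs V) Q v z)"
            proof (induction rule: free1_induct)
              case (scal a b)
              have "ra (Rs V) a v \<in> carrier V" using act_closed(2)[OF bm_Rs[OF hmV] scal(1), of v] v by simp
              then show ?case using p[OF f v scal] p[OF g v scal] eq' by simp
            next
              case (add z w)
              note h = pt_tens_hom(1)[OF fgh(1) bm_Rs[OF hmV] Q(2), of v] pt_tens_hom(1)[OF fgh(2) bm_Rs[OF hmV] Q(2), of v]
              show ?case using add v hom_mult[OF h(1)] hom_mult[OF h(2)] by simp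
            qed
          qed
        qed
      qed
      show "?i ` lmod_hom E (tens (Rs V) Q) Y \<subseteq> (carrier A \<rightarrow>\<^sub>E carrier Y)"
      proof (rule image_subsetI)
        fix f assume f: "f \<in> lmod_hom E (tens (Rs V) Q) Y"
        have "f (pt (Rs V) Q (scal V a u) q) \<in> carrier Y" if "a \<in> carrier A" for a
          using pt_closed[OF bm_Rs[OF hmV] Q(2), of "scal V a u" q] scal_u[OF that] q by (intro lmod_homD(4)[OF f]) simp
        then show "?i f \<in> carrier A \<rightarrow>\<^sub>E carrier Y" by auto
      qed
    qed
    then show ?thesis using B1 lepoll_trans by blast
  qed
  have LT: "left_tensor k R U E (\<lambda>M. M) (\<lambda>z. z) (Rs V) (tens (Rs V)) Q q"
  proof (unfold_locales, goal_cases)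
    case 1 then show ?case by simp
  next
    case (7 W)
    then have "bm W" by (simp add: bm_def)
    then have "bm (tens (Rs V) W)" by simp
    then show ?case unfolding bm_def .
  next
    case (9 W W' f)
    then have W: "bm W" "bm W'" by (auto simp: bm_def)
    have "tm (Rs V) W (Rs V) W' (idr V) f \<in> lmod_hom E (tens (Rs V) W) (tens (Rs V) W')"
      using W 9 id_lmod[of "Rs V"] by (intro tm_lmod) auto
    then show ?case using tm_idr_eq(1)[of "Rs V" W W' f, simplified] W lmod_llin[OF 9(5) W] by simp
  next
    case (12 Y) then show ?case using card[of Y] by (simp add: bm_def)
  next
    case (3 W) then show ?case by (simp add: bm_def)
  next
    case 11 then show ?case using Q(2) by (simp add: bm_def)
  qed (use Q(1) in simp_all)
  have o: "left_tensor.obj U E = bm"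
    by (rule ext) (simp add: left_tensor.obj_def[OF LT] bm_def)
  show ?thesis using left_tensor.hom_obj_exists[OF LT, of Y] Y unfolding left_univ_def Rs_simps o by blast
qed

text \<open>The anti-Hopf property in usable form: the comparison map \<phi> between the inner hom
  of H-modules and that of bimodules is invertible. Transport along it shows that a single H-module,
  with a single H-linear counit, has both universal properties.\<close>

lemma dual_exists:
  assumes "anti_hopf U k R H" and Y: "hm Y"
  obtains W \<epsilon> where "left_univH V Y W \<epsilon>" "left_univ (Rs V) (Rs Y) (Rs W) \<epsilon>"
proof -
  have pres: "preserves_left_inner_homs HC C F" using assms by (simp add: anti_hopf_def)
  obtain G \<epsilon> where G: "left_inner_hom HC V G \<epsilon>" using left_inner_hom_existsH[OF hmV left_univH_exists] by blast
  obtain G' \<epsilon>' where G': "left_inner_hom C (Rs V) G' \<epsilon>'" using left_inner_hom_exists[OF bm_Rs[OF hmV] left_univ_exists] by blast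
  note g = left_inner_hom_univH[OF G hmV Y] and g' = left_inner_hom_univ[OF G' bm_Rs[OF hmV] bm_Rs[OF Y]]
  let ?W = "FO G Y" and ?W' = "FO G' (Rs Y)"
  have W: "hm ?W" and e: "fn (\<epsilon> Y) \<in> lmod_hom A (ht V ?W) Y" using g(1) by (auto simp: left_univH_def)
  have W': "bm ?W'" using g' by (auto simp: left_univ_def)
  have VO: "V \<in> Obj HC" "Y \<in> Obj HC" using hmV Y unfolding hm_Obj by auto
  note f = FA_inv_Xi[OF hmV W Y e]
  obtain \<phi> where \<phi>: "\<phi> \<in> lmod_hom E (Rs ?W) ?W'"
    "\<forall>w\<in>carrier (Rs ?W). \<forall>x\<in>carrier (Rs V). fn (\<epsilon>' (Rs Y)) (pt (Rs V) ?W' x (\<phi> w)) = fn (\<epsilon> Y) (pt (Rs V) (Rs ?W) x w)"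
    and the: "(THE a. a \<in> homset C (Rs ?W) ?W' \<and> \<epsilon>' (Rs Y) \<bullet>\<^bsub>C\<^esub> (Idn C (Rs V) \<star>\<^bsub>C\<^esub> a) = Arrow (tens (Rs V) (Rs ?W)) (Rs Y) (fn (\<epsilon> Y)))
      = Arrow (Rs ?W) ?W' \<phi>"
    using left_comparison[OF G' bm_Rs[OF hmV] bm_Rs[OF Y] bm_Rs[OF W] f(2)] by blast
  have "iso_arrow C (THE a. a \<in> homset C (FO F ?W) (FO G' (FO F Y)) \<and>
      \<epsilon>' (FO F Y) \<bullet>\<^bsub>C\<^esub> (Idn C (FO F V) \<star>\<^bsub>C\<^esub> a) = FA F (\<epsilon> Y) \<bullet>\<^bsub>C\<^esub> inv_arrow C (Xi F V ?W))"
    using pres VO G G' unfolding preserves_left_inner_homs_def F_simps(1) by blast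
  then have "iso_arrow C (Arrow (Rs ?W) ?W' \<phi>)" unfolding f(1)[folded g(2)] F_simps(1) the .
  note i = iso_arrow_inverse[OF this iffD2[OF C_homset_Arrow[OF bm_Rs[OF W] W'] \<phi>(1)]]
  have "left_univ (Rs V) (Rs Y) (Rs ?W) (fn (\<epsilon> Y))"
    by (rule left_univ_iso[OF g' bm_Rs[OF hmV] bm_Rs[OF Y] bm_Rs[OF W] \<phi>(1) i(2)]) (use i(3,4) \<phi>(2) f(2) in auto)
  then show thesis using that g(1) by blast
qed

end

section \<open>Invertibility of half-braidings\<close>

context bialg begin

lemma lu_pt':
  assumes M: "bm M" and i: "i \<in> carrier I" and m: "m \<in> carrier M"
  shows "lu M (pt I M i m) = la M (decoding U (carrier R) i) m" "decoding U (carrier R) i \<in> carrier R" "\<iota> (decoding U (carrier R) i) = i"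
  using i lu_pt[OF M _ m] by (auto simp: I_carrier)

lemma right_lin_pt:
  assumes f: "rlin (tens M N) P f" and M: "bm M" and N: "bm N" and m: "m \<in> carrier M"
  shows "rlin N P (\<lambda>n. f (pt M N m n))"
  by (rule rlin_comp[OF f rlin_pt]) (use M N m in auto)

lemma left_lin_pt:
  assumes f: "llin (tens M N) P f" and M: "bm M" and N: "bm N" and n: "n \<in> carrier N"
  shows "llin M P (\<lambda>m. f (pt M N m n))"
  by (rule llin_comp[OF f llin_pt]) (use M N n in auto)

end

context bialg_reg begin

text \<open>A dual basis of H carried over to V by a \<mapsto> au. The map \<open>f\<close> is
  either embedding of the base ring into the enveloping algebra, so that both finiteness conditions
  are covered.\<close>

lemma dual_basis:
  fixes f :: "'r \<Rightarrow> 'r env"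
  assumes "fg_projective B (module_along (\<lambda>r. env_map H (f r)) A)" and f: "\<And>r. r \<in> carrier B \<Longrightarrow> f r \<in> carrier E"
  obtains n :: nat and h \<pi> where "\<forall>j<n. h j \<in> carrier V" "\<forall>j<n. \<pi> j \<in> hom V (add_monoid B)"
    "\<forall>j<n. \<forall>r\<in>carrier B. \<forall>v\<in>carrier V. \<pi> j (scal (Rs V) (f r) v) = r \<otimes>\<^bsub>B\<^esub> \<pi> j v"
    "\<forall>v\<in>carrier V. v = finprod V (\<lambda>j. scal (Rs V) (f (\<pi> j v)) (h j)) {..<n}"
proof -
  let ?P = "module_along (\<lambda>r. env_map H (f r)) A"
  have P: "left_module B ?P" using assms(1) by (simp add: fg_projective_def)
  have Ps: "carrier ?P = carrier A" "monoid.mult ?P = ring.add A" "scal ?P r a = env_map H (f r) \<otimes>\<^bsub>A\<^esub> a" for r a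
    by (simp_all add: module_along_def)
  obtain n h0 \<pi>0 where *: "\<forall>j<(n::nat). h0 j \<in> carrier ?P" "\<forall>j<n. \<pi>0 j \<in> hom ?P (add_monoid B)"
    "\<forall>j<n. \<forall>a\<in>carrier B. \<forall>x\<in>carrier ?P. \<pi>0 j (scal ?P a x) = a \<otimes>\<^bsub>B\<^esub> \<pi>0 j x"
    "\<forall>x\<in>carrier ?P. x = finprod ?P (\<lambda>j. scal ?P (\<pi>0 j x) (h0 j)) {..<n}"
    by (rule fg_projective_dual_basis[OF assms(1)])
  note h0 = *(1)[rule_format] and \<pi>0 = *(2,3)[rule_format] and ex = *(4)[rule_format]
  define c where "c = inv_into (carrier A) (\<lambda>a. scal V a u)"
  have c: "c (scal V a u) = a" if "a \<in> carrier A" for a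
    using that Vfree inv_into_f_f[of "\<lambda>a. scal V a u" "carrier A" a] by (simp add: c_def free1_def bij_betw_def)
  note lm = left_moduleD[OF hm_lmod[OF hmV]]
  have cv: "c v \<in> carrier A" "scal V (c v) u = v" if v: "v \<in> carrier V" for v
  proof -
    obtain a where "a \<in> carrier A" "v = scal V a u" using V_cases[OF v] .
    then show "c v \<in> carrier A" "scal V (c v) u = v" using c by simp_all
  qed
  have c_add: "c (v \<otimes>\<^bsub>V\<^esub> w) = c v \<oplus>\<^bsub>A\<^esub> c w" if "v \<in> carrier V" "w \<in> carrier V" for v w
    using c[of "c v \<oplus>\<^bsub>A\<^esub> c w"] lm(5)[OF cv(1)[OF that(1)] cv(1)[OF that(2)] u_closed] cv that by simp
  have sh: "(\<lambda>a. scal V a u) \<in> hom ?P V"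
    by (rule homI) (simp_all add: Ps lm(3) lm(5))
  show thesis
  proof (rule that[of n "\<lambda>j. scal V (h0 j) u" "\<lambda>j v. \<pi>0 j (c v)"]; intro allI impI ballI)
    show "scal V (h0 j) u \<in> carrier V" if "j < n" for j using h0[OF that] lm(3) by (simp add: Ps)
    show "(\<lambda>v. \<pi>0 j (c v)) \<in> hom V (add_monoid B)" if "j < n" for j
      by (rule hom_trans[OF \<pi>0(1)[OF that]]) (auto intro!: homI simp: Ps cv c_add)
    show "\<pi>0 j (c (scal (Rs V) (f r) v)) = r \<otimes>\<^bsub>B\<^esub> \<pi>0 j (c v)" if j: "j < n" and r: "r \<in> carrier B" and v: "v \<in> carrier V" for j r v
    proof -
      have "scal (Rs V) (f r) v = scal V (env_map H (f r) \<otimes>\<^bsub>A\<^esub> c v) u"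
        using lm(6)[of "env_map H (f r)" "c v" u] cv[OF v] f[OF r] v by (simp add: Rs_scal)
      then have "c (scal (Rs V) (f r) v) = scal ?P r (c v)" using c cv[OF v] f[OF r] by (simp add: Ps)
      then show ?thesis using \<pi>0(2)[OF j r] cv[OF v] by (simp add: Ps)
    qed
    fix v assume v: "v \<in> carrier V"
    have cvP: "c v \<in> carrier ?P" using cv[OF v] by (simp add: Ps)
    have \<pi>c: "\<pi>0 j (c v) \<in> carrier B" if "j < n" for j using hom_closed[OF \<pi>0(1)[OF that] cvP] by simp
    have "v = (\<lambda>a. scal V a u) (c v)" using cv[OF v] by simp
    also have "c v = finprod ?P (\<lambda>j. scal ?P (\<pi>0 j (c v)) (h0 j)) {..<n}" by (rule ex[OF cvP])
    also have "(\<lambda>a. scal V a u) \<dots> = finprod V (\<lambda>j. scal V (scal ?P (\<pi>0 j (c v)) (h0 j)) u) {..<n}"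
      by (rule hom_finprod[OF sh left_moduleD(2)[OF P] lm(2)]) (use h0 f \<pi>c left_moduleD(3)[OF P] in auto)
    also have "\<dots> = finprod V (\<lambda>j. scal (Rs V) (f (\<pi>0 j (c v))) (scal V (h0 j) u)) {..<n}"
    proof -
      interpret VV: comm_group V by (rule lm(2))
      have t: "scal V (scal ?P (\<pi>0 j (c v)) (h0 j)) u = scal (Rs V) (f (\<pi>0 j (c v))) (scal V (h0 j) u)"
        and tc: "scal (Rs V) (f (\<pi>0 j (c v))) (scal V (h0 j) u) \<in> carrier V" if "j < n" for j
        using h0[OF that] f[OF \<pi>c[OF that]] lm(6)[of "env_map H (f (\<pi>0 j (c v)))" "h0 j" u] lm(3)
        by (simp_all add: Ps Rs_scal)
      show ?thesis by (rule VV.finprod_cong') (use t tc in auto)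
    qed
    finally show "v = finprod V (\<lambda>j. scal (Rs V) (f (\<pi>0 j (c v))) (scal V (h0 j) u)) {..<n}" .
  qed
qed

end

context bialg begin

text \<open>In X \<otimes> I one has x \<otimes> r = x r \<otimes> 1, so the unit axiom determines
  the component at the unit object completely.\<close>

lemma halfbraid_unit:
  assumes s: "halfbraid X s" and x: "x \<in> carrier X" and r: "r \<in> carrier R"
  shows "lu X (s HI (pt X I x (\<iota> r))) = ra X r x" "s HI (pt X I x one_I) = pt I X one_I x"
proof -
  note X = halfbraidD(1)[OF s]
  have "pt X I x (\<iota> r) = pt X I (ra X r x) one_I"
    using pt_add(3)[OF X bm_I x _ r, of one_I] r by (simp add: I_act)
  then show "lu X (s HI (pt X I x (\<iota> r))) = ra X r x" using halfbraidD(8)[OF s] x r X by simp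
  have "s HI (pt X I x one_I) \<in> carrier (tens I X)"
    using hom_closed[OF halfbraidD(3)[OF s hm_HI]] x X by (simp add: strictD(3))
  from lu_inv[OF X this] show "s HI (pt X I x one_I) = pt I X one_I x" using halfbraidD(8)[OF s x] by simp
qed

end

context bialg_reg begin

abbreviation "V' \<equiv> Rs V"

text \<open>With coevaluation \<Sigma> \<open>f j\<close> \<otimes> \<open>h j\<close>, the inverse
  sends v \<otimes> x to the sum over j of (ev \<otimes> X)(v \<otimes> \<sigma>(x \<otimes>
  \<open>f j\<close>)) \<otimes> \<open>h j\<close>, as for a dual object. Naturality of \<sigma>
  holds for H-linear maps only, and the coevaluation is merely an element \<open>cc\<close>. It is
  therefore sent by the H-linear map \<open>kp\<close> into the internal endomorphisms G of V, where
  it equals the value at 1 of the H-linear unit map \<open>et\<close>.\<close>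

lemma halfbraid_inverse:
  assumes "anti_hopf U k R H" and "right_finite k R H" and s: "halfbraid X s"
  obtains b where "b \<in> lmod_hom E (tens V' X) (tens X V')"
    "\<And>t. t \<in> carrier (tens X V') \<Longrightarrow> b (s V t) = t" "\<And>t. t \<in> carrier (tens V' X) \<Longrightarrow> s V (b t) = t"
proof -
  obtain D ev where DH: "left_univH V HI D ev" and "left_univ V' (Rs HI) (Rs D) ev" using dual_exists[OF assms(1) hm_HI] .
  then have Du: "left_univ V' I (Rs D) ev" by (simp add: strictD(3))
  obtain G eps where GH: "left_univH V V G eps" and Gu: "left_univ V' V' (Rs G) eps" using dual_exists[OF assms(1) hmV] .
  let ?D = "Rs D" and ?G = "Rs G"
  have hD: "hm D" and evA: "ev \<in> lmod_hom A (ht V D) HI" using DH by (auto simp: left_univH_def)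
  have hG: "hm G" using GH by (simp add: left_univH_def)
  note X = halfbraidD(1)[OF s]
  have b: "bm V'" "bm ?D" "bm ?G" "bm X" "bm I" using hD hG X by auto
  note evl = left_univD(3,4)[OF Du b(1,5)] and epsl = left_univD(3,4)[OF Gu b(1,1)]
  note lmV = left_moduleD[OF hm_lmod[OF hmV]]
  obtain n h \<pi> where *: "\<forall>j<(n::nat). h j \<in> carrier V" "\<forall>j<n. \<pi> j \<in> hom V (add_monoid R)"
    "\<forall>j<n. \<forall>r\<in>carrier R. \<forall>v\<in>carrier V. \<pi> j (la V' r v) = r \<otimes>\<^bsub>R\<^esub> \<pi> j v"
    "\<forall>v\<in>carrier V. v = finprod V (\<lambda>j. la V' (\<pi> j v) (h j)) {..<n}"
    by (rule dual_basis[OF assms(2)[unfolded right_finite_def] eL_closed])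
  note h = *(1)[rule_format] and \<pi> = *(2,3)[rule_format] and ex = *(4)[rule_format]
  have \<pi>c: "\<pi> j v \<in> carrier R" if "j < n" "v \<in> carrier V" for j v using hom_closed[OF \<pi>(1)[OF that(1)] that(2)] by simp
  \<comment> \<open>Each \<open>\<pi> j\<close> is a left linear map from V to R, hence evaluation
    at an element \<open>f j\<close> of the left inner hom D.\<close>
  have "\<exists>e\<in>carrier D. \<forall>v\<in>carrier V. ev (pt V' ?D v e) = \<iota> (\<pi> j v)" if j: "j < n" for j
  proof -
    have "llin V' I (\<lambda>v. \<iota> (\<pi> j v))"
    proof (rule llinI)
      show "(\<lambda>v. \<iota> (\<pi> j v)) \<in> hom V' I" using hom_trans[OF \<iota>_hom \<pi>(1)[OF j]] by simp
    qed (use j in \<open>simp add: \<pi> I_act \<pi>c\<close>)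
    from left_univ_surj[OF Du b(1,5) this] show ?thesis by (metis Rs_simps(1))
  qed
  then obtain f where f: "\<And>j. j < n \<Longrightarrow> f j \<in> carrier D" "\<And>j v. j < n \<Longrightarrow> v \<in> carrier V \<Longrightarrow> ev (pt V' ?D v (f j)) = \<iota> (\<pi> j v)"
    by metis
  define cf where "cf v e = decoding U (carrier R) (ev (pt V' ?D v e))" for v e
  have evc: "ev (pt V' ?D v e) \<in> carrier I" if "v \<in> carrier V" "e \<in> carrier D" for v e
    using llin_closed[OF evl(1)] that b by simp
  have cf: "cf v e \<in> carrier R" "bm M \<Longrightarrow> m \<in> carrier M \<Longrightarrow> lu M (pt I M (ev (pt V' ?D v e)) m) = la M (cf v e) m" if "v \<in> carrier V" "e \<in> carrier D" for v e M m
    using lu_pt'[OF _ evc[OF that]] lu_pt'(2)[OF bm_I evc[OF that], of one_I] by (auto simp: cf_def)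
  have idA: "idr V \<in> lmod_hom A V V" using HC.Idn_hom[of V] hmV unfolding HC_homset hm_Obj by simp

  \<comment> \<open>The \<open>H\<close>-linear map from \<open>V\<^sup>* \<otimes> V\<close> to the endomorphisms of \<open>V\<close> which sends \<open>f \<otimes> w\<close> to \<open>v \<mapsto> ev (v \<otimes> f) w\<close>
    maps the sum of all \<open>f j \<otimes> h j\<close> to the identity. Naturality of \<open>s\<close> for it gives \<open>s V (b t) = t\<close>, and naturality
    for \<open>ev\<close> gives \<open>b (s V t) = t\<close>.\<close>
  let ?S = "tens V' (tens ?D V')"
  define F1 where "F1 = compose (carrier (ht V (ht D V))) (compose (carrier (ht (ht V D) V)) (lu V') (tm (tens V' ?D) V' I V' ev (idr V))) (ai V' ?D V')"
  have F1A: "F1 \<in> lmod_hom A (ht V (ht D V)) V"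
  proof -
    have "tm (Rs (ht V D)) V' (Rs HI) V' ev (idr V) \<in> lmod_hom A (ht (ht V D) V) (ht HI V)"
      by (rule TensA_HC(2)) (use hD evA idA in auto)
    then have t: "tm (tens V' ?D) V' I V' ev (idr V) \<in> lmod_hom A (ht (ht V D) V) (ht HI V)" using hD by (simp add: strictD)
    show ?thesis unfolding F1_def
      by (intro lmod_hom_comp[OF hm_lmod Assoc_HC(2)] lmod_hom_comp[OF hm_lmod t] lu_HC) (use hD in auto)
  qed
  have F1: "F1 (pt V' (tens ?D V') v (pt ?D V' e w)) = la V' (cf v e) w" if "v \<in> carrier V" "e \<in> carrier D" "w \<in> carrier V" for v e w
  proof -
    have i: "llin V' V' (idr V)" using lin_idr(1)[OF b(1)] by simp
    have "F1 (pt V' (tens ?D V') v (pt ?D V' e w)) = lu V' (pt I V' (ev (pt V' ?D v e)) w)"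
      using that b hD i evl by (simp add: F1_def compose_eq strictD(1) ai_pt tm_pt)
    then show ?thesis using cf that b by simp
  qed
  obtain kp where kp: "kp \<in> lmod_hom A (ht D V) G"
    and kpe: "\<And>v w. v \<in> carrier V \<Longrightarrow> w \<in> carrier (ht D V) \<Longrightarrow> eps (pt V' ?G v (kp w)) = F1 (pt V' (Rs (ht D V)) v w)"
    using GH F1A hm_ht[OF hD hmV] unfolding left_univH_def by (metis (no_types, lifting))
  have kpl: "llin (tens ?D V') ?G kp" "rlin (tens ?D V') ?G kp" using Rs_lin[OF kp] hD hG by (simp_all add: strictD(1))
  have kpe': "eps (pt V' ?G v (kp (pt ?D V' e w))) = la V' (cf v e) w" if "v \<in> carrier V" "e \<in> carrier D" "w \<in> carrier V" for v e w
    using kpe[of v "pt ?D V' e w"] F1[OF that] that hD b by (simp add: strictD(1))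
  obtain et where et: "et \<in> lmod_hom A HI G"
    and ete: "\<And>v w. v \<in> carrier V \<Longrightarrow> w \<in> carrier HI \<Longrightarrow> eps (pt V' ?G v (et w)) = ru V' (pt V' (Rs HI) v w)"
    using GH ru_HC[OF hmV] hm_HI unfolding left_univH_def by (metis (no_types, lifting))
  have etl: "llin I ?G et" "rlin I ?G et" using Rs_lin[OF et] hG by (simp_all add: strictD(3))
  have ete': "eps (pt V' ?G v (et one_I)) = v" if "v \<in> carrier V" for v
    using ete[OF that, of one_I] ru_pt[OF b(1) R.one_closed, of v] that b by (simp add: strictD(3) act_one)
  have etc: "et one_I \<in> carrier G" using lmod_homD(4)[OF et] by simp

  define cc where "cc = finprod (tens ?D V') (\<lambda>j. pt ?D V' (f j) (h j)) {..<n}"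
  have cct: "(\<lambda>j. pt ?D V' (f j) (h j)) \<in> {..<n} \<rightarrow> carrier (tens ?D V')" using f h b by auto
  interpret DV: comm_group "tens ?D V'" using b by simp
  have ccc: "cc \<in> carrier (tens ?D V')" unfolding cc_def using cct by (rule DV.finprod_closed)
  \<comment> \<open>Elements of G are equal when they evaluate equally on every \<open>v\<close>.
    The evaluation of \<open>kp cc\<close> is the dual basis expansion of \<open>v\<close>.\<close>
  have kpcc: "kp cc = et one_I"
  proof (rule left_univ_inj[OF Gu b(1,1)])
    show "kp cc \<in> carrier ?G" "et one_I \<in> carrier ?G" using etc llin_closed[OF kpl(1) ccc] by simp_all
    fix v assume "v \<in> carrier V'"
    then have v: "v \<in> carrier V" by simp
    have e: "(\<lambda>w. eps (pt V' ?G v (kp w))) \<in> hom (tens ?D V') V"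
      using hom_trans[OF rlin_hom[OF right_lin_pt[OF epsl(2) b(1,3)]] llin_hom[OF kpl(1)], of v] v by simp
    have "eps (pt V' ?G v (kp cc)) = finprod V (\<lambda>j. eps (pt V' ?G v (kp (pt ?D V' (f j) (h j))))) {..<n}"
      unfolding cc_def by (rule hom_finprod[OF e DV.comm_group_axioms lmV(2) cct])
    also have "\<dots> = finprod V (\<lambda>j. la V' (\<pi> j v) (h j)) {..<n}"
    proof -
      interpret VV: comm_group V by (rule lmV(2))
      have "cf v (f j) = \<pi> j v" if "j < n" for j using f(2)[OF that v] \<pi>c[OF that v] by (simp add: cf_def)
      moreover have "la V' (\<pi> j v) (h j) \<in> carrier V" if "j < n" for j using act_closed(1)[OF b(1) \<pi>c[OF that v], of "h j"] h[OF that] by simp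
      ultimately show ?thesis by (intro VV.finprod_cong') (auto simp: kpe' v f h)
    qed
    also have "\<dots> = v" using ex[OF v] by simp
    finally show "eps (pt V' ?G v (kp cc)) = eps (pt V' ?G v (et one_I))" using ete'[OF v] by simp
  qed

  let ?sD = "\<lambda>j x. s D (pt X ?D x (f j))"
  define B where "B j T = lu X (tm (tens V' ?D) X I X ev (\<lambda>x. x) (ai V' ?D X (tm V' X V' (tens ?D X) (\<lambda>x. x) (?sD j) T)))" for j T
  have sDl: "llin X (tens ?D X) (\<lambda>x. s D (pt X ?D x e))" if "e \<in> carrier D" for e
    using left_lin_pt[OF halfbraidD(4)[OF s hD] b(4,2)] that by simp
  have sVl: "llin X (tens V' X) (\<lambda>x. s V (pt X V' x w))" if "w \<in> carrier V" for w
    using left_lin_pt[OF halfbraidD(4)[OF s hmV] b(4,1)] that by simp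
  have Bh: "B j \<in> hom (tens V' X) X" if j: "j < n" for j
    unfolding B_def by (rule hom_trans[OF lu_hom hom_trans[OF tm_hom hom_trans[OF ai_hom tm_hom]]])
      (use b evl sDl[OF f(1)[OF j]] in \<open>auto simp: llin_id rlin_id\<close>)
  define sb where "sb T = finprod (tens X V') (\<lambda>j. pt X V' (B j T) (h j)) {..<n}" for T
  have gXV: "comm_group (tens X V')" using b by simp
  have sbh: "sb \<in> hom (tens V' X) (tens X V')"
    unfolding sb_def using h b by (intro hom_finprod_hom[OF _ gXV] hom_trans[OF pt_hom(2) Bh]) auto
  note sVh = halfbraidD(3)[OF s hmV]

  have left: "sb (s V t) = t" if t: "t \<in> carrier (tens X V')" for t
  proof (rule tens_eqI[where f = "\<lambda>t. sb (s V t)" and g = "\<lambda>t. t", OF b(4,1) hom_trans[OF sbh sVh] hom_id _ t])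
    fix x v assume x: "x \<in> carrier X" and "v \<in> carrier V'"
    then have v: "v \<in> carrier V" by simp
    \<comment> \<open>Multiplicativity combines the braidings at V and D into the one at V \<otimes>
      D. Naturality along \<open>ev\<close> then reduces it to the unit object, where it is
      known.\<close>
    have Bx: "B j (s V (pt X V' x v)) = ra X (\<pi> j v) x" if j: "j < n" for j
    proof -
      let ?w = "pt V' ?D v (f j)"
      have w: "?w \<in> carrier (ht V D)" using v f(1)[OF j] b hD by simp
      have c: "s (ht V D) (pt X (tens V' ?D) x ?w) \<in> carrier (tens (tens V' ?D) X)"
        using hom_closed[OF halfbraidD(3)[OF s hm_ht[OF hmV hD]]] x w b hD by (simp add: strictD(1))
      have "B j (s V (pt X V' x v)) = lu X (tm (tens V' ?D) X I X ev (\<lambda>x. x) (s (ht V D) (pt X (tens V' ?D) x ?w)))"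
        unfolding B_def halfbraidD(7)[OF s hmV hD x v f(1)[OF j], symmetric] using ai_props(3)[OF b(1,2,4) c] by simp
      also have "tm (tens V' ?D) X I X ev (\<lambda>x. x) (s (ht V D) (pt X (tens V' ?D) x ?w)) = s HI (pt X I x (ev ?w))"
        using halfbraidD(6)[OF s hm_ht[OF hmV hD] hm_HI evA x w] hD by (simp add: strictD)
      also have "lu X (s HI (pt X I x (ev ?w))) = ra X (\<pi> j v) x"
        using halfbraid_unit(1)[OF s x \<pi>c[OF j v]] f(2)[OF j v] by simp
      finally show ?thesis .
    qed
    have "sb (s V (pt X V' x v)) = finprod (tens X V') (\<lambda>j. pt X V' x (la V' (\<pi> j v) (h j))) {..<n}"
    proof -
      interpret XV: comm_group "tens X V'" by (rule gXV)
      have "pt X V' (B j (s V (pt X V' x v))) (h j) = pt X V' x (la V' (\<pi> j v) (h j))" if j: "j < n" for j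
        unfolding Bx[OF j] using pt_add(3)[OF b(4,1) x, of "h j" "\<pi> j v"] h[OF j] \<pi>c[OF j v] by simp
      moreover have "pt X V' x (la V' (\<pi> j v) (h j)) \<in> carrier (tens X V')" if j: "j < n" for j
        using x b act_closed(1)[OF b(1) \<pi>c[OF j v], of "h j"] h[OF j] by simp
      ultimately show ?thesis unfolding sb_def by (intro XV.finprod_cong') auto
    qed
    also have "\<dots> = pt X V' x (finprod V' (\<lambda>j. la V' (\<pi> j v) (h j)) {..<n})"
      by (rule hom_finprod[OF pt_hom(1)[OF b(4,1) x] bm_group[OF b(1)] gXV, symmetric])
        (use act_closed(1)[OF b(1) \<pi>c[OF _ v]] h in auto)
    also have "finprod V' (\<lambda>j. la V' (\<pi> j v) (h j)) {..<n} = finprod V (\<lambda>j. la V' (\<pi> j v) (h j)) {..<n}"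
      by (simp add: finprod_def)
    also have "\<dots> = v" using ex[OF v] by simp
    finally show "sb (s V (pt X V' x v)) = pt X V' x v" .
  qed

  have right: "s V (sb t) = t" if t: "t \<in> carrier (tens V' X)" for t
  proof (rule tens_eqI[where f = "\<lambda>t. s V (sb t)" and g = "\<lambda>t. t", OF b(1,4) hom_trans[OF sVh sbh] hom_id _ t])
    fix v x assume "v \<in> carrier V'" and x: "x \<in> carrier X"
    then have v: "v \<in> carrier V" by simp
    have ev_l: "rlin ?G V' (\<lambda>g. eps (pt V' ?G v g))" using right_lin_pt[OF epsl(2) b(1,3)] v by simp
    \<comment> \<open>\<Psi> sends (e \<otimes> w) \<otimes> x to ev(v \<otimes> e) w \<otimes> x.
      It is written through \<open>kp\<close> so that naturality of \<sigma> along \<open>kp\<close>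
      can be used.\<close>
    define \<Psi> where "\<Psi> t = tm ?G X V' X (\<lambda>g. eps (pt V' ?G v g)) (\<lambda>x. x) (tm (tens ?D V') X ?G X kp (\<lambda>x. x) t)" for t
    have \<Psi>h: "\<Psi> \<in> hom (tens (tens ?D V') X) (tens V' X)"
      unfolding \<Psi>_def by (rule hom_trans[OF tm_hom tm_hom]) (use b ev_l kpl in \<open>auto simp: llin_id\<close>)
    have \<Psi>0: "\<Psi> (ai ?D V' X (pt ?D (tens V' X) e y)) = la (tens V' X) (cf v e) y" if e: "e \<in> carrier D" and y: "y \<in> carrier (tens V' X)" for e y
    proof (rule tens_eqI[where f = "\<lambda>y. \<Psi> (ai ?D V' X (pt ?D (tens V' X) e y))" and g = "la (tens V' X) (cf v e)", OF b(1,4) _ _ _ y])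
      have e': "e \<in> carrier ?D" using e by simp
      show "(\<lambda>y. \<Psi> (ai ?D V' X (pt ?D (tens V' X) e y))) \<in> hom (tens V' X) (tens V' X)"
        by (rule hom_trans[OF \<Psi>h hom_trans[OF ai_hom pt_hom(1)]]) (use b e' in auto)
      show "la (tens V' X) (cf v e) \<in> hom (tens V' X) (tens V' X)" using act_hom(1) cf(1)[OF v e] b by simp
      fix w x' assume "w \<in> carrier V'" and x': "x' \<in> carrier X"
      then have w: "w \<in> carrier V" by simp
      have kc: "kp (pt ?D V' e w) \<in> carrier G" using llin_closed[OF kpl(1)] e w b by simp
      show "\<Psi> (ai ?D V' X (pt ?D (tens V' X) e (pt V' X w x'))) = la (tens V' X) (cf v e) (pt V' X w x')"
        using e w x' b kc ev_l kpl kpe'[OF v e w] cf(1)[OF v e] by (simp add: ai_pt \<Psi>_def tm_pt llin_id tens_act)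
    qed
    have claim: "s V (pt X V' (lu X (tm (tens V' ?D) X I X ev (\<lambda>x. x) (ai V' ?D X (pt V' (tens ?D X) v t)))) w)
        = \<Psi> (ai ?D V' X (tm ?D X ?D (tens V' X) (\<lambda>x. x) (\<lambda>x. s V (pt X V' x w)) t))"
      if w: "w \<in> carrier V" and t: "t \<in> carrier (tens ?D X)" for w t
    proof -
      let ?f = "\<lambda>t. s V (pt X V' (lu X (tm (tens V' ?D) X I X ev (\<lambda>x. x) (ai V' ?D X (pt V' (tens ?D X) v t)))) w)"
      let ?g = "\<lambda>t. \<Psi> (ai ?D V' X (tm ?D X ?D (tens V' X) (\<lambda>x. x) (\<lambda>x. s V (pt X V' x w)) t))"
      have vw: "v \<in> carrier V'" "w \<in> carrier V'" using v w by auto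
      show ?thesis
      proof (rule tens_eqI[where f = ?f and g = ?g, OF b(2,4) _ _ _ t])
        show "?f \<in> hom (tens ?D X) (tens V' X)"
          by (rule hom_trans[OF sVh hom_trans[OF pt_hom(2) hom_trans[OF lu_hom hom_trans[OF tm_hom hom_trans[OF ai_hom pt_hom(1)]]]]])
            (use b vw evl in \<open>auto simp: llin_id\<close>)
        show "?g \<in> hom (tens ?D X) (tens V' X)"
          by (rule hom_trans[OF \<Psi>h hom_trans[OF ai_hom tm_hom]]) (use b sVl[OF w] in \<open>auto simp: rlin_id\<close>)
        fix e x' assume "e \<in> carrier ?D" and x': "x' \<in> carrier X"
        then have e: "e \<in> carrier D" by simp
        have sc: "s V (pt X V' x' w) \<in> carrier (tens V' X)" using llin_closed[OF sVl[OF w] x'] .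
        have "?f (pt ?D X e x') = s V (pt X V' (la X (cf v e) x') w)"
          using e x' v b evl by (simp add: ai_pt tm_pt llin_id cf)
        also have "\<dots> = la (tens V' X) (cf v e) (s V (pt X V' x' w))" using llinD[OF sVl[OF w] cf(1)[OF v e] x'] .
        also have "\<dots> = ?g (pt ?D X e x')"
          using \<Psi>0[OF e sc] e x' b sVl[OF w] by (simp add: tm_pt rlin_id)
        finally show "?f (pt ?D X e x') = ?g (pt ?D X e x')" .
      qed
    qed
    have step: "s V (pt X V' (B j (pt V' X v x)) (h j)) = \<Psi> (s (ht D V) (pt X (tens ?D V') x (pt ?D V' (f j) (h j))))" if j: "j < n" for j
    proof -
      have tc: "?sD j x \<in> carrier (tens ?D X)" using llin_closed[OF sDl[OF f(1)[OF j]] x] .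
      have "B j (pt V' X v x) = lu X (tm (tens V' ?D) X I X ev (\<lambda>x. x) (ai V' ?D X (pt V' (tens ?D X) v (?sD j x))))"
        using v x b sDl[OF f(1)[OF j]] by (simp add: B_def tm_pt rlin_id)
      then have "s V (pt X V' (B j (pt V' X v x)) (h j)) = \<Psi> (ai ?D V' X (tm ?D X ?D (tens V' X) (\<lambda>x. x) (\<lambda>x. s V (pt X V' x (h j))) (?sD j x)))"
        using claim[OF h[OF j] tc] by simp
      also have "tm ?D X ?D (tens V' X) (\<lambda>x. x) (\<lambda>x. s V (pt X V' x (h j))) (?sD j x) = as ?D V' X (s (ht D V) (pt X (tens ?D V') x (pt ?D V' (f j) (h j))))"
        using halfbraidD(7)[OF s hD hmV x f(1)[OF j] h[OF j]] by simp
      also have "ai ?D V' X \<dots> = s (ht D V) (pt X (tens ?D V') x (pt ?D V' (f j) (h j)))"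
      proof (rule ai_props(3)[OF b(2,1,4)])
        show "s (ht D V) (pt X (tens ?D V') x (pt ?D V' (f j) (h j))) \<in> carrier (tens (tens ?D V') X)"
          using hom_closed[OF halfbraidD(3)[OF s hm_ht[OF hD hmV]]] x f(1)[OF j] h[OF j] b hD by (simp add: strictD(1))
      qed
      finally show ?thesis .
    qed
    let ?\<chi> = "\<lambda>y. \<Psi> (s (ht D V) (pt X (tens ?D V') x y))"
    have sDVh: "s (ht D V) \<in> hom (tens X (tens ?D V')) (tens (tens ?D V') X)"
      using halfbraidD(3)[OF s hm_ht[OF hD hmV]] hD by (simp add: strictD(1))
    have \<chi>: "?\<chi> \<in> hom (tens ?D V') (tens V' X)"
      by (rule hom_trans[OF \<Psi>h hom_trans[OF sDVh pt_hom(1)]]) (use b x in auto)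
    have gVX: "comm_group (tens V' X)" using b by simp
    have pc: "(\<lambda>j. pt X V' (B j (pt V' X v x)) (h j)) \<in> {..<n} \<rightarrow> carrier (tens X V')"
      using h hom_closed[OF Bh] b v x by auto
    have "s V (sb (pt V' X v x)) = finprod (tens V' X) (\<lambda>j. s V (pt X V' (B j (pt V' X v x)) (h j))) {..<n}"
      unfolding sb_def by (rule hom_finprod[OF sVh gXV gVX pc])
    also have "\<dots> = finprod (tens V' X) (\<lambda>j. ?\<chi> (pt ?D V' (f j) (h j))) {..<n}"
    proof -
      interpret VX: comm_group "tens V' X" by (rule gVX)
      show ?thesis using step hom_closed[OF \<chi>] cct by (intro VX.finprod_cong') auto
    qed
    also have "\<dots> = ?\<chi> cc" unfolding cc_def by (rule hom_finprod[OF \<chi> DV.comm_group_axioms gVX cct, symmetric])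
    \<comment> \<open>Naturality along \<open>kp\<close> brings \<open>cc\<close> into G, where it
      becomes \<open>et one_I\<close>. Naturality along \<open>et\<close> then leads to the
      component at the unit object.\<close>
    also have "tm (tens ?D V') X ?G X kp (\<lambda>x. x) (s (ht D V) (pt X (tens ?D V') x cc)) = s G (pt X ?G x (kp cc))"
      using halfbraidD(6)[OF s hm_ht[OF hD hmV] hG kp x] ccc hD by (simp add: strictD(1))
    then have "?\<chi> cc = tm ?G X V' X (\<lambda>g. eps (pt V' ?G v g)) (\<lambda>x. x) (s G (pt X ?G x (et one_I)))"
      unfolding \<Psi>_def kpcc by simp
    also have "s G (pt X ?G x (et one_I)) = tm I X ?G X et (\<lambda>x. x) (pt I X one_I x)"
      using halfbraidD(6)[OF s hm_HI hG et x, of one_I] halfbraid_unit(2)[OF s x R.one_closed] by (simp add: strictD(3))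
    also have "\<dots> = pt ?G X (et one_I) x" using b etl x by (simp add: tm_pt llin_id)
    also have "tm ?G X V' X (\<lambda>g. eps (pt V' ?G v g)) (\<lambda>x. x) \<dots> = pt V' X v x"
      using b ev_l x etc ete'[OF v] by (simp add: tm_pt llin_id)
    finally show "s V (sb (pt V' X v x)) = pt V' X v x" .
  qed

  have bVX: "bm (tens V' X)" "bm (tens X V')" using b by auto
  show thesis
  proof (rule that[of "\<lambda>t\<in>carrier (tens V' X). sb t"])
    have sc: "s V t \<in> carrier (tens V' X)" if "t \<in> carrier (tens X V')" for t using hom_closed[OF sVh that] .
    show "(\<lambda>t\<in>carrier (tens V' X). sb t) \<in> lmod_hom E (tens V' X) (tens X V')"
      by (rule lmod_inverse[OF halfbraidD(2)[OF s hmV] bm_lmod[OF bVX(2)] bm_lmod[OF bVX(1)]])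
        (use left right sc hom_closed[OF sbh] in simp_all)
    show "(\<lambda>t\<in>carrier (tens V' X). sb t) (s V t) = t" if "t \<in> carrier (tens X V')" for t using left[OF that] sc[OF that] by simp
    show "s V ((\<lambda>t\<in>carrier (tens V' X). sb t) t) = t" if "t \<in> carrier (tens V' X)" for t using right[OF that] that by simp
  qed
qed

end

section \<open>The half-braiding on a right inner hom\<close>

context bimods begin

text \<open>Naturality of the associator for maps that need not be arrows: the outer two are linear
  only on the side facing the middle factor. It is checked on pure tensors, as categorical
  naturality speaks about bimodule maps only.\<close>

lemma as_nat:
  assumes b: "bm L" "bm M" "bm N" "bm L'" "bm M'" "bm N'"
    and l: "rlin L L' f" "llin M M' g" "rlin M M' g" "llin N N' h" and t: "t \<in> carrier (tens (tens L M) N)"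
  shows "as L' M' N' (tm (tens L M) N (tens L' M') N' (tm L M L' M' f g) h t)
    = tm L (tens M N) L' (tens M' N') f (tm M N M' N' g h) (as L M N t)"
proof -
  have fg: "rlin (tens L M) (tens L' M') (tm L M L' M' f g)" by (rule tm_rlin) (use b l in auto)
  have gh: "llin (tens M N) (tens M' N') (tm M N M' N' g h)" by (rule tm_llin) (use b l in auto)
  have bb: "bm (tens L M)" "bm (tens L' M')" "bm (tens M N)" "bm (tens M' N')" "bm (tens L' (tens M' N'))" using b by auto
  show ?thesis
    by (rule tens3_eqI'[where f = "\<lambda>t. as L' M' N' (tm (tens L M) N (tens L' M') N' (tm L M L' M' f g) h t)"
          and g = "\<lambda>t. tm L (tens M N) L' (tens M' N') f (tm M N M' N' g h) (as L M N t)",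
          OF b(1-3) hom_trans[OF as_hom tm_hom] hom_trans[OF tm_hom as_hom] bm_group[OF bb(5)] _ t])
      (use b bb l fg gh in \<open>simp_all add: tm_pt as_pt rlin_closed llin_closed\<close>)
qed

end

context bialg begin

text \<open>The half-braiding of P \<otimes> X in the weak centralizer, as a function: braid W past
  X, then past P.\<close>

definition tens_braid where
  "tens_braid P p X s W t = as (Rs W) P X (tm (tens P (Rs W)) X (tens (Rs W) P) X (p W) (\<lambda>x. x) (ai P (Rs W) X
     (tm P (tens X (Rs W)) P (tens (Rs W) X) (\<lambda>x. x) (s W) (as P X (Rs W) t))))"

definition braid_mor where
  "braid_mor P p Q q f \<longleftrightarrow> f \<in> lmod_hom E P Q \<and> (\<forall>W. hm W \<longrightarrow> (\<forall>t\<in>carrier (tens P (Rs W)).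
     tm (Rs W) P (Rs W) Q (\<lambda>x. x) f (p W t) = q W (tm P (Rs W) Q (Rs W) f (\<lambda>x. x) t)))"

lemma halfbraid_nat:
  assumes s: "halfbraid X s" and W: "hm W" "hm W'" and f: "f \<in> lmod_hom A W W'" and t: "t \<in> carrier (tens X (Rs W))"
  shows "s W' (tm X (Rs W) X (Rs W') (\<lambda>x. x) f t) = tm (Rs W) X (Rs W') X f (\<lambda>x. x) (s W t)"
proof -
  note X = halfbraidD(1)[OF s] and l = Rs_lin[OF f W]
  note h = halfbraidD(3)[OF s W(1)] halfbraidD(3)[OF s W(2)]
  have b: "bm (Rs W)" "bm (Rs W')" using W by auto
  show ?thesis
    by (rule tens_eqI[where f = "\<lambda>t. s W' (tm X (Rs W) X (Rs W') (\<lambda>x. x) f t)" and g = "\<lambda>t. tm (Rs W) X (Rs W') X f (\<lambda>x. x) (s W t)",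
        OF X b(1) hom_trans[OF h(2) tm_hom] hom_trans[OF tm_hom h(1)] _ t])
      (use X b l halfbraidD(6)[OF s W f] in \<open>simp_all add: tm_pt rlin_id llin_id\<close>)
qed

lemma halfbraid_mult:
  assumes s: "halfbraid X s" and W: "hm W" "hm W'" and t: "t \<in> carrier (tens X (Rs W))" and w: "w \<in> carrier W'"
  shows "as (Rs W) (Rs W') X (s (ht W W') (as X (Rs W) (Rs W') (pt (tens X (Rs W)) (Rs W') t w)))
    = tm (Rs W) X (Rs W) (tens (Rs W') X) (\<lambda>x. x) (\<lambda>x. s W' (pt X (Rs W') x w)) (s W t)"
proof -
  note X = halfbraidD(1)[OF s]
  have b: "bm (Rs W)" "bm (Rs W')" "bm (tens X (Rs W))" using W X by auto
  have w': "w \<in> carrier (Rs W')" using w by simp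
  have sh: "s (ht W W') \<in> hom (tens X (tens (Rs W) (Rs W'))) (tens (tens (Rs W) (Rs W')) X)"
    using halfbraidD(3)[OF s hm_ht[OF W]] W by (simp add: strictD(1))
  have l: "llin X (tens (Rs W') X) (\<lambda>x. s W' (pt X (Rs W') x w))"
    using left_lin_pt[OF halfbraidD(4)[OF s W(2)] X b(2) w'] .
  show ?thesis
    by (rule tens_eqI[where f = "\<lambda>t. as (Rs W) (Rs W') X (s (ht W W') (as X (Rs W) (Rs W') (pt (tens X (Rs W)) (Rs W') t w)))"
        and g = "\<lambda>t. tm (Rs W) X (Rs W) (tens (Rs W') X) (\<lambda>x. x) (\<lambda>x. s W' (pt X (Rs W') x w)) (s W t)",
        OF X b(1) hom_trans[OF as_hom hom_trans[OF sh hom_trans[OF as_hom pt_hom(2)]]] hom_trans[OF tm_hom halfbraidD(3)[OF s W(1)]] _ t])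
      (use X b w' l halfbraidD(7)[OF s W _ _ w] in \<open>simp_all add: as_pt rlin_id\<close>)
qed

end

text \<open>\<open>sX\<close> and \<open>sY\<close> are the half-braidings \<sigma> and \<tau>, and
  \<open>ep\<close> is the counit \<epsilon>. Only the inverse \<open>sb\<close> of \<sigma> at V is
  assumed; for a general module a left inverse \<open>qw\<close> is derived from it.\<close>

locale hom_braid = bialg_reg k R U H V u
  for k :: "'k ring" and R :: "('k, 'r) module" and U :: "'u set set" and H :: "('k, 'r, 'h, 'u) bialgebroid_data"
    and V :: "('h, 'u) lmod" and u :: 'u +
  fixes X :: "('r env, 'u) lmod" and sX and Y :: "('r env, 'u) lmod" and sY and Z :: "('r env, 'u) lmod" and ep sb :: "'u \<Rightarrow> 'u"
  assumes lfin: "left_finite k R H" and sX: "halfbraid X sX" and sY: "halfbraid Y sY" and Zu: "right_univ X Y Z ep"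
    and sb: "sb \<in> lmod_hom E (tens V' X) (tens X V')"
    and sb_s: "t \<in> carrier (tens X V') \<Longrightarrow> sb (sX V t) = t" and s_sb: "t' \<in> carrier (tens V' X) \<Longrightarrow> sX V (sb t') = t'"
begin

lemma bms [simp]: "bm X" "bm Y" "bm Z" "bm V'"
  using halfbraidD(1)[OF sX] halfbraidD(1)[OF sY] right_univD(1)[OF Zu] by auto

lemma ep_lin: "llin (tens Z X) Y ep" "rlin (tens Z X) Y ep" "ep \<in> hom (tens Z X) Y"
  using right_univD[OF Zu] lmod_homD(1) by auto

lemma sb_lin: "llin (tens V' X) (tens X V') sb" "rlin (tens V' X) (tens X V') sb" "sb \<in> hom (tens V' X) (tens X V')"
  using sb by (auto simp: lmod_hom_iff llin_def)

abbreviation "px x e \<equiv> ep (pt Z X e x)"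

lemma px_llin: "x \<in> carrier X \<Longrightarrow> llin Z Y (px x)"
  by (rule left_lin_pt[OF ep_lin(1)]) auto

lemma px_rlin: "e \<in> carrier Z \<Longrightarrow> rlin X Y (\<lambda>x. px x e)"
  by (rule right_lin_pt[OF ep_lin(2)]) auto

text \<open>Evaluation of \<open>Z\<close> at \<open>x\<close>, resp. of \<open>e\<close> on \<open>X\<close>, next to an inert tensor factor \<open>W\<close>.\<close>

definition "cx W x = tm W Z W Y (\<lambda>v. v) (px x)"
definition "ee W e = tm X W Y W (\<lambda>x. px x e) (\<lambda>v. v)"

lemma cx:
  assumes "bm W" "x \<in> carrier X"
  shows "cx W x \<in> hom (tens W Z) (tens W Y)" "llin (tens W Z) (tens W Y) (cx W x)"
    "w \<in> carrier W \<Longrightarrow> e \<in> carrier Z \<Longrightarrow> cx W x (pt W Z w e) = pt W Y w (px x e)"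
    "t \<in> carrier (tens W Z) \<Longrightarrow> cx W x t \<in> carrier (tens W Y)"
  unfolding cx_def using assms px_llin[OF assms(2)]
  by (auto intro!: tm_hom tm_llin tm_closed simp: rlin_id llin_id tm_pt)

lemma ee:
  assumes "bm W" "e \<in> carrier Z"
  shows "ee W e \<in> hom (tens X W) (tens Y W)" "rlin (tens X W) (tens Y W) (ee W e)"
    "x \<in> carrier X \<Longrightarrow> w \<in> carrier W \<Longrightarrow> ee W e (pt X W x w) = pt Y W (px x e) w"
    "t \<in> carrier (tens X W) \<Longrightarrow> ee W e t \<in> carrier (tens Y W)"
  unfolding ee_def using assms px_rlin[OF assms(2)]
  by (auto intro!: tm_hom tm_rlin tm_closed simp: rlin_id llin_id tm_pt)

section \<open>Evaluation and scalars\<close>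

lemma ee_z:
  assumes W: "bm W" and t: "t \<in> carrier (tens X W)" and e: "e \<in> carrier Z"
  shows "e' \<in> carrier Z \<Longrightarrow> ee W (e \<otimes>\<^bsub>Z\<^esub> e') t = ee W e t \<otimes>\<^bsub>tens Y W\<^esub> ee W e' t"
    "r \<in> carrier R \<Longrightarrow> ee W (la Z r e) t = la (tens Y W) r (ee W e t)"
    "r \<in> carrier R \<Longrightarrow> ee W (ra Z r e) t = ee W e (la (tens X W) r t)"
proof -
  have YW: "bm (tens Y W)" "bm (tens X W)" using W by auto
  have pxc: "px x e \<in> carrier Y" if "x \<in> carrier X" "e \<in> carrier Z" for x e using llin_closed[OF px_llin[OF that(1)] that(2)] .
  show "ee W (e \<otimes>\<^bsub>Z\<^esub> e') t = ee W e t \<otimes>\<^bsub>tens Y W\<^esub> ee W e' t" if e': "e' \<in> carrier Z"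
    by (rule tens_eqI[where f = "ee W (e \<otimes>\<^bsub>Z\<^esub> e')" and g = "\<lambda>t. ee W e t \<otimes>\<^bsub>tens Y W\<^esub> ee W e' t",
        OF bms(1) W ee(1)[OF W] hom_sum_hom[OF ee(1)[OF W e] ee(1)[OF W e'] bm_group[OF YW(1)]] _ t])
      (use e e' W in \<open>simp_all add: ee pxc hom_mult[OF ep_lin(3)] pt_add\<close>)
  show "ee W (la Z r e) t = la (tens Y W) r (ee W e t)" if r: "r \<in> carrier R"
    by (rule tens_eqI[where f = "ee W (la Z r e)" and g = "\<lambda>t. la (tens Y W) r (ee W e t)",
        OF bms(1) W ee(1)[OF W] hom_trans[OF act_hom(1)[OF YW(1) r] ee(1)[OF W e]] _ t])
      (use e r W in \<open>simp_all add: ee llinD[OF px_llin] tens_act pxc\<close>)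
  show "ee W (ra Z r e) t = ee W e (la (tens X W) r t)" if r: "r \<in> carrier R"
    by (rule tens_eqI[where f = "ee W (ra Z r e)" and g = "\<lambda>t. ee W e (la (tens X W) r t)",
        OF bms(1) W ee(1)[OF W] hom_trans[OF ee(1)[OF W e] act_hom(1)[OF YW(2) r]] _ t])
      (use e r W in \<open>simp_all add: ee tens_act pt_add(3)\<close>)
qed

lemma ee_nat:
  assumes W: "bm W" "bm W'" and f: "llin W W' f" and e: "e \<in> carrier Z" and t: "t \<in> carrier (tens X W)"
  shows "tm Y W Y W' (\<lambda>y. y) f (ee W e t) = ee W' e (tm X W X W' (\<lambda>x. x) f t)"
  by (rule tens_eqI[where f = "\<lambda>t. tm Y W Y W' (\<lambda>y. y) f (ee W e t)" and g = "\<lambda>t. ee W' e (tm X W X W' (\<lambda>x. x) f t)",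
      OF bms(1) W(1) hom_trans[OF tm_hom ee(1)[OF W(1) e]] hom_trans[OF ee(1)[OF W(2) e] tm_hom] _ t])
    (use W f e llin_closed[OF px_llin] in \<open>simp_all add: ee tm_pt rlin_id llin_closed\<close>)

lemma cx_nat:
  assumes W: "bm W" "bm W'" and f: "rlin W W' f" and x: "x \<in> carrier X" and t: "t \<in> carrier (tens W Z)"
  shows "cx W' x (tm W Z W' Z f (\<lambda>e. e) t) = tm W Y W' Y f (\<lambda>y. y) (cx W x t)"
  by (rule tens_eqI[where f = "\<lambda>t. cx W' x (tm W Z W' Z f (\<lambda>e. e) t)" and g = "\<lambda>t. tm W Y W' Y f (\<lambda>y. y) (cx W x t)",
      OF W(1) bms(3) hom_trans[OF cx(1)[OF W(2) x] tm_hom] hom_trans[OF tm_hom cx(1)[OF W(1) x]] _ t])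
    (use W f x llin_closed[OF px_llin[OF x]] in \<open>simp_all add: cx tm_pt llin_id rlin_closed\<close>)

lemma cx_ra:
  assumes W: "bm W" and x: "x \<in> carrier X" and r: "r \<in> carrier R" and t: "t \<in> carrier (tens W Z)"
  shows "cx W x (ra (tens W Z) r t) = cx W (la X r x) t"
proof -
  have WZ: "bm (tens W Z)" and rx: "la X r x \<in> carrier X" using W x r by auto
  show ?thesis
    by (rule tens_eqI[where f = "\<lambda>t. cx W x (ra (tens W Z) r t)" and g = "cx W (la X r x)",
        OF W bms(3) hom_trans[OF cx(1)[OF W x] act_hom(2)[OF WZ r]] cx(1)[OF W rx] _ t])
      (use W x r in \<open>simp_all add: cx tens_act pt_add(3)\<close>)
qed

section \<open>Left finiteness: tensoring with V commutes with the inner hom\<close>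

text \<open>A dual basis for the right R-module structure of V, over which V \<otimes> N is
  balanced, gives coordinates \<open>q j N\<close> with v \<otimes> n \<mapsto>
  \<open>\<pi> j\<close> v n. They are right linear and natural in N for left linear maps, hence
  compatible with evaluations.\<close>

lemma coordinates:
  obtains n :: nat and h and q :: "nat \<Rightarrow> ('r env, 'u) lmod \<Rightarrow> 'u \<Rightarrow> 'u" where "\<And>j. j < n \<Longrightarrow> h j \<in> carrier V"
    "\<And>j N. j < n \<Longrightarrow> bm N \<Longrightarrow> rlin (tens V' N) N (q j N)"
    "\<And>N t. bm N \<Longrightarrow> t \<in> carrier (tens V' N) \<Longrightarrow> t = finprod (tens V' N) (\<lambda>j. pt V' N (h j) (q j N t)) {..<n}"
    "\<And>j N P f t. j < n \<Longrightarrow> bm N \<Longrightarrow> bm P \<Longrightarrow> llin N P f \<Longrightarrow> t \<in> carrier (tens V' N) \<Longrightarrow> f (q j N t) = q j P (tm V' N V' P (\<lambda>v. v) f t)"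
proof -
  have e: "fg_projective (opposite R) (module_along (\<lambda>r. env_map H (eR r)) A)"
    using lfin by (simp add: left_finite_def left_op_module_def)
  have er: "\<And>r. r \<in> carrier (opposite R) \<Longrightarrow> eR r \<in> carrier E" by simp
  obtain n h \<pi> where *: "\<forall>j<(n::nat). h j \<in> carrier V" "\<forall>j<n. \<pi> j \<in> hom V (add_monoid (opposite R))"
    "\<forall>j<n. \<forall>r\<in>carrier (opposite R). \<forall>v\<in>carrier V. \<pi> j (ra V' r v) = r \<otimes>\<^bsub>opposite R\<^esub> \<pi> j v"
    "\<forall>v\<in>carrier V. v = finprod V (\<lambda>j. ra V' (\<pi> j v) (h j)) {..<n}"
    by (rule dual_basis[OF e er])
  note h = *(1)[rule_format] and ex = *(4)[rule_format]
  have \<pi>: "\<pi> j v \<in> carrier R" "w \<in> carrier V \<Longrightarrow> \<pi> j (v \<otimes>\<^bsub>V\<^esub> w) = \<pi> j v \<oplus>\<^bsub>R\<^esub> \<pi> j w"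
    "r \<in> carrier R \<Longrightarrow> \<pi> j (ra V' r v) = \<pi> j v \<otimes>\<^bsub>R\<^esub> r" if "j < n" "v \<in> carrier V" for j v w r
    using *(2,3) that by (auto simp: hom_def)
  define q where "q j N = bl V' N N (\<lambda>v n. la N (\<pi> j v) n)" for j N
  have bal: "bal V' N N (\<lambda>v n. la N (\<pi> j v) n)" if "j < n" "bm N" for j N
    by (rule balI) (use that \<pi>[OF that(1)] in \<open>auto intro!: act_hom homI simp: act_add act_mult\<close>)
  note q = lift[OF bms(4) _ _ bal, folded q_def]
  have qp: "q j N (pt V' N v m) = la N (\<pi> j v) m" if "j < n" "bm N" "v \<in> carrier V" "m \<in> carrier N" for j N v m
    using q(3)[OF that(2,2,1,2)] that by simp
  have qh: "q j N \<in> hom (tens V' N) N" if "j < n" "bm N" for j N using q(1)[OF that(2,2,1,2)] .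
  show thesis
  proof (rule that[of n h q])
    show "rlin (tens V' N) N (q j N)" if "j < n" "bm N" for j N
      by (rule tens_rlinI[OF bms(4) that(2,2) qh[OF that]]) (use that \<pi> in \<open>simp add: qp act_mult(3)\<close>)
    show "f (q j N t) = q j P (tm V' N V' P (\<lambda>v. v) f t)" if "j < n" "bm N" "bm P" and f: "llin N P f" and t: "t \<in> carrier (tens V' N)" for j N P f t
      by (rule tens_eqI[where f = "\<lambda>t. f (q j N t)" and g = "\<lambda>t. q j P (tm V' N V' P (\<lambda>v. v) f t)",
          OF bms(4) that(2) hom_trans[OF llin_hom[OF f] qh[OF that(1,2)]] hom_trans[OF qh[OF that(1,3)] tm_hom] _ t])
        (use that f \<pi> in \<open>simp_all add: qp tm_pt rlin_id llinD[OF f] llin_closed[OF f]\<close>)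
    show "t = finprod (tens V' N) (\<lambda>j. pt V' N (h j) (q j N t)) {..<n}" if N: "bm N" and t: "t \<in> carrier (tens V' N)" for N t
    proof -
      have g: "comm_group (tens V' N)" "comm_group V" using N bm_group[OF bm_tens[OF bms(4) N]] left_moduleD(2)[OF hm_lmod[OF hmV]] by auto
      interpret VN: comm_group "tens V' N" by (rule g(1))
      show ?thesis
      proof (rule tens_eqI[where f = "\<lambda>t. t" and g = "\<lambda>t. finprod (tens V' N) (\<lambda>j. pt V' N (h j) (q j N t)) {..<n}",
          OF bms(4) N hom_id hom_finprod_hom[OF hom_trans[OF pt_hom(1) qh] g(1)] _ t])
        fix v m assume "v \<in> carrier V'" and m: "m \<in> carrier N"
        then have v: "v \<in> carrier V" by simp
        have rc: "ra V' (\<pi> j v) (h j) \<in> carrier V" if "j < n" for j using act_closed(2)[OF bms(4) \<pi>(1)[OF that v], of "h j"] h[OF that] by simp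
        have ph: "(\<lambda>v. pt V' N v m) \<in> hom V (tens V' N)" using pt_hom(2)[OF bms(4) N m] by simp
        have "pt V' N v m = pt V' N (finprod V (\<lambda>j. ra V' (\<pi> j v) (h j)) {..<n}) m" using ex[OF v] by simp
        also have "\<dots> = finprod (tens V' N) (\<lambda>j. pt V' N (ra V' (\<pi> j v) (h j)) m) {..<n}"
          by (rule hom_finprod[OF ph g(2,1)]) (use rc in auto)
        also have "\<dots> = finprod (tens V' N) (\<lambda>j. pt V' N (h j) (q j N (pt V' N v m))) {..<n}"
        proof -
          have "pt V' N (ra V' (\<pi> j v) (h j)) m = pt V' N (h j) (q j N (pt V' N v m))" if j: "j < n" for j
            using pt_add(3)[OF bms(4) N _ m \<pi>(1)[OF j v], of "h j"] h[OF j] j v m N by (simp add: qp)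
          moreover have "pt V' N (h j) (q j N (pt V' N v m)) \<in> carrier (tens V' N)" if j: "j < n" for j
            using h[OF j] qp[OF j N v m] N act_closed(1)[OF N \<pi>(1)[OF j v] m] by simp
          ultimately show ?thesis by (intro VN.finprod_cong') auto
        qed
        finally show "pt V' N v m = finprod (tens V' N) (\<lambda>j. pt V' N (h j) (q j N (pt V' N v m))) {..<n}" .
      qed (use N h in auto)
    qed
  qed (use h in blast)
qed

text \<open>Tensoring with V preserves joint injectivity even of an infinite family of maps:
  coordinates commute with the maps, so each coordinate of \<open>t\<close> and of \<open>t'\<close>
  agree by the hypothesis on N. Finiteness of the sum is what allows infinite families.\<close>

lemma separated:
  assumes N: "bm N" and P: "bm P" and \<phi>: "\<And>x. x \<in> S \<Longrightarrow> llin N P (\<phi> x)"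
    and inj: "\<And>m m'. m \<in> carrier N \<Longrightarrow> m' \<in> carrier N \<Longrightarrow> (\<And>x. x \<in> S \<Longrightarrow> \<phi> x m = \<phi> x m') \<Longrightarrow> m = m'"
    and t: "t \<in> carrier (tens V' N)" "t' \<in> carrier (tens V' N)"
    and eq: "\<And>x. x \<in> S \<Longrightarrow> tm V' N V' P (\<lambda>v. v) (\<phi> x) t = tm V' N V' P (\<lambda>v. v) (\<phi> x) t'"
  shows "t = t'"
proof -
  obtain n :: nat and h q where h: "\<And>j. j < n \<Longrightarrow> h j \<in> carrier V"
    and q: "\<And>j N. j < n \<Longrightarrow> bm N \<Longrightarrow> rlin (tens V' N) N (q j N)"
    "\<And>N t. bm N \<Longrightarrow> t \<in> carrier (tens V' N) \<Longrightarrow> t = finprod (tens V' N) (\<lambda>j. pt V' N (h j) (q j N t)) {..<n}"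
    "\<And>j N P f t. j < n \<Longrightarrow> bm N \<Longrightarrow> bm P \<Longrightarrow> llin N P f \<Longrightarrow> t \<in> carrier (tens V' N) \<Longrightarrow> f (q j N t) = q j P (tm V' N V' P (\<lambda>v. v) f t)"
    using coordinates by blast
  have qc: "q j N t \<in> carrier N" if "j < n" "t \<in> carrier (tens V' N)" for j t using rlin_closed[OF q(1)[OF that(1) N] that(2)] .
  have qe: "q j N t = q j N t'" if j: "j < n" for j
    by (rule inj[OF qc[OF j t(1)] qc[OF j t(2)]]) (simp add: q(3)[OF j N P \<phi> t(1)] q(3)[OF j N P \<phi> t(2)] eq)
  interpret VN: comm_group "tens V' N" using N by simp
  have "t = finprod (tens V' N) (\<lambda>j. pt V' N (h j) (q j N t)) {..<n}" by (rule q(2)[OF N t(1)])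
  also have "\<dots> = finprod (tens V' N) (\<lambda>j. pt V' N (h j) (q j N t')) {..<n}"
    by (rule VN.finprod_cong') (use qe h qc[OF _ t(2)] N in auto)
  also have "\<dots> = t'" using q(2)[OF N t(2)] by simp
  finally show ?thesis .
qed

lemma separated1:
  assumes t: "t \<in> carrier (tens V' Z)" "t' \<in> carrier (tens V' Z)" and eq: "\<And>x. x \<in> carrier X \<Longrightarrow> cx V' x t = cx V' x t'"
  shows "t = t'"
  by (rule separated[OF bms(3,2), where \<phi> = px and S = "carrier X"])
    (use t eq px_llin right_univ_inj[OF Zu bms(1,2)] in \<open>auto simp: cx_def\<close>)

text \<open>Iterates the previous statement, with N = V \<otimes> Z and the evaluations V \<otimes>
  Z \<rightarrow> V \<otimes> Y as the jointly injective family.\<close>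

lemma separated2:
  assumes t: "t \<in> carrier (tens V' (tens V' Z))" "t' \<in> carrier (tens V' (tens V' Z))"
    and eq: "\<And>x. x \<in> carrier X \<Longrightarrow> tm V' (tens V' Z) V' (tens V' Y) (\<lambda>v. v) (cx V' x) t = tm V' (tens V' Z) V' (tens V' Y) (\<lambda>v. v) (cx V' x) t'"
  shows "t = t'"
  by (rule separated[where N = "tens V' Z" and P = "tens V' Y" and \<phi> = "cx V'" and S = "carrier X"])
    (use t eq cx(2)[OF bms(4)] separated1 in auto)

text \<open>Each coordinate of \<kappa> is a right linear map X \<rightarrow> Y and so is evaluation
  of some \<open>e j\<close> in Z. The sum of \<open>h j\<close> \<otimes> \<open>e j\<close> then
  represents \<kappa>.\<close>

lemma represented:
  assumes \<kappa>: "rlin X (tens V' Y) \<kappa>"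
  shows "\<exists>t\<in>carrier (tens V' Z). \<forall>x\<in>carrier X. cx V' x t = \<kappa> x"
proof -
  obtain n :: nat and h q where h: "\<And>j. j < n \<Longrightarrow> h j \<in> carrier V"
    and q: "\<And>j N. j < n \<Longrightarrow> bm N \<Longrightarrow> rlin (tens V' N) N (q j N)"
    "\<And>N t. bm N \<Longrightarrow> t \<in> carrier (tens V' N) \<Longrightarrow> t = finprod (tens V' N) (\<lambda>j. pt V' N (h j) (q j N t)) {..<n}"
    "\<And>j N P f t. j < n \<Longrightarrow> bm N \<Longrightarrow> bm P \<Longrightarrow> llin N P f \<Longrightarrow> t \<in> carrier (tens V' N) \<Longrightarrow> f (q j N t) = q j P (tm V' N V' P (\<lambda>v. v) f t)"
    using coordinates by blast
  have "\<exists>e\<in>carrier Z. \<forall>x\<in>carrier X. px x e = q j Y (\<kappa> x)" if j: "j < n" for j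
  proof (rule right_univ_surj[OF Zu bms(1,2) rlin_comp[OF q(1)[OF j bms(2)] \<kappa>]])
    fix e assume "e \<in> carrier Z" "\<And>x. x \<in> carrier X \<Longrightarrow> px x e = q j Y (\<kappa> x)"
    then show ?thesis by (intro bexI[of _ e]) auto
  qed
  then have "\<forall>j\<in>{..<n}. \<exists>e. e \<in> carrier Z \<and> (\<forall>x\<in>carrier X. px x e = q j Y (\<kappa> x))" by auto
  from bchoice[OF this] obtain e where e: "\<And>j. j < n \<Longrightarrow> e j \<in> carrier Z" "\<And>j x. j < n \<Longrightarrow> x \<in> carrier X \<Longrightarrow> px x (e j) = q j Y (\<kappa> x)"
    by auto
  have g: "comm_group (tens V' Z)" "comm_group (tens V' Y)" by simp_all
  interpret VZ: comm_group "tens V' Z" by (rule g(1))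
  interpret VY: comm_group "tens V' Y" by (rule g(2))
  let ?t = "finprod (tens V' Z) (\<lambda>j. pt V' Z (h j) (e j)) {..<n}"
  have c: "(\<lambda>j. pt V' Z (h j) (e j)) \<in> {..<n} \<rightarrow> carrier (tens V' Z)" using h e by auto
  have "cx V' x ?t = \<kappa> x" if x: "x \<in> carrier X" for x
  proof -
    have \<kappa>x: "\<kappa> x \<in> carrier (tens V' Y)" using rlin_closed[OF \<kappa> x] .
    have "cx V' x ?t = finprod (tens V' Y) (\<lambda>j. cx V' x (pt V' Z (h j) (e j))) {..<n}"
      by (rule hom_finprod[OF cx(1)[OF bms(4) x] g c])
    also have "\<dots> = finprod (tens V' Y) (\<lambda>j. pt V' Y (h j) (q j Y (\<kappa> x))) {..<n}"
      by (rule VY.finprod_cong') (use h e x rlin_closed[OF q(1) \<kappa>x] in \<open>auto simp: cx\<close>)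
    also have "\<dots> = \<kappa> x" using q(2)[OF bms(2) \<kappa>x] by simp
    finally show ?thesis .
  qed
  moreover have "?t \<in> carrier (tens V' Z)" using c by (rule VZ.finprod_closed)
  ultimately show ?thesis by blast
qed

text \<open>As \<open>V\<close> is free on \<open>u\<close>, every \<open>w \<in> W\<close> is the image of \<open>u\<close> under a unique map \<open>rq W w : V \<rightarrow> W\<close>; by
  naturality a half-braiding is determined by its values on \<open>x \<otimes> u\<close>.\<close>

abbreviation "rq W w \<equiv> ext1 A V u W w"

lemma rq:
  assumes "hm W" "w \<in> carrier W"
  shows "rq W w \<in> lmod_hom A V W" "rq W w u = w" "llin V' (Rs W) (rq W w)" "rlin V' (Rs W) (rq W w)"
    "v \<in> carrier V \<Longrightarrow> rq W w v \<in> carrier W"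
  using ext1[OF Vfree hm_lmod[OF assms(1)] assms(2)] Rs_lin[OF _ hmV assms(1), of "rq W w"] lmod_homD(4)[of "rq W w" A V W v]
  by auto

lemma rq_nat: "hm W \<Longrightarrow> hm W' \<Longrightarrow> f \<in> lmod_hom A W W' \<Longrightarrow> w \<in> carrier W \<Longrightarrow> v \<in> carrier V \<Longrightarrow> f (rq W w v) = rq W' (f w) v"
  using ext1_natural[OF Vfree hm_lmod hm_lmod] by blast

lemma rq_self: "v \<in> carrier V \<Longrightarrow> v' \<in> carrier V \<Longrightarrow> hm W \<Longrightarrow> w \<in> carrier W \<Longrightarrow> rq W w (rq V v' v) = rq W (rq W w v') v"
  using rq_nat[OF hmV _ rq(1)] by blast

lemma rq_add:
  assumes W: "hm W" and w: "w \<in> carrier W" "w' \<in> carrier W" and v: "v \<in> carrier V"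
  shows "rq W (w \<otimes>\<^bsub>W\<^esub> w') v = rq W w v \<otimes>\<^bsub>W\<^esub> rq W w' v"
  using V_cases[OF v] by (metis ext1_scal[OF Vfree] left_moduleD(4)[OF hm_lmod[OF W]] w)

text \<open>Naturality of \<sigma> carried over to its inverse.\<close>

lemma sb_nat:
  assumes f: "f \<in> lmod_hom A V V" and t: "t \<in> carrier (tens V' X)"
  shows "sb (tm V' X V' X f (\<lambda>x. x) t) = tm X V' X V' (\<lambda>x. x) f (sb t)"
proof -
  note fl = Rs_lin[OF f hmV hmV]
  have st: "sb t \<in> carrier (tens X V')" using hom_closed[OF sb_lin(3) t] .
  have "sX V (tm X V' X V' (\<lambda>x. x) f (sb t)) = tm V' X V' X f (\<lambda>x. x) t"
    using halfbraid_nat[OF sX hmV hmV f st] s_sb[OF t] by simp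
  moreover have "tm X V' X V' (\<lambda>x. x) f (sb t) \<in> carrier (tens X V')"
    using fl st by (intro tm_closed) (auto simp: rlin_id)
  ultimately show ?thesis using sb_s[of "tm X V' X V' (\<lambda>x. x) f (sb t)"] by simp
qed

section \<open>The coaction on the inner hom\<close>

definition "su x = sb (pt V' X u x)"

lemma su:
  shows "x \<in> carrier X \<Longrightarrow> su x \<in> carrier (tens X V')" "rlin X (tens X V') su"
    "x \<in> carrier X \<Longrightarrow> sX V (su x) = pt V' X u x"
    "v \<in> carrier V \<Longrightarrow> x \<in> carrier X \<Longrightarrow> tm X V' X V' (\<lambda>x. x) (rq V v) (su x) = sb (pt V' X v x)"
proof -
  have u': "u \<in> carrier V'" by simp
  show "rlin X (tens X V') su"
    unfolding su_def using right_lin_pt[OF sb_lin(2) bms(4,1) u'] .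
  then show "x \<in> carrier X \<Longrightarrow> su x \<in> carrier (tens X V')" by (rule rlin_closed)
  show "x \<in> carrier X \<Longrightarrow> sX V (su x) = pt V' X u x" unfolding su_def by (rule s_sb) simp
  show "tm X V' X V' (\<lambda>x. x) (rq V v) (su x) = sb (pt V' X v x)" if "v \<in> carrier V" "x \<in> carrier X"
    using sb_nat[OF rq(1)[OF hmV that(1)], of "pt V' X u x"] that rq[OF hmV that(1)] by (simp add: su_def tm_pt llin_id)
qed

text \<open>\<open>su\<close> is right linear, but left scalars do not commute with it, since u
  \<otimes> r x = u r \<otimes> x and in general r u and u r differ from u. They are absorbed by the
  endomorphisms of V that send \<open>u\<close> to r u or to u r.\<close>

lemma su_act:
  assumes x: "x \<in> carrier X" and r: "r \<in> carrier R"
  shows "la (tens X V') r (su x) = tm X V' X V' (\<lambda>x. x) (rq V (la V' r u)) (su x)"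
    "su (la X r x) = tm X V' X V' (\<lambda>x. x) (rq V (ra V' r u)) (su x)"
proof -
  have c: "la V' r u \<in> carrier V" "ra V' r u \<in> carrier V" using act_closed[OF bms(4) r, of u] by simp_all
  have "la (tens X V') r (su x) = sb (la (tens V' X) r (pt V' X u x))" using llinD[OF sb_lin(1) r] x by (simp add: su_def)
  then show "la (tens X V') r (su x) = tm X V' X V' (\<lambda>x. x) (rq V (la V' r u)) (su x)" using su(4)[OF c(1) x] x r by (simp add: tens_act)
  have "pt V' X u (la X r x) = pt V' X (ra V' r u) x" using pt_add(3)[OF bms(4,1) _ x r, of u] by simp
  then show "su (la X r x) = tm X V' X V' (\<lambda>x. x) (rq V (ra V' r u)) (su x)" using su(4)[OF c(2) x] by (simp add: su_def)
qed

text \<open>The right linear map X \<rightarrow> V \<otimes> Y that the coaction has to represent;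
  it is \<tau> after \<epsilon>(e \<otimes> _) after the inverse of \<sigma>, started at u \<otimes>
  x.\<close>

definition kk where "kk e x = sY V (ee V' e (su x))"

lemma sYV: "sY V \<in> hom (tens Y V') (tens V' Y)" "llin (tens Y V') (tens V' Y) (sY V)" "rlin (tens Y V') (tens V' Y) (sY V)"
  using halfbraidD(3-5)[OF sY hmV] .

lemma kk_nat:
  assumes e: "e \<in> carrier Z" and x: "x \<in> carrier X" and W: "hm W" and f: "f \<in> lmod_hom A V W"
  shows "tm V' Y (Rs W) Y f (\<lambda>y. y) (kk e x) = sY W (ee (Rs W) e (tm X V' X (Rs W) (\<lambda>x. x) f (su x)))"
proof -
  note fl = Rs_lin[OF f hmV W]
  have "tm V' Y (Rs W) Y f (\<lambda>y. y) (kk e x) = sY W (tm Y V' Y (Rs W) (\<lambda>x. x) f (ee V' e (su x)))"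
    unfolding kk_def by (rule halfbraid_nat[OF sY hmV W f ee(4), symmetric]) (use e su x in auto)
  also have "tm Y V' Y (Rs W) (\<lambda>x. x) f (ee V' e (su x)) = ee (Rs W) e (tm X V' X (Rs W) (\<lambda>x. x) f (su x))"
    by (rule ee_nat) (use W fl e su x in auto)
  finally show ?thesis .
qed

text \<open>\<open>kk e\<close> is right linear as a composite of right linear maps, hence is
  represented by an element of V \<otimes> Z.\<close>

lemma coaction_exists: "\<exists>\<delta>. \<forall>e\<in>carrier Z. \<delta> e \<in> carrier (tens V' Z) \<and> (\<forall>x\<in>carrier X. cx V' x (\<delta> e) = kk e x)"
proof (rule bchoice, rule ballI)
  fix e assume e: "e \<in> carrier Z"
  have "rlin X (tens V' Y) (kk e)"
    unfolding kk_def by (rule rlin_comp[OF sYV(3) rlin_comp[OF ee(2)[OF bms(4) e] su(2)]])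
  from represented[OF this] show "\<exists>t. t \<in> carrier (tens V' Z) \<and> (\<forall>x\<in>carrier X. cx V' x t = kk e x)" by blast
qed

definition \<delta> where "\<delta> = (SOME \<delta>. \<forall>e\<in>carrier Z. \<delta> e \<in> carrier (tens V' Z) \<and> (\<forall>x\<in>carrier X. cx V' x (\<delta> e) = kk e x))"

lemma \<delta>: "e \<in> carrier Z \<Longrightarrow> \<delta> e \<in> carrier (tens V' Z)" "e \<in> carrier Z \<Longrightarrow> x \<in> carrier X \<Longrightarrow> cx V' x (\<delta> e) = kk e x"
  using someI_ex[OF coaction_exists] unfolding \<delta>_def[symmetric] by auto

lemma \<delta>_eqI: "t \<in> carrier (tens V' Z) \<Longrightarrow> e \<in> carrier Z \<Longrightarrow> (\<And>x. x \<in> carrier X \<Longrightarrow> cx V' x t = kk e x) \<Longrightarrow> \<delta> e = t"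
  using separated1[of "\<delta> e" t] \<delta> by simp

lemma \<delta>_llin: "llin Z (tens V' Z) \<delta>"
proof (rule llinI[OF homI])
  fix e e' assume e: "e \<in> carrier Z" "e' \<in> carrier Z"
  show "\<delta> e \<in> carrier (tens V' Z)" using \<delta>(1)[OF e(1)] .
  show "\<delta> (e \<otimes>\<^bsub>Z\<^esub> e') = \<delta> e \<otimes>\<^bsub>tens V' Z\<^esub> \<delta> e'"
  proof (rule \<delta>_eqI)
    fix x assume x: "x \<in> carrier X"
    have "kk (e \<otimes>\<^bsub>Z\<^esub> e') x = kk e x \<otimes>\<^bsub>tens V' Y\<^esub> kk e' x"
      unfolding kk_def using e x by (simp add: ee_z(1) su hom_mult[OF sYV(1)] ee(4))
    then show "cx V' x (\<delta> e \<otimes>\<^bsub>tens V' Z\<^esub> \<delta> e') = kk (e \<otimes>\<^bsub>Z\<^esub> e') x"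
      using e x by (simp add: hom_mult[OF cx(1)] \<delta>)
  qed (use e \<delta> in auto)
next
  fix r e assume r: "r \<in> carrier R" and e: "e \<in> carrier Z"
  show "\<delta> (la Z r e) = la (tens V' Z) r (\<delta> e)"
  proof (rule \<delta>_eqI)
    fix x assume x: "x \<in> carrier X"
    show "cx V' x (la (tens V' Z) r (\<delta> e)) = kk (la Z r e) x"
      using r e x by (simp add: llinD[OF cx(2)] \<delta>) (simp add: kk_def ee_z su llinD[OF sYV(2)] ee(4))
  qed (use r e \<delta> in auto)
qed

text \<open>The first equation makes the half-braiding built from \<delta> well defined on a
  balanced tensor product, the second makes it right linear. The second says that \<delta> e lies in
  the Takeuchi product: replacing u by u r in the V-factor has the same effect as the right action
  of r on the Z-factor.\<close>

lemma \<delta>_ra: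
  assumes e: "e \<in> carrier Z" and r: "r \<in> carrier R"
  shows "\<delta> (ra Z r e) = tm V' Z V' Z (rq V (la V' r u)) (\<lambda>e. e) (\<delta> e)"
    "tm V' Z V' Z (rq V (ra V' r u)) (\<lambda>e. e) (\<delta> e) = ra (tens V' Z) r (\<delta> e)"
proof -
  have c: "la V' r u \<in> carrier V" "ra V' r u \<in> carrier V" using act_closed[OF bms(4) r, of u] by simp_all
  note q = rq[OF hmV c(1)] and q' = rq[OF hmV c(2)]
  show "\<delta> (ra Z r e) = tm V' Z V' Z (rq V (la V' r u)) (\<lambda>e. e) (\<delta> e)"
  proof (rule \<delta>_eqI)
    show "tm V' Z V' Z (rq V (la V' r u)) (\<lambda>e. e) (\<delta> e) \<in> carrier (tens V' Z)"
      by (rule tm_closed) (use q \<delta>(1)[OF e] in \<open>auto simp: llin_id\<close>)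
    fix x assume x: "x \<in> carrier X"
    have "cx V' x (tm V' Z V' Z (rq V (la V' r u)) (\<lambda>e. e) (\<delta> e)) = tm V' Y V' Y (rq V (la V' r u)) (\<lambda>y. y) (kk e x)"
      using cx_nat[OF bms(4,4) q(4) x \<delta>(1)[OF e]] \<delta>(2)[OF e x] by simp
    also have "\<dots> = sY V (ee V' e (la (tens X V') r (su x)))"
      using kk_nat[OF e x hmV q(1)] su_act(1)[OF x r] by simp
    also have "\<dots> = kk (ra Z r e) x" unfolding kk_def using ee_z(3)[OF bms(4) su(1)[OF x] e r] by simp
    finally show "cx V' x (tm V' Z V' Z (rq V (la V' r u)) (\<lambda>e. e) (\<delta> e)) = kk (ra Z r e) x" .
  qed (use r e in auto)
  show "tm V' Z V' Z (rq V (ra V' r u)) (\<lambda>e. e) (\<delta> e) = ra (tens V' Z) r (\<delta> e)"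
  proof (rule separated1)
    show "tm V' Z V' Z (rq V (ra V' r u)) (\<lambda>e. e) (\<delta> e) \<in> carrier (tens V' Z)"
      by (rule tm_closed) (use q' \<delta>(1)[OF e] in \<open>auto simp: llin_id\<close>)
    show "ra (tens V' Z) r (\<delta> e) \<in> carrier (tens V' Z)" using r \<delta>(1)[OF e] by simp
    fix x assume x: "x \<in> carrier X"
    have rx: "la X r x \<in> carrier X" using x r by simp
    have "cx V' x (tm V' Z V' Z (rq V (ra V' r u)) (\<lambda>e. e) (\<delta> e)) = tm V' Y V' Y (rq V (ra V' r u)) (\<lambda>y. y) (kk e x)"
      using cx_nat[OF bms(4,4) q'(4) x \<delta>(1)[OF e]] \<delta>(2)[OF e x] by simp
    also have "\<dots> = sY V (ee V' e (su (la X r x)))"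
      using kk_nat[OF e x hmV q'(1)] su_act(2)[OF x r] by simp
    also have "\<dots> = cx V' (la X r x) (\<delta> e)" using \<delta>(2)[OF e rx] by (simp add: kk_def)
    also have "\<dots> = cx V' x (ra (tens V' Z) r (\<delta> e))" using cx_ra[OF bms(4) x r \<delta>(1)[OF e]] by simp
    finally show "cx V' x (tm V' Z V' Z (rq V (ra V' r u)) (\<lambda>e. e) (\<delta> e)) = cx V' x (ra (tens V' Z) r (\<delta> e))" .
  qed
qed

lemma rq_act:
  assumes W: "hm W" and w: "w \<in> carrier W" and r: "r \<in> carrier R" and v: "v \<in> carrier V"
  shows "rq W (la (Rs W) r w) v = rq W w (rq V (la V' r u) v)" "rq W (ra (Rs W) r w) v = rq W w (rq V (ra V' r u) v)"
proof -
  have c: "la V' r u \<in> carrier V" "ra V' r u \<in> carrier V" using act_closed[OF bms(4) r, of u] by simp_all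
  note q = rq[OF W w]
  have "rq W w (la V' r u) = la (Rs W) r w" "rq W w (ra V' r u) = ra (Rs W) r w"
    using llinD[OF q(3) r, of u] rlinD[OF q(4) r, of u] q(2) by simp_all
  then show "rq W (la (Rs W) r w) v = rq W w (rq V (la V' r u) v)" "rq W (ra (Rs W) r w) v = rq W w (rq V (ra V' r u) v)"
    using rq_self[OF v c(1) W w] rq_self[OF v c(2) W w] by simp_all
qed

section \<open>The half-braiding given by the coaction\<close>

definition rw where "rw W w t = tm V' Z (Rs W) Z (rq W w) (\<lambda>e. e) t"
text \<open>If \<delta> e is the sum of \<open>h i\<close> u \<otimes> \<open>e i\<close>, then e
  \<otimes> w goes to the sum of \<open>h i\<close> w \<otimes> \<open>e i\<close>: the usual
  passage from a coaction to a braiding.\<close>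

definition rh where "rh W = bl Z (Rs W) (tens (Rs W) Z) (\<lambda>e w. rw W w (\<delta> e))"

lemma rw:
  assumes "hm W" "w \<in> carrier W"
  shows "rw W w \<in> hom (tens V' Z) (tens (Rs W) Z)" "llin (tens V' Z) (tens (Rs W) Z) (rw W w)" "rlin (tens V' Z) (tens (Rs W) Z) (rw W w)"
    "t \<in> carrier (tens V' Z) \<Longrightarrow> rw W w t \<in> carrier (tens (Rs W) Z)"
  unfolding rw_def using assms rq[OF assms] by (auto intro!: tm_hom tm_llin tm_rlin tm_closed simp: llin_id rlin_id)

lemma rw_act:
  assumes W: "hm W" and w: "w \<in> carrier W" and r: "r \<in> carrier R" and e: "e \<in> carrier Z"
  shows "rw W (la (Rs W) r w) (\<delta> e) = rw W w (\<delta> (ra Z r e))" "rw W (ra (Rs W) r w) (\<delta> e) = ra (tens (Rs W) Z) r (rw W w (\<delta> e))"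
proof -
  have c: "la V' r u \<in> carrier V" "ra V' r u \<in> carrier V" using act_closed[OF bms(4) r, of u] by simp_all
  have cw: "la (Rs W) r w \<in> carrier W" "ra (Rs W) r w \<in> carrier W" using act_closed[OF bm_Rs[OF W] r, of w] w by simp_all
  note q = rq[OF hmV c(1)] rq[OF hmV c(2)] rq[OF W w] rq[OF W cw(1)] rq[OF W cw(2)]
  have "rw W w (\<delta> (ra Z r e)) = tm V' Z (Rs W) Z (\<lambda>v. rq W w (rq V (la V' r u) v)) (\<lambda>e. e) (\<delta> e)"
    unfolding rw_def \<delta>_ra(1)[OF e r] by (rule tm_comp) (use q W \<delta>(1)[OF e] in \<open>auto simp: llin_id\<close>)
  also have "\<dots> = rw W (la (Rs W) r w) (\<delta> e)"
    unfolding rw_def by (rule tm_cong) (use q W rq_act[OF W w r] \<delta>(1)[OF e] in \<open>auto simp: llin_id intro: rlin_comp\<close>)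
  finally show "rw W (la (Rs W) r w) (\<delta> e) = rw W w (\<delta> (ra Z r e))" by simp
  have "ra (tens (Rs W) Z) r (rw W w (\<delta> e)) = rw W w (ra (tens V' Z) r (\<delta> e))"
    using rlinD[OF rw(3)[OF W w] r \<delta>(1)[OF e]] by simp
  also have "\<dots> = tm V' Z (Rs W) Z (\<lambda>v. rq W w (rq V (ra V' r u) v)) (\<lambda>e. e) (\<delta> e)"
    unfolding rw_def \<delta>_ra(2)[OF e r, symmetric] by (rule tm_comp) (use q W \<delta>(1)[OF e] in \<open>auto simp: llin_id\<close>)
  also have "\<dots> = rw W (ra (Rs W) r w) (\<delta> e)"
    unfolding rw_def by (rule tm_cong) (use q W rq_act[OF W w r] \<delta>(1)[OF e] in \<open>auto simp: llin_id intro: rlin_comp\<close>)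
  finally show "rw W (ra (Rs W) r w) (\<delta> e) = ra (tens (Rs W) Z) r (rw W w (\<delta> e))" by simp
qed

lemma rw_add:
  assumes W: "hm W" and w: "w \<in> carrier W" "w' \<in> carrier W" and t: "t \<in> carrier (tens V' Z)"
  shows "rw W (w \<otimes>\<^bsub>W\<^esub> w') t = rw W w t \<otimes>\<^bsub>tens (Rs W) Z\<^esub> rw W w' t"
proof -
  have ww: "w \<otimes>\<^bsub>W\<^esub> w' \<in> carrier W" using w bm_m_closed[OF bm_Rs[OF W], of w w'] by simp
  have g: "comm_group (tens (Rs W) Z)" using W by simp
  show ?thesis
    by (rule tens_eqI[where f = "rw W (w \<otimes>\<^bsub>W\<^esub> w')" and g = "\<lambda>t. rw W w t \<otimes>\<^bsub>tens (Rs W) Z\<^esub> rw W w' t",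
        OF bms(4,3) rw(1)[OF W ww] hom_sum_hom[OF rw(1)[OF W w(1)] rw(1)[OF W w(2)] g] _ t])
      (use W w ww rq[OF W w(1)] rq[OF W w(2)] rq[OF W ww] rq_add[OF W w] pt_add(2)[OF bm_Rs[OF W] bms(3)] in \<open>simp_all add: rw_def tm_pt llin_id\<close>)
qed

text \<open>Additivity in e and in w is inherited from \<delta> and from \<open>rq\<close>;
  balancedness is the compatibility of \<delta> with right scalars.\<close>

lemma rh_bal:
  assumes W: "hm W"
  shows "bal Z (Rs W) (tens (Rs W) Z) (\<lambda>e w. rw W w (\<delta> e))"
proof (rule balI)
  fix e assume e: "e \<in> carrier Z"
  show "(\<lambda>w. rw W w (\<delta> e)) \<in> hom (Rs W) (tens (Rs W) Z)"
    using rw_add[OF W _ _ \<delta>(1)[OF e]] rw(4)[OF W _ \<delta>(1)[OF e]] by (auto intro!: homI)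
next
  fix w assume "w \<in> carrier (Rs W)"
  then show "(\<lambda>e. rw W w (\<delta> e)) \<in> hom Z (tens (Rs W) Z)"
    by (intro hom_trans[OF rw(1)[OF W] llin_hom[OF \<delta>_llin]]) simp
next
  fix r e w assume "r \<in> carrier R" "e \<in> carrier Z" "w \<in> carrier (Rs W)"
  then show "rw W w (\<delta> (ra Z r e)) = rw W (la (Rs W) r w) (\<delta> e)" using rw_act(1)[OF W] by simp
qed

lemma rh:
  assumes W: "hm W"
  shows "rh W \<in> lmod_hom E (tens Z (Rs W)) (tens (Rs W) Z)" "rh W \<in> hom (tens Z (Rs W)) (tens (Rs W) Z)"
    "e \<in> carrier Z \<Longrightarrow> w \<in> carrier W \<Longrightarrow> rh W (pt Z (Rs W) e w) = rw W w (\<delta> e)"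
proof -
  have b: "bm (Rs W)" "bm (tens (Rs W) Z)" using W by auto
  note l = lift[OF bms(3) b(1,2) rh_bal[OF W], folded rh_def]
  show p: "rh W (pt Z (Rs W) e w) = rw W w (\<delta> e)" if "e \<in> carrier Z" "w \<in> carrier W" for e w using l(3) that by simp
  show "rh W \<in> hom (tens Z (Rs W)) (tens (Rs W) Z)" by (rule l(1))
  show "rh W \<in> lmod_hom E (tens Z (Rs W)) (tens (Rs W) Z)"
    unfolding lmod_hom_iff[OF bm_tens[OF bms(3) b(1)] b(2)]
  proof (intro conjI l(2) tens_llinI[OF bms(3) b l(1)] tens_rlinI[OF bms(3) b l(1)])
    fix r e w assume r: "r \<in> carrier R" and e: "e \<in> carrier Z" and "w \<in> carrier (Rs W)"
    then have w: "w \<in> carrier W" by simp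
    have c: "ra (Rs W) r w \<in> carrier W" using act_closed(2)[OF b(1) r, of w] w by simp
    show "rh W (pt Z (Rs W) (la Z r e) w) = la (tens (Rs W) Z) r (rh W (pt Z (Rs W) e w))"
      using r e w llinD[OF \<delta>_llin r e] llinD[OF rw(2)[OF W w] r \<delta>(1)[OF e]] by (simp add: p)
    show "rh W (pt Z (Rs W) e (ra (Rs W) r w)) = ra (tens (Rs W) Z) r (rh W (pt Z (Rs W) e w))"
      using r e w c rw_act(2)[OF W w r e] by (simp add: p)
  qed
qed

section \<open>A left inverse of \<sigma> at every module\<close>

definition qw where "qw W = bl (Rs W) X (tens X (Rs W)) (\<lambda>w x. tm X V' X (Rs W) (\<lambda>x. x) (rq W w) (su x))"

lemma qw_aux:
  assumes W: "hm W" and w: "w \<in> carrier W"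
  shows "tm X V' X (Rs W) (\<lambda>x. x) (rq W w) \<in> hom (tens X V') (tens X (Rs W))"
    "t \<in> carrier (tens X V') \<Longrightarrow> tm X V' X (Rs W) (\<lambda>x. x) (rq W w) t \<in> carrier (tens X (Rs W))"
  using W rq[OF W w] by (auto intro!: tm_hom tm_closed simp: rlin_id)

lemma qw:
  assumes W: "hm W"
  shows "qw W \<in> hom (tens (Rs W) X) (tens X (Rs W))"
    "w \<in> carrier W \<Longrightarrow> x \<in> carrier X \<Longrightarrow> qw W (pt (Rs W) X w x) = tm X V' X (Rs W) (\<lambda>x. x) (rq W w) (su x)"
proof -
  have b: "bm (Rs W)" "bm (tens X (Rs W))" using W by auto
  have "bal (Rs W) X (tens X (Rs W)) (\<lambda>w x. tm X V' X (Rs W) (\<lambda>x. x) (rq W w) (su x))"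
  proof (rule balI)
    fix w assume "w \<in> carrier (Rs W)"
    then show "(\<lambda>x. tm X V' X (Rs W) (\<lambda>x. x) (rq W w) (su x)) \<in> hom X (tens X (Rs W))"
      by (intro hom_trans[OF qw_aux(1)[OF W] rlin_hom[OF su(2)]]) simp
  next
    fix x assume x: "x \<in> carrier X"
    have g: "comm_group (tens X (Rs W))" using W by simp
    have "tm X V' X (Rs W) (\<lambda>x. x) (rq W (w \<otimes>\<^bsub>W\<^esub> w')) t = tm X V' X (Rs W) (\<lambda>x. x) (rq W w) t \<otimes>\<^bsub>tens X (Rs W)\<^esub> tm X V' X (Rs W) (\<lambda>x. x) (rq W w') t"
      if w: "w \<in> carrier W" "w' \<in> carrier W" and t: "t \<in> carrier (tens X V')" for w w' t
    proof -
      have ww: "w \<otimes>\<^bsub>W\<^esub> w' \<in> carrier W" using w bm_m_closed[OF b(1), of w w'] by simp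
      show ?thesis
        by (rule tens_eqI[where f = "tm X V' X (Rs W) (\<lambda>x. x) (rq W (w \<otimes>\<^bsub>W\<^esub> w'))" and
            g = "\<lambda>t. tm X V' X (Rs W) (\<lambda>x. x) (rq W w) t \<otimes>\<^bsub>tens X (Rs W)\<^esub> tm X V' X (Rs W) (\<lambda>x. x) (rq W w') t",
            OF bms(1,4) qw_aux(1)[OF W ww] hom_sum_hom[OF qw_aux(1)[OF W w(1)] qw_aux(1)[OF W w(2)] g] _ t])
          (use W w ww rq[OF W w(1)] rq[OF W w(2)] rq[OF W ww] rq_add[OF W w] pt_add(1)[OF bms(1) b(1)] in \<open>simp_all add: tm_pt rlin_id\<close>)
    qed
    then show "(\<lambda>w. tm X V' X (Rs W) (\<lambda>x. x) (rq W w) (su x)) \<in> hom (Rs W) (tens X (Rs W))"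
      using qw_aux(2)[OF W _ su(1)[OF x]] su(1)[OF x] by (auto intro!: homI)
  next
    fix r w x assume r: "r \<in> carrier R" and "w \<in> carrier (Rs W)" and x: "x \<in> carrier X"
    then have w: "w \<in> carrier W" by simp
    have c: "ra V' r u \<in> carrier V" using act_closed[OF bms(4) r, of u] by simp
    have cw: "ra (Rs W) r w \<in> carrier W" using act_closed[OF b(1) r, of w] w by simp
    note q = rq[OF hmV c] rq[OF W w] rq[OF W cw]
    have "tm X V' X (Rs W) (\<lambda>x. x) (rq W w) (su (la X r x)) = tm X V' X (Rs W) (\<lambda>x. x) (\<lambda>v. rq W w (rq V (ra V' r u) v)) (su x)"
      unfolding su_act(2)[OF x r] by (rule tm_comp) (use q W su(1)[OF x] in \<open>auto simp: rlin_id\<close>)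
    also have "\<dots> = tm X V' X (Rs W) (\<lambda>x. x) (rq W (ra (Rs W) r w)) (su x)"
      by (rule tm_cong) (use q W rq_act[OF W w r] su(1)[OF x] in \<open>auto simp: rlin_id intro: llin_comp\<close>)
    finally show "tm X V' X (Rs W) (\<lambda>x. x) (rq W (ra (Rs W) r w)) (su x) = tm X V' X (Rs W) (\<lambda>x. x) (rq W w) (su (la X r x))" by simp
  qed
  note l = lift[OF b(1) bms(1) b(2) this, folded qw_def]
  show "qw W \<in> hom (tens (Rs W) X) (tens X (Rs W))" by (rule l(1))
  show "w \<in> carrier W \<Longrightarrow> x \<in> carrier X \<Longrightarrow> qw W (pt (Rs W) X w x) = tm X V' X (Rs W) (\<lambda>x. x) (rq W w) (su x)" using l(3) by simp
qed

lemma qw_sX: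
  assumes W: "hm W" and t: "t \<in> carrier (tens X (Rs W))"
  shows "qw W (sX W t) = t"
proof (rule tens_eqI[where f = "\<lambda>t. qw W (sX W t)" and g = "\<lambda>t. t", OF bms(1) bm_Rs[OF W] hom_trans[OF qw(1)[OF W] halfbraidD(3)[OF sX W]] hom_id _ t])
  fix x w assume x: "x \<in> carrier X" and "w \<in> carrier (Rs W)"
  then have w: "w \<in> carrier W" by simp
  note q = rq[OF W w]
  have *: "qw W (tm V' X (Rs W) X (rq W w) (\<lambda>x. x) T) = tm X V' X (Rs W) (\<lambda>x. x) (rq W w) (sb T)" if T: "T \<in> carrier (tens V' X)" for T
  proof (rule tens_eqI[where f = "\<lambda>T. qw W (tm V' X (Rs W) X (rq W w) (\<lambda>x. x) T)" and g = "\<lambda>T. tm X V' X (Rs W) (\<lambda>x. x) (rq W w) (sb T)",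
      OF bms(4,1) hom_trans[OF qw(1)[OF W] tm_hom] hom_trans[OF qw_aux(1)[OF W w] sb_lin(3)] _ T])
    fix v x assume "v \<in> carrier V'" and x: "x \<in> carrier X"
    then have v: "v \<in> carrier V" by simp
    note qv = rq[OF hmV v] and qq = rq[OF W q(5)[OF v]]
    have "qw W (tm V' X (Rs W) X (rq W w) (\<lambda>x. x) (pt V' X v x)) = tm X V' X (Rs W) (\<lambda>x. x) (rq W (rq W w v)) (su x)"
      using v x W q by (simp add: tm_pt llin_id qw)
    also have "\<dots> = tm X V' X (Rs W) (\<lambda>x. x) (\<lambda>v'. rq W w (rq V v v')) (su x)"
      by (rule tm_cong) (use W q qv qq rq_self[OF _ v W w] su(1)[OF x] in \<open>auto simp: rlin_id intro: llin_comp\<close>)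
    also have "\<dots> = tm X V' X (Rs W) (\<lambda>x. x) (rq W w) (tm X V' X V' (\<lambda>x. x) (rq V v) (su x))"
      by (rule tm_comp[symmetric]) (use W q qv su(1)[OF x] in \<open>auto simp: rlin_id\<close>)
    finally show "qw W (tm V' X (Rs W) X (rq W w) (\<lambda>x. x) (pt V' X v x)) = tm X V' X (Rs W) (\<lambda>x. x) (rq W w) (sb (pt V' X v x))"
      using su(4)[OF v x] by simp
  qed (use W q in \<open>auto simp: llin_id\<close>)
  have c: "pt X V' x u \<in> carrier (tens X V')" using x by simp
  have "sX W (pt X (Rs W) x w) = tm V' X (Rs W) X (rq W w) (\<lambda>x. x) (sX V (pt X V' x u))"
    using halfbraidD(6)[OF sX hmV W q(1) x u_closed] q(2) by simp
  then have "qw W (sX W (pt X (Rs W) x w)) = tm X V' X (Rs W) (\<lambda>x. x) (rq W w) (pt X V' x u)"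
    using *[OF hom_closed[OF halfbraidD(3)[OF sX hmV] c]] sb_s[OF c] by simp
  also have "\<dots> = pt X (Rs W) x w" using W q x by (simp add: tm_pt rlin_id)
  finally show "qw W (sX W (pt X (Rs W) x w)) = pt X (Rs W) x w" .
qed

lemma sX_inj: "hm W \<Longrightarrow> t \<in> carrier (tens X (Rs W)) \<Longrightarrow> t' \<in> carrier (tens X (Rs W)) \<Longrightarrow> sX W t = sX W t' \<Longrightarrow> t = t'"
  using qw_sX by metis

section \<open>Coassociativity of the coaction\<close>

lemma as_cx:
  assumes b: "bm M" "bm N" and x: "x \<in> carrier X" and t: "t \<in> carrier (tens (tens M N) Z)"
  shows "tm M (tens N Z) M (tens N Y) (\<lambda>v. v) (cx N x) (as M N Z t) = as M N Y (cx (tens M N) x t)"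
proof -
  have b': "bm (tens M N)" "bm (tens M (tens N Y))" using b by auto
  show ?thesis
    by (rule tens3_eqI'[where f = "\<lambda>t. tm M (tens N Z) M (tens N Y) (\<lambda>v. v) (cx N x) (as M N Z t)" and g = "\<lambda>t. as M N Y (cx (tens M N) x t)",
        OF b bms(3) hom_trans[OF tm_hom as_hom] hom_trans[OF as_hom cx(1)[OF b'(1) x]] bm_group[OF b'(2)] _ t])
      (use b b' x llin_closed[OF px_llin[OF x]] in \<open>simp_all add: as_pt tm_pt rlin_id cx\<close>)
qed

lemma as_ee:
  assumes b: "bm M" "bm N" and e: "e \<in> carrier Z" and t: "t \<in> carrier (tens (tens X M) N)"
  shows "ee (tens M N) e (as X M N t) = as Y M N (tm (tens X M) N (tens Y M) N (ee M e) (\<lambda>n. n) t)"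
proof -
  have b': "bm (tens M N)" "bm (tens Y (tens M N))" using b by auto
  show ?thesis
    by (rule tens3_eqI'[where f = "\<lambda>t. ee (tens M N) e (as X M N t)" and g = "\<lambda>t. as Y M N (tm (tens X M) N (tens Y M) N (ee M e) (\<lambda>n. n) t)",
        OF bms(1) b hom_trans[OF ee(1)[OF b'(1) e] as_hom] hom_trans[OF as_hom tm_hom] bm_group[OF b'(2)] _ t])
      (use b b' e llin_closed[OF px_llin] in \<open>simp_all add: as_pt tm_pt llin_id ee\<close>)
qed

lemma tm_add2:
  assumes b: "bm M" "bm N" "bm N'" and fg: "llin N N' f" "llin N N' g" and t: "t \<in> carrier (tens M N)"
  shows "tm M N M N' (\<lambda>m. m) (\<lambda>n. f n \<otimes>\<^bsub>N'\<^esub> g n) t = tm M N M N' (\<lambda>m. m) f t \<otimes>\<^bsub>tens M N'\<^esub> tm M N M N' (\<lambda>m. m) g t"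
proof -
  have c: "f n \<in> carrier N'" "g n \<in> carrier N'" if "n \<in> carrier N" for n using fg that by (auto simp: llin_closed)
  have l: "llin N N' (\<lambda>n. f n \<otimes>\<^bsub>N'\<^esub> g n)"
    by (rule llinI[OF hom_sum_hom[OF llin_hom[OF fg(1)] llin_hom[OF fg(2)] bm_group[OF b(3)]]])
      (use b c in \<open>simp add: llinD[OF fg(1)] llinD[OF fg(2)] act_add\<close>)
  have g: "comm_group (tens M N')" using b by simp
  show ?thesis
    by (rule tens_eqI[where f = "tm M N M N' (\<lambda>m. m) (\<lambda>n. f n \<otimes>\<^bsub>N'\<^esub> g n)" and g = "\<lambda>t. tm M N M N' (\<lambda>m. m) f t \<otimes>\<^bsub>tens M N'\<^esub> tm M N M N' (\<lambda>m. m) g t",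
        OF b(1,2) tm_hom hom_sum_hom[OF tm_hom tm_hom g] _ t])
      (use b fg l c in \<open>simp_all add: tm_pt rlin_id pt_add\<close>)
qed

text \<open>The comultiplication of H, read on V: the H-linear map with u \<mapsto> u \<otimes>
  u.\<close>

definition "\<Delta> = rq (ht V V) (pt V' V' u u)"

lemma \<Delta>: "\<Delta> \<in> lmod_hom A V (ht V V)" "\<Delta> u = pt V' V' u u" "llin V' (tens V' V') \<Delta>" "rlin V' (tens V' V') \<Delta>"
    "v \<in> carrier V \<Longrightarrow> \<Delta> v \<in> carrier (tens V' V')"
proof -
  have c: "pt V' V' u u \<in> carrier (ht V V)" by simp
  show "\<Delta> \<in> lmod_hom A V (ht V V)" "\<Delta> u = pt V' V' u u" "llin V' (tens V' V') \<Delta>" "rlin V' (tens V' V') \<Delta>"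
    "v \<in> carrier V \<Longrightarrow> \<Delta> v \<in> carrier (tens V' V')"
    using rq[OF hm_ht[OF hmV hmV] c] by (simp_all add: \<Delta>_def strictD(1))
qed

text \<open>Both sides are H-linear in \<open>v\<close> and agree at the generator \<open>u\<close>.
  Thus the action of H on W \<otimes> W' is computed through \<Delta>.\<close>

lemma \<Delta>_rq:
  assumes W: "hm W" "hm W'" and w: "w \<in> carrier W" "w' \<in> carrier W'" and v: "v \<in> carrier V"
  shows "tm V' V' (Rs W) (Rs W') (rq W w) (rq W' w') (\<Delta> v) = rq (ht W W') (pt (Rs W) (Rs W') w w') v"
proof -
  note q = rq[OF W(1) w(1)] rq[OF W(2) w(2)]
  have c: "pt V' V' u u \<in> carrier (ht V V)" by simp
  have "tm V' V' (Rs W) (Rs W') (rq W w) (rq W' w') (pt V' V' u u) = pt (Rs W) (Rs W') w w'"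
    using W q by (simp add: tm_pt)
  then show ?thesis
    using rq_nat[OF hm_ht[OF hmV hmV] hm_ht[OF W] TensA_HC(2)[OF hmV hmV W q(1,6)] c v] unfolding \<Delta>_def by simp
qed

text \<open>With \<open>su\<close> as \<open>x \<mapsto> \<sigma>\<inverse> (u \<otimes> x)\<close>, multiplicativity of \<open>\<sigma>\<close> becomes the coassociativity
  \<open>su_\<Delta>\<close> of \<open>su\<close>, as \<open>\<sigma>\<close> is injective.\<close>

definition "zz t = as X V' V' (tm X V' (tens X V') V' su (\<lambda>v. v) t)"

lemma zz: "zz \<in> hom (tens X V') (tens X (tens V' V'))"
  "x \<in> carrier X \<Longrightarrow> v \<in> carrier V \<Longrightarrow> zz (pt X V' x v) = as X V' V' (pt (tens X V') V' (su x) v)"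
  unfolding zz_def
  by (rule hom_trans[OF as_hom tm_hom]) (auto simp: su llin_id tm_pt)

lemma sY_VV: "sY (ht V V) \<in> hom (tens Y (tens V' V')) (tens (tens V' V') Y)"
  and sX_VV: "sX (ht V V) \<in> hom (tens X (tens V' V')) (tens (tens V' V') X)"
  using halfbraidD(3)[OF sY hm_ht[OF hmV hmV]] halfbraidD(3)[OF sX hm_ht[OF hmV hmV]] by (simp_all add: strictD(1))

text \<open>For t = x \<otimes> v, \<open>zz t\<close> is \<open>su x\<close> \<otimes> v.
  Multiplicativity first braids the V-part of \<open>su x\<close>, giving u \<otimes> x by the
  choice of \<open>su\<close>, and then braids v past x.\<close>

lemma sX_zz:
  assumes t: "t \<in> carrier (tens X V')"
  shows "as V' V' X (sX (ht V V) (zz t)) = pt V' (tens V' X) u (sX V t)"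
proof (rule tens_eqI[where f = "\<lambda>t. as V' V' X (sX (ht V V) (zz t))" and g = "\<lambda>t. pt V' (tens V' X) u (sX V t)",
    OF bms(1,4) hom_trans[OF as_hom hom_trans[OF sX_VV zz(1)]] hom_trans[OF pt_hom(1) halfbraidD(3)[OF sX hmV]] _ t])
  fix x v assume x: "x \<in> carrier X" and "v \<in> carrier V'"
  then have v: "v \<in> carrier V" by simp
  have l: "llin X (tens V' X) (\<lambda>x. sX V (pt X V' x v))"
    by (rule left_lin_pt[OF halfbraidD(4)[OF sX hmV]]) (use v in auto)
  show "as V' V' X (sX (ht V V) (zz (pt X V' x v))) = pt V' (tens V' X) u (sX V (pt X V' x v))"
    using halfbraid_mult[OF sX hmV hmV su(1)[OF x] v] x v l by (simp add: zz su tm_pt rlin_id)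
qed simp_all

lemma su_\<Delta>:
  assumes x: "x \<in> carrier X"
  shows "tm X V' X (tens V' V') (\<lambda>x. x) \<Delta> (su x) = zz (su x)"
proof (rule sX_inj[OF hm_ht[OF hmV hmV]])
  have c: "tm X V' X (tens V' V') (\<lambda>x. x) \<Delta> (su x) \<in> carrier (tens X (tens V' V'))"
    by (rule tm_closed) (use \<Delta> su(1)[OF x] in \<open>auto simp: rlin_id\<close>)
  have c': "zz (su x) \<in> carrier (tens X (tens V' V'))" by (rule hom_closed[OF zz(1) su(1)[OF x]])
  show "tm X V' X (tens V' V') (\<lambda>x. x) \<Delta> (su x) \<in> carrier (tens X (Rs (ht V V)))" "zz (su x) \<in> carrier (tens X (Rs (ht V V)))"
    using c c' by (simp_all add: strictD(1))
  let ?P = "pt (tens V' V') X (pt V' V' u u) x"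
  have 1: "sX (ht V V) (tm X V' X (tens V' V') (\<lambda>x. x) \<Delta> (su x)) = ?P"
    using halfbraid_nat[OF sX hmV hm_ht[OF hmV hmV] \<Delta>(1) su(1)[OF x]] x \<Delta> by (simp add: strictD(1) su tm_pt llin_id)
  have 2: "as V' V' X (sX (ht V V) (zz (su x))) = as V' V' X ?P"
    using sX_zz[OF su(1)[OF x]] x by (simp add: su as_pt)
  have c2: "sX (ht V V) (zz (su x)) \<in> carrier (tens (tens V' V') X)" by (rule hom_closed[OF sX_VV c'])
  have "sX (ht V V) (zz (su x)) = ?P"
    using ai_props(3)[OF bms(4,4,1) c2] ai_props(3)[OF bms(4,4,1), of ?P] x unfolding 2 by simp
  then show "sX (ht V V) (tm X V' X (tens V' V') (\<lambda>x. x) \<Delta> (su x)) = sX (ht V V) (zz (su x))" using 1 by simp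
qed

lemma sYe_llin: "t \<in> carrier (tens X V') \<Longrightarrow> llin Z (tens V' Y) (\<lambda>e. sY V (ee V' e t))"
  by (rule llin_comp[OF sYV(2)], rule llinI[OF homI]) (simp_all add: ee(4) ee_z)

text \<open>The counterpart for \<tau>. Braiding the first factor produces \<open>kk e x\<close>,
  which is \<delta> e evaluated at x; the second braiding then takes place behind this
  evaluation.\<close>

lemma sY_zz:
  assumes e: "e \<in> carrier Z" and t: "t \<in> carrier (tens X V')"
  shows "as V' V' Y (sY (ht V V) (ee (tens V' V') e (zz t))) = tm V' Z V' (tens V' Y) (\<lambda>v. v) (\<lambda>e. sY V (ee V' e t)) (\<delta> e)"
proof (rule tens_eqI[where f = "\<lambda>t. as V' V' Y (sY (ht V V) (ee (tens V' V') e (zz t)))"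
      and g = "\<lambda>t. tm V' Z V' (tens V' Y) (\<lambda>v. v) (\<lambda>e. sY V (ee V' e t)) (\<delta> e)", OF bms(1,4) hom_trans[OF as_hom hom_trans[OF sY_VV hom_trans[OF ee(1) zz(1)]]] _ _ t])
  \<comment> \<open>Here \<open>t\<close> occurs inside the map that is tensored with V, so
    additivity in \<open>t\<close> needs that \<open>tm\<close> is additive in its second
    map.\<close>
  show "(\<lambda>t. tm V' Z V' (tens V' Y) (\<lambda>v. v) (\<lambda>e. sY V (ee V' e t)) (\<delta> e)) \<in> hom (tens X V') (tens V' (tens V' Y))"
  proof (rule homI)
    fix t t' assume t: "t \<in> carrier (tens X V')" and t': "t' \<in> carrier (tens X V')"
    have tt: "t \<otimes>\<^bsub>tens X V'\<^esub> t' \<in> carrier (tens X V')" by (rule bm_m_closed[OF bm_tens t t']) auto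
    show "tm V' Z V' (tens V' Y) (\<lambda>v. v) (\<lambda>e. sY V (ee V' e t)) (\<delta> e) \<in> carrier (tens V' (tens V' Y))"
      by (rule tm_closed[OF _ _ _ _ rlin_id sYe_llin[OF t] \<delta>(1)[OF e]]) auto
    have "tm V' Z V' (tens V' Y) (\<lambda>v. v) (\<lambda>e. sY V (ee V' e (t \<otimes>\<^bsub>tens X V'\<^esub> t'))) (\<delta> e)
        = tm V' Z V' (tens V' Y) (\<lambda>v. v) (\<lambda>e. sY V (ee V' e t) \<otimes>\<^bsub>tens V' Y\<^esub> sY V (ee V' e t')) (\<delta> e)"
    proof (rule tm_cong[OF _ _ _ _ rlin_id sYe_llin[OF tt] rlin_id _ refl _ \<delta>(1)[OF e]])
      show eq: "sY V (ee V' e (t \<otimes>\<^bsub>tens X V'\<^esub> t')) = sY V (ee V' e t) \<otimes>\<^bsub>tens V' Y\<^esub> sY V (ee V' e t')" if "e \<in> carrier Z" for e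
        using that t t' by (simp add: hom_mult[OF ee(1)] hom_mult[OF sYV(1)] ee(4))
      show "llin Z (tens V' Y) (\<lambda>e. sY V (ee V' e t) \<otimes>\<^bsub>tens V' Y\<^esub> sY V (ee V' e t'))"
        using sYe_llin[OF tt] eq by (auto simp: llin_def hom_def Pi_iff)
    qed auto
    then show "tm V' Z V' (tens V' Y) (\<lambda>v. v) (\<lambda>e. sY V (ee V' e (t \<otimes>\<^bsub>tens X V'\<^esub> t'))) (\<delta> e)
        = tm V' Z V' (tens V' Y) (\<lambda>v. v) (\<lambda>e. sY V (ee V' e t)) (\<delta> e)
          \<otimes>\<^bsub>tens V' (tens V' Y)\<^esub> tm V' Z V' (tens V' Y) (\<lambda>v. v) (\<lambda>e. sY V (ee V' e t')) (\<delta> e)"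
      using tm_add2[OF bms(4,3) bm_tens[OF bms(4,2)] sYe_llin[OF t] sYe_llin[OF t'] \<delta>(1)[OF e]] by simp
  qed
  fix x v assume x: "x \<in> carrier X" and "v \<in> carrier V'"
  then have v: "v \<in> carrier V" by simp
  have l: "llin Y (tens V' Y) (\<lambda>y. sY V (pt Y V' y v))"
    by (rule left_lin_pt[OF sYV(2)]) (use v in auto)
  have "ee (tens V' V') e (zz (pt X V' x v)) = as Y V' V' (pt (tens Y V') V' (ee V' e (su x)) v)"
    using as_ee[OF bms(4,4) e, of "pt (tens X V') V' (su x) v"] x v e by (simp add: zz su tm_pt ee llin_id)
  then have "as V' V' Y (sY (ht V V) (ee (tens V' V') e (zz (pt X V' x v))))
      = tm V' Y V' (tens V' Y) (\<lambda>v. v) (\<lambda>y. sY V (pt Y V' y v)) (kk e x)"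
    using halfbraid_mult[OF sY hmV hmV ee(4)[OF bms(4) e su(1)[OF x]] v] by (simp add: kk_def)
  also have "\<dots> = tm V' Z V' (tens V' Y) (\<lambda>v. v) (\<lambda>e. sY V (pt Y V' (px x e) v)) (\<delta> e)"
    unfolding \<delta>(2)[OF e x, symmetric] cx_def
    by (rule tm_comp) (use l px_llin[OF x] \<delta>(1)[OF e] in \<open>auto simp: rlin_id\<close>)
  also have "\<dots> = tm V' Z V' (tens V' Y) (\<lambda>v. v) (\<lambda>e. sY V (ee V' e (pt X V' x v))) (\<delta> e)"
    by (rule tm_cong) (use l px_llin[OF x] sYe_llin[of "pt X V' x v"] \<delta>(1)[OF e] x v in \<open>auto simp: rlin_id ee intro: llin_comp\<close>)
  finally show "as V' V' Y (sY (ht V V) (ee (tens V' V') e (zz (pt X V' x v))))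
      = tm V' Z V' (tens V' Y) (\<lambda>v. v) (\<lambda>e. sY V (ee V' e (pt X V' x v))) (\<delta> e)" .
qed (use e in auto)

text \<open>Elements of V \<otimes> (V \<otimes> Z) are separated by evaluation at all x. After
  evaluation the left side is \<tau> at V \<otimes> V applied to \<Delta> on \<open>su x\<close>,
  which the coassociativity of \<open>su\<close> and the multiplicativity of \<tau> turn into two
  successive coactions.\<close>

lemma coassoc:
  assumes e: "e \<in> carrier Z"
  shows "as V' V' Z (tm V' Z (tens V' V') Z \<Delta> (\<lambda>e. e) (\<delta> e)) = tm V' Z V' (tens V' Z) (\<lambda>v. v) \<delta> (\<delta> e)"
proof (rule separated2)
  have b: "bm (tens V' V')" by simp
  have c: "tm V' Z (tens V' V') Z \<Delta> (\<lambda>e. e) (\<delta> e) \<in> carrier (tens (tens V' V') Z)"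
    by (rule tm_closed) (use \<Delta> \<delta>(1)[OF e] in \<open>auto simp: llin_id\<close>)
  then show "as V' V' Z (tm V' Z (tens V' V') Z \<Delta> (\<lambda>e. e) (\<delta> e)) \<in> carrier (tens V' (tens V' Z))"
    by (intro hom_closed[OF as_hom]) auto
  show "tm V' Z V' (tens V' Z) (\<lambda>v. v) \<delta> (\<delta> e) \<in> carrier (tens V' (tens V' Z))"
    by (rule tm_closed[OF _ _ _ _ rlin_id \<delta>_llin \<delta>(1)[OF e]]) auto
  fix x assume x: "x \<in> carrier X"
  have "tm V' (tens V' Z) V' (tens V' Y) (\<lambda>v. v) (cx V' x) (as V' V' Z (tm V' Z (tens V' V') Z \<Delta> (\<lambda>e. e) (\<delta> e)))
      = as V' V' Y (cx (tens V' V') x (tm V' Z (tens V' V') Z \<Delta> (\<lambda>e. e) (\<delta> e)))"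
    by (rule as_cx[OF bms(4,4) x c])
  also have "cx (tens V' V') x (tm V' Z (tens V' V') Z \<Delta> (\<lambda>e. e) (\<delta> e)) = tm V' Y (tens V' V') Y \<Delta> (\<lambda>y. y) (kk e x)"
    using cx_nat[OF bms(4) b \<Delta>(4) x \<delta>(1)[OF e]] \<delta>(2)[OF e x] by simp
  also have "\<dots> = sY (ht V V) (ee (tens V' V') e (zz (su x)))"
    using kk_nat[OF e x hm_ht[OF hmV hmV] \<Delta>(1)] su_\<Delta>[OF x] by (simp add: strictD(1))
  also have "as V' V' Y \<dots> = tm V' Z V' (tens V' Y) (\<lambda>v. v) (\<lambda>e. kk e x) (\<delta> e)"
    using sY_zz[OF e su(1)[OF x]] by (simp add: kk_def)
  also have "\<dots> = tm V' Z V' (tens V' Y) (\<lambda>v. v) (\<lambda>e. cx V' x (\<delta> e)) (\<delta> e)"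
    by (rule tm_cong) (use sYe_llin[OF su(1)[OF x]] llin_comp[OF cx(2)[OF bms(4) x] \<delta>_llin] \<delta> e x in \<open>auto simp: rlin_id kk_def\<close>)
  also have "\<dots> = tm V' (tens V' Z) V' (tens V' Y) (\<lambda>v. v) (cx V' x) (tm V' Z V' (tens V' Z) (\<lambda>v. v) \<delta> (\<delta> e))"
    by (rule tm_comp[symmetric]) (use \<delta>_llin cx(2)[OF bms(4) x] \<delta>(1)[OF e] in \<open>auto simp: rlin_id\<close>)
  finally show "tm V' (tens V' Z) V' (tens V' Y) (\<lambda>v. v) (cx V' x) (as V' V' Z (tm V' Z (tens V' V') Z \<Delta> (\<lambda>e. e) (\<delta> e)))
      = tm V' (tens V' Z) V' (tens V' Y) (\<lambda>v. v) (cx V' x) (tm V' Z V' (tens V' Z) (\<lambda>v. v) \<delta> (\<delta> e))" .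
qed

section \<open>The axioms of a half-braiding on the inner hom\<close>

lemma rh_llin: "hm W \<Longrightarrow> w \<in> carrier W \<Longrightarrow> llin Z (tens (Rs W) Z) (\<lambda>e. rh W (pt Z (Rs W) e w))"
  by (rule left_lin_pt[OF lmod_llin[OF rh(1)]]) auto

lemma rh_nat:
  assumes W: "hm W" "hm W'" and f: "f \<in> lmod_hom A W W'" and e: "e \<in> carrier Z" and w: "w \<in> carrier W"
  shows "rh W' (pt Z (Rs W') e (f w)) = tm (Rs W) Z (Rs W') Z f (\<lambda>e. e) (rh W (pt Z (Rs W) e w))"
proof -
  note q = rq[OF W(1) w] and fl = Rs_lin[OF f W]
  have fw: "f w \<in> carrier W'" using lmod_homD(4)[OF f w] .
  note q' = rq[OF W(2) fw]
  have "tm (Rs W) Z (Rs W') Z f (\<lambda>e. e) (rw W w (\<delta> e)) = tm V' Z (Rs W') Z (\<lambda>v. f (rq W w v)) (\<lambda>e. e) (\<delta> e)"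
    unfolding rw_def by (rule tm_comp) (use W q fl \<delta>(1)[OF e] in \<open>auto simp: llin_id\<close>)
  also have "\<dots> = rw W' (f w) (\<delta> e)"
    unfolding rw_def
    by (rule tm_cong) (use W q q' fl rq_nat[OF W f w] \<delta>(1)[OF e] in \<open>auto simp: llin_id intro: rlin_comp\<close>)
  finally show ?thesis using W e w fw by (simp add: rh)
qed

lemma rw_eq: "rw W w = tm V' Z (Rs W) Z (rq W w) (\<lambda>e. e)"
  by (simp add: rw_def fun_eq_iff)

text \<open>The map V \<rightarrow> W \<otimes> W' with u \<mapsto> w \<otimes> w' factors through
  \<Delta>. This reduces multiplicativity at W and W' to coassociativity of \<delta>.\<close>

lemma rh_mult:
  assumes W: "hm W" "hm W'" and e: "e \<in> carrier Z" and w: "w \<in> carrier W" "w' \<in> carrier W'"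
  shows "as (Rs W) (Rs W') Z (rh (ht W W') (pt Z (tens (Rs W) (Rs W')) e (pt (Rs W) (Rs W') w w')))
    = tm (Rs W) Z (Rs W) (tens (Rs W') Z) (\<lambda>x. x) (\<lambda>e. rh W' (pt Z (Rs W') e w')) (rh W (pt Z (Rs W) e w))"
proof -
  let ?W = "Rs W" and ?W' = "Rs W'"
  let ?m = "tm V' V' ?W ?W' (rq W w) (rq W' w')"
  have ww: "pt ?W ?W' w w' \<in> carrier (ht W W')" using W w by simp
  note q = rq[OF W(1) w(1)] rq[OF W(2) w(2)] rq[OF hm_ht[OF W] ww]
  have b: "bm ?W" "bm ?W'" "bm (tens ?W ?W')" "bm (tens ?W' Z)" using W by auto
  have m: "rlin (tens V' V') (tens ?W ?W') ?m" by (rule tm_rlin) (use b q in auto)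
  have d: "tm V' Z (tens V' V') Z \<Delta> (\<lambda>e. e) (\<delta> e) \<in> carrier (tens (tens V' V') Z)"
    by (rule tm_closed) (use \<Delta> \<delta>(1)[OF e] in \<open>auto simp: llin_id\<close>)
  have "rh (ht W W') (pt Z (tens ?W ?W') e (pt ?W ?W' w w')) = rw (ht W W') (pt ?W ?W' w w') (\<delta> e)"
    using rh(3)[OF hm_ht[OF W] e ww] W by (simp add: strictD(1))
  also have "\<dots> = tm V' Z (tens ?W ?W') Z (\<lambda>v. ?m (\<Delta> v)) (\<lambda>e. e) (\<delta> e)"
    unfolding rw_def strictD(1)[OF W]
    by (rule tm_cong) (use b q(14) W \<Delta>(4) m \<Delta>_rq[OF W w] \<delta>(1)[OF e] in \<open>auto simp: llin_id strictD(1) intro: rlin_comp\<close>)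
  also have "\<dots> = tm (tens V' V') Z (tens ?W ?W') Z ?m (\<lambda>e. e) (tm V' Z (tens V' V') Z \<Delta> (\<lambda>e. e) (\<delta> e))"
    by (rule tm_comp[symmetric]) (use b m \<Delta> \<delta>(1)[OF e] in \<open>auto simp: llin_id\<close>)
  finally have "as ?W ?W' Z (rh (ht W W') (pt Z (tens ?W ?W') e (pt ?W ?W' w w'))) = as ?W ?W' Z (tm (tens V' V') Z (tens ?W ?W') Z ?m (\<lambda>e. e) (tm V' Z (tens V' V') Z \<Delta> (\<lambda>e. e) (\<delta> e)))" by (rule arg_cong)
  also have "\<dots> = tm V' (tens V' Z) ?W (tens ?W' Z) (rq W w) (rw W' w') (as V' V' Z (tm V' Z (tens V' V') Z \<Delta> (\<lambda>e. e) (\<delta> e)))"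
    unfolding rw_eq by (rule as_nat[OF bms(4,4,3) b(1,2) bms(3) q(4,8,9) llin_id d])
  also have "\<dots> = tm V' Z ?W (tens ?W' Z) (rq W w) (\<lambda>e. rw W' w' (\<delta> e)) (\<delta> e)"
    unfolding coassoc[OF e]
    by (rule tm_comp[OF bms(4,3,4) bm_tens[OF bms(4,3)] b(1,4) rlin_id \<delta>_llin q(4) rw(2)[OF W(2) w(2)] \<delta>(1)[OF e]])
  also have "\<dots> = tm V' Z ?W (tens ?W' Z) (rq W w) (\<lambda>e. rh W' (pt Z ?W' e w')) (\<delta> e)"
    by (rule tm_cong) (use b q llin_comp[OF rw(2)[OF W(2) w(2)] \<delta>_llin] rh_llin[OF W(2) w(2)] rh(3)[OF W(2)] w \<delta>(1)[OF e] in auto)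
  also have "\<dots> = tm ?W Z ?W (tens ?W' Z) (\<lambda>x. x) (\<lambda>e. rh W' (pt Z ?W' e w')) (rw W w (\<delta> e))"
    unfolding rw_def by (rule tm_comp[symmetric]) (use b q rh_llin[OF W(2) w(2)] \<delta>(1)[OF e] in \<open>auto simp: llin_id rlin_id\<close>)
  finally show ?thesis using rh(3)[OF W(1) e w(1)] by simp
qed

text \<open>The counit law for \<delta>, tested by evaluating at all x.\<close>

lemma rh_unit:
  assumes e: "e \<in> carrier Z"
  shows "lu Z (rh HI (pt Z I e one_I)) = e"
proof -
  have o: "one_I \<in> carrier HI" "one_I \<in> carrier I" by simp_all
  note q = rq[OF hm_HI o(1), unfolded strictD(3)]
  note r = rw[OF hm_HI o(1), unfolded strictD(3)]
  have rc: "rw HI one_I (\<delta> e) \<in> carrier (tens I Z)" by (rule r(4)[OF \<delta>(1)[OF e]])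
  have "lu Z (rw HI one_I (\<delta> e)) = e"
  proof (rule right_univ_inj[OF Zu bms(1,2) hom_closed[OF lu_hom rc] e])
    fix x assume x: "x \<in> carrier X"
    have c: "tm X V' X I (\<lambda>x. x) (rq HI one_I) (su x) \<in> carrier (tens X I)"
      by (rule tm_closed) (use q su x in \<open>auto simp: rlin_id\<close>)
    \<comment> \<open>The counit law for \<open>su\<close>: both elements have the same image under
      \<sigma> at the unit object, and \<sigma> is injective there.\<close>
    have "tm X V' X I (\<lambda>x. x) (rq HI one_I) (su x) = pt X I x one_I"
    proof (rule sX_inj[OF hm_HI])
      show "sX HI (tm X V' X I (\<lambda>x. x) (rq HI one_I) (su x)) = sX HI (pt X I x one_I)"
        using halfbraid_nat[OF sX hmV hm_HI rq(1)[OF hm_HI o(1)] su(1)[OF x]] halfbraid_unit(2)[OF sX x R.one_closed] x q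
        by (simp add: strictD(3) su tm_pt llin_id)
    qed (use c x in \<open>simp_all add: strictD(3)\<close>)
    then have k: "tm V' Y I Y (rq HI one_I) (\<lambda>y. y) (kk e x) = pt I Y one_I (px x e)"
      using kk_nat[OF e x hmV rq(1)[OF hmV]] kk_nat[OF e x hm_HI rq(1)[OF hm_HI o(1)]] e x
        halfbraid_unit(2)[OF sY _ R.one_closed] llin_closed[OF px_llin[OF x] e]
      by (simp add: strictD(3) ee)
    have "px x (lu Z t) = lu Y (cx I x t)" if t: "t \<in> carrier (tens I Z)" for t
    proof (rule tens_eqI[where f = "\<lambda>t. px x (lu Z t)" and g = "\<lambda>t. lu Y (cx I x t)",
        OF bm_I bms(3) hom_trans[OF llin_hom[OF px_llin[OF x]] lu_hom] hom_trans[OF lu_hom cx(1)[OF bm_I x]] _ t])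
      fix i z assume "i \<in> carrier I" and z: "z \<in> carrier Z"
      then obtain r where r: "r \<in> carrier R" "i = \<iota> r" by (auto simp: I_carrier)
      show "px x (lu Z (pt I Z i z)) = lu Y (cx I x (pt I Z i z))"
        using r z x llinD[OF px_llin[OF x] r(1) z] llin_closed[OF px_llin[OF x] z] by (simp add: lu_pt cx)
    qed auto
    from this[OF rc] have "px x (lu Z (rw HI one_I (\<delta> e))) = lu Y (cx I x (rw HI one_I (\<delta> e)))" .
    also have "cx I x (rw HI one_I (\<delta> e)) = tm V' Y I Y (rq HI one_I) (\<lambda>y. y) (kk e x)"
      unfolding rw_def strictD(3) using cx_nat[OF bms(4) bm_I q(4) x \<delta>(1)[OF e]] \<delta>(2)[OF e x] by simp
    also have "lu Y \<dots> = px x e" unfolding k using llin_closed[OF px_llin[OF x] e] by (simp add: lu_pt act_one)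
    finally show "px x (lu Z (rw HI one_I (\<delta> e))) = px x e" .
  qed auto
  then show ?thesis using rh(3)[OF hm_HI e o(1)] by (simp add: strictD(3))
qed

lemma halfbraid_rh: "halfbraid Z rh"
  unfolding halfbraid_def
  using rh(1) rh_nat rh_mult rh_unit by simp

section \<open>The inner hom of bimodules as inner hom in the weak centralizer\<close>

text \<open>The defining property of \<delta>, extended from u \<otimes> x to all T in W \<otimes>
  X: braiding past \<open>e\<close> followed by evaluation is \<tau> of \<open>e\<close> evaluated
  on \<open>qw W T\<close>. For T in the image of \<sigma>, \<open>qw\<close> cancels
  \<sigma>.\<close>

lemma ep_tens_braid:
  assumes W: "hm W" and e: "e \<in> carrier Z" and T: "T \<in> carrier (tens (Rs W) X)"
  shows "tm (Rs W) (tens Z X) (Rs W) Y (\<lambda>w. w) ep (as (Rs W) Z X (tm (tens Z (Rs W)) X (tens (Rs W) Z) X (rh W) (\<lambda>x. x)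
      (ai Z (Rs W) X (pt Z (tens (Rs W) X) e T)))) = sY W (ee (Rs W) e (qw W T))" (is "?f T = ?g T")
proof -
  let ?W = "Rs W"
  have b: "bm ?W" "bm (tens ?W X)" "bm (tens Z X)" "bm (tens ?W Y)" "bm (tens ?W Z)" "bm (tens Z ?W)" using W by auto
  note rl = lmod_rlin[OF rh(1)[OF W] b(6,5)]
  have ep_as: "tm ?W (tens Z X) ?W Y (\<lambda>w. w) ep (as ?W Z X (pt (tens ?W Z) X s x)) = cx ?W x s" if x: "x \<in> carrier X" and s: "s \<in> carrier (tens ?W Z)" for x s
    by (rule tens_eqI[where f = "\<lambda>s. tm ?W (tens Z X) ?W Y (\<lambda>w. w) ep (as ?W Z X (pt (tens ?W Z) X s x))" and g = "cx ?W x",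
        OF b(1) bms(3) hom_trans[OF tm_hom hom_trans[OF as_hom pt_hom(2)]] cx(1)[OF b(1) x] _ s])
      (use b x ep_lin in \<open>simp_all add: rlin_id as_pt tm_pt cx\<close>)
  show ?thesis
  proof (rule tens_eqI[where f = ?f and g = ?g, OF b(1) bms(1) hom_trans[OF tm_hom hom_trans[OF as_hom hom_trans[OF tm_hom hom_trans[OF ai_hom pt_hom(1)]]]]
        hom_trans[OF halfbraidD(3)[OF sY W] hom_trans[OF ee(1)[OF b(1) e] qw(1)[OF W]]] _ T])
    fix w x assume "w \<in> carrier ?W" and x: "x \<in> carrier X"
    then have w: "w \<in> carrier W" by simp
    note q = rq[OF W w]
    have rc: "rw W w (\<delta> e) \<in> carrier (tens ?W Z)" by (rule rw(4)[OF W w \<delta>(1)[OF e]])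
    have "?f (pt ?W X w x) = tm ?W (tens Z X) ?W Y (\<lambda>w. w) ep (as ?W Z X (pt (tens ?W Z) X (rw W w (\<delta> e)) x))"
      using b e w x W rl by (simp add: ai_pt tm_pt llin_id rh(3))
    also have "\<dots> = cx ?W x (rw W w (\<delta> e))" by (rule ep_as[OF x rc])
    also have "\<dots> = tm V' Y ?W Y (rq W w) (\<lambda>y. y) (kk e x)"
      unfolding rw_def using cx_nat[OF bms(4) b(1) q(4) x \<delta>(1)[OF e]] \<delta>(2)[OF e x] by simp
    also have "\<dots> = ?g (pt ?W X w x)" using kk_nat[OF e x W q(1)] qw(2)[OF W w x] by simp
    finally show "?f (pt ?W X w x) = ?g (pt ?W X w x)" .
  qed (use b e rl ep_lin in \<open>auto simp: rlin_id llin_id\<close>)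
qed

lemma braid_mor_ep: "braid_mor (tens Z X) (tens_braid Z rh X sX) Y sY ep"
  unfolding braid_mor_def
proof (intro conjI allI impI ballI)
  show "ep \<in> lmod_hom E (tens Z X) Y" by (rule right_univD(2)[OF Zu])
  fix W t assume W: "hm W" and t: "t \<in> carrier (tens (tens Z X) (Rs W))"
  let ?W = "Rs W"
  have b: "bm ?W" "bm (tens ?W X)" "bm (tens X ?W)" "bm (tens Z X)" "bm (tens ?W Y)" "bm (tens ?W Z)" "bm (tens Z ?W)" using W by auto
  note rl = lmod_rlin[OF rh(1)[OF W] b(7,6)]
  show "tm ?W (tens Z X) ?W Y (\<lambda>x. x) ep (tens_braid Z rh X sX W t) = sY W (tm (tens Z X) ?W Y ?W ep (\<lambda>x. x) t)"
    unfolding tens_braid_def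
  proof (rule tens3_eqI'[where f = "\<lambda>t. tm ?W (tens Z X) ?W Y (\<lambda>w. w) ep (as ?W Z X (tm (tens Z ?W) X (tens ?W Z) X (rh W) (\<lambda>x. x)
      (ai Z ?W X (tm Z (tens X ?W) Z (tens ?W X) (\<lambda>x. x) (sX W) (as Z X ?W t)))))" and g = "\<lambda>t. sY W (tm (tens Z X) ?W Y ?W ep (\<lambda>x. x) t)",
        OF bms(3,1) b(1) hom_trans[OF tm_hom hom_trans[OF as_hom hom_trans[OF tm_hom hom_trans[OF ai_hom hom_trans[OF tm_hom as_hom]]]]]
        hom_trans[OF halfbraidD(3)[OF sY W] tm_hom] bm_group[OF b(5)] _ t])
    fix e x w assume e: "e \<in> carrier Z" and x: "x \<in> carrier X" and w: "w \<in> carrier ?W"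
    have p: "pt X ?W x w \<in> carrier (tens X ?W)" using b x w by simp
    have c: "sX W (pt X ?W x w) \<in> carrier (tens ?W X)" by (rule hom_closed[OF halfbraidD(3)[OF sX W] p])
    show "tm ?W (tens Z X) ?W Y (\<lambda>w. w) ep (as ?W Z X (tm (tens Z ?W) X (tens ?W Z) X (rh W) (\<lambda>x. x)
      (ai Z ?W X (tm Z (tens X ?W) Z (tens ?W X) (\<lambda>x. x) (sX W) (as Z X ?W (pt (tens Z X) ?W (pt Z X e x) w))))))
      = sY W (tm (tens Z X) ?W Y ?W ep (\<lambda>x. x) (pt (tens Z X) ?W (pt Z X e x) w))"
      using ep_tens_braid[OF W e c] qw_sX[OF W p] b e x w halfbraidD(4)[OF sX W] ep_lin
      by (simp add: as_pt tm_pt rlin_id llin_id ee)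
  qed (use b rl ep_lin halfbraidD(4)[OF sX W] in \<open>auto simp: rlin_id llin_id\<close>)
qed

text \<open>A braided map P \<otimes> X \<rightarrow> Y corresponds to a braided map P \<rightarrow>
  Z. By naturality and freeness of V it suffices to compare at g \<otimes> u, where the claim is an
  equation for \<delta>(\<phi> g) and can be tested by evaluating at all x.\<close>

lemma braid_mor_unique_map:
  assumes p: "halfbraid P p" and f: "braid_mor (tens P X) (tens_braid P p X sX) Y sY f" and \<phi>: "\<phi> \<in> lmod_hom E P Z"
    and \<phi>f: "\<And>g x. g \<in> carrier P \<Longrightarrow> x \<in> carrier X \<Longrightarrow> ep (pt Z X (\<phi> g) x) = f (pt P X g x)"
  shows "braid_mor P p Z rh \<phi>"
proof -
  note P = halfbraidD(1)[OF p]
  have bPX: "bm (tens P X)" "bm (tens P V')" "bm (tens V' P)" "bm (tens V' X)" "bm (tens X V')" using P by auto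
  have fl: "f \<in> lmod_hom E (tens P X) Y" using f by (simp add: braid_mor_def)
  note fl = lmod_llin[OF fl bPX(1) bms(2)] lmod_rlin[OF fl bPX(1) bms(2)]
  note \<phi>l = lmod_llin[OF \<phi> P bms(3)] lmod_rlin[OF \<phi> P bms(3)]
  have \<phi>c: "\<phi> g \<in> carrier Z" if "g \<in> carrier P" for g using llin_closed[OF \<phi>l(1) that] .
  note pl = halfbraidD(3-5)[OF p hmV] and sl = halfbraidD(3-5)[OF sX hmV]
  have fx: "llin P Y (\<lambda>g. f (pt P X g x))" if "x \<in> carrier X" for x by (rule left_lin_pt[OF fl(1) P bms(1) that])
  have base: "\<delta> (\<phi> g) = tm V' P V' Z (\<lambda>v. v) \<phi> (p V (pt P V' g u))" if g: "g \<in> carrier P" for g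
  proof (rule \<delta>_eqI[OF _ \<phi>c[OF g]])
    let ?s = "p V (pt P V' g u)"
    have s: "?s \<in> carrier (tens V' P)" using hom_closed[OF pl(1)] P g by simp
    show "tm V' P V' Z (\<lambda>v. v) \<phi> ?s \<in> carrier (tens V' Z)" by (rule tm_closed) (use P \<phi>l s in \<open>auto simp: rlin_id\<close>)
    fix x assume x: "x \<in> carrier X"
    have c: "pt P (tens X V') g (su x) \<in> carrier (tens P (tens X V'))" using P g su(1)[OF x] by simp
    \<comment> \<open>The element g \<otimes> \<open>su x\<close>: braiding V past X turns
      \<open>su x\<close> into u \<otimes> x, so that the half-braiding of P is then applied exactly
      to g \<otimes> u.\<close>
    let ?t = "ai P X V' (pt P (tens X V') g (su x))"
    have t: "?t \<in> carrier (tens (tens P X) V')" by (rule hom_closed[OF ai_hom c]) (use P in auto)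
    have "cx V' x (tm V' P V' Z (\<lambda>v. v) \<phi> ?s) = tm V' P V' Y (\<lambda>v. v) (\<lambda>g. px x (\<phi> g)) ?s"
      unfolding cx_def by (rule tm_comp) (use P \<phi>l s px_llin[OF x] in \<open>auto simp: rlin_id\<close>)
    also have "\<dots> = tm V' P V' Y (\<lambda>v. v) (\<lambda>g. f (pt P X g x)) ?s"
      by (rule tm_cong) (use P s fx[OF x] llin_comp[OF px_llin[OF x] \<phi>l(1)] \<phi>f x in \<open>auto simp: rlin_id\<close>)
    also have "\<dots> = tm V' (tens P X) V' Y (\<lambda>v. v) f (as V' P X (pt (tens V' P) X ?s x))"
      by (rule tens_eqI[where g = "\<lambda>s. tm V' (tens P X) V' Y (\<lambda>v. v) f (as V' P X (pt (tens V' P) X s x))" and f = "tm V' P V' Y (\<lambda>v. v) (\<lambda>g. f (pt P X g x))",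
          OF bms(4) P tm_hom hom_trans[OF tm_hom hom_trans[OF as_hom pt_hom(2)]] _ s])
        (use P x fx[OF x] fl in \<open>simp_all add: as_pt tm_pt rlin_id\<close>)
    also have "as V' P X (pt (tens V' P) X ?s x) = tens_braid P p X sX V ?t"
      unfolding tens_braid_def using P g x c su(1,3)[OF x] pl sl by (simp add: ai_props(4) tm_pt rlin_id llin_id ai_pt)
    also have "tm V' (tens P X) V' Y (\<lambda>v. v) f (tens_braid P p X sX V ?t) = sY V (tm (tens P X) V' Y V' f (\<lambda>x. x) ?t)"
      using f t hmV unfolding braid_mor_def by simp
    also have "tm (tens P X) V' Y V' f (\<lambda>x. x) ?t = ee V' (\<phi> g) (su x)"
      by (rule tens_eqI[where f = "\<lambda>T. tm (tens P X) V' Y V' f (\<lambda>x. x) (ai P X V' (pt P (tens X V') g T))" and g = "ee V' (\<phi> g)",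
          OF bms(1,4) hom_trans[OF tm_hom hom_trans[OF ai_hom pt_hom(1)]] ee(1)[OF bms(4) \<phi>c[OF g]] _ su(1)[OF x]])
        (use P g fl \<phi>c[OF g] \<phi>f[OF g] in \<open>simp_all add: ai_pt tm_pt llin_id ee\<close>)
    finally show "cx V' x (tm V' P V' Z (\<lambda>v. v) \<phi> ?s) = kk (\<phi> g) x" by (simp add: kk_def)
  qed
  show ?thesis
    unfolding braid_mor_def
  proof (intro conjI allI impI ballI \<phi>)
    fix W t assume W: "hm W" and t: "t \<in> carrier (tens P (Rs W))"
    let ?W = "Rs W"
    have b: "bm ?W" "bm (tens ?W Z)" "bm (tens Z ?W)" using W by auto
    show "tm ?W P ?W Z (\<lambda>x. x) \<phi> (p W t) = rh W (tm P ?W Z ?W \<phi> (\<lambda>x. x) t)"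
    proof (rule tens_eqI[where f = "\<lambda>t. tm ?W P ?W Z (\<lambda>x. x) \<phi> (p W t)" and g = "\<lambda>t. rh W (tm P ?W Z ?W \<phi> (\<lambda>x. x) t)",
          OF P b(1) hom_trans[OF tm_hom halfbraidD(3)[OF p W]] hom_trans[OF rh(2)[OF W] tm_hom] _ t])
      fix g w assume g: "g \<in> carrier P" and "w \<in> carrier ?W"
      then have w: "w \<in> carrier W" by simp
      note q = rq[OF W w]
      have s: "p V (pt P V' g u) \<in> carrier (tens V' P)" using hom_closed[OF pl(1)] P g by simp
      have "p W (pt P ?W g w) = tm V' P ?W P (rq W w) (\<lambda>x. x) (p V (pt P V' g u))"
        using halfbraidD(6)[OF p hmV W q(1) g u_closed] q(2) by simp
      then have "tm ?W P ?W Z (\<lambda>x. x) \<phi> (p W (pt P ?W g w)) = tm V' P ?W Z (rq W w) \<phi> (p V (pt P V' g u))"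
        using tm_comp[OF bms(4) P b(1) P b(1) bms(3) q(4) llin_id rlin_id \<phi>l(1) s] by simp
      also have "\<dots> = rw W w (\<delta> (\<phi> g))"
        unfolding rw_def base[OF g] by (rule tm_comp[symmetric]) (use P b s q \<phi>l in \<open>auto simp: rlin_id llin_id\<close>)
      also have "\<dots> = rh W (tm P ?W Z ?W \<phi> (\<lambda>x. x) (pt P ?W g w))"
        using P b g w \<phi>c[OF g] \<phi>l by (simp add: tm_pt llin_id rh(3)[OF W])
      finally show "tm ?W P ?W Z (\<lambda>x. x) \<phi> (p W (pt P ?W g w)) = rh W (tm P ?W Z ?W \<phi> (\<lambda>x. x) (pt P ?W g w))" .
    qed (use P b \<phi>l in \<open>auto simp: rlin_id llin_id\<close>)
  qed
qed

end

section \<open>The weak centralizer and the skew dual\<close>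

text \<open>The preimage is \<open>g\<close> under G, conjugated by \<theta>. It has the same image
  under G as \<open>g\<close> after applying F, and naturality of \<theta>' recovers an arrow from
  its image under G.\<close>

lemma equivalence_full:
  fixes C :: "('o, 'a, 'm) cat_scheme" and D :: "('p, 'b, 'n) cat_scheme" and F :: "('o, 'a, 'p, 'b, 'z) ftor_scheme"
  assumes F: "is_equivalence C D F" and X: "X \<in> Obj C" and Y: "Y \<in> Obj C" and g: "g \<in> homset D (FO F X) (FO F Y)"
  shows "\<exists>f\<in>homset C X Y. FA F f = g"
proof -
  obtain G :: "('p, 'b, 'o, 'a) ftor" and \<theta> \<theta>' where fF: "is_ftor C D F" and fG: "is_ftor D C G" and \<theta>: "natural_iso C C (ftor_comp G F) ftor_id \<theta>"
    and \<theta>': "natural_iso D D (ftor_comp F G) ftor_id \<theta>'"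
    using F by (auto simp: is_equivalence_def)
  interpret C: category C using fF by (simp add: is_ftor_def)
  interpret D: category D using fF by (simp add: is_ftor_def)
  have FX: "FO F X \<in> Obj D" "FO F Y \<in> Obj D" using fF X Y by (auto simp: is_ftor_def)
  have Fa: "FA F f \<in> homset D (FO F A) (FO F B)" if "f \<in> homset C A B" for f A B using fF that by (auto simp: is_ftor_def)
  have Ga: "FA G f \<in> homset C (FO G A) (FO G B)" if "f \<in> homset D A B" for f A B using fG that by (auto simp: is_ftor_def)
  have t: "\<theta> A \<in> homset C (FO G (FO F A)) A" "iso_arrow C (\<theta> A)" if "A \<in> Obj C" for A
    using \<theta> that by (auto simp: natural_iso_def ftor_comp_def ftor_id_def)
  have t': "\<theta>' A \<in> homset D (FO F (FO G A)) A" "iso_arrow D (\<theta>' A)" if "A \<in> Obj D" for A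
    using \<theta>' that by (auto simp: natural_iso_def ftor_comp_def ftor_id_def)
  have n: "\<theta> B \<bullet>\<^bsub>C\<^esub> FA G (FA F f) = f \<bullet>\<^bsub>C\<^esub> \<theta> A" if "f \<in> homset C A B" for f A B
    using \<theta> that by (auto simp: natural_iso_def ftor_comp_def ftor_id_def)
  have n': "\<theta>' B \<bullet>\<^bsub>D\<^esub> FA F (FA G f) = f \<bullet>\<^bsub>D\<^esub> \<theta>' A" if "f \<in> homset D A B" for f A B
    using \<theta>' that by (auto simp: natural_iso_def ftor_comp_def ftor_id_def)
  obtain i where i: "i \<in> homset C X (FO G (FO F X))" "i \<bullet>\<^bsub>C\<^esub> \<theta> X = Idn C (FO G (FO F X))"
    using t[OF X] by (auto simp: iso_arrow_def inverse_arrows_def homset_def)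
  obtain j where j: "j \<in> homset C Y (FO G (FO F Y))" "j \<bullet>\<^bsub>C\<^esub> \<theta> Y = Idn C (FO G (FO F Y))"
    using t[OF Y] by (auto simp: iso_arrow_def inverse_arrows_def homset_def)
  obtain l where l: "l \<in> homset D (FO F X) (FO F (FO G (FO F X)))" "\<theta>' (FO F X) \<bullet>\<^bsub>D\<^esub> l = Idn D (FO F X)"
    using t'[OF FX(1)] by (auto simp: iso_arrow_def inverse_arrows_def homset_def)
  define f where "f = \<theta> Y \<bullet>\<^bsub>C\<^esub> FA G g \<bullet>\<^bsub>C\<^esub> i"
  have Gg: "FA G g \<in> homset C (FO G (FO F X)) (FO G (FO F Y))" by (rule Ga[OF g])
  have f: "f \<in> homset C X Y" unfolding f_def using C.Cmp_hom[OF C.Cmp_hom[OF i(1) Gg] t(1)[OF Y]] .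
  have GF: "FA G (FA F f) \<in> homset C (FO G (FO F X)) (FO G (FO F Y))" by (rule Ga[OF Fa[OF f]])
  have "f \<bullet>\<^bsub>C\<^esub> \<theta> X = \<theta> Y \<bullet>\<^bsub>C\<^esub> FA G g"
    unfolding f_def
    using C.Cmp_assoc[OF t(1)[OF X] C.Cmp_hom[OF i(1) Gg] t(1)[OF Y]] C.Cmp_assoc[OF t(1)[OF X] i(1) Gg] C.Cmp_Idn[OF Gg] i(2) by simp
  then have "\<theta> Y \<bullet>\<^bsub>C\<^esub> FA G (FA F f) = \<theta> Y \<bullet>\<^bsub>C\<^esub> FA G g" using n[OF f] by simp
  then have "j \<bullet>\<^bsub>C\<^esub> (\<theta> Y \<bullet>\<^bsub>C\<^esub> FA G (FA F f)) = j \<bullet>\<^bsub>C\<^esub> (\<theta> Y \<bullet>\<^bsub>C\<^esub> FA G g)" by simp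
  then have "FA G (FA F f) = FA G g"
    using C.Cmp_assoc[OF GF t(1)[OF Y] j(1)] C.Cmp_assoc[OF Gg t(1)[OF Y] j(1)] C.Idn_Cmp[OF GF] C.Idn_Cmp[OF Gg] j(2) by simp
  then have "FA F f \<bullet>\<^bsub>D\<^esub> \<theta>' (FO F X) = g \<bullet>\<^bsub>D\<^esub> \<theta>' (FO F X)" using n'[OF g] n'[OF Fa[OF f]] by simp
  then have "(FA F f \<bullet>\<^bsub>D\<^esub> \<theta>' (FO F X)) \<bullet>\<^bsub>D\<^esub> l = (g \<bullet>\<^bsub>D\<^esub> \<theta>' (FO F X)) \<bullet>\<^bsub>D\<^esub> l" by simp
  then have "FA F f = g"
    using D.Cmp_assoc[OF l(1) t'(1)[OF FX(1)] Fa[OF f]] D.Cmp_assoc[OF l(1) t'(1)[OF FX(1)] g] D.Cmp_Idn[OF g] D.Cmp_Idn[OF Fa[OF f]] l(2) by simp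
  then show ?thesis using f by blast
qed

lemma equivalence_surjective:
  assumes "is_equivalence C D F" and "Y \<in> Obj D"
  shows "\<exists>X\<in>Obj C. \<exists>h\<in>homset D (FO F X) Y. iso_arrow D h"
  using assms unfolding is_equivalence_def natural_iso_def ftor_comp_def ftor_id_def is_ftor_def by fastforce

section \<open>Morphisms and tensor products of the weak centralizer as functions\<close>

context bialg begin

abbreviation "WC \<equiv> weak_centralizer HC C F"

lemma WC_simps:
  "Obj WC = wc_objects HC C F" "Arr WC = wc_arrows HC C F" "Dom WC = src" "Cod WC = tgt"
  "Idn WC P = Arrow P P (Idn C (fst P))" "Cmp WC g f = Arrow (src f) (tgt g) (fn g \<bullet>\<^bsub>C\<^esub> fn f)"
  "TensO WC = wc_tens HC C F"
  "TensA WC f g = Arrow (wc_tens HC C F (src f) (src g)) (wc_tens HC C F (tgt f) (tgt g)) (TensA C (fn f) (fn g))"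
  by (simp_all add: weak_centralizer_def Let_def)

abbreviation "wco P p \<equiv> (P, wc_arr P p)"

lemma wc_mor_eq:
  assumes p: "halfbraid P p" and q: "halfbraid Q q" and f: "f \<in> lmod_hom E P Q" and W: "hm W"
  shows "(Idn C (Rs W) \<star>\<^bsub>C\<^esub> Arrow P Q f) \<bullet>\<^bsub>C\<^esub> wc_arr P p W = wc_arr Q q W \<bullet>\<^bsub>C\<^esub> (Arrow P Q f \<star>\<^bsub>C\<^esub> Idn C (Rs W)) \<longleftrightarrow>
    (\<forall>t\<in>carrier (tens P (Rs W)). tm (Rs W) P (Rs W) Q (\<lambda>x. x) f (p W t) = q W (tm P (Rs W) Q (Rs W) f (\<lambda>x. x) t))"
proof -
  let ?W = "Rs W" and ?S = "tens P (Rs W)"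
  have o: "W \<in> Obj HC" using W by (simp add: hm_def)
  have b: "bm P" "bm Q" "bm ?W" using halfbraidD(1)[OF p] halfbraidD(1)[OF q] W by auto
  note fl = lmod_llin[OF f b(1,2)] lmod_rlin[OF f b(1,2)]
  have c: "p W t \<in> carrier (tens ?W P)" if "t \<in> carrier ?S" for t using hom_closed[OF halfbraidD(3)[OF p W] that] .
  have m: "tm ?W P ?W Q (\<lambda>x\<in>carrier W. x) f (p W t) = tm ?W P ?W Q (\<lambda>x. x) f (p W t)"
    "tm P ?W Q ?W f (\<lambda>x\<in>carrier W. x) t = tm P ?W Q ?W f (\<lambda>x. x) t" if "t \<in> carrier ?S" for t
    using tm_idr(1)[OF b(3,1) c[OF that] b(2) fl(1)] tm_idr(2)[OF b(1,3) that b(2) fl(2)] by simp_all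
  have L: "(Idn C ?W \<star>\<^bsub>C\<^esub> Arrow P Q f) \<bullet>\<^bsub>C\<^esub> wc_arr P p W = Arrow ?S (tens ?W Q) (\<lambda>t\<in>carrier ?S. tm ?W P ?W Q (\<lambda>x. x) f (p W t))"
    using o b fl c m by (auto simp: wc_arr_def compose_def cong: restrict_cong simp del: HC_simps)
  have R: "wc_arr Q q W \<bullet>\<^bsub>C\<^esub> (Arrow P Q f \<star>\<^bsub>C\<^esub> Idn C ?W) = Arrow ?S (tens ?W Q) (\<lambda>t\<in>carrier ?S. q W (tm P ?W Q ?W f (\<lambda>x. x) t))"
    using o b fl m by (auto simp: wc_arr_def compose_def cong: restrict_cong simp del: HC_simps)
  show ?thesis unfolding L R by (auto simp: fun_eq_iff restrict_def)
qed

lemma wc_homset: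
  assumes p: "halfbraid P p" and q: "halfbraid Q q"
  shows "a \<in> homset WC (wco P p) (wco Q q) \<longleftrightarrow> (\<exists>f. a = Arrow (wco P p) (wco Q q) (Arrow P Q f) \<and> braid_mor P p Q q f)"
proof
  have b: "bm P" "bm Q" using halfbraidD(1)[OF p] halfbraidD(1)[OF q] by auto
  have O: "wco P p \<in> wc_objects HC C F" "wco Q q \<in> wc_objects HC C F" using p q unfolding wc_objects_iff by blast+
  show "\<exists>f. a = Arrow (wco P p) (wco Q q) (Arrow P Q f) \<and> braid_mor P p Q q f" if a: "a \<in> homset WC (wco P p) (wco Q q)"
  proof -
    from a obtain g where g: "a = Arrow (wco P p) (wco Q q) g" "g \<in> homset C P Q"
      "\<forall>V\<in>Obj HC. (Idn C (FO F V) \<star>\<^bsub>C\<^esub> g) \<bullet>\<^bsub>C\<^esub> wc_arr P p V = wc_arr Q q V \<bullet>\<^bsub>C\<^esub> (g \<star>\<^bsub>C\<^esub> Idn C (FO F V))"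
      unfolding homset_def[of WC] WC_simps wc_arrows_def by (auto simp del: HC_simps C_simps F_simps)
    obtain f where f: "g = Arrow P Q f" "f \<in> lmod_hom E P Q" using g(2) unfolding C_homset by metis
    have "braid_mor P p Q q f"
      unfolding braid_mor_def
    proof (intro conjI f(2) allI impI)
      fix W assume W: "hm W"
      then have "(Idn C (Rs W) \<star>\<^bsub>C\<^esub> g) \<bullet>\<^bsub>C\<^esub> wc_arr P p W = wc_arr Q q W \<bullet>\<^bsub>C\<^esub> (g \<star>\<^bsub>C\<^esub> Idn C (Rs W))"
        using g(3) unfolding hm_Obj[symmetric] F_simps(1) by blast
      from iffD1[OF wc_mor_eq[OF p q f(2) W] this[unfolded f(1)]]
      show "\<forall>t\<in>carrier (tens P (Rs W)). tm (Rs W) P (Rs W) Q (\<lambda>x. x) f (p W t) = q W (tm P (Rs W) Q (Rs W) f (\<lambda>x. x) t)" .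
    qed
    then show ?thesis using f g by blast
  qed
  assume "\<exists>f. a = Arrow (wco P p) (wco Q q) (Arrow P Q f) \<and> braid_mor P p Q q f"
  then obtain f where a: "a = Arrow (wco P p) (wco Q q) (Arrow P Q f)" and f: "braid_mor P p Q q f" by blast
  have fl: "f \<in> lmod_hom E P Q" using f by (simp add: braid_mor_def)
  have "\<forall>V\<in>Obj HC. (Idn C (FO F V) \<star>\<^bsub>C\<^esub> Arrow P Q f) \<bullet>\<^bsub>C\<^esub> wc_arr P p V = wc_arr Q q V \<bullet>\<^bsub>C\<^esub> (Arrow P Q f \<star>\<^bsub>C\<^esub> Idn C (FO F V))"
  proof
    fix W assume "W \<in> Obj HC"
    then have W: "hm W" unfolding hm_Obj .
    show "(Idn C (FO F W) \<star>\<^bsub>C\<^esub> Arrow P Q f) \<bullet>\<^bsub>C\<^esub> wc_arr P p W = wc_arr Q q W \<bullet>\<^bsub>C\<^esub> (Arrow P Q f \<star>\<^bsub>C\<^esub> Idn C (FO F W))"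
      unfolding F_simps(1) by (rule iffD2[OF wc_mor_eq[OF p q fl W]]) (use f W in \<open>auto simp: braid_mor_def\<close>)
  qed
  moreover have "Arrow P Q f \<in> homset C P Q" using fl C_homset_Arrow[OF b] by simp
  ultimately show "a \<in> homset WC (wco P p) (wco Q q)"
    unfolding homset_def[of WC] WC_simps wc_arrows_def a using O by (auto simp del: HC_simps C_simps F_simps)
qed

text \<open>Components of a half-braiding are extensional functions, so the formula for the tensor
  product has to be restricted to its domain.\<close>

definition tens_braid_r where
  "tens_braid_r P p X s W = (\<lambda>t\<in>carrier (tens (tens P X) (Rs W)). tens_braid P p X s W t)"

lemma wc_tens_eq:
  assumes p: "halfbraid P p" and s: "halfbraid X s"
  shows "wc_tens HC C F (wco P p) (wco X s) = wco (tens P X) (tens_braid_r P p X s)"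
proof -
  have b: "bm P" "bm X" using halfbraidD(1)[OF p] halfbraidD(1)[OF s] by auto
  have "Assoc C (FO F W) P X \<bullet>\<^bsub>C\<^esub> (wc_arr P p W \<star>\<^bsub>C\<^esub> Idn C X) \<bullet>\<^bsub>C\<^esub>
        inv_arrow C (Assoc C P (FO F W) X) \<bullet>\<^bsub>C\<^esub> (Idn C P \<star>\<^bsub>C\<^esub> wc_arr X s W) \<bullet>\<^bsub>C\<^esub> Assoc C P X (FO F W)
      = Arrow (tens (tens P X) (Rs W)) (tens (Rs W) (tens P X)) (tens_braid_r P p X s W)" (is "?L = _") if o: "W \<in> Obj HC" for W
  proof -
    have W: "hm W" using o unfolding hm_Obj .
    let ?W = "Rs W"
    have bW: "bm ?W" using W by simp
    note l = halfbraidD(4,5)[OF p W] halfbraidD(4,5)[OF s W]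
    note i = ai_props(1)[OF b(1) bW b(2), unfolded Assoc_eq[OF b(1) bW b(2)]]
    let ?S = "tens (tens P X) ?W"
    have c1: "as P X ?W t \<in> carrier (tens P (tens X ?W))" if "t \<in> carrier ?S" for t
      by (rule hom_closed[OF as_hom that]) (use b bW in auto)
    have m1: "tm P (tens X ?W) P (tens ?W X) (idr P) (s W) (as P X ?W t) = tm P (tens X ?W) P (tens ?W X) (\<lambda>x. x) (s W) (as P X ?W t)"
      if "t \<in> carrier ?S" for t by (rule tm_idr(1)) (use b bW l c1[OF that] in auto)
    have c2: "ai P ?W X (tm P (tens X ?W) P (tens ?W X) (\<lambda>x. x) (s W) (as P X ?W t)) \<in> carrier (tens (tens P ?W) X)"
      if "t \<in> carrier ?S" for t
      by (rule hom_closed[OF ai_hom tm_closed]) (use b bW l c1[OF that] in \<open>auto simp: rlin_id\<close>)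
    have m2: "tm (tens P ?W) X (tens ?W P) X (p W) (idr X) t = tm (tens P ?W) X (tens ?W P) X (p W) (\<lambda>x. x) t"
      if "t \<in> carrier (tens (tens P ?W) X)" for t by (rule tm_idr(2)) (use b bW l that in auto)
    let ?h = "\<lambda>t. as ?W P X (tm (tens P ?W) X (tens ?W P) X (p W) (idr X) (ai P ?W X (tm P (tens X ?W) P (tens ?W X) (idr P) (s W) (as P X ?W t))))"
    have h: "?h t = tens_braid P p X s W t" if "t \<in> carrier ?S" for t
      unfolding tens_braid_def m1[OF that] m2[OF c2[OF that]] ..
    have "?L = Arrow ?S (tens ?W (tens P X)) (\<lambda>t\<in>carrier ?S. ?h t)"
      using o b bW i by (auto simp: wc_arr_def Assoc_eq compose_def cong: restrict_cong simp del: HC_simps)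
    also have "(\<lambda>t\<in>carrier ?S. ?h t) = tens_braid_r P p X s W" unfolding tens_braid_r_def by (rule restrict_ext) (rule h)
    finally show ?thesis .
  qed
  then show ?thesis
    unfolding wc_tens_def Let_def fst_conv snd_conv C_simps(1) wc_arr_def[of "tens P X"] by (auto intro: restrict_ext)
qed

lemma braid_mor_tens_r:
  "halfbraid P p \<Longrightarrow> halfbraid X s \<Longrightarrow> braid_mor (tens P X) (tens_braid_r P p X s) Y q f \<longleftrightarrow> braid_mor (tens P X) (tens_braid P p X s) Y q f"
  by (simp add: braid_mor_def tens_braid_r_def)

end

lemma (in bialg) halfbraid_wc_arr_cong:
  assumes "wc_arr X s = wc_arr X s'" "hm W" shows "s W = s' W"
  using fun_cong[OF assms(1), of W] assms(2) by (simp add: wc_arr_def hm_def)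

section \<open>Transfer along the equivalence with modules over the skew dual\<close>

locale skew_dual = bialg_reg k R U H V u + D: bialg k R U D
  for k :: "'k ring" and R :: "('k, 'r) module" and U :: "'u set set" and H :: "('k, 'r, 'h, 'u) bialgebroid_data"
    and V :: "('h, 'u) lmod" and u :: 'u and D :: "('k, 'r, 'd, 'u) bialgebroid_data" +
  fixes K :: "(('d, 'u) lmod, (('d, 'u) lmod, 'u \<Rightarrow> 'u) arrow,
      ('r env, 'u) lmod \<times> (('h, 'u) lmod \<Rightarrow> (('r env, 'u) lmod, 'u \<Rightarrow> 'u) arrow),
      (('r env, 'u) lmod \<times> (('h, 'u) lmod \<Rightarrow> (('r env, 'u) lmod, 'u \<Rightarrow> 'u) arrow), (('r env, 'u) lmod, 'u \<Rightarrow> 'u) arrow) arrow) monftor"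
  assumes left_finite: "left_finite k R H" and right_finite: "right_finite k R H" and anti_hopf: "anti_hopf U k R H"
    and K_mon: "is_monftor D.HC WC K" and K_equiv: "is_equivalence D.HC WC K"
    and K_under: "monftor_eq_on D.HC (monftor_comp C (wc_underlying HC C F) K) D.F"
begin

lemma K_under_simps:
  shows "D.hm P \<Longrightarrow> fst (FO K P) = D.Rs P"
    "f \<in> Arr D.HC \<Longrightarrow> fn (FA K f) = Arrow (D.Rs (src f)) (D.Rs (tgt f)) (fn f)"
    "D.hm P \<Longrightarrow> D.hm Q \<Longrightarrow> Idn C (fst (wc_tens HC C F (FO K P) (FO K Q))) \<bullet>\<^bsub>C\<^esub> fn (Xi K P Q) = Idn C (D.Rs (D.ht P Q))"
  using K_under unfolding monftor_eq_on_def D.hm_Obj[symmetric]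
  by (simp_all add: monftor_comp_def wc_underlying_def strict_monftor_def WC_simps del: D.HC_simps C_simps)

lemma K_ftor: "is_ftor D.HC WC K" and WC_mon: "monoidal_category WC"
  using K_mon by (simp_all add: is_monftor_def)

lemma K_obj_ex:
  assumes P: "D.hm P" shows "\<exists>p. halfbraid (D.Rs P) p \<and> FO K P = wco (D.Rs P) p"
proof -
  have "FO K P \<in> wc_objects HC C F"
    using K_ftor P unfolding is_ftor_def WC_simps D.hm_Obj[symmetric] by blast
  then have "(D.Rs P, snd (FO K P)) \<in> wc_objects HC C F" using K_under_simps(1)[OF P] by (metis prod.collapse)
  then show ?thesis unfolding wc_objects_iff using K_under_simps(1)[OF P] by (metis prod.collapse)
qed

text \<open>The half-braiding that the equivalence puts on the bimodule underlying a
  D-module.\<close>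

definition kb where "kb P = (SOME p. halfbraid (D.Rs P) p \<and> FO K P = wco (D.Rs P) p)"

lemma kb: "D.hm P \<Longrightarrow> halfbraid (D.Rs P) (kb P)" "D.hm P \<Longrightarrow> FO K P = wco (D.Rs P) (kb P)"
  using someI_ex[OF K_obj_ex] unfolding kb_def by blast+

lemma K_homset:
  "D.hm P \<Longrightarrow> D.hm Q \<Longrightarrow> a \<in> homset WC (FO K P) (FO K Q) \<longleftrightarrow>
    (\<exists>f. a = Arrow (FO K P) (FO K Q) (Arrow (D.Rs P) (D.Rs Q) f) \<and> braid_mor (D.Rs P) (kb P) (D.Rs Q) (kb Q) f)"
  using wc_homset[OF kb(1) kb(1)] by (simp add: kb(2))

text \<open>The functor K keeps underlying functions, so a function is D-linear iff it is a morphism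
  of the weak centralizer. One direction is functoriality, the other is fullness of an
  equivalence.\<close>

lemma K_full:
  assumes P: "D.hm P" and Q: "D.hm Q"
  shows "f \<in> lmod_hom D.A P Q \<longleftrightarrow> braid_mor (D.Rs P) (kb P) (D.Rs Q) (kb Q) f"
proof
  have O: "P \<in> Obj D.HC" "Q \<in> Obj D.HC" using P Q unfolding D.hm_Obj .
  have fa: "fn (FA K (Arrow P Q g)) = Arrow (D.Rs P) (D.Rs Q) g" if "g \<in> lmod_hom D.A P Q" for g
    using K_under_simps(2)[of "Arrow P Q g"] P Q that by (simp add: D.HC_Arr)
  show "braid_mor (D.Rs P) (kb P) (D.Rs Q) (kb Q) f" if f: "f \<in> lmod_hom D.A P Q"
  proof -
    have "FA K (Arrow P Q f) \<in> homset WC (FO K P) (FO K Q)"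
      using K_ftor D.homset_Arrow[OF P Q, of f] f unfolding is_ftor_def by blast
    then show ?thesis using fa[OF f] unfolding K_homset[OF P Q] by auto
  qed
  assume f: "braid_mor (D.Rs P) (kb P) (D.Rs Q) (kb Q) f"
  then have "Arrow (FO K P) (FO K Q) (Arrow (D.Rs P) (D.Rs Q) f) \<in> homset WC (FO K P) (FO K Q)" unfolding K_homset[OF P Q] by blast
  from equivalence_full[OF K_equiv O this] obtain a where a: "a \<in> homset D.HC P Q" "FA K a = Arrow (FO K P) (FO K Q) (Arrow (D.Rs P) (D.Rs Q) f)" by blast
  then obtain g where g: "a = Arrow P Q g" "g \<in> lmod_hom D.A P Q" unfolding D.HC_homset by metis
  show "f \<in> lmod_hom D.A P Q" using fa[OF g(2)] a(2) g by simp
qed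

text \<open>Taken from the monoidal structure of the weak centralizer, which is part of the
  statement that K is a monoidal functor.\<close>

lemma halfbraid_tens:
  assumes p: "halfbraid P p" and q: "halfbraid Q q"
  shows "halfbraid (tens P Q) (tens_braid_r P p Q q)"
proof -
  interpret WC: monoidal_category WC by (rule WC_mon)
  have "wco P p \<in> Obj WC" "wco Q q \<in> Obj WC" using p q unfolding WC_simps wc_objects_iff by blast+
  from WC.TensO_closed[OF this] have "wco (tens P Q) (tens_braid_r P p Q q) \<in> wc_objects HC C F"
    unfolding WC_simps wc_tens_eq[OF p q] .
  then obtain s where s: "halfbraid (tens P Q) s" "wc_arr (tens P Q) (tens_braid_r P p Q q) = wc_arr (tens P Q) s"
    unfolding wc_objects_iff by blast
  show ?thesis
    using s(1) halfbraid_wc_arr_cong[OF s(2)] unfolding halfbraid_def by simp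
qed

text \<open>The functors to bimodules on both sides are strict, so the structure map of K is carried
  by the identity function. Being a morphism of the weak centralizer, it forces the half-braiding of
  a tensor product of D-modules to be the tensor product of the half-braidings.\<close>

lemma K_tens:
  assumes P: "D.hm P" and X: "D.hm X" and Y: "D.hm Y"
  shows "f \<in> lmod_hom D.A (D.ht P X) Y \<longleftrightarrow>
    braid_mor (tens (D.Rs P) (D.Rs X)) (tens_braid (D.Rs P) (kb P) (D.Rs X) (kb X)) (D.Rs Y) (kb Y) f"
proof -
  let ?T = "tens (D.Rs P) (D.Rs X)" and ?tb = "tens_braid (D.Rs P) (kb P) (D.Rs X) (kb X)"
  let ?tr = "tens_braid_r (D.Rs P) (kb P) (D.Rs X) (kb X)"
  have PX: "D.hm (D.ht P X)" using P X by simp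
  note T = D.strictD(1)[OF P X]
  have bT: "bm ?T" using P X by simp
  note eqT = wc_tens_eq[OF kb(1)[OF P] kb(1)[OF X], folded kb(2)[OF P] kb(2)[OF X]]
  note hT = halfbraid_tens[OF kb(1)[OF P] kb(1)[OF X]]
  have kT: "halfbraid ?T (kb (D.ht P X))" "FO K (D.ht P X) = wco ?T (kb (D.ht P X))" using kb[OF PX] T by simp_all
  have "Xi K P X \<in> homset WC (FO K (D.ht P X)) (wc_tens HC C F (FO K P) (FO K X))"
    using K_mon P X unfolding is_monftor_def D.hm_Obj[symmetric] WC_simps by blast
  then obtain g where g: "Xi K P X = Arrow (wco ?T (kb (D.ht P X))) (wco ?T ?tr) (Arrow ?T ?T g)" "braid_mor ?T (kb (D.ht P X)) ?T ?tr g"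
    unfolding kT(2) eqT wc_homset[OF kT(1) hT] by blast
  have gl: "g \<in> lmod_hom E ?T ?T" using g(2) by (simp add: braid_mor_def)
  have "compose (carrier ?T) (idr ?T) g = idr ?T"
    using K_under_simps(3)[OF P X] unfolding g eqT T by simp
  then have gid: "g t = t" if "t \<in> carrier ?T" for t
    using that lmod_homD(4)[OF gl that] by (auto simp: compose_def fun_eq_iff restrict_def) metis
  have eq: "kb (D.ht P X) W t = ?tb W t" if W: "hm W" and t: "t \<in> carrier (tens ?T (Rs W))" for W t
  proof -
    have b: "bm (Rs W)" using W by simp
    note l = lmod_llin[OF gl bT bT] lmod_rlin[OF gl bT bT]
    have c: "kb (D.ht P X) W t \<in> carrier (tens (Rs W) ?T)" by (rule hom_closed[OF halfbraidD(3)[OF kT(1) W] t])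
    have "tm (Rs W) ?T (Rs W) ?T (\<lambda>x. x) g (kb (D.ht P X) W t) = ?tr W (tm ?T (Rs W) ?T (Rs W) g (\<lambda>x. x) t)"
      using g(2) W t by (simp add: braid_mor_def)
    also have "tm ?T (Rs W) ?T (Rs W) g (\<lambda>x. x) t = tm ?T (Rs W) ?T (Rs W) (\<lambda>x. x) (\<lambda>x. x) t"
      by (rule tm_cong) (use bT b l gid t in \<open>auto simp: llin_id rlin_id\<close>)
    also have "\<dots> = t" by (rule tm_id[OF bT b t])
    also have "tm (Rs W) ?T (Rs W) ?T (\<lambda>x. x) g (kb (D.ht P X) W t) = tm (Rs W) ?T (Rs W) ?T (\<lambda>x. x) (\<lambda>x. x) (kb (D.ht P X) W t)"
      by (rule tm_cong) (use bT b l gid c in \<open>auto simp: llin_id rlin_id\<close>)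
    also have "\<dots> = kb (D.ht P X) W t" by (rule tm_id[OF b bT c])
    finally show ?thesis using t by (simp add: tens_braid_r_def)
  qed
  show ?thesis
    unfolding K_full[OF PX Y] T braid_mor_def using eq by simp
qed

lemma braid_mor_comp:
  assumes p: "halfbraid P p" and q: "halfbraid Q q" and s: "halfbraid S s" and f: "braid_mor P p Q q f" and g: "braid_mor Q q S s g"
  shows "braid_mor P p S s (compose (carrier P) g f)"
proof -
  interpret WC: monoidal_category WC by (rule WC_mon)
  have "Arrow (wco P p) (wco Q q) (Arrow P Q f) \<in> homset WC (wco P p) (wco Q q)" "Arrow (wco Q q) (wco S s) (Arrow Q S g) \<in> homset WC (wco Q q) (wco S s)"
    using f g wc_homset[OF p q] wc_homset[OF q s] by blast+
  from WC.Cmp_hom[OF this] show ?thesis unfolding wc_homset[OF p s] by (simp add: WC_simps)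
qed

lemma braid_mor_tm_id:
  assumes p: "halfbraid P p" and q: "halfbraid Q q" and s: "halfbraid X s" and f: "braid_mor P p Q q f"
  shows "braid_mor (tens P X) (tens_braid_r P p X s) (tens Q X) (tens_braid_r Q q X s) (tm P X Q X f (idr X))"
proof -
  interpret WC: monoidal_category WC by (rule WC_mon)
  have f: "Arrow (wco P p) (wco Q q) (Arrow P Q f) \<in> homset WC (wco P p) (wco Q q)" using f wc_homset[OF p q] by blast
  have X: "wco X s \<in> Obj WC" using s unfolding WC_simps wc_objects_iff by blast
  show ?thesis
    using WC.TensA_hom[OF f WC.Idn_hom[OF X]]
    unfolding WC_simps(7,8) wc_tens_eq[OF p s] wc_tens_eq[OF q s] wc_homset[OF halfbraid_tens[OF p s] halfbraid_tens[OF q s]]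
    by (simp add: WC_simps wc_tens_eq[OF p s] wc_tens_eq[OF q s])
qed

text \<open>An isomorphism in the weak centralizer consists of two mutually inverse functions
  compatible with the half-braidings.\<close>

lemma K_surjective:
  assumes z: "halfbraid Z z"
  obtains Q f g where "D.hm Q" "braid_mor (D.Rs Q) (kb Q) Z z f" "braid_mor Z z (D.Rs Q) (kb Q) g"
    "\<And>x. x \<in> carrier Q \<Longrightarrow> g (f x) = x" "\<And>x. x \<in> carrier Z \<Longrightarrow> f (g x) = x"
proof -
  have "wco Z z \<in> Obj WC" using z unfolding WC_simps wc_objects_iff by blast
  from equivalence_surjective[OF K_equiv this] obtain Q h where Q: "D.hm Q" and h: "h \<in> homset WC (FO K Q) (wco Z z)" "iso_arrow WC h"
    using D.hm_Obj by blast
  note hom = wc_homset[OF kb(1)[OF Q] z] wc_homset[OF z kb(1)[OF Q]]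
  obtain f where f: "h = Arrow (FO K Q) (wco Z z) (Arrow (D.Rs Q) Z f)" "braid_mor (D.Rs Q) (kb Q) Z z f"
    using h(1) unfolding kb(2)[OF Q] hom by blast
  obtain h' where "h' \<in> homset WC (wco Z z) (FO K Q)" and i: "h' \<bullet>\<^bsub>WC\<^esub> h = Idn WC (FO K Q)" "h \<bullet>\<^bsub>WC\<^esub> h' = Idn WC (wco Z z)"
    using h(2) unfolding iso_arrow_def inverse_arrows_def f(1) WC_simps(3,4) arrow.sel by blast
  then obtain g where g: "h' = Arrow (wco Z z) (FO K Q) (Arrow Z (D.Rs Q) g)" "braid_mor Z z (D.Rs Q) (kb Q) g"
    unfolding kb(2)[OF Q] hom by blast
  have c: "compose (carrier Q) g f = (\<lambda>x\<in>carrier Q. x)" "compose (carrier Z) f g = idr Z"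
    using i unfolding f(1) g(1) by (simp_all add: WC_simps kb(2)[OF Q])
  show thesis
    by (rule that[OF Q f(2) g(2)]) (metis c compose_eq restrict_apply')+
qed

text \<open>Z with its half-braiding is isomorphic to a D-module Q via \<open>h\<close>. Evaluation
  becomes a D-linear map Q \<otimes> X \<rightarrow> Y, so the universal property of P yields
  \<open>g\<close> : Q \<rightarrow> P, and the inverse of \<phi> is \<open>g\<close> after
  \<open>h'\<close>.\<close>

lemma comparison_iso:
  assumes X: "D.hm X" and Y: "D.hm Y" and P: "D.right_univH X Y P e" and Z: "right_univ (D.Rs X) (D.Rs Y) Z ep"
    and \<phi>: "\<phi> \<in> lmod_hom E (D.Rs P) Z"
    and \<phi>e: "\<And>g x. g \<in> carrier P \<Longrightarrow> x \<in> carrier X \<Longrightarrow> ep (pt Z (D.Rs X) (\<phi> g) x) = e (pt (D.Rs P) (D.Rs X) g x)"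
  shows "\<exists>\<psi>\<in>lmod_hom E Z (D.Rs P). (\<forall>p\<in>carrier P. \<psi> (\<phi> p) = p) \<and> (\<forall>z\<in>carrier Z. \<phi> (\<psi> z) = z)"
proof -
  let ?X = "D.Rs X" and ?Y = "D.Rs Y" and ?P = "D.Rs P"
  have hmP: "D.hm P" and e: "e \<in> lmod_hom D.A (D.ht P X) Y"
    and ex1: "\<And>W f. D.hm W \<Longrightarrow> f \<in> lmod_hom D.A (D.ht W X) Y \<Longrightarrow> \<exists>!g. g \<in> lmod_hom D.A W P \<and> (\<forall>w\<in>carrier W. \<forall>x\<in>carrier X. e (pt ?P ?X (g w) x) = f (pt (D.Rs W) ?X w x))"
    using P by (auto simp: D.right_univH_def)
  note hX = kb(1)[OF X] and hY = kb(1)[OF Y] and hP = kb(1)[OF hmP]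
  have b: "bm ?X" "bm ?Y" "bm ?P" using X Y hmP by auto
  obtain sb where sb: "sb \<in> lmod_hom E (tens V' ?X) (tens ?X V')"
    "\<And>t. t \<in> carrier (tens ?X V') \<Longrightarrow> sb (kb X V t) = t" "\<And>t. t \<in> carrier (tens V' ?X) \<Longrightarrow> kb X V (sb t) = t"
    by (rule halfbraid_inverse[OF anti_hopf right_finite hX]) (rule that)
  interpret B: hom_braid k R U H V u ?X "kb X" ?Y "kb Y" Z ep sb
    by unfold_locales (use left_finite hX hY Z sb in auto)
  have bZ: "bm Z" by simp
  note hZ = B.halfbraid_rh
  have e': "braid_mor (tens ?P ?X) (tens_braid ?P (kb P) ?X (kb X)) ?Y (kb Y) e" using e K_tens[OF hmP X Y] by simp
  have \<phi>m: "braid_mor ?P (kb P) Z B.rh \<phi>"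
    by (rule B.braid_mor_unique_map[OF hP e' \<phi>]) (use \<phi>e in simp)
  obtain Q h h' where Q: "D.hm Q" and h: "braid_mor (D.Rs Q) (kb Q) Z B.rh h" and h': "braid_mor Z B.rh (D.Rs Q) (kb Q) h'"
    and hh: "\<And>x. x \<in> carrier Q \<Longrightarrow> h' (h x) = x" "\<And>x. x \<in> carrier Z \<Longrightarrow> h (h' x) = x"
    using K_surjective[OF hZ] by blast
  let ?Q = "D.Rs Q"
  have bQ: "bm ?Q" using Q by simp
  note hQ = kb(1)[OF Q]
  have hl: "h \<in> lmod_hom E ?Q Z" "h' \<in> lmod_hom E Z ?Q" using h h' by (simp_all add: braid_mor_def)
  have hr: "rlin ?Q Z h" by (rule lmod_rlin[OF hl(1) bQ bZ])
  have h'c: "h' z \<in> carrier Q" if "z \<in> carrier Z" for z using lmod_homD(4)[OF hl(2) that] by simp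
  have \<phi>c: "\<phi> p \<in> carrier Z" if "p \<in> carrier P" for p using lmod_homD(4)[OF \<phi>] that by simp
  define f where "f = compose (carrier (tens ?Q ?X)) ep (tm ?Q ?X Z ?X h (idr ?X))"
  have "braid_mor (tens ?Q ?X) (tens_braid_r ?Q (kb Q) ?X (kb X)) ?Y (kb Y) f"
    unfolding f_def
    by (rule braid_mor_comp[OF halfbraid_tens[OF hQ hX] halfbraid_tens[OF hZ hX] hY braid_mor_tm_id[OF hQ hZ hX h]])
      (use B.braid_mor_ep braid_mor_tens_r[OF hZ hX] in simp)
  then have f: "f \<in> lmod_hom D.A (D.ht Q X) Y" using braid_mor_tens_r[OF hQ hX] K_tens[OF Q X Y] by simp
  have f_pt: "f (pt ?Q ?X q x) = ep (pt Z ?X (h q) x)" if "q \<in> carrier Q" "x \<in> carrier X" for q x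
    using that b(1) bQ bZ hr lin_idr(1)[OF b(1)] by (simp add: f_def compose_def tm_pt)
  obtain g where g: "g \<in> lmod_hom D.A Q P" and ge: "\<And>q x. q \<in> carrier Q \<Longrightarrow> x \<in> carrier X \<Longrightarrow> e (pt ?P ?X (g q) x) = ep (pt Z ?X (h q) x)"
    using ex1[OF Q f] f_pt by auto
  have gc: "g q \<in> carrier P" if "q \<in> carrier Q" for q using lmod_homD(4)[OF g that] .
  have gl: "g \<in> lmod_hom E ?Q ?P" by (rule D.Rs_lmod[OF g D.hm_lmod[OF Q]])
  \<comment> \<open>Elements of Z are determined by their evaluations, and the maps involved are
    compatible with evaluation.\<close>
  have \<phi>\<psi>: "\<phi> (g (h' z)) = z" if z: "z \<in> carrier Z" for z
    by (rule right_univ_inj[OF Z b(1,2) \<phi>c[OF gc[OF h'c[OF z]]] z])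
      (use z \<phi>e gc h'c ge hh(2) in simp)
  have "braid_mor ?P (kb P) ?Q (kb Q) (compose (carrier ?P) h' \<phi>)" by (rule braid_mor_comp[OF hP hZ hQ \<phi>m h'])
  \<comment> \<open>For the other composite the uniqueness for P is needed, which concerns D-linear
    maps only. This is where it matters that \<phi> respects the half-braidings.\<close>
  then have k: "compose (carrier ?P) h' \<phi> \<in> lmod_hom D.A P Q" unfolding K_full[OF hmP Q] .
  have gk: "compose (carrier P) g (compose (carrier ?P) h' \<phi>) \<in> lmod_hom D.A P P" by (rule lmod_hom_comp[OF D.hm_lmod[OF hmP] k g])
  have id: "(\<lambda>p\<in>carrier P. p) \<in> lmod_hom D.A P P" using left_moduleD(3)[OF D.hm_lmod[OF hmP]] by (auto simp: lmod_hom_def hom_def left_moduleD[OF D.hm_lmod[OF hmP]] comm_groupE(1)[OF left_moduleD(2)[OF D.hm_lmod[OF hmP]]])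
  have \<psi>\<phi>: "g (h' (\<phi> p)) = p" if p: "p \<in> carrier P" for p
  proof -
    have "compose (carrier P) g (compose (carrier ?P) h' \<phi>) = (\<lambda>p\<in>carrier P. p)"
    proof (rule ex1E[OF ex1[OF hmP e]])
      fix g0 assume "\<forall>y. y \<in> lmod_hom D.A P P \<and> (\<forall>w\<in>carrier P. \<forall>x\<in>carrier X. e (pt ?P ?X (y w) x) = e (pt ?P ?X w x)) \<longrightarrow> y = g0"
      then have u: "\<And>y. y \<in> lmod_hom D.A P P \<Longrightarrow> (\<And>w x. w \<in> carrier P \<Longrightarrow> x \<in> carrier X \<Longrightarrow> e (pt ?P ?X (y w) x) = e (pt ?P ?X w x)) \<Longrightarrow> y = g0" by blast
      show ?thesis
        by (rule trans[OF u[OF gk] u[OF id, symmetric]]) (simp_all add: compose_def ge h'c \<phi>c hh \<phi>e)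
    qed
    from fun_cong[OF this, of p] show ?thesis using p by (simp add: compose_def)
  qed
  show ?thesis
    by (rule bexI[of _ "compose (carrier Z) g h'"]) (use \<phi>\<psi> \<psi>\<phi> \<phi>c lmod_hom_comp[OF bm_lmod[OF bZ] hl(2) gl] in \<open>auto simp: compose_def\<close>)
qed

text \<open>The comparison arrow of the definition is the one carried by \<phi>, and a two-sided
  inverse linear function makes it invertible.\<close>

lemma preserves_right: "preserves_right_inner_homs D.HC C D.F"
  unfolding preserves_right_inner_homs_def
proof (intro ballI allI impI)
  fix X G \<epsilon> G' \<epsilon>' Y
  assume "X \<in> Obj D.HC" and G: "right_inner_hom D.HC X G \<epsilon>" and "right_inner_hom C (FO D.F X) G' \<epsilon>'" and "Y \<in> Obj D.HC"
  then have X: "D.hm X" and Y: "D.hm Y" and G': "right_inner_hom C (D.Rs X) G' \<epsilon>'" unfolding D.hm_Obj D.F_simps(1) by blast+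
  note g = D.right_inner_hom_univH[OF G X Y] and g' = right_inner_hom_univ[OF G' D.bm_Rs[OF X] D.bm_Rs[OF Y]]
  let ?W = "FO G Y" and ?W' = "FO G' (D.Rs Y)" and ?X = "D.Rs X"
  have W: "D.hm ?W" and e: "fn (\<epsilon> Y) \<in> lmod_hom D.A (D.ht ?W X) Y" using g(1) by (auto simp: D.right_univH_def)
  have b: "bm ?W'" "bm (D.Rs ?W)" "bm ?X" using g' W X by (auto simp: right_univ_def)
  note f = D.FA_inv_Xi[OF W X Y e]
  obtain \<phi> where \<phi>: "\<phi> \<in> lmod_hom E (D.Rs ?W) ?W'"
    "\<forall>w\<in>carrier (D.Rs ?W). \<forall>x\<in>carrier ?X. fn (\<epsilon>' (D.Rs Y)) (pt ?W' ?X (\<phi> w) x) = fn (\<epsilon> Y) (pt (D.Rs ?W) ?X w x)"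
    and the: "(THE a. a \<in> homset C (D.Rs ?W) ?W' \<and> \<epsilon>' (D.Rs Y) \<bullet>\<^bsub>C\<^esub> (a \<star>\<^bsub>C\<^esub> Idn C ?X) = Arrow (tens (D.Rs ?W) ?X) (D.Rs Y) (fn (\<epsilon> Y)))
      = Arrow (D.Rs ?W) ?W' \<phi>"
    using right_comparison[OF G' D.bm_Rs[OF X] D.bm_Rs[OF Y] D.bm_Rs[OF W] f(2)] by blast
  obtain \<psi> where \<psi>: "\<psi> \<in> lmod_hom E ?W' (D.Rs ?W)" "\<forall>w\<in>carrier ?W. \<psi> (\<phi> w) = w" "\<forall>z\<in>carrier ?W'. \<phi> (\<psi> z) = z"
    using comparison_iso[OF X Y g(1) g' \<phi>(1)] \<phi>(2) by auto
  have "inverse_arrows C (Arrow (D.Rs ?W) ?W' \<phi>) (Arrow ?W' (D.Rs ?W) \<psi>)"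
    unfolding inverse_arrows_def
    using C_homset_Arrow[OF b(2,1), of \<phi>] C_homset_Arrow[OF b(1,2), of \<psi>] \<phi>(1) \<psi>
    by (auto simp: homset_def compose_def)
  then show "iso_arrow C (THE \<phi>. \<phi> \<in> homset C (FO D.F (FO G Y)) (FO G' (FO D.F Y)) \<and>
      \<epsilon>' (FO D.F Y) \<bullet>\<^bsub>C\<^esub> (\<phi> \<star>\<^bsub>C\<^esub> Idn C (FO D.F X)) = FA D.F (\<epsilon> Y) \<bullet>\<^bsub>C\<^esub> inv_arrow C (Xi D.F (FO G Y) X))"
    unfolding f(1)[folded g(2)] D.F_simps(1) the iso_arrow_def by blast
qed

end

theorem theorem2p2:
  fixes k :: "'k ring"
    and R :: "('k, 'r) module"
    and H :: "('k, 'r, 'h, 'u) bialgebroid_data"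
    and D :: "('k, 'r, 'h \<Rightarrow> 'r, 'u) bialgebroid_data"
    and U :: "'u set set"
  assumes "cring k"
    and "k_algebra k R"
    and "module_universe (carrier R) U"
    and "module_universe (carrier (alg H)) U"
    and "left_finite k R H"
    and "hopf U k R H"
    and "right_finite k R H"
    and "anti_hopf U k R H"
    and "left_skew_dual U k R H D"
  shows "hopf U k R D"
proof -
  have H: "bialgebroid U k R H" and D: "bialgebroid U k R D"
    using assms by (simp_all add: anti_hopf_def left_skew_dual_def)
  have A: "ring (alg H)" using H by (simp add: bialgebroid_def k_algebra_def)
  have mon: "monoidal_category (bimod_cat U k R)" using H by (simp add: bialgebroid_def strict_monoidal_def)
  obtain B where B: "B \<in> U" "carrier (alg H) \<lesssim> B" using module_universe_lepoll_self[OF assms(4)] .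
  \<comment> \<open>The regular H-module has a copy in the universe, because H itself is no larger
    than one of its members.\<close>
  obtain V u where V: "free1 (alg H) V u" "carrier V \<in> U" using free1_exists[OF A assms(4) B(2,1)] .
  obtain K where K: "is_monftor (mon D) (weak_centralizer (mon H) (bimod_cat U k R) (underlying U k R H)) K"
    "is_equivalence (mon D) (weak_centralizer (mon H) (bimod_cat U k R) (underlying U k R H)) K"
    "monftor_eq_on (mon D) (monftor_comp (bimod_cat U k R)
        (wc_underlying (mon H) (bimod_cat U k R) (underlying U k R H)) K) (underlying U k R D)"
    using assms(9) unfolding left_skew_dual_def Let_def by blast
  interpret skew_dual k R U H V u D K
    by (intro skew_dual.intro skew_dual_axioms.intro bialg_reg.intro bialg_reg_axioms.intro bialg.intro bialg_axioms.intro
        bimods.intro bimods_axioms.intro env_algebra.intro) (rule assms H D mon V K)+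
  show ?thesis unfolding hopf_def using D preserves_right by blast
qed

end
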